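(* Let $S\subset\mathbb H$ be a minimal cone of class $C^1$. Then one of the following holds: (1) $S$ is a vertical plane; or (2) $S$ is the horizontal plane $\{t=0\}$; or (3) $S=C(I_1,\dots,I_k)$ for some $k\ge2$ and some pairwise disjoint non-empty open arcs $I_1,\dots,I_k$ of $\mathbb S^1$ with $\mathbb S^1=\bigcup_{j=1}^k\overline{I_j}$. Moreover, these cases are distinguished by the singular set $S_0$ of $S$: $S_0$ is empty in case (1), a single point in case (2), and a finite family of horizontal half-lines starting from the vertex $0$ in case (3).
   Context: Heisenberg group: $\mathbb H=\mathbb R^3$ with product $(x,y,t)*(x',y',t')=(x+x',y+y',t+t'+(x'y-xy'))$ and dilations $\delta_\lambda(x,y,t)=(\lambda x,\lambda y,\lambda^2t)$, $\lambda>0$. Left-invariant fields: $X=\partial_x+y\,\partial_t$, $Y=\partial_y-x\,\partial_t$, $T=\partial_t$. A horizontal vector field is $V=v_1X+v_2Y$, with $|V|=(v_1^2+v_2^2)^{1/2}$ and $\operatorname{div}V=Xv_1+Yv_2$. The horizontal plane at $p$ is $\operatorname{span}\{X_p,Y_p\}$. A horizontal half-line is a set $\{p*(sa,sb,0): s\ge0\}$ with $p\in\mathbb H$, $(a,b)\ne(0,0)$. A vertical plane is an affine plane of $\mathbb R^3$ parallel to the $t$-axis. A cone is a set invariant under all $\delta_\lambda$, $\lambda>0$ (its vertex is $0$). Perimeter: for $E\subset\mathbb H$ measurable and $\Omega\subset\mathbb H$ open, $P(E;\Omega)=\sup\{\int_E\operatorname{div}(V)\,d\mathcal L^3: V \text{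 a } C^1 \text{ horizontal vector field with compact support in }\Omega,\ |V|\le1\}$. $E$ has locally finite perimeter if $P(E;\Omega)<\infty$ for every bounded open $\Omega$; then $|\partial E|$ denotes the Radon measure with $|\partial E|(\Omega)=P(E;\Omega)$ for open $\Omega$. $E$ is a perimeter minimizer in $\Omega$ if $P(E;\Omega)\le P(F;\Omega)$ for every $F$ of locally finite perimeter whose symmetric difference with $E$ is relatively compact in $\Omega$; it is a local perimeter minimizer if this holds in every bounded open set $\Omega$. A (non-empty) surface $S\subset\mathbb H$ is minimal if there is a local perimeter minimizer $E$ of locally finite perimeter such that $S$ is the closure of the reduced boundary of $E$, i.e. $S$ is the support of $|\partial E|$. A minimal cone is a minimal surface that is a cone. A surface is of class $C^k$ if it is an embedded two-dimensional $C^k$ submanifold of $\mathbb R^3$. The singular set $S_0$ of a $C^1$ surface $S$ is the set of $p\in S$ with $T_pS=\operatorname{span}\{X_p,Y_p\}$. The surfaces $C(I_1,\dots,I_k)$: for $A\subset\mathbb S^1$, $0\# A=\{rv: r\ge0,\ v\in A\}$. All arcs $I$ are open of length $2\alpha$ with $\alpha\in(0,\pi)$. If $I=\{(\cos\theta,\sin\theta):|\theta|<\alpha\}$, set $u_I(x,y)=y(|y|\cot\alpha-x)$ for $(x,y)\in 0\# I$ and $u_I=0$ elsewhere on $\mathbb R^2$. If $I$ is centred at $(\cos\theta_0,\sin\theta_0)$, then $u_I=u_{I'}\circ R_{-\theta_0}$, where $R_{-\theta_0}$ is the rotation of the plane by $-\theta_0$ and $I'=R_{-\theta_0}I$. For pairwise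 disjoint open arcs $I_1,\dots,I_k$, $C(I_1,\dots,I_k)$ is the $t$-graph $\{(x,y,u(x,y)):(x,y)\in\mathbb R^2\}$ of $u=\sum_{i=1}^k u_{I_i}$. *)

theory Defs
  imports "HOL-Analysis.Analysis"
begin

type_synonym heis = "real \<times> real \<times> real"
type_synonym plane = "real \<times> real"

fun heis_mult :: "heis \<Rightarrow> heis \<Rightarrow> heis" where
  "heis_mult (x, y, t) (x', y', t') = (x + x', y + y', t + t' + (x' * y - x * y'))"

fun dil :: "real \<Rightarrow> heis \<Rightarrow> heis" where
  "dil r (x, y, t) = (r * x, r * y, r\<^sup>2 * t)"

fun Xvec :: "heis \<Rightarrow> heis" where
  "Xvec (x, y, t) = (1, 0, y)"

fun Yvec :: "heis \<Rightarrow> heis" where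
  "Yvec (x, y, t) = (0, 1, - x)"

definition horizontal_plane :: "heis \<Rightarrow> heis set" where
  "horizontal_plane p = span {Xvec p, Yvec p}"

definition horizontal_half_line :: "heis \<Rightarrow> heis set \<Rightarrow> bool" where
  "horizontal_half_line p L \<longleftrightarrow>
     (\<exists>a b. (a, b) \<noteq> (0, 0) \<and> L = {heis_mult p (s * a, s * b, 0) | s. s \<ge> 0})"

definition vertical_plane :: "heis set \<Rightarrow> bool" where
  "vertical_plane S \<longleftrightarrow>
     affine S \<and> aff_dim S = 2 \<and> (\<forall>p\<in>S. \<forall>s. p + (0, 0, s) \<in> S)"

definition heis_cone :: "heis set \<Rightarrow> bool" where
  "heis_cone S \<longleftrightarrow> (\<forall>r>0. dil r ` S = S)"

text \<open>Only used for open \<open>U\<close>.\<close>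

definition C1_on :: "'a::real_normed_vector set \<Rightarrow> ('a \<Rightarrow> 'b::real_normed_vector) \<Rightarrow> bool" where
  "C1_on U f \<longleftrightarrow>
     (\<exists>f' :: 'a \<Rightarrow> 'a \<Rightarrow>\<^sub>L 'b.
        (\<forall>x\<in>U. (f has_derivative blinfun_apply (f' x)) (at x)) \<and> continuous_on U f')"

text \<open>A horizontal vector field \<open>v1 X + v2 Y\<close> is represented by its pair of coefficients;
  \<open>X v1\<close> at \<open>p\<close> is the derivative of \<open>v1\<close> at \<open>p\<close> in the direction \<open>Xvec p\<close>.\<close>

definition hdiv :: "(heis \<Rightarrow> real) \<Rightarrow> (heis \<Rightarrow> real) \<Rightarrow> heis \<Rightarrow> real" where
  "hdiv v1 v2 p = frechet_derivative v1 (at p) (Xvec p) + frechet_derivative v2 (at p) (Yvec p)"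

definition test_fields :: "heis set \<Rightarrow> ((heis \<Rightarrow> real) \<times> (heis \<Rightarrow> real)) set" where
  "test_fields \<Omega> =
     {(v1, v2). C1_on UNIV v1 \<and> C1_on UNIV v2
        \<and> compact (closure {p. (v1 p, v2 p) \<noteq> (0, 0)})
        \<and> closure {p. (v1 p, v2 p) \<noteq> (0, 0)} \<subseteq> \<Omega>
        \<and> (\<forall>p. sqrt ((v1 p)\<^sup>2 + (v2 p)\<^sup>2) \<le> 1)}"

definition perimeter :: "heis set \<Rightarrow> heis set \<Rightarrow> ereal" where
  "perimeter E \<Omega> = (SUP (v1, v2)\<in>test_fields \<Omega>. ereal (LINT p:E|lebesgue. hdiv v1 v2 p))"

definition locally_finite_perimeter :: "heis set \<Rightarrow> bool" where
  "locally_finite_perimeter E \<longleftrightarrow>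
     E \<in> sets lebesgue \<and> (\<forall>\<Omega>. open \<Omega> \<and> bounded \<Omega> \<longrightarrow> perimeter E \<Omega> < \<infinity>)"

definition perimeter_minimizer_in :: "heis set \<Rightarrow> heis set \<Rightarrow> bool" where
  "perimeter_minimizer_in \<Omega> E \<longleftrightarrow>
     (\<forall>F. locally_finite_perimeter F
        \<and> compact (closure (sym_diff E F)) \<and> closure (sym_diff E F) \<subseteq> \<Omega>
        \<longrightarrow> perimeter E \<Omega> \<le> perimeter F \<Omega>)"

definition local_perimeter_minimizer :: "heis set \<Rightarrow> bool" where
  "local_perimeter_minimizer E \<longleftrightarrow>
     (\<forall>\<Omega>. open \<Omega> \<and> bounded \<Omega> \<longrightarrow> perimeter_minimizer_in \<Omega> E)"

text \<open>The support of the Radon measure \<open>|\<partial>E|\<close>: the points all of whose open neighbourhoods have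
  positive measure. Only open sets enter, and on these \<open>|\<partial>E|\<close> is \<open>perimeter E\<close> by definition.\<close>

definition perimeter_support :: "heis set \<Rightarrow> heis set" where
  "perimeter_support E = {p. \<forall>\<Omega>. open \<Omega> \<and> p \<in> \<Omega> \<longrightarrow> perimeter E \<Omega> > 0}"

definition minimal_surface :: "heis set \<Rightarrow> bool" where
  "minimal_surface S \<longleftrightarrow>
     S \<noteq> {} \<and>
     (\<exists>E. locally_finite_perimeter E \<and> local_perimeter_minimizer E \<and> S = perimeter_support E)"

definition minimal_cone :: "heis set \<Rightarrow> bool" where
  "minimal_cone S \<longleftrightarrow> minimal_surface S \<and> heis_cone S"

text \<open>Embedded two-dimensional submanifold: locally flattened onto \<open>{t = 0}\<close> by a
  \<open>C\<^sup>1\<close> diffeomorphism between open subsets of the ambient space.\<close>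

definition C1_surface :: "heis set \<Rightarrow> bool" where
  "C1_surface S \<longleftrightarrow>
     (\<forall>p\<in>S. \<exists>U V (\<phi> :: heis \<Rightarrow> heis) (\<psi> :: heis \<Rightarrow> heis). open U \<and> p \<in> U \<and> open V
        \<and> homeomorphism U V \<phi> \<psi> \<and> C1_on U \<phi> \<and> C1_on V \<psi>
        \<and> \<phi> ` (U \<inter> S) = V \<inter> {(x, y, t). t = 0})"

definition tangent_space :: "heis set \<Rightarrow> heis \<Rightarrow> heis set" where
  "tangent_space S p =
     {v. \<exists>\<gamma> \<epsilon>. \<epsilon> > 0 \<and> \<gamma> C1_differentiable_on {-\<epsilon><..<\<epsilon>} \<and> \<gamma> ` {-\<epsilon><..<\<epsilon>} \<subseteq> S
        \<and> \<gamma> 0 = p \<and> (\<gamma> has_vector_derivative v) (at 0)}"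

definition singular_set :: "heis set \<Rightarrow> heis set" where
  "singular_set S = {p\<in>S. tangent_space S p = horizontal_plane p}"

text \<open>The open arc with centre \<open>(cos \<theta>0, sin \<theta>0)\<close> and length \<open>2 \<alpha>\<close>. Arcs are given by the
  parameters \<open>\<theta>0\<close> and \<open>\<alpha>\<close>; for \<open>0 < \<alpha> < \<pi>\<close> the arc determines \<open>\<alpha>\<close>, and \<open>\<theta>0\<close> up to
  multiples of \<open>2 \<pi>\<close>, so that \<open>u_arc\<close> below depends on the arc only.\<close>

definition arc_of :: "real \<Rightarrow> real \<Rightarrow> plane set" where
  "arc_of \<theta>0 \<alpha> = {(cos \<theta>, sin \<theta>) | \<theta>. \<bar>\<theta> - \<theta>0\<bar> < \<alpha>}"

definition sector :: "plane set \<Rightarrow> plane set" where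
  "sector A = {r *\<^sub>R v | r v. r \<ge> 0 \<and> v \<in> A}"

fun rot :: "real \<Rightarrow> plane \<Rightarrow> plane" where
  "rot \<theta> (x, y) = (cos \<theta> * x - sin \<theta> * y, sin \<theta> * x + cos \<theta> * y)"

fun u_centred :: "real \<Rightarrow> plane \<Rightarrow> real" where
  "u_centred \<alpha> (x, y) =
     (if (x, y) \<in> sector (arc_of 0 \<alpha>) then y * (\<bar>y\<bar> * cot \<alpha> - x) else 0)"

definition u_arc :: "real \<Rightarrow> real \<Rightarrow> plane \<Rightarrow> real" where
  "u_arc \<theta>0 \<alpha> = u_centred \<alpha> \<circ> rot (- \<theta>0)"

definition C_surface :: "nat \<Rightarrow> (nat \<Rightarrow> real) \<Rightarrow> (nat \<Rightarrow> real) \<Rightarrow> heis set" where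
  "C_surface k \<theta> \<alpha> = {(x, y, \<Sum>i<k. u_arc (\<theta> i) (\<alpha> i) (x, y)) | x y. True}"

definition is_C_surface :: "heis set \<Rightarrow> bool" where
  "is_C_surface S \<longleftrightarrow>
     (\<exists>k \<theta> \<alpha>. k \<ge> 2 \<and> (\<forall>i<k. 0 < \<alpha> i \<and> \<alpha> i < pi)
        \<and> disjoint_family_on (\<lambda>i. arc_of (\<theta> i) (\<alpha> i)) {..<k}
        \<and> sphere 0 1 = (\<Union>i<k. closure (arc_of (\<theta> i) (\<alpha> i)))
        \<and> S = C_surface k \<theta> \<alpha>)"

end

theory Submission imports Defs begin

text \<open>
  A minimal cone is first shown to be a plane or a graph, and the graph is then determined by an
  ordinary differential equation for a function of the angle.

  \<^emph>\<open>Blow-up at the vertex.\<close> A closed cone contains \<open>0\<close>, and near \<open>0\<close> it is the zero set of a \<open>C\<^sup>1\<close> function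
  \<open>f\<close> without critical points. Dilations scale \<open>t\<close> faster than \<open>x, y\<close>. If the derivative of \<open>f\<close> at \<open>0\<close> does not vanish on
  \<open>{t = 0}\<close>, dilating forces \<open>S\<close> into a vertical plane, which it fills by invariance of domain. Otherwise
  the cone is near \<open>0\<close>, hence by dilation everywhere, the graph of a \<open>C\<^sup>1\<close> function \<open>u\<close> with
  \<open>u (r q) = r\<^sup>2 u q\<close> (\<open>cone_dichotomy\<close>).

  \<^emph>\<open>First variation.\<close> A set without perimeter in a connected open set is null or full there, so that the
  minimizer bounded by the graph is the region below or above it (\<open>minimizer_one_side\<close>). The perimeter of
  the region below a graph is the integral of the length of
  \<open>G = (\<partial>\<^sub>x u - y, \<partial>\<^sub>y u + x)\<close> (\<open>perimeter_subgraph_le\<close>, \<open>area_le_perimeter\<close>). Comparing \<open>u\<close> with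
  \<open>u + \<epsilon> \<phi>\<close> shows that the horizontal normal \<open>n = G / |G|\<close> is weakly divergence free on the whole plane,
  also across the zeros of \<open>G\<close> (\<open>minimal_graph_stationary\<close>).

  \<^emph>\<open>The equation for the angle.\<close> Let \<open>u = r\<^sup>2 h \<theta>\<close> in polar coordinates. Then \<open>n\<close> depends on \<open>\<theta>\<close> only; its radial
  and angular components \<open>a\<close> and \<open>b\<close> are the normalizations of \<open>2 h\<close> and \<open>h' + 1\<close>. The weak equation says that \<open>b' = - a\<close> where
  \<open>h \<noteq> 0\<close>, and that \<open>b\<close> has a limit at the directions in which \<open>G = 0\<close>, which are those with \<open>h = 0\<close> and \<open>h' = -1\<close>
  (\<open>stationary_cone_profile\<close>). Since \<open>a\<^sup>2 + b\<^sup>2 = 1\<close>, the vector \<open>n\<close> is constant on each sector where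
  \<open>h \<noteq> 0\<close>. There the remaining first order equation gives
  \<open>h = \<plusminus> sin (\<theta> - c) sin (c + \<alpha> - \<theta>) / sin \<alpha>\<close> on an arc of length \<open>\<alpha> < \<pi>\<close> (\<open>positive_arc\<close>, \<open>negative_arc\<close>). The
  slope is \<open>1\<close> at one end and \<open>-1\<close> at the other, and around a zero with slope \<open>-1\<close> the limit of \<open>b\<close> is the
  cosine of the length of either neighbouring arc. So the two arcs have equal length, and together they are the
  profile of \<open>u\<^sub>I\<close> (\<open>singular_sym_arc\<close>). If \<open>h\<close> is not identically zero, then these arcs are
  disjoint, finitely many, and their closures cover the circle (\<open>cone_is_C_surface\<close>).

  \<^emph>\<open>Singular set.\<close> The plane tangent to the graph is horizontal where \<open>G = 0\<close>: at \<open>0\<close> and on the rays in the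
  singular directions. If \<open>h = 0\<close> there are no such directions, and otherwise there is one in the middle of each arc.
\<close>

section \<open>Tangent planes of graphs, and the blow-up of a cone\<close>

text \<open>
  The partial derivatives are arguments because all integral formulas below mention them.
\<close>

definition C1_plane :: "(plane \<Rightarrow> real) \<Rightarrow> (plane \<Rightarrow> real) \<Rightarrow> (plane \<Rightarrow> real) \<Rightarrow> bool" where
  "C1_plane u ux uy \<longleftrightarrow>
     (\<forall>p. (u has_derivative (\<lambda>v. ux p * fst v + uy p * snd v)) (at p))
     \<and> continuous_on UNIV ux \<and> continuous_on UNIV uy"

lemma C1_planeD:
  assumes "C1_plane u ux uy"
  shows "(u has_derivative (\<lambda>v. ux p * fst v + uy p * snd v)) (at p)"
    "continuous_on UNIV ux" "continuous_on UNIV uy" "continuous_on UNIV u"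
proof -
  show d: "(u has_derivative (\<lambda>v. ux p * fst v + uy p * snd v)) (at p)" for p
    using assms unfolding C1_plane_def by blast
  show "continuous_on UNIV ux" "continuous_on UNIV uy" using assms by (simp_all add: C1_plane_def)
  show "continuous_on UNIV u" using has_derivative_continuous[OF d] by (simp add: continuous_at_imp_continuous_on)
qed

lemma horizontal_plane_eq: "horizontal_plane (x, y, t) = {(v1, v2, y * v1 - x * v2) | v1 v2. True}"
proof -
  have "v \<in> span {(1, 0, y), (0, 1, - x)} \<longleftrightarrow> (\<exists>k l. v = k *\<^sub>R (1, 0, y) + l *\<^sub>R (0, 1, - x))" for v :: heis
    by (auto simp: span_insert span_singleton algebra_simps)
  then show ?thesis by (auto simp: horizontal_plane_def algebra_simps)
qed

lemma tangent_space_graph: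
  assumes u: "C1_plane u ux uy"
  shows "tangent_space {(x, y, u (x, y)) | x y. True} (x0, y0, u (x0, y0))
    = {(v1, v2, ux (x0, y0) * v1 + uy (x0, y0) * v2) | v1 v2. True}"
proof (intro subset_antisym subsetI)
  fix v assume "v \<in> tangent_space {(x, y, u (x, y)) | x y. True} (x0, y0, u (x0, y0))"
  then obtain \<gamma> \<epsilon> where g: "\<epsilon> > 0" "\<gamma> ` {-\<epsilon><..<\<epsilon>} \<subseteq> {(x, y, u (x, y)) | x y. True}"
    "\<gamma> 0 = (x0, y0, u (x0, y0))" "(\<gamma> has_vector_derivative v) (at 0)"
    by (auto simp: tangent_space_def)
  define \<beta> where "\<beta> s = (fst (\<gamma> s), fst (snd (\<gamma> s)))" for s
  have \<beta>D: "(\<beta> has_vector_derivative (fst v, fst (snd v))) (at 0)"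
    unfolding \<beta>_def by (intro has_vector_derivative_Pair bounded_linear.has_vector_derivative[OF bounded_linear_fst]
      bounded_linear.has_vector_derivative[OF bounded_linear_snd] g(4))
  have b0: "\<beta> 0 = (x0, y0)" by (simp add: \<beta>_def g)
  have "((u \<circ> \<beta>) has_derivative (\<lambda>v. ux (\<beta> 0) * fst v + uy (\<beta> 0) * snd v) \<circ> (\<lambda>s. s *\<^sub>R (fst v, fst (snd v)))) (at 0)"
    using \<beta>D C1_planeD(1)[OF u] unfolding has_vector_derivative_def by (rule diff_chain_at)
  then have 1: "((u \<circ> \<beta>) has_vector_derivative (ux (x0, y0) * fst v + uy (x0, y0) * fst (snd v))) (at 0)"
    unfolding has_vector_derivative_def b0 by (simp add: comp_def algebra_simps)
  have "((\<lambda>s. snd (snd (\<gamma> s))) has_vector_derivative snd (snd v)) (at 0)"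
    by (intro bounded_linear.has_vector_derivative[OF bounded_linear_snd] g(4))
  then have 2: "((u \<circ> \<beta>) has_vector_derivative snd (snd v)) (at 0)"
  proof (rule has_vector_derivative_transform_within_open)
    show "open {-\<epsilon><..<\<epsilon>}" "0 \<in> {-\<epsilon><..<\<epsilon>}" using g(1) by auto
    fix s assume "s \<in> {-\<epsilon><..<\<epsilon>}"
    then have "\<gamma> s \<in> {(x, y, u (x, y)) | x y. True}" using g(2) by blast
    then show "snd (snd (\<gamma> s)) = (u \<circ> \<beta>) s" by (auto simp: \<beta>_def)
  qed
  have "snd (snd v) = ux (x0, y0) * fst v + uy (x0, y0) * fst (snd v)"
    using vector_derivative_unique_at[OF 2 1] .
  then show "v \<in> {(v1, v2, ux (x0, y0) * v1 + uy (x0, y0) * v2) | v1 v2. True}"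
    by (cases v) auto
next
  fix v assume "v \<in> {(v1, v2, ux (x0, y0) * v1 + uy (x0, y0) * v2) | v1 v2. True}"
  then obtain v1 v2 where v: "v = (v1, v2, ux (x0, y0) * v1 + uy (x0, y0) * v2)" by blast
  define \<beta> where "\<beta> s = (x0 + s * v1, y0 + s * v2)" for s
  define \<gamma> where "\<gamma> s = (x0 + s * v1, y0 + s * v2, u (\<beta> s))" for s
  have \<beta>D: "(\<beta> has_vector_derivative (v1, v2)) (at s)" for s
    unfolding \<beta>_def by (auto intro!: derivative_eq_intros has_vector_derivative_Pair simp: has_real_derivative_iff_has_vector_derivative[symmetric])
  have "((u \<circ> \<beta>) has_derivative (\<lambda>v. ux (\<beta> s) * fst v + uy (\<beta> s) * snd v) \<circ> (\<lambda>s. s *\<^sub>R (v1, v2))) (at s)" for s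
    using \<beta>D C1_planeD(1)[OF u] unfolding has_vector_derivative_def by (rule diff_chain_at)
  then have uD: "((\<lambda>s. u (\<beta> s)) has_vector_derivative (ux (\<beta> s) * v1 + uy (\<beta> s) * v2)) (at s)" for s
    unfolding has_vector_derivative_def by (simp add: comp_def algebra_simps)
  have gD: "(\<gamma> has_vector_derivative (v1, v2, ux (\<beta> s) * v1 + uy (\<beta> s) * v2)) (at s)" for s
    unfolding \<gamma>_def
    by (intro has_vector_derivative_Pair uD)
       (auto intro!: derivative_eq_intros simp: has_real_derivative_iff_has_vector_derivative[symmetric])
  have cb: "continuous_on UNIV \<beta>" unfolding \<beta>_def by (intro continuous_intros)
  have "continuous_on A (\<lambda>s. (v1, v2, ux (\<beta> s) * v1 + uy (\<beta> s) * v2))" for A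
    by (intro continuous_intros continuous_on_compose2[OF C1_planeD(2)[OF u], of _ \<beta>]
      continuous_on_compose2[OF C1_planeD(3)[OF u], of _ \<beta>] continuous_on_subset[OF cb]) simp_all
  then have "\<gamma> C1_differentiable_on {-1<..<1}"
    unfolding C1_differentiable_on_def using gD by (intro exI[of _ "\<lambda>s. (v1, v2, ux (\<beta> s) * v1 + uy (\<beta> s) * v2)"]) auto
  moreover have "\<gamma> ` {-1<..<1} \<subseteq> {(x, y, u (x, y)) | x y. True}" by (auto simp: \<gamma>_def \<beta>_def)
  moreover have "\<gamma> 0 = (x0, y0, u (x0, y0))" by (simp add: \<gamma>_def \<beta>_def)
  moreover have "(\<gamma> has_vector_derivative v) (at 0)" using gD[of 0] by (simp add: v \<beta>_def)
  ultimately show "v \<in> tangent_space {(x, y, u (x, y)) | x y. True} (x0, y0, u (x0, y0))"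
    unfolding tangent_space_def by (intro CollectI exI[of _ \<gamma>] exI[of _ 1]) auto
qed

text \<open>
  Both planes project isomorphically onto the \<open>x\<close>-\<open>y\<close>-plane, so they agree exactly if their slopes do.
\<close>

lemma singular_set_graph:
  assumes u: "C1_plane u ux uy"
  shows "singular_set {(x, y, u (x, y)) | x y. True} =
    {(x, y, u (x, y)) | x y. ux (x, y) = y \<and> uy (x, y) = - x}"
proof -
  have "{(v1, v2, a * v1 + b * v2) | v1 v2. True} = {(v1, v2, y * v1 - x * v2) | v1 v2. True}
    \<longleftrightarrow> a = y \<and> b = - x" (is "?L = ?R \<longleftrightarrow> _") for a b x y :: real
  proof
    assume e: "?L = ?R"
    have "(1, 0, a) \<in> ?L" "(0, 1, b) \<in> ?L" by auto
    then have "(1, 0, a) \<in> ?R" "(0, 1, b) \<in> ?R" unfolding e by blast+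
    then show "a = y \<and> b = - x" by auto
  qed auto
  then show ?thesis
    unfolding singular_set_def using tangent_space_graph[OF u] horizontal_plane_eq by auto
qed

text \<open>
  The vertical direction is tangent to such a set, and it is never horizontal.
\<close>

lemma singular_set_vertical:
  assumes S: "\<And>p s. p \<in> S \<Longrightarrow> p + (0, 0, s) \<in> S"
  shows "singular_set S = {}"
proof (rule ccontr)
  assume "singular_set S \<noteq> {}"
  then obtain x y t where p: "(x, y, t) \<in> S" "tangent_space S (x, y, t) = horizontal_plane (x, y, t)"
    by (auto simp: singular_set_def)
  define \<gamma> where "\<gamma> s = (x, y, t + s)" for s
  have gD: "(\<gamma> has_vector_derivative (0, 0, 1)) (at s)" for s
    unfolding \<gamma>_def by (intro has_vector_derivative_Pair)
       (auto intro!: derivative_eq_intros simp: has_real_derivative_iff_has_vector_derivative[symmetric])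
  have "\<gamma> C1_differentiable_on {-1<..<1}"
    unfolding C1_differentiable_on_def using gD by (intro exI[of _ "\<lambda>_. (0, 0, 1)"]) auto
  moreover have "\<gamma> ` {-1<..<1} \<subseteq> S" using S[OF p(1)] by (auto simp: \<gamma>_def)
  ultimately have "(0, 0, 1) \<in> tangent_space S (x, y, t)"
    unfolding tangent_space_def using gD[of 0] by (intro CollectI exI[of _ \<gamma>] exI[of _ 1]) (auto simp: \<gamma>_def)
  then show False unfolding p(2) horizontal_plane_eq by auto
qed

lemma C1_plane_local:
  assumes "\<And>p. \<exists>N k1 k2. open N \<and> p \<in> N \<and> continuous_on N k1 \<and> continuous_on N k2
    \<and> (\<forall>q\<in>N. (u has_derivative (\<lambda>v. k1 q * fst v + k2 q * snd v)) (at q))"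
  shows "\<exists>ux uy. C1_plane u ux uy"
proof -
  define ux where "ux p = frechet_derivative u (at p) (1, 0)" for p
  define uy where "uy p = frechet_derivative u (at p) (0, 1)" for p
  have loc: "(u has_derivative (\<lambda>v. ux p * fst v + uy p * snd v)) (at p) \<and> isCont ux p \<and> isCont uy p" for p
  proof -
    obtain N k1 k2 where N: "open N" "p \<in> N" "continuous_on N k1" "continuous_on N k2"
      and d: "\<And>q. q \<in> N \<Longrightarrow> (u has_derivative (\<lambda>v. k1 q * fst v + k2 q * snd v)) (at q)" using assms[of p] by blast
    have e: "ux q = k1 q" "uy q = k2 q" if "q \<in> N" for q
      using frechet_derivative_at[OF d[OF that], symmetric] by (simp_all add: ux_def uy_def)
    have "continuous_on N ux" "continuous_on N uy" using N(3,4) e by (simp_all cong: continuous_on_cong)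
    then show ?thesis using d[OF N(2)] e[OF N(2)] N by (auto simp: continuous_on_eq_continuous_at)
  qed
  then have "C1_plane u ux uy" unfolding C1_plane_def by (auto intro: continuous_at_imp_continuous_on)
  then show ?thesis by blast
qed

lemma dil_simps: "dil r p = (r * fst p, r * fst (snd p), r\<^sup>2 * snd (snd p))"
  by (cases p) simp

lemma heis_cone_dil: assumes "heis_cone S" "0 < r" shows "dil r p \<in> S \<longleftrightarrow> p \<in> S"
proof
  assume "p \<in> S" then show "dil r p \<in> S" using assms unfolding heis_cone_def by blast
next
  assume "dil r p \<in> S"
  then have "dil (1 / r) (dil r p) \<in> S" using assms unfolding heis_cone_def by (metis imageI zero_less_divide_1_iff)
  moreover have "dil (1 / r) (dil r p) = p" using assms(2) by (cases p) (simp add: power_divide)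
  ultimately show "p \<in> S" by simp
qed

text \<open>
  Every orbit of the dilations ends at \<open>0\<close>. Hence properties near \<open>0\<close> determine a cone.
\<close>

lemma dil_tendsto_0: "((\<lambda>r. dil r p) \<longlongrightarrow> 0) (at_right 0)"
proof -
  have "((\<lambda>r. dil r p) \<longlongrightarrow> (0 * fst p, 0 * fst (snd p), 0\<^sup>2 * snd (snd p))) (at_right 0)"
    unfolding dil_simps by (intro tendsto_intros)
  then show ?thesis by (simp add: zero_prod_def)
qed

lemma eventually_dil_in:
  assumes "open U" "0 \<in> U" shows "\<forall>\<^sub>F r in at_right 0. dil r p \<in> U"
  using topological_tendstoD[OF dil_tendsto_0 assms] .

lemma cone_contains_0:
  assumes "heis_cone S" "closed S" "S \<noteq> {}" shows "0 \<in> S"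
proof -
  obtain p where "p \<in> S" using assms by blast
  then have "\<forall>\<^sub>F r in at_right 0. dil r p \<in> S"
    using heis_cone_dil[OF assms(1)] by (intro eventually_mono[OF eventually_at_right_less[of "0::real"]]) blast
  then show ?thesis by (rule Lim_in_closed_set[OF assms(2) _ trivial_limit_at_right_real dil_tendsto_0])
qed

text \<open>
  Let \<open>f\<close> be the third component of a flattening chart at \<open>0\<close>, so that \<open>S\<close> is \<open>{f = 0}\<close> near
  \<open>0\<close>, and let \<open>(a, b, c)\<close> be its gradient at \<open>0\<close>. For \<open>q = (x, y, t) \<in> S\<close> the curve \<open>r \<mapsto> dil r q\<close> lies in \<open>S\<close> and
  leaves \<open>0\<close> with velocity \<open>(x, y, 0)\<close>, whence \<open>a x + b y = 0\<close>. If \<open>(a, b) \<noteq> 0\<close>, this confines \<open>S\<close> to a vertical plane.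
  If \<open>(a, b) = 0\<close>, then \<open>c \<noteq> 0\<close> and \<open>f = 0\<close> can be solved for \<open>t\<close> near \<open>0\<close>; a dilation
  carries any point into the range of this solution.
\<close>

lemma cone_dichotomy:
  assumes cone: "heis_cone S" and C1: "C1_surface S" and cl: "closed S" and ne: "S \<noteq> {}"
  shows "(\<exists>a b. (a, b) \<noteq> (0, 0) \<and> S = {(x, y, t). a * x + b * y = 0})
    \<or> (\<exists>u ux uy. C1_plane u ux uy \<and> (\<forall>r>0. \<forall>x y. u (r * x, r * y) = r\<^sup>2 * u (x, y))
        \<and> S = {(x, y, u (x, y)) | x y. True})"
proof -
  have S0: "0 \<in> S" by (rule cone_contains_0[OF cone cl ne])
  obtain U V and \<phi> \<psi> :: "heis \<Rightarrow> heis" where U: "open U" "0 \<in> U" "open V" "homeomorphism U V \<phi> \<psi>" "C1_on U \<phi>" "C1_on V \<psi>"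
    and flat: "\<phi> ` (U \<inter> S) = V \<inter> {(x, y, t). t = 0}"
    using C1 S0 unfolding C1_surface_def by meson
  obtain \<phi>' where phiD: "\<And>q. q \<in> U \<Longrightarrow> (\<phi> has_derivative blinfun_apply (\<phi>' q)) (at q)" and phic: "continuous_on U \<phi>'"
    using U(5) unfolding C1_on_def by blast
  obtain \<psi>' where psiD: "\<And>q. q \<in> V \<Longrightarrow> (\<psi> has_derivative blinfun_apply (\<psi>' q)) (at q)"
    using U(6) unfolding C1_on_def by blast
  define f :: "heis \<Rightarrow> real" where "f q = snd (snd (\<phi> q))" for q
  define f' :: "heis \<Rightarrow> heis \<Rightarrow> real" where "f' q v = snd (snd (blinfun_apply (\<phi>' q) v))" for q v
  have fD: "(f has_derivative f' q) (at q)" if "q \<in> U" for q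
    unfolding f_def f'_def by (intro has_derivative_snd phiD that)
  have inS: "q \<in> S \<longleftrightarrow> f q = 0" if q: "q \<in> U" for q
  proof
    assume "q \<in> S"
    then have "q \<in> U \<inter> S" using q by blast
    from imageI[OF this, of \<phi>] have "\<phi> q \<in> V \<inter> {(x, y, t). t = 0}" unfolding flat .
    then show "f q = 0" by (auto simp: f_def)
  next
    assume "f q = 0"
    have "\<phi> q \<in> V" using imageI[OF q, of \<phi>] unfolding homeomorphism_image1[OF U(4)] .
    moreover have "\<phi> q \<in> {(x, y, t). t = 0}"
      using \<open>f q = 0\<close> unfolding f_def mem_Collect_eq case_prod_unfold .
    ultimately have "\<phi> q \<in> V \<inter> {(x, y, t). t = 0}" by (rule IntI)
    then obtain q' where q'2: "q' \<in> U \<inter> S" and q'3: "\<phi> q = \<phi> q'" unfolding flat[symmetric] by (rule imageE)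
    have q': "q' \<in> U" "q' \<in> S" by (rule IntD1[OF q'2], rule IntD2[OF q'2])
    have "q = q'"
      using homeomorphism_apply1[OF U(4) q] homeomorphism_apply1[OF U(4) q'(1)] arg_cong[OF q'3, of \<psi>] by argo
    then show "q \<in> S" using q'(2) by (simp only:)
  qed
  have lin: "linear (f' q)" if "q \<in> U" for q
    using fD[OF that] has_derivative_linear by blast
  have f'_eq: "f' q v = fst v * f' q (1, 0, 0) + fst (snd v) * f' q (0, 1, 0) + snd (snd v) * f' q (0, 0, 1)" if "q \<in> U" for q v
  proof -
    have "v = fst v *\<^sub>R (1, 0, 0) + fst (snd v) *\<^sub>R (0, 1, 0) + snd (snd v) *\<^sub>R (0, 0, 1)"
      by (cases v) auto
    then have "f' q v = f' q (fst v *\<^sub>R (1, 0, 0) + fst (snd v) *\<^sub>R (0, 1, 0) + snd (snd v) *\<^sub>R (0, 0, 1))" by simp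
    also have "\<dots> = fst v *\<^sub>R f' q (1, 0, 0) + fst (snd v) *\<^sub>R f' q (0, 1, 0) + snd (snd v) *\<^sub>R f' q (0, 0, 1)"
      by (simp only: linear_add[OF lin[OF that]] linear_cmul[OF lin[OF that]])
    finally show ?thesis by simp
  qed
  define a b c where "a = f' 0 (1, 0, 0)" and "b = f' 0 (0, 1, 0)" and "c = f' 0 (0, 0, 1)"
  show ?thesis
  proof (cases "(a, b) = (0, 0)")
    case False
    let ?P = "{(x, y, t). a * x + b * y = 0} :: heis set" and ?H = "{(x, y, t). t = 0} :: heis set"
    have "S \<subseteq> ?P"
    proof
      fix q assume q: "q \<in> S"
      obtain x y t where xyt: "q = (x, y, t)" by (cases q)
      have "((\<lambda>r. dil r q) has_derivative (\<lambda>s. (s * x, s * y, 0))) (at 0)"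
        unfolding xyt dil.simps by (auto intro!: derivative_eq_intros has_derivative_Pair)
      moreover have "(f has_derivative f' 0) (at (dil 0 q))" using fD[OF U(2)] by (simp add: xyt zero_prod_def)
      ultimately have "((f \<circ> (\<lambda>r. dil r q)) has_derivative f' 0 \<circ> (\<lambda>s. (s * x, s * y, 0))) (at 0)"
        by (rule diff_chain_at)
      moreover have "f' 0 \<circ> (\<lambda>s. (s * x, s * y, 0)) = (\<lambda>s. (a * x + b * y) * s)"
      proof
        fix s
        show "(f' 0 \<circ> (\<lambda>s. (s * x, s * y, 0))) s = (a * x + b * y) * s"
          unfolding comp_apply f'_eq[OF U(2), of "(s * x, s * y, 0)"] a_def b_def by (simp add: algebra_simps)
      qed
      ultimately have "((\<lambda>r. f (dil r q)) has_real_derivative (a * x + b * y)) (at 0)"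
        by (simp add: has_field_derivative_def comp_def)
      then have "((\<lambda>r. (f (dil r q) - f (dil 0 q)) / (r - 0)) \<longlongrightarrow> a * x + b * y) (at 0)"
        by (simp add: has_field_derivative_iff)
      then have "((\<lambda>r. (f (dil r q) - f (dil 0 q)) / (r - 0)) \<longlongrightarrow> a * x + b * y) (at_right 0)"
        by (simp add: filterlim_at_split)
      moreover have "\<forall>\<^sub>F r in at_right 0. (f (dil r q) - f (dil 0 q)) / (r - 0) = 0"
        using eventually_dil_in[OF U(1,2), of q] eventually_at_right_less[of "0::real"]
      proof eventually_elim
        case (elim r)
        have "f (dil r q) = 0" using inS[OF elim(1)] heis_cone_dil[OF cone elim(2)] q by blast
        moreover have "f (dil 0 q) = 0" using inS[OF U(2)] S0 by (simp add: xyt zero_prod_def)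
        ultimately show ?case by simp
      qed
      ultimately have "((\<lambda>r::real. 0) \<longlongrightarrow> a * x + b * y) (at_right (0::real))"
        by (rule Lim_transform_eventually)
      then have "a * x + b * y = 0" by (simp add: tendsto_const_iff)
      then show "q \<in> ?P" by (simp add: xyt)
    qed
    moreover have "?P \<subseteq> S"
    proof -
      have P: "?P = {v. (a, b, 0) \<bullet> v = 0}" and H: "?H = {v. (0, 0, 1) \<bullet> v = 0}" by auto
      have sub: "subspace ?P" "subspace ?H" unfolding P H by (rule subspace_hyperplane)+
      have "dim ?P = 2" "dim ?H = 2" unfolding P H using False by (subst dim_hyperplane; auto simp: zero_prod_def)+
      then have dims: "dim ?P \<le> dim ?H" by simp
      have ope: "openin (top_of_set ?H) (V \<inter> ?H)" unfolding Int_commute[of V] by (rule openin_open_Int[OF U(3)])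
      have cont: "continuous_on (V \<inter> ?H) \<psi>"
        by (rule continuous_on_subset[of V]) (use U(4) in \<open>simp_all add: homeomorphism_def\<close>)
      have img: "\<psi> ` (V \<inter> ?H) = U \<inter> S"
      proof -
        have "\<psi> (\<phi> q) = q" if "q \<in> U \<inter> S" for q using homeomorphism_apply1[OF U(4)] that by blast
        then show ?thesis unfolding flat[symmetric] image_image by simp
      qed
      have inj: "inj_on \<psi> (V \<inter> ?H)"
        by (rule inj_on_inverseI[of _ \<phi>]) (use U(4) in \<open>simp add: homeomorphism_def\<close>)
      have "\<psi> ` (V \<inter> ?H) \<subseteq> ?P" unfolding img using \<open>S \<subseteq> ?P\<close> by (rule le_infI2)
      then have "\<psi> \<in> (V \<inter> ?H) \<rightarrow> ?P" unfolding image_subset_iff_funcset .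
      (* psi maps an open piece of {t = 0} injectively into P, so the image, which is S near 0, is open in P *)
      from invariance_of_domain_subspaces[OF ope sub(2,1) dims cont this inj]
      have "openin (top_of_set ?P) (U \<inter> S)" using img by simp
      then obtain W where W: "open W" "U \<inter> S = ?P \<inter> W" by (auto simp: openin_open)
      (* P is a cone as well, so every point of P is dilated into the neighbourhood W of 0 *)
      show "?P \<subseteq> S"
      proof
        fix q assume q: "q \<in> ?P"
        have "0 \<in> W" using W S0 U by blast
        have "\<forall>\<^sub>F r in at_right 0. dil r q \<in> W \<and> 0 < r"
          using eventually_dil_in[OF W(1) \<open>0 \<in> W\<close>, of q] eventually_at_right_less[of "0::real"] by (rule eventually_conj)
        then obtain r where r: "dil r q \<in> W" "0 < r"
          using eventually_happens'[OF trivial_limit_at_right_real] by blast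
        obtain x y t where xyt: "q = (x, y, t)" by (cases q)
        have "a * (r * x) + b * (r * y) = r * (a * x + b * y)" by (simp add: algebra_simps)
        then have "dil r q \<in> ?P" using q by (simp add: xyt)
        then have "dil r q \<in> ?P \<inter> W" using r(1) by (rule IntI)
        then have "dil r q \<in> S" unfolding W(2)[symmetric] by (rule IntD2)
        then show "q \<in> S" using heis_cone_dil[OF cone r(2)] by simp
      qed
    qed
    ultimately show ?thesis using False by blast
  next
    case True
    then have ab: "a = 0" "b = 0" by auto
    have c0: "c \<noteq> 0"
    proof
      assume "c = 0"
      then have z: "f' 0 v = 0" for v using f'_eq[OF U(2), of v] ab by (simp add: a_def b_def c_def)
      have "\<phi> 0 \<in> V" using U by (auto simp: homeomorphism_def)
      have "((\<psi> \<circ> \<phi>) has_derivative (\<psi>' (\<phi> 0)) \<circ> (\<phi>' 0)) (at 0)"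
        by (rule diff_chain_at[OF phiD[OF U(2)] psiD[OF \<open>\<phi> 0 \<in> V\<close>]])
      moreover have "((\<psi> \<circ> \<phi>) has_derivative (\<lambda>v. v)) (at 0)"
        by (rule has_derivative_transform_within_open[OF has_derivative_ident U(1,2)])
           (use U(4) in \<open>simp add: homeomorphism_def\<close>)
      ultimately have "blinfun_apply (\<psi>' (\<phi> 0)) \<circ> blinfun_apply (\<phi>' 0) = (\<lambda>v. v)" by (rule has_derivative_unique)
      from fun_cong[OF this] have "\<And>v. blinfun_apply (\<psi>' (\<phi> 0)) (blinfun_apply (\<phi>' 0) v) = v" by (simp only: comp_apply)
      then have "inj (blinfun_apply (\<phi>' 0))" by (rule inj_on_inverseI)
      then have "surj (blinfun_apply (\<phi>' 0))"
        by (intro linear_inj_imp_surj) (simp add: blinfun.bounded_linear_right bounded_linear.linear)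
      then obtain v where "(0, 0, 1) = blinfun_apply (\<phi>' 0) v" by (rule surjE)
      then show False using z[of v] by (simp add: f'_def flip: \<open>(0, 0, 1) = blinfun_apply (\<phi>' 0) v\<close>)
    qed
    define A B :: "heis \<Rightarrow>\<^sub>L heis" where "A = Blinfun (\<lambda>v. (fst v, fst (snd v), 0))" and "B = Blinfun (\<lambda>v. (0, 0, snd (snd v)))"
    have A: "blinfun_apply A v = (fst v, fst (snd v), 0)" for v
      unfolding A_def by (subst bounded_linear_Blinfun_apply) (auto intro!: bounded_linear_intros bounded_linear_Pair)
    have B: "blinfun_apply B v = (0, 0, snd (snd v))" for v
      unfolding B_def by (subst bounded_linear_Blinfun_apply) (auto intro!: bounded_linear_intros bounded_linear_Pair)
    (* G keeps x and y and replaces t by f, and its inverse solves f = 0 for t *)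
    define G where "G q = (fst q, fst (snd q), f q)" for q
    define G' where "G' q = A + (B o\<^sub>L \<phi>' q)" for q
    have G': "blinfun_apply (G' q) v = (fst v, fst (snd v), f' q v)" for q v
      by (simp add: G'_def blinfun.add_left A B f'_def)
    have GD: "(G has_derivative blinfun_apply (G' q)) (at q)" if "q \<in> U" for q
      unfolding G_def[abs_def] G'[abs_def]
      by (intro has_derivative_Pair fD that has_derivative_fst has_derivative_snd has_derivative_ident)
    have Gc: "continuous_on U G'" unfolding G'_def[abs_def]
      by (intro continuous_intros bounded_bilinear.continuous_on[OF bounded_bilinear_blinfun_compose] phic)
    define J :: "heis \<Rightarrow>\<^sub>L heis" where "J = Blinfun (\<lambda>v. (fst v, fst (snd v), snd (snd v) / c))"
    have J: "blinfun_apply J v = (fst v, fst (snd v), snd (snd v) / c)" for v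
    proof -
      have "linear (\<lambda>v::heis. (fst v, fst (snd v), snd (snd v) / c))"
        by (rule linearI) (simp_all add: add_divide_distrib)
      then show ?thesis unfolding J_def by (subst bounded_linear_Blinfun_apply) (simp_all add: linear_conv_bounded_linear)
    qed
    have JG: "J o\<^sub>L G' 0 = id_blinfun"
    proof (rule blinfun_eqI)
      fix v
      have "f' 0 v = c * snd (snd v)" using f'_eq[OF U(2), of v] ab unfolding a_def b_def c_def by simp
      then show "blinfun_apply (J o\<^sub>L G' 0) v = blinfun_apply id_blinfun v" using c0 by (simp add: J G')
    qed
    obtain U' V' g g' where I: "open U'" "U' \<subseteq> U" "0 \<in> U'" "open V'" "G 0 \<in> V'" "homeomorphism U' V' G g"
      "\<And>y. y \<in> V' \<Longrightarrow> (g has_derivative (g' y)) (at y)" "\<And>y. y \<in> V' \<Longrightarrow> bij (blinfun_apply (G'(g y)))"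
      by (rule inverse_function_theorem[OF U(1) GD Gc U(2) JG], assumption) (rule that; assumption)
    have G0: "G 0 = 0" using inS[OF U(2)] S0 by (simp add: G_def zero_prod_def)
    define e where "e p = (fst p, snd p, 0::real)" for p :: plane
    have eD: "(e has_derivative e) (at p)" for p unfolding e_def[abs_def] by (auto intro!: derivative_eq_intros)
    have ec: "continuous_on UNIV e" unfolding e_def by (intro continuous_intros)
    define D where "D = e -` V'"
    have D: "open D" "0 \<in> D"
    proof -
      show "open D" unfolding D_def using open_vimage[OF I(4) ec] .
      have "e 0 = G 0" using G0 by (simp add: e_def zero_prod_def)
      then show "0 \<in> D" using I(5) by (simp add: D_def)
    qed
    define u0 where "u0 p = snd (snd (g (e p)))" for p
    have gin: "g (e p) \<in> U'" "G (g (e p)) = e p" if "p \<in> D" for p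
      using that I(6) by (auto simp: D_def homeomorphism_def)
    have gu0: "g (e p) = (fst p, snd p, u0 p)" and fg: "f (g (e p)) = 0" if "p \<in> D" for p
      using gin(2)[OF that] by (auto simp: G_def e_def u0_def prod_eq_iff)
    have inD: "(x, y) \<in> D \<and> t = u0 (x, y)" if "(x, y, t) \<in> U'" "(x, y, t) \<in> S" for x y t
    proof -
      have "G (x, y, t) = e (x, y)" using inS[of "(x, y, t)"] that I(2) by (auto simp: G_def e_def)
      moreover have "G (x, y, t) \<in> V'" "g (G (x, y, t)) = (x, y, t)" using that(1) I(6) unfolding homeomorphism_def by blast+
      ultimately have "e (x, y) \<in> V'" "g (e (x, y)) = (x, y, t)" by simp_all
      then show ?thesis by (simp add: D_def u0_def)
    qed
    have u0S: "(x, y, u0 (x, y)) \<in> S" if "(x, y) \<in> D" for x y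
    proof -
      have "g (e (x, y)) \<in> U" using gin(1)[OF that] I(2) by blast
      then have "g (e (x, y)) \<in> S" using inS fg[OF that] by simp
      then show ?thesis unfolding gu0[OF that] by simp
    qed
    have small: "\<exists>r>0. (r * x, r * y) \<in> D \<and> dil r q \<in> U' \<and> dil r q' \<in> U'" for x y q q'
    proof -
      have "((\<lambda>r. (r * x, r * y)) \<longlongrightarrow> (0 * x, 0 * y)) (at_right 0)" by (intro tendsto_intros)
      then have "((\<lambda>r. (r * x, r * y)) \<longlongrightarrow> 0) (at_right 0)" by (simp add: zero_prod_def)
      then have "\<forall>\<^sub>F r in at_right 0. (r * x, r * y) \<in> D" using topological_tendstoD D by blast
      then have "\<forall>\<^sub>F r in at_right 0. 0 < r \<and> (r * x, r * y) \<in> D \<and> dil r q \<in> U' \<and> dil r q' \<in> U'"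
        using eventually_dil_in[OF I(1,3)] by (intro eventually_conj eventually_at_right_less)
      then show ?thesis using eventually_happens'[OF trivial_limit_at_right_real] by blast
    qed
    have ex: "(x, y, u0 (r * x, r * y) / r\<^sup>2) \<in> S" if "(r * x, r * y) \<in> D" "0 < r" for x y r
    proof -
      have "dil r (x, y, u0 (r * x, r * y) / r\<^sup>2) \<in> S" using u0S[OF that(1)] that(2) by simp
      then show ?thesis using heis_cone_dil[OF cone that(2)] by blast
    qed
    have un: "t = t'" if "(x, y, t) \<in> S" "(x, y, t') \<in> S" for x y t t'
    proof -
      obtain r where r: "r > 0" "dil r (x, y, t) \<in> U'" "dil r (x, y, t') \<in> U'" using small by blast
      have "r\<^sup>2 * t = u0 (r * x, r * y)" "r\<^sup>2 * t' = u0 (r * x, r * y)"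
        using inD[of "r * x" "r * y" "r\<^sup>2 * t"] inD[of "r * x" "r * y" "r\<^sup>2 * t'"] r
          heis_cone_dil[OF cone r(1), of "(x, y, t)"] heis_cone_dil[OF cone r(1), of "(x, y, t')"] that
        by simp_all
      then have "r\<^sup>2 * t = r\<^sup>2 * t'" by linarith
      then show ?thesis using r(1) by simp
    qed
    define u where "u p = (THE t. (fst p, snd p, t) \<in> S)" for p
    have u: "(x, y, t) \<in> S \<longleftrightarrow> t = u (x, y)" for x y t
    proof -
      obtain r where "r > 0" "(r * x, r * y) \<in> D" using small by blast
      then have "\<exists>t. (x, y, t) \<in> S" using ex by blast
      then have "\<exists>!t. (x, y, t) \<in> S" using un by blast
      then have "(x, y, u (x, y)) \<in> S" unfolding u_def fst_conv snd_conv by (rule theI')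
      then show ?thesis using un by blast
    qed
    have uhom: "u (r * x, r * y) = r\<^sup>2 * u (x, y)" if "0 < r" for r x y
    proof -
      have "(x, y, u (x, y)) \<in> S" using u by blast
      then have "dil r (x, y, u (x, y)) \<in> S" using heis_cone_dil[OF cone that] by blast
      then show ?thesis using u[of "r * x" "r * y"] by simp
    qed
    have uu0: "u (x, y) = u0 (r * x, r * y) / r\<^sup>2" if "(r * x, r * y) \<in> D" "0 < r" for x y r
      using ex[OF that] by (simp add: u)
    define k where "k j q = - f' (g (e q)) j / f' (g (e q)) (0, 0, 1)" for j q
    have ft: "f' (g (e q)) (0, 0, 1) \<noteq> 0" if "q \<in> D" for q
    proof
      assume "f' (g (e q)) (0, 0, 1) = 0"
      then have "blinfun_apply (G' (g (e q))) (0, 0, 1) = blinfun_apply (G' (g (e q))) 0"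
        by (simp add: G' f'_def blinfun.zero_right flip: zero_prod_def)
      moreover have "inj (blinfun_apply (G' (g (e q))))" using I(8)[of "e q"] that by (simp add: D_def bij_def)
      ultimately have "(0, 0, 1) = (0 :: heis)" by (rule injD[rotated])
      then show False by (simp add: zero_prod_def)
    qed
    have u0D: "(u0 has_derivative (\<lambda>v. k (1, 0, 0) q * fst v + k (0, 1, 0) q * snd v)) (at q)" if q: "q \<in> D" for q
    proof -
      have eq: "e q \<in> V'" using q by (simp add: D_def)
      have geD: "((\<lambda>p. g (e p)) has_derivative (\<lambda>v. g' (e q) (e v))) (at q)"
        using diff_chain_at[OF eD I(7)[OF eq]] by (simp add: comp_def)
      define M where "M v = snd (snd (g' (e q) (e v)))" for v
      have M: "(u0 has_derivative M) (at q)"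
        unfolding u0_def[abs_def] M_def[abs_def] by (intro has_derivative_snd geD)
      have "((\<lambda>p. (fst p, snd p, u0 p)) has_derivative (\<lambda>v. (fst v, snd v, M v))) (at q)"
        by (auto intro!: derivative_eq_intros M)
      then have "((\<lambda>p. g (e p)) has_derivative (\<lambda>v. (fst v, snd v, M v))) (at q)"
        by (rule has_derivative_transform_within_open[OF _ D(1) q]) (simp add: gu0)
      moreover have "(f has_derivative f' (g (e q))) (at (g (e q)))" using fD gin(1)[OF q] I(2) by blast
      ultimately have "(f \<circ> (\<lambda>p. g (e p)) has_derivative f' (g (e q)) \<circ> (\<lambda>v. (fst v, snd v, M v))) (at q)"
        by (rule diff_chain_at)
      moreover have "(f \<circ> (\<lambda>p. g (e p)) has_derivative (\<lambda>v. 0)) (at q)"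
        by (rule has_derivative_transform_within_open[OF has_derivative_const[of 0] D(1) q]) (simp add: fg)
      ultimately have z: "f' (g (e q)) \<circ> (\<lambda>v. (fst v, snd v, M v)) = (\<lambda>v. 0)" by (rule has_derivative_unique)
      have gU: "g (e q) \<in> U" using gin(1)[OF q] I(2) by blast
      have "M v = k (1, 0, 0) q * fst v + k (0, 1, 0) q * snd v" for v
      proof -
        have "f' (g (e q)) (fst v, snd v, M v) = 0" using fun_cong[OF z, of v] by (simp only: comp_apply)
        then have "fst v * f' (g (e q)) (1, 0, 0) + snd v * f' (g (e q)) (0, 1, 0) + M v * f' (g (e q)) (0, 0, 1) = 0"
          using f'_eq[OF gU, of "(fst v, snd v, M v)"] by simp
        then have "M v = - (fst v * f' (g (e q)) (1, 0, 0) + snd v * f' (g (e q)) (0, 1, 0)) / f' (g (e q)) (0, 0, 1)"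
          using ft[OF q] by (simp add: field_simps)
        then show ?thesis by (simp add: k_def diff_divide_distrib add_divide_distrib mult.commute)
      qed
      then have "M = (\<lambda>v. k (1, 0, 0) q * fst v + k (0, 1, 0) q * snd v)" by (rule ext)
      then show ?thesis using M by simp
    qed
    have gec: "continuous_on D (\<lambda>q. g (e q))"
    proof (rule continuous_on_compose2[of V' g D e])
      show "continuous_on V' g" using I(6) by (simp add: homeomorphism_def)
      show "continuous_on D e" by (rule continuous_on_subset[OF ec]) simp
    qed (simp add: D_def)
    have kc: "continuous_on D (k j)" for j
    proof -
      have "continuous_on U (\<lambda>q. f' q j)" for j unfolding f'_def by (intro continuous_intros phic)
      then have "continuous_on D (\<lambda>q. f' (g (e q)) j)" for j
        by (rule continuous_on_compose2[OF _ gec]) (use gin(1) I(2) in auto)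
      then show ?thesis unfolding k_def[abs_def] using ft by (intro continuous_intros) auto
    qed
    have C1u: "\<exists>ux uy. C1_plane u ux uy"
    proof (rule C1_plane_local)
      fix p :: plane
      obtain r where r: "r > 0" "(r * fst p, r * snd p) \<in> D" using small by blast
      define N where "N = (\<lambda>q. r *\<^sub>R q) -` D"
      have N: "open N" "p \<in> N"
        using r D(1) by (auto simp: N_def scaleR_prod_def intro!: continuous_open_vimage continuous_intros)
      have rc: "continuous_on N (\<lambda>q. k j (r *\<^sub>R q))" for j
      proof (rule continuous_on_compose2[OF kc])
        show "continuous_on N (\<lambda>q. r *\<^sub>R q)" by (intro continuous_intros)
      qed (auto simp: N_def)
      have der: "(u has_derivative (\<lambda>v. k (1, 0, 0) (r *\<^sub>R q) / r * fst v + k (0, 1, 0) (r *\<^sub>R q) / r * snd v)) (at q)" if q: "q \<in> N" for q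
      proof -
        have "((\<lambda>q. r *\<^sub>R q) has_derivative (\<lambda>v. r *\<^sub>R v)) (at q)" by (auto intro!: derivative_eq_intros)
        moreover have "r *\<^sub>R q \<in> D" using q by (simp add: N_def)
        ultimately have "(u0 \<circ> (\<lambda>q. r *\<^sub>R q) has_derivative (\<lambda>v. k (1, 0, 0) (r *\<^sub>R q) * fst v + k (0, 1, 0) (r *\<^sub>R q) * snd v) \<circ> (\<lambda>v. r *\<^sub>R v)) (at q)"
          using u0D by (intro diff_chain_at)
        then have "((\<lambda>q. u0 (r *\<^sub>R q) / r\<^sup>2) has_derivative (\<lambda>v. (k (1, 0, 0) (r *\<^sub>R q) * (r * fst v) + k (0, 1, 0) (r *\<^sub>R q) * (r * snd v)) / r\<^sup>2)) (at q)"
          using bounded_linear.has_derivative[OF bounded_linear_divide[of "r\<^sup>2"]] by (simp add: comp_def)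
        moreover have "(k (1, 0, 0) (r *\<^sub>R q) * (r * fst v) + k (0, 1, 0) (r *\<^sub>R q) * (r * snd v)) / r\<^sup>2
          = k (1, 0, 0) (r *\<^sub>R q) / r * fst v + k (0, 1, 0) (r *\<^sub>R q) / r * snd v" for v
          using r(1) by (simp add: field_simps power2_eq_square)
        ultimately have "((\<lambda>q. u0 (r *\<^sub>R q) / r\<^sup>2) has_derivative (\<lambda>v. k (1, 0, 0) (r *\<^sub>R q) / r * fst v + k (0, 1, 0) (r *\<^sub>R q) / r * snd v)) (at q)"
          by simp
        then show ?thesis
        proof (rule has_derivative_transform_within_open[OF _ N(1) q])
          fix q' assume "q' \<in> N"
          then show "u0 (r *\<^sub>R q') / r\<^sup>2 = u q'" using uu0[of r "fst q'" "snd q'"] r(1) by (cases q') (simp add: N_def)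
        qed
      qed
      have rc': "continuous_on N (\<lambda>q. k j (r *\<^sub>R q) / r)" for j
        using continuous_on_divide[OF rc continuous_on_const] r(1) by simp
      show "\<exists>N k1 k2. open N \<and> p \<in> N \<and> continuous_on N k1 \<and> continuous_on N k2
        \<and> (\<forall>q\<in>N. (u has_derivative (\<lambda>v. k1 q * fst v + k2 q * snd v)) (at q))"
        by (intro exI[of _ N] exI[of _ "\<lambda>q. k (1, 0, 0) (r *\<^sub>R q) / r"] exI[of _ "\<lambda>q. k (0, 1, 0) (r *\<^sub>R q) / r"]
          conjI ballI N rc' der)
    qed
    have Su: "S = {(x, y, u (x, y)) | x y. True}" using u by auto
    obtain ux uy where "C1_plane u ux uy" using C1u by (elim exE)
    then show ?thesis
      by (intro disjI2 exI[of _ u] exI[of _ ux] exI[of _ uy] conjI allI impI uhom Su)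
  qed
qed

lemma vertical_plane_linear:
  assumes "(a, b) \<noteq> (0, 0)" shows "vertical_plane {(x, y, t). a * x + b * y = 0}"
proof -
  have P: "{(x, y, t). a * x + b * y = 0} = {v. (a, b, 0::real) \<bullet> v = 0}" by auto
  have "dim {v. (a, b, 0::real) \<bullet> v = 0} = 2" using assms by (subst dim_hyperplane) (auto simp: zero_prod_def)
  then show ?thesis unfolding vertical_plane_def P
    using subspace_hyperplane[of "(a, b, 0::real)"]
    by (auto simp: subspace_imp_affine aff_dim_subspace)
qed

section \<open>The divergence theorem for subgraphs\<close>

lemma continuous_on_UNIV_compose:
  "continuous_on UNIV f \<Longrightarrow> continuous_on A g \<Longrightarrow> continuous_on A (\<lambda>x. f (g x))"
  by (rule continuous_on_compose2[of UNIV f A g]) simp_all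

text \<open>
  The coefficients of a test field, with their partial derivatives as arguments.
\<close>

definition C1_heis :: "(heis \<Rightarrow> real) \<Rightarrow> (heis \<Rightarrow> real) \<Rightarrow> (heis \<Rightarrow> real) \<Rightarrow> (heis \<Rightarrow> real) \<Rightarrow> bool" where
  "C1_heis v vx vy vt \<longleftrightarrow>
     (\<forall>p. (v has_derivative (\<lambda>h. vx p * fst h + vy p * fst (snd h) + vt p * snd (snd h))) (at p))
     \<and> continuous_on UNIV vx \<and> continuous_on UNIV vy \<and> continuous_on UNIV vt"

lemma C1_heisD:
  assumes "C1_heis v vx vy vt"
  shows "(v has_derivative (\<lambda>h. vx p * fst h + vy p * fst (snd h) + vt p * snd (snd h))) (at p)"
    "continuous_on UNIV vx" "continuous_on UNIV vy" "continuous_on UNIV vt" "continuous_on UNIV v"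
proof -
  show d: "(v has_derivative (\<lambda>h. vx p * fst h + vy p * fst (snd h) + vt p * snd (snd h))) (at p)" for p
    using assms unfolding C1_heis_def by blast
  show "continuous_on UNIV vx" "continuous_on UNIV vy" "continuous_on UNIV vt"
    using assms by (simp_all add: C1_heis_def)
  show "continuous_on UNIV v" using has_derivative_continuous[OF d] by (simp add: continuous_at_imp_continuous_on)
qed

lemma C1_heis_imp_C1_on: assumes "C1_heis v vx vy vt" shows "C1_on UNIV v"
proof -
  define px py pt :: "heis \<Rightarrow>\<^sub>L real" where "px = Blinfun fst" and "py = Blinfun (\<lambda>h. fst (snd h))" and "pt = Blinfun (\<lambda>h. snd (snd h))"
  have p: "blinfun_apply px h = fst h" "blinfun_apply py h = fst (snd h)" "blinfun_apply pt h = snd (snd h)" for h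
    unfolding px_def py_def pt_def by (subst bounded_linear_Blinfun_apply; auto intro!: bounded_linear_intros)+
  define f' where "f' q = vx q *\<^sub>R px + vy q *\<^sub>R py + vt q *\<^sub>R pt" for q
  have "blinfun_apply (f' q) = (\<lambda>h. vx q * fst h + vy q * fst (snd h) + vt q * snd (snd h))" for q
    by (rule ext) (simp add: f'_def p blinfun.add_left blinfun.scaleR_left)
  moreover have "continuous_on UNIV f'" unfolding f'_def[abs_def] by (intro continuous_intros C1_heisD[OF assms])
  ultimately show ?thesis unfolding C1_on_def using C1_heisD(1)[OF assms] by (intro exI[of _ f']) simp
qed

lemma C1_on_imp_C1_heis: assumes "C1_on UNIV v" shows "\<exists>vx vy vt. C1_heis v vx vy vt"
proof -
  obtain f' where d: "\<And>p. (v has_derivative blinfun_apply (f' p)) (at p)" and c: "continuous_on UNIV f'"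
    using assms unfolding C1_on_def by blast
  have "blinfun_apply (f' p) = (\<lambda>h. f' p (1, 0, 0) * fst h + f' p (0, 1, 0) * fst (snd h) + f' p (0, 0, 1) * snd (snd h))" for p
  proof
    fix h :: heis
    have "h = fst h *\<^sub>R (1, 0, 0) + fst (snd h) *\<^sub>R (0, 1, 0) + snd (snd h) *\<^sub>R (0, 0, 1)" by (cases h) auto
    then have "f' p h = f' p (fst h *\<^sub>R (1, 0, 0) + fst (snd h) *\<^sub>R (0, 1, 0) + snd (snd h) *\<^sub>R (0, 0, 1))" by simp
    also have "\<dots> = f' p (1, 0, 0) * fst h + f' p (0, 1, 0) * fst (snd h) + f' p (0, 0, 1) * snd (snd h)"
      by (simp only: blinfun.add_right blinfun.scaleR_right real_scaleR_def mult.commute)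
    finally show "f' p h = f' p (1, 0, 0) * fst h + f' p (0, 1, 0) * fst (snd h) + f' p (0, 0, 1) * snd (snd h)" .
  qed
  then have "C1_heis v (\<lambda>p. f' p (1, 0, 0)) (\<lambda>p. f' p (0, 1, 0)) (\<lambda>p. f' p (0, 0, 1))"
    unfolding C1_heis_def using d c by (auto intro!: continuous_intros)
  then show ?thesis by blast
qed

lemma hdiv_eq:
  assumes "C1_heis v1 v1x v1y v1t" "C1_heis v2 v2x v2y v2t"
  shows "hdiv v1 v2 (x, y, t) = v1x (x, y, t) + y * v1t (x, y, t) + v2y (x, y, t) - x * v2t (x, y, t)"
  unfolding hdiv_def frechet_derivative_at[OF C1_heisD(1)[OF assms(1)], symmetric]
    frechet_derivative_at[OF C1_heisD(1)[OF assms(2)], symmetric] by simp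

text \<open>
  Support in a cube, in a form that passes to slices and to partial derivatives.
\<close>

definition box_supp :: "real \<Rightarrow> (heis \<Rightarrow> real) \<Rightarrow> bool" where
  "box_supp R v \<longleftrightarrow> (\<forall>x y t. R < \<bar>x\<bar> \<or> R < \<bar>y\<bar> \<or> R < \<bar>t\<bar> \<longrightarrow> v (x, y, t) = 0)"

lemma notin_cube: "(x, y, t) \<notin> cbox (-R, -R, -R) (R, R, R) \<longleftrightarrow> R < \<bar>x\<bar> \<or> R < \<bar>y\<bar> \<or> R < \<bar>t\<bar>" for R :: real
  unfolding cbox_Pair_iff by auto

lemma notin_square: "(x, y) \<notin> cbox (-R, -R) (R, R) \<longleftrightarrow> R < \<bar>x\<bar> \<or> R < \<bar>y\<bar>" for R :: real
  unfolding cbox_Pair_iff by auto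

lemma box_suppD: "box_supp R f \<Longrightarrow> R < \<bar>x\<bar> \<or> R < \<bar>y\<bar> \<or> R < \<bar>t\<bar> \<Longrightarrow> f (x, y, t) = 0"
  unfolding box_supp_def by blast

lemma box_supp_outside: "box_supp R v \<Longrightarrow> p \<notin> cbox (-R, -R, -R) (R, R, R) \<Longrightarrow> v p = 0"
  by (cases p) (simp only: notin_cube box_suppD)

lemma exists_box_supp:
  assumes "compact K" "\<And>p. p \<notin> K \<Longrightarrow> v p = 0" shows "\<exists>R0. \<forall>R\<ge>R0. box_supp R v"
proof -
  obtain B where B: "\<And>p. p \<in> K \<Longrightarrow> norm p \<le> B" using compact_imp_bounded[OF assms(1)] unfolding bounded_iff by blast
  have n: "\<bar>x\<bar> \<le> norm (x, y, t)" "\<bar>y\<bar> \<le> norm (x, y, t)" "\<bar>t\<bar> \<le> norm (x, y, t)" for x y t :: real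
    unfolding norm_Pair by (auto intro: real_le_rsqrt simp: real_sqrt_ge_abs1 add_increasing add_increasing2)
  have "box_supp R v" if "B \<le> R" for R
    unfolding box_supp_def
  proof (intro allI impI)
    fix x y t assume "R < \<bar>x\<bar> \<or> R < \<bar>y\<bar> \<or> R < \<bar>t\<bar>"
    then have "B < norm (x, y, t)" using n(1)[where x=x and y=y and t=t] n(2)[where x=x and y=y and t=t] n(3)[where x=x and y=y and t=t] that by linarith
    then have "(x, y, t) \<notin> K" using B by fastforce
    then show "v (x, y, t) = 0" by (rule assms(2))
  qed
  then show ?thesis by blast
qed

lemma box_supp_deriv:
  assumes v: "C1_heis v vx vy vt" and s: "box_supp R v"
  shows "box_supp R vx" "box_supp R vy" "box_supp R vt"
proof -
  have z: "vx (x, y, t) = 0 \<and> vy (x, y, t) = 0 \<and> vt (x, y, t) = 0" if "R < \<bar>x\<bar> \<or> R < \<bar>y\<bar> \<or> R < \<bar>t\<bar>" for x y t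
  proof -
    define N where "N = - cbox (-R, -R, -R) (R, R, R :: real)"
    have "open N" unfolding N_def by (simp add: closed_cbox open_Compl)
    have pN: "(x, y, t) \<in> N" using that unfolding N_def Compl_iff notin_cube .
    have "(v has_derivative (\<lambda>h. 0)) (at (x, y, t))"
      by (rule has_derivative_transform_within_open[OF has_derivative_const[of 0] \<open>open N\<close> pN])
         (simp add: N_def box_supp_outside[OF s])
    from has_derivative_unique[OF this C1_heisD(1)[OF v]]
    have e: "0 = vx (x, y, t) * fst h + vy (x, y, t) * fst (snd h) + vt (x, y, t) * snd (snd h)" for h by (rule fun_cong)
    show ?thesis using e[of "(1, 0, 0)"] e[of "(0, 1, 0)"] e[of "(0, 0, 1)"] by simp
  qed
  show "box_supp R vx" "box_supp R vy" "box_supp R vt" unfolding box_supp_def using z by blast+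
qed

lemma integrable_continuous_compact_support:
  fixes f :: "'a::euclidean_space \<Rightarrow> real"
  assumes "continuous_on UNIV f" "compact K" "\<And>x. x \<notin> K \<Longrightarrow> f x = 0"
  shows "integrable lborel f"
proof -
  have "integrable lborel (\<lambda>x. indicator K x *\<^sub>R f x)"
    by (rule borel_integrable_compact[OF assms(2) continuous_on_subset[OF assms(1)]]) simp
  moreover have "(\<lambda>x. indicator K x *\<^sub>R f x) = f" using assms(3) by (auto simp: indicator_def fun_eq_iff)
  ultimately show ?thesis by simp
qed

lemma integrable_indicator_times:
  fixes f :: "'a::euclidean_space \<Rightarrow> real"
  assumes "integrable lborel f" "B \<in> sets borel"
  shows "integrable lborel (\<lambda>x. indicator B x * f x)"
  using integrable_mult_indicator[of B lborel f] assms by simp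

lemma section_borel: "B \<in> sets borel \<Longrightarrow> Pair x -` B \<in> sets borel"
  for B :: "('a::euclidean_space \<times> 'b::euclidean_space) set"
  using measurable_sets_borel[of "Pair x" borel B] by (simp add: borel_measurable_continuous_onI continuous_on_Pair)

lemma section_borel2: "B \<in> sets borel \<Longrightarrow> (\<lambda>x. (x, y)) -` B \<in> sets borel"
  for B :: "('a::euclidean_space \<times> 'b::euclidean_space) set"
  using measurable_sets_borel[of "\<lambda>x. (x, y)" borel B] by (simp add: borel_measurable_continuous_onI continuous_on_Pair)

lemma fubini_fst:
  fixes f :: "'a::euclidean_space \<times> 'b::euclidean_space \<Rightarrow> real"
  assumes "integrable lborel f"
  shows "(LINT p|lborel. f p) = (LINT x|lborel. LINT y|lborel. f (x, y))"
  using lborel_pair.integral_fst'[of f] assms by (simp add: lborel_prod)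

lemma fubini_snd:
  fixes f :: "'a::euclidean_space \<times> 'b::euclidean_space \<Rightarrow> real"
  assumes "integrable lborel f"
  shows "(LINT p|lborel. f p) = (LINT y|lborel. LINT x|lborel. f (x, y))"
  using lborel_pair.integral_snd[of "\<lambda>x y. f (x, y)"] assms by (simp add: lborel_prod)

lemma slice_integrable:
  fixes f :: "heis \<Rightarrow> real"
  assumes f: "continuous_on UNIV f" "box_supp R f" and B: "B \<in> sets borel"
  shows "integrable lborel (\<lambda>p. indicator B p * f p)"
    "integrable lborel (\<lambda>q. indicator B (x, q) * f (x, q))"
    "integrable lborel (\<lambda>t. indicator B (x, y, t) * f (x, y, t))"
    "integrable lborel (\<lambda>y. indicator B (x, y, t) * f (x, y, t))"
    "integrable lborel (\<lambda>x. indicator B (x, y, t) * f (x, y, t))"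
proof -
  have s: "R < \<bar>x\<bar> \<or> R < \<bar>y\<bar> \<or> R < \<bar>t\<bar> \<Longrightarrow> f (x, y, t) = 0" for x y t by (rule box_suppD[OF f(2)])
  show "integrable lborel (\<lambda>p. indicator B p * f p)"
    by (rule integrable_indicator_times[OF integrable_continuous_compact_support[OF f(1) compact_cbox box_supp_outside[OF f(2)]] B])
  have c: "continuous_on UNIV (\<lambda>q. f (x, q))" by (intro continuous_on_UNIV_compose[OF f(1)] continuous_intros)
  have "integrable lborel (\<lambda>q. f (x, q))"
  proof (rule integrable_continuous_compact_support[OF c compact_cbox[of "(-R, -R)" "(R, R)"]])
    fix q :: plane assume "q \<notin> cbox (-R, -R) (R, R)"
    moreover obtain y t where q: "q = (y, t)" by (cases q)
    ultimately have "R < \<bar>y\<bar> \<or> R < \<bar>t\<bar>" by (simp only: notin_square)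
    then show "f (x, q) = 0" unfolding q by (intro s) blast
  qed
  from integrable_indicator_times[OF this section_borel[OF B, of x]]
  show "integrable lborel (\<lambda>q. indicator B (x, q) * f (x, q))" by (simp add: indicator_def)
  have 1: "continuous_on UNIV (\<lambda>t. f (x, y, t))" "continuous_on UNIV (\<lambda>y. f (x, y, t))" "continuous_on UNIV (\<lambda>x. f (x, y, t))"
    by (intro continuous_on_UNIV_compose[OF f(1)] continuous_intros)+
  have i: "integrable lborel (\<lambda>t. f (x, y, t))" "integrable lborel (\<lambda>y. f (x, y, t))" "integrable lborel (\<lambda>x. f (x, y, t))"
    by (rule integrable_continuous_compact_support[OF _ compact_Icc[of "-R" R]], rule 1, rule s, force)+
  show "integrable lborel (\<lambda>t. indicator B (x, y, t) * f (x, y, t))"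
    using integrable_indicator_times[OF i(1) section_borel[OF section_borel[OF B, of x], of y]] by (simp add: indicator_def)
  show "integrable lborel (\<lambda>y. indicator B (x, y, t) * f (x, y, t))"
    using integrable_indicator_times[OF i(2) section_borel2[OF section_borel[OF B, of x], of t]] by (simp add: indicator_def)
  show "integrable lborel (\<lambda>x. indicator B (x, y, t) * f (x, y, t))"
    using integrable_indicator_times[OF i(3) section_borel2[OF B, of "(y, t)"]] by (simp add: indicator_def)
qed

lemma fubini_heis:
  fixes f :: "heis \<Rightarrow> real"
  assumes f: "continuous_on UNIV f" "box_supp R f" and B: "B \<in> sets borel"
  shows "(LINT p|lborel. indicator B p * f p) = (LINT x|lborel. LINT y|lborel. LINT t|lborel. indicator B (x, y, t) * f (x, y, t))"
    "(LINT p|lborel. indicator B p * f p) = (LINT x|lborel. LINT t|lborel. LINT y|lborel. indicator B (x, y, t) * f (x, y, t))"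
    "(LINT p|lborel. indicator B p * f p) = (LINT q|lborel. LINT x|lborel. indicator B (x, q) * f (x, q))"
proof -
  note i = slice_integrable[OF f B]
  show "(LINT p|lborel. indicator B p * f p) = (LINT x|lborel. LINT y|lborel. LINT t|lborel. indicator B (x, y, t) * f (x, y, t))"
    unfolding fubini_fst[OF i(1)] fubini_fst[OF i(2)] ..
  show "(LINT p|lborel. indicator B p * f p) = (LINT x|lborel. LINT t|lborel. LINT y|lborel. indicator B (x, y, t) * f (x, y, t))"
    unfolding fubini_fst[OF i(1)] fubini_snd[OF i(2)] ..
  show "(LINT p|lborel. indicator B p * f p) = (LINT q|lborel. LINT x|lborel. indicator B (x, q) * f (x, q))"
    by (rule fubini_snd[OF i(1)])
qed

lemma integral_deriv_zero:
  fixes F :: "real \<Rightarrow> real"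
  assumes "\<And>x. (F has_real_derivative F' x) (at x)" "continuous_on UNIV F'" "\<And>x. R < \<bar>x\<bar> \<Longrightarrow> F x = 0" "\<And>x. R < \<bar>x\<bar> \<Longrightarrow> F' x = 0"
  shows "(LINT x|lborel. F' x) = 0" "(LINT x|lborel. indicator {..<0} x * F' x) = F 0"
proof -
  (* both ends of [-b, b] lie strictly outside the support *)
  define b where "b = \<bar>R\<bar> + 1"
  have b: "F b = 0" "F (-b) = 0" "0 < b" using assms(3) by (simp_all add: b_def)
  have ic: "isCont F' x" for x using assms(2) by (simp add: continuous_on_eq_continuous_at)
  have 0: "F' x = 0" if "x \<notin> {-b..b}" for x using assms(4)[of x] that by (force simp: b_def)
  have "(LINT x|lborel. F' x * indicator {-b..b} x) = F b - F (-b)"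
    by (rule integral_FTC_Icc_real) (use assms(1) ic b in auto)
  moreover have "(\<lambda>x. F' x * indicator {-b..b} x) = F'" using 0 by (auto simp: indicator_def fun_eq_iff)
  ultimately show "(LINT x|lborel. F' x) = 0" using b by simp
  have "(LINT x|lborel. F' x * indicator {-b..0} x) = F 0 - F (-b)"
    by (rule integral_FTC_Icc_real) (use assms(1) ic b in auto)
  moreover have "(LINT x|lborel. F' x * indicator {-b..0} x) = (LINT x|lborel. indicator {..<0} x * F' x)"
  proof (rule integral_cong_AE)
    have [measurable]: "F' \<in> borel_measurable borel" using assms(2) by (rule borel_measurable_continuous_onI)
    show "(\<lambda>x. F' x * indicat_real {- b..0} x) \<in> borel_measurable lborel" "(\<lambda>x. indicat_real {..<0} x * F' x) \<in> borel_measurable lborel"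
      by measurable
    have "AE x in lborel. x \<noteq> (0::real)" by (rule AE_lborel_singleton)
    then show "AE x in lborel. F' x * indicat_real {- b..0} x = indicat_real {..<0} x * F' x"
      by eventually_elim (use 0 in \<open>auto simp: indicator_def\<close>)
  qed
  ultimately show "(LINT x|lborel. indicator {..<0} x * F' x) = F 0" using b by simp
qed

lemma C1_heis_partials:
  assumes v: "C1_heis v vx vy vt"
  shows "((\<lambda>x. v (x, y, t)) has_real_derivative vx (x, y, t)) (at x)"
    "((\<lambda>y. v (x, y, t)) has_real_derivative vy (x, y, t)) (at y)"
    "((\<lambda>t. v (x, y, t)) has_real_derivative vt (x, y, t)) (at t)"
proof -
  have 1: "((\<lambda>x. (x, y, t)) has_derivative (\<lambda>h. (h, 0, 0))) (at x)" for x
    by (auto intro!: derivative_eq_intros has_derivative_Pair simp: zero_prod_def)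
  have 2: "((\<lambda>y. (x, y, t)) has_derivative (\<lambda>h. (0, h, 0))) (at y)" for y
    by (intro has_derivative_Pair derivative_intros)
  have 3: "((\<lambda>t. (x, y, t)) has_derivative (\<lambda>h. (0, 0, h))) (at t)" for t
    by (intro has_derivative_Pair derivative_intros)
  show "((\<lambda>x. v (x, y, t)) has_real_derivative vx (x, y, t)) (at x)"
    using diff_chain_at[OF 1 C1_heisD(1)[OF v]] by (simp add: has_field_derivative_def comp_def)
  show "((\<lambda>y. v (x, y, t)) has_real_derivative vy (x, y, t)) (at y)"
    using diff_chain_at[OF 2 C1_heisD(1)[OF v]] by (simp add: has_field_derivative_def comp_def)
  show "((\<lambda>t. v (x, y, t)) has_real_derivative vt (x, y, t)) (at t)"
    using diff_chain_at[OF 3 C1_heisD(1)[OF v]] by (simp add: has_field_derivative_def comp_def)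
qed

text \<open>
  The model case of a subgraph, to which a shear reduces all others.
\<close>

definition lower :: "heis set" where "lower = {p. snd (snd p) < 0}"

lemma lower_borel: "lower \<in> sets borel"
  unfolding lower_def by (intro borel_open open_Collect_less continuous_intros)

lemma lower_mem: "(x, y, t) \<in> lower \<longleftrightarrow> t < 0" by (simp add: lower_def)

lemma lower_integral_x_y:
  assumes v: "C1_heis v vx vy vt" and s: "box_supp R v"
  shows "(LINT p|lborel. indicator lower p * vx p) = 0" "(LINT p|lborel. indicator lower p * vy p) = 0"
proof -
  note d = C1_heisD[OF v] and sd = box_supp_deriv[OF v s]
  have "(LINT x|lborel. indicator lower (x, q) * vx (x, q)) = 0" for q
  proof (cases q)
    case (Pair y t)
    have "(LINT x|lborel. vx (x, y, t)) = 0"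
      by (rule integral_deriv_zero(1)[OF C1_heis_partials(1)[OF v], of _ _ R])
         (simp_all add: box_suppD[OF s] box_suppD[OF sd(1)], intro continuous_on_UNIV_compose[OF d(2)] continuous_intros)
    then show ?thesis by (simp add: Pair indicator_def lower_mem)
  qed
  then show "(LINT p|lborel. indicator lower p * vx p) = 0"
    unfolding fubini_heis(3)[OF d(2) sd(1) lower_borel] by simp
  have "(LINT y|lborel. indicator lower (x, y, t) * vy (x, y, t)) = 0" for x t
  proof -
    have "(LINT y|lborel. vy (x, y, t)) = 0"
      by (rule integral_deriv_zero(1)[OF C1_heis_partials(2)[OF v], of _ _ R])
         (simp_all add: box_suppD[OF s] box_suppD[OF sd(2)], intro continuous_on_UNIV_compose[OF d(3)] continuous_intros)
    then show ?thesis by (simp add: indicator_def lower_mem)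
  qed
  then show "(LINT p|lborel. indicator lower p * vy p) = 0"
    unfolding fubini_heis(2)[OF d(3) sd(2) lower_borel] by simp
qed

definition subgraph :: "(plane \<Rightarrow> real) \<Rightarrow> heis set" where
  "subgraph w = {(x, y, t). t < w (x, y)}"

lemma subgraph_mem: "(x, y, t) \<in> subgraph w \<longleftrightarrow> t < w (x, y)" by (simp add: subgraph_def)

lemma subgraph_borel: assumes "continuous_on UNIV w" shows "subgraph w \<in> sets borel"
proof -
  have "subgraph w = {p. snd (snd p) < w (fst p, fst (snd p))}" by (auto simp: subgraph_def)
  moreover have "open {p. snd (snd p) < w (fst p, fst (snd p))}"
    by (intro open_Collect_less continuous_on_UNIV_compose[OF assms] continuous_intros)
  ultimately show ?thesis by simp
qed

lemma integral_translate: "(LINT t|lborel. f (t::real)) = (LINT t|lborel. f (t + c) :: real)"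
  using lborel_integral_real_affine[of 1 f c] by (simp add: add.commute)

lemma subgraph_integral_t:
  assumes v: "C1_heis v vx vy vt" and s: "box_supp R v"
  shows "(LINT t|lborel. indicator {..<c} t * vt (x, y, t)) = v (x, y, c)"
proof -
  have D: "((\<lambda>t. v (x, y, t + c)) has_real_derivative vt (x, y, t + c)) (at t)" for t
    by (rule DERIV_shift[THEN iffD1, OF C1_heis_partials(3)[OF v]])
  have "(LINT t|lborel. indicator {..<c} t * vt (x, y, t)) = (LINT t|lborel. indicator {..<c} (t + c) * vt (x, y, t + c))"
    by (rule integral_translate)
  also have "\<dots> = (LINT t|lborel. indicator {..<0} t * vt (x, y, t + c))" by (simp add: indicator_def)
  also have "\<dots> = v (x, y, 0 + c)"
  proof (rule integral_deriv_zero(2)[OF D, of "R + \<bar>c\<bar>"])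
    show "continuous_on UNIV (\<lambda>t. vt (x, y, t + c))" by (intro continuous_on_UNIV_compose[OF C1_heisD(4)[OF v]] continuous_intros)
    fix t assume "R + \<bar>c\<bar> < \<bar>t\<bar>"
    then have "R < \<bar>t + c\<bar>" by linarith
    then show "v (x, y, t + c) = 0" "vt (x, y, t + c) = 0" using box_suppD[OF s] box_suppD[OF box_supp_deriv(3)[OF v s]] by blast+
  qed
  finally show ?thesis by simp
qed

lemma plane_integral_iter:
  fixes g :: "plane \<Rightarrow> real"
  assumes "continuous_on UNIV g" "\<And>x y. R < \<bar>x\<bar> \<or> R < \<bar>y\<bar> \<Longrightarrow> g (x, y) = 0"
  shows "(LINT x|lborel. LINT y|lborel. g (x, y)) = (LINT q|lborel. g q)" "integrable lborel g"
proof -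
  show i: "integrable lborel g"
  proof (rule integrable_continuous_compact_support[OF assms(1) compact_cbox[of "(-R, -R)" "(R, R)"]])
    fix q :: plane assume "q \<notin> cbox (-R, -R) (R, R)"
    then show "g q = 0" by (cases q) (simp only: notin_square assms(2))
  qed
  show "(LINT x|lborel. LINT y|lborel. g (x, y)) = (LINT q|lborel. g q)" by (rule fubini_fst[OF i, symmetric])
qed

lemma C1_heis_shear:
  assumes v: "C1_heis v vx vy vt" and w: "C1_plane w wx wy"
  defines "\<Psi> \<equiv> \<lambda>p. (fst p, fst (snd p), snd (snd p) + w (fst p, fst (snd p)))"
  shows "C1_heis (\<lambda>p. v (\<Psi> p)) (\<lambda>p. vx (\<Psi> p) + wx (fst p, fst (snd p)) * vt (\<Psi> p))
    (\<lambda>p. vy (\<Psi> p) + wy (fst p, fst (snd p)) * vt (\<Psi> p)) (\<lambda>p. vt (\<Psi> p))"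
proof -
  have "((\<lambda>p. (fst p, fst (snd p))) has_derivative (\<lambda>h. (fst h, fst (snd h)))) (at p)" for p :: heis
    by (intro has_derivative_Pair derivative_intros)
  from diff_chain_at[OF this C1_planeD(1)[OF w]]
  have wD: "((\<lambda>p. w (fst p, fst (snd p))) has_derivative
    (\<lambda>h. wx (fst p, fst (snd p)) * fst h + wy (fst p, fst (snd p)) * fst (snd h))) (at p)" for p :: heis
    by (simp add: comp_def)
  have PD: "(\<Psi> has_derivative (\<lambda>h. (fst h, fst (snd h), snd (snd h) +
    (wx (fst p, fst (snd p)) * fst h + wy (fst p, fst (snd p)) * fst (snd h))))) (at p)" for p
    unfolding \<Psi>_def by (intro has_derivative_Pair derivative_intros wD)
  have Pc: "continuous_on UNIV \<Psi>"
    using has_derivative_continuous[OF PD] by (simp add: continuous_at_imp_continuous_on)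
  show ?thesis unfolding C1_heis_def
  proof (intro conjI allI)
    fix p
    show "((\<lambda>p. v (\<Psi> p)) has_derivative (\<lambda>h. (vx (\<Psi> p) + wx (fst p, fst (snd p)) * vt (\<Psi> p)) * fst h
      + (vy (\<Psi> p) + wy (fst p, fst (snd p)) * vt (\<Psi> p)) * fst (snd h) + vt (\<Psi> p) * snd (snd h))) (at p)"
      using diff_chain_at[OF PD C1_heisD(1)[OF v]] by (simp add: comp_def algebra_simps)
  qed (intro continuous_intros continuous_on_UNIV_compose[OF _ Pc] C1_heisD[OF v] continuous_on_UNIV_compose[OF C1_planeD(2)[OF w]]
        continuous_on_UNIV_compose[OF C1_planeD(3)[OF w]])+
qed

lemma bounded_on_square:
  fixes w :: "plane \<Rightarrow> real"
  assumes "continuous_on UNIV w" shows "\<exists>M\<ge>0. \<forall>x y. \<bar>x\<bar> \<le> R \<and> \<bar>y\<bar> \<le> R \<longrightarrow> \<bar>w (x, y)\<bar> \<le> M"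
proof -
  have "compact (w ` cbox (-R, -R) (R, R))" by (intro compact_continuous_image compact_cbox continuous_on_subset[OF assms]) simp
  from compact_imp_bounded[OF this] obtain B where "\<forall>z\<in>w ` cbox (-R, -R) (R, R). norm z \<le> B" unfolding bounded_iff by blast
  then have B: "\<bar>w q\<bar> \<le> B" if "q \<in> cbox (-R, -R) (R, R)" for q using that by simp
  have "\<bar>w (x, y)\<bar> \<le> \<bar>B\<bar>" if "\<bar>x\<bar> \<le> R" "\<bar>y\<bar> \<le> R" for x y
  proof -
    have "(x, y) \<in> cbox (-R, -R) (R, R)" using notin_square[of x y R] that by linarith
    then show ?thesis using B by force
  qed
  then show ?thesis by (intro exI[of _ "\<bar>B\<bar>"]) simp
qed

text \<open>
  The shear \<open>(x, y, t) \<mapsto> (x, y, t + w (x, y))\<close> preserves the measure and carries the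
  half-space \<open>t < 0\<close> onto the subgraph. For the half-space, each integral is
  computed by integrating the differentiated variable first.
\<close>

lemma subgraph_integrals:
  assumes v: "C1_heis v vx vy vt" and s: "box_supp R v" and w: "C1_plane w wx wy"
  shows "(LINT p|lborel. indicator (subgraph w) p * vt p) = (LINT q|lborel. v (fst q, snd q, w q))"
    "(LINT p|lborel. indicator (subgraph w) p * vx p) = - (LINT q|lborel. wx q * v (fst q, snd q, w q))"
    "(LINT p|lborel. indicator (subgraph w) p * vy p) = - (LINT q|lborel. wy q * v (fst q, snd q, w q))"
proof -
  note d = C1_heisD[OF v] and sd = box_supp_deriv[OF v s] and wc = C1_planeD(2-4)[OF w]
  note B = subgraph_borel[OF wc(3)]
  define \<Psi> where "\<Psi> p = (fst p, fst (snd p), snd (snd p) + w (fst p, fst (snd p)))" for p :: heis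
  note sh = C1_heis_shear[OF v w, folded \<Psi>_def]
  obtain M where M: "M \<ge> 0" "\<And>x y. \<bar>x\<bar> \<le> R \<Longrightarrow> \<bar>y\<bar> \<le> R \<Longrightarrow> \<bar>w (x, y)\<bar> \<le> M"
    using bounded_on_square[OF wc(3), of R] by blast
  have supp: "box_supp (R + M) (\<lambda>p. f (\<Psi> p))" if "box_supp R f" for f
    unfolding box_supp_def
  proof (intro allI impI)
    fix x y t assume a: "R + M < \<bar>x\<bar> \<or> R + M < \<bar>y\<bar> \<or> R + M < \<bar>t\<bar>"
    have "R < \<bar>x\<bar> \<or> R < \<bar>y\<bar> \<or> R < \<bar>t + w (x, y)\<bar>" using a M(1) M(2)[of x y] by linarith
    then show "f (\<Psi> (x, y, t)) = 0" using box_suppD[OF that] by (simp add: \<Psi>_def)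
  qed
  have ps: "R < \<bar>x\<bar> \<or> R < \<bar>y\<bar> \<Longrightarrow> v (x, y, t) = 0" for x y t using box_suppD[OF s] by blast
  have vc: "continuous_on UNIV (\<lambda>q. v (fst q, snd q, w q))"
    by (intro continuous_on_UNIV_compose[OF d(5)] continuous_intros wc)
  have ind: "indicator (subgraph w) (x, y, t) = (indicator {..<w (x, y)} t :: real)" for x y t
    by (simp add: indicator_def subgraph_mem)
  show "(LINT p|lborel. indicator (subgraph w) p * vt p) = (LINT q|lborel. v (fst q, snd q, w q))"
    unfolding fubini_heis(1)[OF d(4) sd(3) B] ind subgraph_integral_t[OF v s]
    using plane_integral_iter(1)[OF vc, of R] ps by simp
  have main: "(LINT p|lborel. indicator (subgraph w) p * vj p) = - (LINT q|lborel. wj q * v (fst q, snd q, w q))"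
    if vj: "continuous_on UNIV vj" "box_supp R vj" and wj: "continuous_on UNIV wj"
      and z: "(LINT p|lborel. indicator lower p * (vj (\<Psi> p) + wj (fst p, fst (snd p)) * vt (\<Psi> p))) = 0" for vj wj
  proof -
    have Pc: "continuous_on UNIV \<Psi>" unfolding \<Psi>_def by (intro continuous_intros continuous_on_UNIV_compose[OF wc(3)])
    have c1: "continuous_on UNIV (\<lambda>p. vj (\<Psi> p))" "box_supp (R + M) (\<lambda>p. vj (\<Psi> p))"
      using supp[OF vj(2)] continuous_on_UNIV_compose[OF vj(1) Pc] by auto
    have c2: "continuous_on UNIV (\<lambda>p. wj (fst p, fst (snd p)) * vt (\<Psi> p))" "box_supp (R + M) (\<lambda>p. wj (fst p, fst (snd p)) * vt (\<Psi> p))"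
      using supp[OF sd(3)] by (auto simp: box_supp_def intro!: continuous_intros continuous_on_UNIV_compose[OF wj] continuous_on_UNIV_compose[OF d(4) Pc])
    have ind0: "indicator lower (x, y, t) = (indicator {..<w (x, y)} (t + w (x, y)) :: real)" for x y t
      by (simp add: indicator_def lower_mem)
    have "(LINT p|lborel. indicator (subgraph w) p * vj p) = (LINT x|lborel. LINT y|lborel. LINT t|lborel. indicator {..<w (x, y)} t * vj (x, y, t))"
      unfolding fubini_heis(1)[OF vj B] ind ..
    also have "\<dots> = (LINT x|lborel. LINT y|lborel. LINT t|lborel. indicator lower (x, y, t) * vj (\<Psi> (x, y, t)))"
    proof (rule Bochner_Integration.integral_cong[OF refl], rule Bochner_Integration.integral_cong[OF refl])
      fix x y :: real
      show "(LINT t|lborel. indicator {..<w (x, y)} t * vj (x, y, t)) = (LINT t|lborel. indicator lower (x, y, t) * vj (\<Psi> (x, y, t)))"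
        by (subst integral_translate[of _ "w (x, y)"]) (simp add: ind0 \<Psi>_def)
    qed
    also have "\<dots> = (LINT p|lborel. indicator lower p * vj (\<Psi> p))"
      by (rule fubini_heis(1)[OF c1 lower_borel, symmetric])
    also have "\<dots> = - (LINT p|lborel. indicator lower p * (wj (fst p, fst (snd p)) * vt (\<Psi> p)))"
      using z Bochner_Integration.integral_add[OF slice_integrable(1)[OF c1 lower_borel] slice_integrable(1)[OF c2 lower_borel]]
      by (simp add: distrib_left)
    also have "(LINT p|lborel. indicator lower p * (wj (fst p, fst (snd p)) * vt (\<Psi> p)))
      = (LINT x|lborel. LINT y|lborel. LINT t|lborel. indicator lower (x, y, t) * (wj (x, y) * vt (\<Psi> (x, y, t))))"
      unfolding fubini_heis(1)[OF c2 lower_borel] by simp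
    also have "\<dots> = (LINT x|lborel. LINT y|lborel. wj (x, y) * v (x, y, w (x, y)))"
    proof (rule Bochner_Integration.integral_cong[OF refl], rule Bochner_Integration.integral_cong[OF refl])
      fix x y :: real
      have "(LINT t|lborel. indicator lower (x, y, t) * (wj (x, y) * vt (\<Psi> (x, y, t))))
        = wj (x, y) * (LINT t|lborel. indicator lower (x, y, t) * vt (\<Psi> (x, y, t)))"
        by (subst integral_mult_right_zero[symmetric]) (simp add: mult.left_commute)
      also have "(LINT t|lborel. indicator lower (x, y, t) * vt (\<Psi> (x, y, t))) = (LINT t|lborel. indicator {..<w (x, y)} t * vt (x, y, t))"
        by (subst integral_translate[of _ "w (x, y)"]) (simp add: ind0 \<Psi>_def)
      also have "\<dots> = v (x, y, w (x, y))" by (rule subgraph_integral_t[OF v s])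
      finally show "(LINT t|lborel. indicator lower (x, y, t) * (wj (x, y) * vt (\<Psi> (x, y, t)))) = wj (x, y) * v (x, y, w (x, y))" .
    qed
    also have "\<dots> = (LINT q|lborel. wj q * v (fst q, snd q, w q))"
      using plane_integral_iter(1)[OF continuous_on_mult[OF wj vc], of R] ps by simp
    finally show ?thesis .
  qed
  show "(LINT p|lborel. indicator (subgraph w) p * vx p) = - (LINT q|lborel. wx q * v (fst q, snd q, w q))"
    by (rule main[OF d(2) sd(1) wc(1) lower_integral_x_y(1)[OF sh supp[OF s]]])
  show "(LINT p|lborel. indicator (subgraph w) p * vy p) = - (LINT q|lborel. wy q * v (fst q, snd q, w q))"
    by (rule main[OF d(3) sd(2) wc(2) lower_integral_x_y(2)[OF sh supp[OF s]]])
qed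

lemma C1_heis_times_coord:
  assumes v: "C1_heis v vx vy vt"
  shows "C1_heis (\<lambda>p. fst (snd p) * v p) (\<lambda>p. fst (snd p) * vx p) (\<lambda>p. v p + fst (snd p) * vy p) (\<lambda>p. fst (snd p) * vt p)"
    "C1_heis (\<lambda>p. fst p * v p) (\<lambda>p. v p + fst p * vx p) (\<lambda>p. fst p * vy p) (\<lambda>p. fst p * vt p)"
proof -
  note d = C1_heisD[OF v]
  show "C1_heis (\<lambda>p. fst (snd p) * v p) (\<lambda>p. fst (snd p) * vx p) (\<lambda>p. v p + fst (snd p) * vy p) (\<lambda>p. fst (snd p) * vt p)"
    unfolding C1_heis_def
  proof (intro conjI allI)
    fix p show "((\<lambda>p. fst (snd p) * v p) has_derivative (\<lambda>h. fst (snd p) * vx p * fst h + (v p + fst (snd p) * vy p) * fst (snd h) + fst (snd p) * vt p * snd (snd h))) (at p)"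
      by (rule derivative_eq_intros d(1) refl)+ (simp add: algebra_simps)
  qed (intro continuous_intros d)+
  show "C1_heis (\<lambda>p. fst p * v p) (\<lambda>p. v p + fst p * vx p) (\<lambda>p. fst p * vy p) (\<lambda>p. fst p * vt p)"
    unfolding C1_heis_def
  proof (intro conjI allI)
    fix p show "((\<lambda>p. fst p * v p) has_derivative (\<lambda>h. (v p + fst p * vx p) * fst h + fst p * vy p * fst (snd h) + fst p * vt p * snd (snd h))) (at p)"
      by (rule derivative_eq_intros d(1) refl)+ (simp add: algebra_simps)
  qed (intro continuous_intros d)+
qed

lemma box_supp_mult: "box_supp R f \<Longrightarrow> box_supp R (\<lambda>p. g p * f p)" by (simp add: box_supp_def)

text \<open>
  The boundary term is the flux of \<open>v1 X + v2 Y\<close> through the graph: the vector \<open>(wx - y, wy + x)\<close> collects the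
  components of its normal along \<open>X\<close> and \<open>Y\<close>.
\<close>

theorem subgraph_divergence:
  assumes v1: "C1_heis v1 v1x v1y v1t" "box_supp R v1" and v2: "C1_heis v2 v2x v2y v2t" "box_supp R v2" and w: "C1_plane w wx wy"
  shows "(LINT p|lborel. indicator (subgraph w) p * hdiv v1 v2 p)
    = - (LINT q|lborel. v1 (fst q, snd q, w q) * (wx q - snd q) + v2 (fst q, snd q, w q) * (wy q + fst q))"
proof -
  note d1 = C1_heisD[OF v1(1)] and d2 = C1_heisD[OF v2(1)]
  note s1 = box_supp_deriv[OF v1] and s2 = box_supp_deriv[OF v2] and wc = C1_planeD(2-4)[OF w]
  note B = subgraph_borel[OF wc(3)]
  note y1 = C1_heis_times_coord(1)[OF v1(1)] and x2 = C1_heis_times_coord(2)[OF v2(1)]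
  have i: "integrable lborel (\<lambda>p. indicator (subgraph w) p * v1x p)" "integrable lborel (\<lambda>p. indicator (subgraph w) p * (fst (snd p) * v1t p))"
    "integrable lborel (\<lambda>p. indicator (subgraph w) p * v2y p)" "integrable lborel (\<lambda>p. indicator (subgraph w) p * (fst p * v2t p))"
    by (rule slice_integrable(1)[OF _ _ B, of _ R]; (intro continuous_intros d1 d2 box_supp_mult s1 s2))+
  have hd: "hdiv v1 v2 p = v1x p + fst (snd p) * v1t p + v2y p - fst p * v2t p" for p
    using hdiv_eq[OF v1(1) v2(1)] by (cases p) simp
  have "(LINT p|lborel. indicator (subgraph w) p * hdiv v1 v2 p)
    = (LINT p|lborel. indicator (subgraph w) p * v1x p + indicator (subgraph w) p * (fst (snd p) * v1t p)
        + indicator (subgraph w) p * v2y p - indicator (subgraph w) p * (fst p * v2t p))"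
    by (simp only: hd right_diff_distrib distrib_left)
  also have "\<dots> = (LINT p|lborel. indicator (subgraph w) p * v1x p) + (LINT p|lborel. indicator (subgraph w) p * (fst (snd p) * v1t p))
        + (LINT p|lborel. indicator (subgraph w) p * v2y p) - (LINT p|lborel. indicator (subgraph w) p * (fst p * v2t p))"
    using i by simp
  also have "\<dots> = - (LINT q|lborel. wx q * v1 (fst q, snd q, w q)) + (LINT q|lborel. snd q * v1 (fst q, snd q, w q))
       - (LINT q|lborel. wy q * v2 (fst q, snd q, w q)) - (LINT q|lborel. fst q * v2 (fst q, snd q, w q))"
    using subgraph_integrals(2)[OF v1 w] subgraph_integrals(3)[OF v2 w]
      subgraph_integrals(1)[OF y1 box_supp_mult[OF v1(2)] w] subgraph_integrals(1)[OF x2 box_supp_mult[OF v2(2)] w] by simp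
  also have "\<dots> = - (LINT q|lborel. v1 (fst q, snd q, w q) * (wx q - snd q) + v2 (fst q, snd q, w q) * (wy q + fst q))"
  proof -
    have vc: "continuous_on UNIV (\<lambda>q. v1 (fst q, snd q, w q))" "continuous_on UNIV (\<lambda>q. v2 (fst q, snd q, w q))"
      by (intro continuous_on_UNIV_compose[OF d1(5)] continuous_on_UNIV_compose[OF d2(5)] continuous_intros wc)+
    have ii: "integrable lborel (\<lambda>q. g q * v1 (fst q, snd q, w q))" "integrable lborel (\<lambda>q. g q * v2 (fst q, snd q, w q))"
      if "continuous_on UNIV g" for g
      by (rule plane_integral_iter(2)[OF continuous_on_mult[OF that vc(1)], of R], use box_suppD[OF v1(2)] in fastforce)
         (rule plane_integral_iter(2)[OF continuous_on_mult[OF that vc(2)], of R], use box_suppD[OF v2(2)] in fastforce)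
    have "(LINT q|lborel. v1 (fst q, snd q, w q) * (wx q - snd q) + v2 (fst q, snd q, w q) * (wy q + fst q))
      = (LINT q|lborel. wx q * v1 (fst q, snd q, w q) - snd q * v1 (fst q, snd q, w q) + wy q * v2 (fst q, snd q, w q) + fst q * v2 (fst q, snd q, w q))"
      by (simp add: algebra_simps)
    also have "\<dots> = (LINT q|lborel. wx q * v1 (fst q, snd q, w q)) - (LINT q|lborel. snd q * v1 (fst q, snd q, w q))
       + (LINT q|lborel. wy q * v2 (fst q, snd q, w q)) + (LINT q|lborel. fst q * v2 (fst q, snd q, w q))"
      using ii(1)[OF wc(1)] ii(1)[OF continuous_on_snd[OF continuous_on_id]] ii(2)[OF wc(2)] ii(2)[OF continuous_on_fst[OF continuous_on_id]]
      by simp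
    finally show ?thesis by simp
  qed
  finally show ?thesis .
qed

section \<open>Smooth approximations of indicator functions\<close>

text \<open>
  Two derivatives are needed in order to apply a commutator of horizontal fields to a test function.
\<close>

definition C2_real :: "(real \<Rightarrow> real) \<Rightarrow> bool" where
  "C2_real f \<longleftrightarrow> (\<exists>f' f''. (\<forall>x. (f has_real_derivative f' x) (at x)) \<and> (\<forall>x. (f' has_real_derivative f'' x) (at x))
     \<and> continuous_on UNIV f'')"

lemma C2_realI:
  assumes "\<And>x. (f has_real_derivative f' x) (at x)" "\<And>x. (f' has_real_derivative f'' x) (at x)" "continuous_on UNIV f''"
  shows "C2_real f"
  using assms unfolding C2_real_def by blast

lemma DERIV_continuous_on: "(\<And>x. (f has_real_derivative f' x) (at x)) \<Longrightarrow> continuous_on A f"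
  by (meson DERIV_isCont continuous_at_imp_continuous_on)

lemma C2_real_mult: assumes "C2_real f" "C2_real g" shows "C2_real (\<lambda>x. f x * g x)"
proof -
  obtain f' f'' where f: "\<And>x. (f has_real_derivative f' x) (at x)" "\<And>x. (f' has_real_derivative f'' x) (at x)" "continuous_on UNIV f''"
    using assms(1) unfolding C2_real_def by blast
  obtain g' g'' where g: "\<And>x. (g has_real_derivative g' x) (at x)" "\<And>x. (g' has_real_derivative g'' x) (at x)" "continuous_on UNIV g''"
    using assms(2) unfolding C2_real_def by blast
  show ?thesis
  proof (rule C2_realI)
    show "((\<lambda>x. f x * g x) has_real_derivative f' x * g x + f x * g' x) (at x)" for x
      by (rule derivative_eq_intros f g refl)+ simp
    show "((\<lambda>x. f' x * g x + f x * g' x) has_real_derivative f'' x * g x + 2 * (f' x * g' x) + f x * g'' x) (at x)" for x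
      by (rule derivative_eq_intros f g refl)+ simp
    show "continuous_on UNIV (\<lambda>x. f'' x * g x + 2 * (f' x * g' x) + f x * g'' x)"
      by (intro continuous_intros f(3) g(3) DERIV_continuous_on[OF f(1)] DERIV_continuous_on[OF f(2)] DERIV_continuous_on[OF g(1)] DERIV_continuous_on[OF g(2)])
  qed
qed

lemma C2_real_const: "C2_real (\<lambda>_. c)"
  by (rule C2_realI[of _ "\<lambda>_. 0" "\<lambda>_. 0"]) auto

lemma C2_real_id: "C2_real (\<lambda>x. x)"
  by (rule C2_realI[of _ "\<lambda>_. 1" "\<lambda>_. 0"]) auto

lemma C2_real_diff: assumes "C2_real f" "C2_real g" shows "C2_real (\<lambda>x. f x - g x)"
proof -
  obtain f' f'' where f: "\<And>x. (f has_real_derivative f' x) (at x)" "\<And>x. (f' has_real_derivative f'' x) (at x)" "continuous_on UNIV f''"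
    using assms(1) unfolding C2_real_def by blast
  obtain g' g'' where g: "\<And>x. (g has_real_derivative g' x) (at x)" "\<And>x. (g' has_real_derivative g'' x) (at x)" "continuous_on UNIV g''"
    using assms(2) unfolding C2_real_def by blast
  show ?thesis
    by (rule C2_realI[of _ "\<lambda>x. f' x - g' x" "\<lambda>x. f'' x - g'' x"])
       (intro derivative_intros f g continuous_intros)+
qed

lemma C2_real_power: "C2_real f \<Longrightarrow> C2_real (\<lambda>x. f x ^ n)"
  by (induction n) (simp_all add: C2_real_const C2_real_mult)

lemma DERIV_positive_part_power:
  "((\<lambda>z::real. (max 0 z) ^ Suc (Suc n)) has_real_derivative real (Suc (Suc n)) * (max 0 z) ^ Suc n) (at z)"
proof (cases z "0::real" rule: linorder_cases)
  case less
  have "((\<lambda>z::real. 0) has_real_derivative 0) (at z)" by simp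
  then have "((\<lambda>z::real. (max 0 z) ^ Suc (Suc n)) has_real_derivative 0) (at z)"
    by (rule has_field_derivative_transform_within_open[of _ _ _ "{..<0}"]) (use less in auto)
  then show ?thesis using less by simp
next
  case greater
  have "((\<lambda>z::real. z ^ Suc (Suc n)) has_real_derivative real (Suc (Suc n)) * z ^ Suc n) (at z)"
    by (auto intro!: derivative_eq_intros simp del: power_Suc)
  then have "((\<lambda>z::real. (max 0 z) ^ Suc (Suc n)) has_real_derivative real (Suc (Suc n)) * z ^ Suc n) (at z)"
    by (rule has_field_derivative_transform_within_open[of _ _ _ "{0<..}"]) (use greater in auto)
  then show ?thesis using greater by simp
next
  case equal
  have "((\<lambda>h::real. (max 0 h) ^ Suc n) \<longlongrightarrow> (max 0 0) ^ Suc n) (at 0)"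
    by (intro tendsto_intros)
  then have "((\<lambda>h::real. (max 0 h) ^ Suc n) \<longlongrightarrow> 0) (at 0)" by simp
  moreover have "\<forall>\<^sub>F h::real in at 0. (max 0 h) ^ Suc n = ((max 0 h) ^ Suc (Suc n) - (max 0 0) ^ Suc (Suc n)) / (h - 0)"
    by (rule eventually_mono[OF eventually_neq_at_within[of 0]]) (auto simp: max_def)
  ultimately have "((\<lambda>h::real. ((max 0 h) ^ Suc (Suc n) - (max 0 0) ^ Suc (Suc n)) / (h - 0)) \<longlongrightarrow> 0) (at 0)"
    by (rule Lim_transform_eventually)
  then show ?thesis unfolding equal has_field_derivative_iff by simp
qed

lemma C2_real_positive_part_cube:
  assumes "C2_real f" shows "C2_real (\<lambda>x. (max 0 (f x)) ^ 3)"
proof -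
  obtain f' f'' where f: "\<And>x. (f has_real_derivative f' x) (at x)" "\<And>x. (f' has_real_derivative f'' x) (at x)" "continuous_on UNIV f''"
    using assms(1) unfolding C2_real_def by blast
  have d3: "((\<lambda>x. (max 0 (f x)) ^ 3) has_real_derivative 3 * (max 0 (f x)) ^ 2 * f' x) (at x)" for x
    using DERIV_chain2[OF DERIV_positive_part_power[of 1] f(1)] by (simp add: numeral_3_eq_3 numeral_2_eq_2)
  have d2: "((\<lambda>x. (max 0 (f x)) ^ 2) has_real_derivative 2 * max 0 (f x) * f' x) (at x)" for x
    using DERIV_chain2[OF DERIV_positive_part_power[of 0] f(1)] by (simp add: numeral_2_eq_2)
  show ?thesis
  proof (rule C2_realI[OF d3])
    show "((\<lambda>x. 3 * (max 0 (f x)) ^ 2 * f' x) has_real_derivative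
      6 * max 0 (f x) * f' x * f' x + 3 * (max 0 (f x)) ^ 2 * f'' x) (at x)" for x
      by (rule derivative_eq_intros d2 f refl)+ (simp add: algebra_simps)
    show "continuous_on UNIV (\<lambda>x. 6 * max 0 (f x) * f' x * f' x + 3 * (max 0 (f x)) ^ 2 * f'' x)"
      by (intro continuous_intros f(3) DERIV_continuous_on[OF f(1)] DERIV_continuous_on[OF f(2)])
  qed
qed

text \<open>
  With \<open>w\<close> the positive part of the parabola that vanishes at \<open>a\<close> and \<open>b\<close> and has maximum \<open>1\<close>, the function \<open>1 - (1 - w\<^sup>3)\<^sup>n\<close> increases to
  the indicator of \<open>(a, b)\<close> as \<open>n\<close> grows. The cube of a positive part is twice differentiable.
\<close>

definition bump :: "real \<Rightarrow> real \<Rightarrow> nat \<Rightarrow> real \<Rightarrow> real" where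
  "bump a b n x = 1 - (1 - (max 0 (4 * (x - a) * (b - x) / (b - a)\<^sup>2)) ^ 3) ^ n"

lemma C2_real_bump: "C2_real (bump a b n)"
proof -
  have "C2_real (\<lambda>x. 4 / (b - a)\<^sup>2 * ((x - a) * (b - x)))"
    by (intro C2_real_mult C2_real_diff C2_real_const C2_real_id)
  moreover have "4 / (b - a)\<^sup>2 * ((x - a) * (b - x)) = 4 * (x - a) * (b - x) / (b - a)\<^sup>2" for x by simp
  ultimately have q: "C2_real (\<lambda>x. 4 * (x - a) * (b - x) / (b - a)\<^sup>2)" by (simp only:)
  show ?thesis unfolding bump_def[abs_def]
    by (intro C2_real_diff C2_real_const C2_real_power C2_real_positive_part_cube q)
qed

lemma bump_base:
  fixes a b x :: real
  assumes "a < b"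
  shows "0 \<le> max 0 (4 * (x - a) * (b - x) / (b - a)\<^sup>2) ^ 3" "max 0 (4 * (x - a) * (b - x) / (b - a)\<^sup>2) ^ 3 \<le> 1"
    "a < x \<Longrightarrow> x < b \<Longrightarrow> 0 < max 0 (4 * (x - a) * (b - x) / (b - a)\<^sup>2) ^ 3"
    "\<not> (a < x \<and> x < b) \<Longrightarrow> max 0 (4 * (x - a) * (b - x) / (b - a)\<^sup>2) ^ 3 = 0"
proof -
  let ?w = "4 * (x - a) * (b - x) / (b - a)\<^sup>2"
  have "0 \<le> ((x - a) - (b - x))\<^sup>2" by simp
  then have "4 * (x - a) * (b - x) \<le> (b - a)\<^sup>2" by (simp add: power2_eq_square algebra_simps)
  then have "?w \<le> 1" using assms by (simp add: divide_le_eq)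
  then show "0 \<le> max 0 ?w ^ 3" "max 0 ?w ^ 3 \<le> 1" by (simp_all add: power_le_one)
  show "0 < max 0 ?w ^ 3" if "a < x" "x < b" using that assms by simp
  show "max 0 ?w ^ 3 = 0" if "\<not> (a < x \<and> x < b)"
  proof -
    have "x \<le> a \<or> b \<le> x" using that by linarith
    then have "(x - a) * (b - x) \<le> 0" using assms by (auto simp: mult_le_0_iff)
    moreover have "?w = 4 / (b - a)\<^sup>2 * ((x - a) * (b - x))" by simp
    moreover have "0 \<le> 4 / (b - a)\<^sup>2" by simp
    ultimately have "?w \<le> 0" by (metis mult_nonneg_nonpos)
    then show ?thesis by simp
  qed
qed

lemma bump_bounds: "a < b \<Longrightarrow> 0 \<le> bump a b n x \<and> bump a b n x \<le> 1"
  unfolding bump_def using bump_base(1,2)[of a b x] by (simp add: power_le_one)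

lemma bump_outside: "a < b \<Longrightarrow> \<not> (a < x \<and> x < b) \<Longrightarrow> bump a b n x = 0"
  unfolding bump_def using bump_base(4)[of a b x] by simp

lemma bump_positive: "a < x \<Longrightarrow> x < b \<Longrightarrow> 0 < bump a b 1 x"
  unfolding bump_def using bump_base(3)[of a b x] by simp

lemma bump_tendsto: assumes "a < b" shows "(\<lambda>n. bump a b n x) \<longlonglongrightarrow> indicator {a<..<b} x"
proof (cases "a < x \<and> x < b")
  case True
  let ?s = "max 0 (4 * (x - a) * (b - x) / (b - a)\<^sup>2) ^ 3"
  have "norm (1 - ?s) < 1" using bump_base(2,3)[OF assms, of x] True by simp
  from tendsto_diff[OF tendsto_const LIMSEQ_power_zero[OF this]]
  show ?thesis using True unfolding bump_def by simp
next
  case False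
  moreover have "indicator {a<..<b} x = (0 :: real)" using False by (simp add: indicator_def)
  ultimately show ?thesis using bump_outside[OF assms False] by simp
qed

lemma bump_continuous: "continuous_on A (bump a b n)"
  using C2_real_bump unfolding C2_real_def by (metis DERIV_continuous_on)

lemma C1_heis_product:
  assumes f: "\<And>x. (f has_real_derivative f' x) (at x)" "continuous_on UNIV f'"
    and g: "\<And>x. (g has_real_derivative g' x) (at x)" "continuous_on UNIV g'"
    and k: "\<And>x. (k has_real_derivative k' x) (at x)" "continuous_on UNIV k'"
  shows "C1_heis (\<lambda>p. f (fst p) * g (fst (snd p)) * k (snd (snd p)))
    (\<lambda>p. f' (fst p) * g (fst (snd p)) * k (snd (snd p))) (\<lambda>p. f (fst p) * g' (fst (snd p)) * k (snd (snd p)))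
    (\<lambda>p. f (fst p) * g (fst (snd p)) * k' (snd (snd p)))"
  unfolding C1_heis_def
proof (intro conjI allI)
  fix p :: heis
  have 1: "((\<lambda>p. f (fst p)) has_derivative (\<lambda>h. f' (fst p) * fst h)) (at p)"
    using diff_chain_at[OF has_derivative_fst[OF has_derivative_ident] f(1)[unfolded has_field_derivative_def]] by (simp add: comp_def)
  have 2: "((\<lambda>p. g (fst (snd p))) has_derivative (\<lambda>h. g' (fst (snd p)) * fst (snd h))) (at p)"
    using diff_chain_at[OF has_derivative_fst[OF has_derivative_snd[OF has_derivative_ident]] g(1)[unfolded has_field_derivative_def]] by (simp add: comp_def)
  have 3: "((\<lambda>p. k (snd (snd p))) has_derivative (\<lambda>h. k' (snd (snd p)) * snd (snd h))) (at p)"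
    using diff_chain_at[OF has_derivative_snd[OF has_derivative_snd[OF has_derivative_ident]] k(1)[unfolded has_field_derivative_def]] by (simp add: comp_def)
  show "((\<lambda>p. f (fst p) * g (fst (snd p)) * k (snd (snd p))) has_derivative
    (\<lambda>h. f' (fst p) * g (fst (snd p)) * k (snd (snd p)) * fst h + f (fst p) * g' (fst (snd p)) * k (snd (snd p)) * fst (snd h)
     + f (fst p) * g (fst (snd p)) * k' (snd (snd p)) * snd (snd h))) (at p)"
    by (rule derivative_eq_intros 1 2 3 refl)+ (simp add: algebra_simps)
next
  have c: "continuous_on UNIV f" "continuous_on UNIV g" "continuous_on UNIV k"
    using DERIV_continuous_on f g k by blast+
  note i = continuous_on_UNIV_compose[OF c(1)] continuous_on_UNIV_compose[OF c(2)] continuous_on_UNIV_compose[OF c(3)]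
    continuous_on_UNIV_compose[OF f(2)] continuous_on_UNIV_compose[OF g(2)] continuous_on_UNIV_compose[OF k(2)]
  show "continuous_on UNIV (\<lambda>p::heis. f' (fst p) * g (fst (snd p)) * k (snd (snd p)))"
    "continuous_on UNIV (\<lambda>p::heis. f (fst p) * g' (fst (snd p)) * k (snd (snd p)))"
    "continuous_on UNIV (\<lambda>p::heis. f (fst p) * g (fst (snd p)) * k' (snd (snd p)))"
    by (intro continuous_on_mult i continuous_intros)+
qed

section \<open>The perimeter of a subgraph\<close>

text \<open>
  The perimeter does not see null sets, and a measurable set may have to be replaced by a Borel set before Fubini applies.
\<close>

definition ae_eq :: "heis set \<Rightarrow> heis set \<Rightarrow> bool" where
  "ae_eq E B \<longleftrightarrow> (AE p in lborel. p \<in> E \<longleftrightarrow> p \<in> B)"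

lemma ae_eq_integral:
  assumes E: "E \<in> sets lebesgue" and B: "B \<in> sets borel" and eq: "ae_eq E B" and f: "continuous_on UNIV f"
  shows "(LINT p:E|lebesgue. f p) = (LINT p|lborel. indicator B p * (f p :: real))"
proof -
  have fm: "f \<in> borel_measurable borel" using f by (rule borel_measurable_continuous_onI)
  then have fl: "f \<in> borel_measurable lebesgue" by (simp add: measurable_completion)
  have B': "B \<in> sets lebesgue" using B by simp
  have "AE p in lebesgue. p \<in> E \<longleftrightarrow> p \<in> B" using eq unfolding ae_eq_def by (rule AE_completion)
  then have "(LINT p:E|lebesgue. f p) = (LINT p|lebesgue. indicator B p * f p)"
    unfolding set_lebesgue_integral_def real_scaleR_def
  proof (intro integral_cong_AE)
    show "(\<lambda>x. indicat_real E x * f x) \<in> borel_measurable lebesgue"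
      using E fl by (intro borel_measurable_times borel_measurable_indicator)
    show "(\<lambda>x. indicat_real B x * f x) \<in> borel_measurable lebesgue"
      using B' fl by (intro borel_measurable_times borel_measurable_indicator)
    assume "AE p in lebesgue. p \<in> E \<longleftrightarrow> p \<in> B"
    then show "AE x in lebesgue. indicat_real E x * f x = indicat_real B x * f x"
      by eventually_elim (simp add: indicator_def)
  qed
  also have "\<dots> = (LINT p|lborel. indicator B p * f p)"
    using B fm by (intro integral_completion) simp
  finally show ?thesis .
qed

lemma hdiv_continuous:
  assumes "C1_heis v1 v1x v1y v1t" "C1_heis v2 v2x v2y v2t"
  shows "continuous_on UNIV (hdiv v1 v2)"
proof -
  have e: "hdiv v1 v2 = (\<lambda>p. v1x p + fst (snd p) * v1t p + v2y p - fst p * v2t p)"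
  proof
    fix p show "hdiv v1 v2 p = v1x p + fst (snd p) * v1t p + v2y p - fst p * v2t p"
      using hdiv_eq[OF assms] by (cases p) simp
  qed
  show ?thesis unfolding e by (intro continuous_intros C1_heisD[OF assms(1)] C1_heisD[OF assms(2)])
qed

lemma test_fieldsE:
  assumes "(v1, v2) \<in> test_fields \<Omega>"
  shows "\<exists>v1x v1y v1t v2x v2y v2t R. C1_heis v1 v1x v1y v1t \<and> C1_heis v2 v2x v2y v2t \<and> box_supp R v1 \<and> box_supp R v2
    \<and> (\<forall>p. p \<notin> \<Omega> \<longrightarrow> v1 p = 0 \<and> v2 p = 0) \<and> (\<forall>p. sqrt ((v1 p)\<^sup>2 + (v2 p)\<^sup>2) \<le> 1)"
proof -
  have t: "C1_on UNIV v1" "C1_on UNIV v2" "compact (closure {p. (v1 p, v2 p) \<noteq> (0, 0)})"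
    "closure {p. (v1 p, v2 p) \<noteq> (0, 0)} \<subseteq> \<Omega>" "\<And>p. sqrt ((v1 p)\<^sup>2 + (v2 p)\<^sup>2) \<le> 1"
    using assms unfolding test_fields_def by blast+
  have z: "v1 p = 0 \<and> v2 p = 0" if "p \<notin> closure {p. (v1 p, v2 p) \<noteq> (0, 0)}" for p
    using that closure_subset[of "{p. (v1 p, v2 p) \<noteq> (0, 0)}"] by blast
  obtain v1x v1y v1t where 1: "C1_heis v1 v1x v1y v1t" using C1_on_imp_C1_heis[OF t(1)] by blast
  obtain v2x v2y v2t where 2: "C1_heis v2 v2x v2y v2t" using C1_on_imp_C1_heis[OF t(2)] by blast
  obtain R1 where R1: "\<forall>R\<ge>R1. box_supp R v1" using exists_box_supp[OF t(3), of v1] z by blast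
  obtain R2 where R2: "\<forall>R\<ge>R2. box_supp R v2" using exists_box_supp[OF t(3), of v2] z by blast
  have b: "box_supp (max R1 R2) v1" "box_supp (max R1 R2) v2" using R1 R2 by simp_all
  have o: "\<forall>p. p \<notin> \<Omega> \<longrightarrow> v1 p = 0 \<and> v2 p = 0" using z t(4) by blast
  show ?thesis by (intro exI conjI) (rule 1, rule 2, rule b(1), rule b(2), rule o, rule allI, rule t(5))
qed

lemma test_fieldsI:
  assumes "C1_heis v1 v1x v1y v1t" "C1_heis v2 v2x v2y v2t" "compact K" "K \<subseteq> \<Omega>"
    "\<And>p. p \<notin> K \<Longrightarrow> v1 p = 0" "\<And>p. p \<notin> K \<Longrightarrow> v2 p = 0" "\<And>p. (v1 p)\<^sup>2 + (v2 p)\<^sup>2 \<le> 1"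
  shows "(v1, v2) \<in> test_fields \<Omega>"
proof -
  have "{p. (v1 p, v2 p) \<noteq> (0, 0)} \<subseteq> K" using assms(5,6) by blast
  then have c: "closure {p. (v1 p, v2 p) \<noteq> (0, 0)} \<subseteq> K" using compact_imp_closed[OF assms(3)] by (rule closure_minimal)
  have k: "compact (closure {p. (v1 p, v2 p) \<noteq> (0, 0)})"
    unfolding compact_closure by (rule bounded_subset[OF compact_imp_bounded[OF assms(3)] \<open>{p. (v1 p, v2 p) \<noteq> (0, 0)} \<subseteq> K\<close>])
  have n: "sqrt ((v1 p)\<^sup>2 + (v2 p)\<^sup>2) \<le> 1" for p unfolding real_sqrt_le_1_iff by (rule assms(7))
  show ?thesis
    unfolding test_fields_def mem_Collect_eq case_prod_conv
    by (intro conjI allI C1_heis_imp_C1_on[OF assms(1)] C1_heis_imp_C1_on[OF assms(2)] k subset_trans[OF c assms(4)] n)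
qed

text \<open>
  The length of \<open>(wx - y, wy + x)\<close>, which is the density of the perimeter of the subgraph.
\<close>

definition speed :: "(plane \<Rightarrow> real) \<Rightarrow> (plane \<Rightarrow> real) \<Rightarrow> plane \<Rightarrow> real" where
  "speed wx wy q = sqrt ((wx q - snd q)\<^sup>2 + (wy q + fst q)\<^sup>2)"

definition square :: "real \<Rightarrow> plane set" where "square R = {q. \<bar>fst q\<bar> < R \<and> \<bar>snd q\<bar> < R}"

lemma square_borel: "square R \<in> sets borel"
proof -
  have "square R = {q. \<bar>fst q\<bar> < R} \<inter> {q. \<bar>snd q\<bar> < R}" by (auto simp: square_def)
  moreover have "open {q::plane. \<bar>fst q\<bar> < R}" "open {q::plane. \<bar>snd q\<bar> < R}"
    by (intro open_Collect_less continuous_intros)+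
  ultimately show ?thesis by (simp add: open_Int)
qed

lemma speed_continuous: assumes "C1_plane w wx wy" shows "continuous_on A (speed wx wy)"
  unfolding speed_def
  by (intro continuous_intros continuous_on_subset[OF C1_planeD(2)[OF assms]] continuous_on_subset[OF C1_planeD(3)[OF assms]]) simp_all

lemma integrable_on_square:
  fixes g :: "plane \<Rightarrow> real"
  assumes "continuous_on UNIV g" shows "integrable lborel (\<lambda>q. indicator (square R) q * g q)"
proof -
  have "integrable lborel (\<lambda>q. indicator (cbox (-R, -R) (R, R)) q *\<^sub>R g q)"
    by (rule borel_integrable_compact[OF compact_cbox continuous_on_subset[OF assms]]) simp
  then have i: "integrable lborel (\<lambda>q. indicator (cbox (-R, -R) (R, R)) q * g q)" by simp
  have e: "indicator (square R) q * g q = indicator (square R) q * (indicator (cbox (-R, -R) (R, R)) q * g q)" for q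
  proof (cases q)
    case (Pair x y)
    then show ?thesis using notin_square[of x y R] by (auto simp: indicator_def square_def)
  qed
  show ?thesis by (subst e) (rule integrable_indicator_times[OF i square_borel])
qed

definition area :: "real \<Rightarrow> (plane \<Rightarrow> real) \<Rightarrow> (plane \<Rightarrow> real) \<Rightarrow> real" where
  "area R wx wy = (LINT q|lborel. indicator (square R) q * speed wx wy q)"

lemma cauchy_schwarz_2: "- (a * c + b * d) \<le> sqrt (c\<^sup>2 + d\<^sup>2)" if "sqrt (a\<^sup>2 + b\<^sup>2) \<le> 1" for a b c d :: real
proof -
  have "- (a * c + b * d) \<le> norm (a, b) * norm (c, d)"
    using Cauchy_Schwarz_ineq2[of "(a, b)" "(c, d)"] by (simp add: inner_prod_def)
  also have "\<dots> \<le> 1 * norm (c, d)" using that by (intro mult_right_mono) (simp_all add: norm_Pair)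
  finally show ?thesis by (simp add: norm_Pair)
qed

text \<open>
  The flux density is \<open>v \<cdot> (wx - y, wy + x)\<close>, and \<open>|v| \<le> 1\<close>.
\<close>

theorem perimeter_subgraph_le:
  assumes E: "E \<in> sets lebesgue" "ae_eq E (subgraph w)" and w: "C1_plane w wx wy"
    and \<Omega>: "\<And>x y t. (x, y, t) \<in> \<Omega> \<Longrightarrow> \<bar>x\<bar> < R \<and> \<bar>y\<bar> < R"
  shows "perimeter E \<Omega> \<le> ereal (area R wx wy)"
  unfolding perimeter_def
proof (rule SUP_least, clarify)
  fix v1 v2 assume "(v1, v2) \<in> test_fields \<Omega>"
  from test_fieldsE[OF this] obtain v1x v1y v1t v2x v2y v2t S
    where v1: "C1_heis v1 v1x v1y v1t" "box_supp S v1" and v2: "C1_heis v2 v2x v2y v2t" "box_supp S v2"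
      and z: "\<forall>p. p \<notin> \<Omega> \<longrightarrow> v1 p = 0 \<and> v2 p = 0" and n: "\<forall>p. sqrt ((v1 p)\<^sup>2 + (v2 p)\<^sup>2) \<le> 1"
    by (elim exE conjE)
  note wc = C1_planeD(2-4)[OF w]
  have vc: "continuous_on UNIV (\<lambda>q. v1 (fst q, snd q, w q))" "continuous_on UNIV (\<lambda>q. v2 (fst q, snd q, w q))"
    by (intro continuous_on_UNIV_compose[OF C1_heisD(5)[OF v1(1)]] continuous_on_UNIV_compose[OF C1_heisD(5)[OF v2(1)]] continuous_intros wc)+
  let ?g = "\<lambda>q. - (v1 (fst q, snd q, w q) * (wx q - snd q) + v2 (fst q, snd q, w q) * (wy q + fst q))"
  have gi: "integrable lborel ?g"
  proof (rule plane_integral_iter(2)[where R = S])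
    show "continuous_on UNIV ?g" by (intro continuous_intros vc wc)
    show "?g (x, y) = 0" if "S < \<bar>x\<bar> \<or> S < \<bar>y\<bar>" for x y
    proof -
      have "v1 (x, y, w (x, y)) = 0" "v2 (x, y, w (x, y)) = 0" using box_suppD[OF v1(2)] box_suppD[OF v2(2)] that by blast+
      then show ?thesis by simp
    qed
  qed
  have "(LINT p:E|lebesgue. hdiv v1 v2 p) = (LINT p|lborel. indicator (subgraph w) p * hdiv v1 v2 p)"
    by (rule ae_eq_integral[OF E(1) subgraph_borel[OF wc(3)] E(2) hdiv_continuous[OF v1(1) v2(1)]])
  also have "\<dots> = (LINT q|lborel. ?g q)"
    by (simp only: Bochner_Integration.integral_minus subgraph_divergence[OF v1 v2 w])
  also have "\<dots> \<le> area R wx wy"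
    unfolding area_def
  proof (rule integral_mono[OF gi integrable_on_square[OF speed_continuous[OF w]]])
    fix q
    show "?g q \<le> indicator (square R) q * speed wx wy q"
    proof (cases "q \<in> square R")
      case True
      then show ?thesis using cauchy_schwarz_2[OF n[rule_format, of "(fst q, snd q, w q)"]] by (simp add: speed_def)
    next
      case False
      then have "(fst q, snd q, w q) \<notin> \<Omega>" using \<Omega> by (auto simp: square_def)
      then show ?thesis using z False by simp
    qed
  qed
  finally show "ereal (LINT p:E|lebesgue. hdiv v1 v2 p) \<le> ereal (area R wx wy)" by simp
qed

lemma subgraph_locally_finite:
  assumes E: "E \<in> sets lebesgue" "ae_eq E (subgraph w)" and w: "C1_plane w wx wy"
  shows "locally_finite_perimeter E"
  unfolding locally_finite_perimeter_def
proof (intro conjI allI impI E(1))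
  fix \<Omega> :: "heis set" assume "open \<Omega> \<and> bounded \<Omega>"
  then obtain B where B: "\<And>p. p \<in> \<Omega> \<Longrightarrow> norm p \<le> B" unfolding bounded_iff by blast
  have n: "\<bar>x\<bar> \<le> norm (x, y, t)" "\<bar>y\<bar> \<le> norm (x, y, t)" for x y t :: real
    unfolding norm_Pair by (auto intro: real_le_rsqrt simp: real_sqrt_ge_abs1 add_increasing add_increasing2)
  have "perimeter E \<Omega> \<le> ereal (area (B + 1) wx wy)"
  proof (rule perimeter_subgraph_le[OF E w])
    fix x y t assume "(x, y, t) \<in> \<Omega>"
    from B[OF this] n(1)[where x=x and y=y and t=t] n(2)[where x=x and y=y and t=t] show "\<bar>x\<bar> < B + 1 \<and> \<bar>y\<bar> < B + 1" by linarith
  qed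
  then show "perimeter E \<Omega> < \<infinity>" by (rule order_le_less_trans) simp
qed

definition slab :: "real \<Rightarrow> real \<Rightarrow> heis set" where
  "slab R M = {p. \<bar>fst p\<bar> < R \<and> \<bar>fst (snd p)\<bar> < R \<and> \<bar>snd (snd p)\<bar> < M}"

lemma slab_open: "open (slab R M)"
proof -
  have "slab R M = {p. \<bar>fst p\<bar> < R} \<inter> {p. \<bar>fst (snd p)\<bar> < R} \<inter> {p. \<bar>snd (snd p)\<bar> < M}" by (auto simp: slab_def)
  moreover have "open {p::heis. \<bar>fst p\<bar> < R}" "open {p::heis. \<bar>fst (snd p)\<bar> < R}" "open {p::heis. \<bar>snd (snd p)\<bar> < M}"
    by (intro open_Collect_less continuous_intros)+
  ultimately show ?thesis by (simp add: open_Int)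
qed

lemma slab_bounded: "bounded (slab R M)"
proof (rule bounded_subset[OF bounded_cbox[of "(-R, -R, -M)" "(R, R, M)"]])
  show "slab R M \<subseteq> cbox (-R, -R, -M) (R, R, M)" by (auto simp: slab_def cbox_Pair_iff)
qed

lemma C1_heis_mult:
  assumes "C1_heis f fx fy ft" "C1_heis g gx gy gt"
  shows "C1_heis (\<lambda>p. f p * g p) (\<lambda>p. fx p * g p + f p * gx p) (\<lambda>p. fy p * g p + f p * gy p) (\<lambda>p. ft p * g p + f p * gt p)"
  unfolding C1_heis_def
proof (intro conjI allI)
  note f = C1_heisD[OF assms(1)] and g = C1_heisD[OF assms(2)]
  fix p show "((\<lambda>p. f p * g p) has_derivative (\<lambda>h. (fx p * g p + f p * gx p) * fst h + (fy p * g p + f p * gy p) * fst (snd h)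
    + (ft p * g p + f p * gt p) * snd (snd h))) (at p)"
    by (rule derivative_eq_intros f(1) g(1) refl)+ (simp add: algebra_simps)
qed (intro continuous_intros C1_heisD[OF assms(1)] C1_heisD[OF assms(2)])+

text \<open>
  Polynomials serve as the differentiable approximations of the merely continuous normal.
\<close>

lemma real_polynomial_C1_heis:
  assumes "real_polynomial_function (g :: heis \<Rightarrow> real)" shows "\<exists>gx gy gt. C1_heis g gx gy gt"
  using assms
proof (induction rule: real_polynomial_function.induct)
  case (linear f)
  have "f h = f (1, 0, 0) * fst h + f (0, 1, 0) * fst (snd h) + f (0, 0, 1) * snd (snd h)" for h
  proof -
    have "h = fst h *\<^sub>R (1, 0, 0) + fst (snd h) *\<^sub>R (0, 1, 0) + snd (snd h) *\<^sub>R (0, 0, 1)" by (cases h) auto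
    then have "f h = f (fst h *\<^sub>R (1, 0, 0) + fst (snd h) *\<^sub>R (0, 1, 0) + snd (snd h) *\<^sub>R (0, 0, 1))" by simp
    then show ?thesis
      by (simp only: linear_add[OF bounded_linear.linear[OF linear]] linear_cmul[OF bounded_linear.linear[OF linear]] real_scaleR_def mult.commute)
  qed
  then have "f = (\<lambda>h. f (1, 0, 0) * fst h + f (0, 1, 0) * fst (snd h) + f (0, 0, 1) * snd (snd h))" by (rule ext)
  moreover have "(f has_derivative f) (at p)" for p by (rule bounded_linear_imp_has_derivative[OF linear])
  ultimately have "C1_heis f (\<lambda>_. f (1, 0, 0)) (\<lambda>_. f (0, 1, 0)) (\<lambda>_. f (0, 0, 1))"
    unfolding C1_heis_def by (simp only: continuous_on_const simp_thms)
  then show ?case by blast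
next
  case (const c)
  have "C1_heis (\<lambda>_. c) (\<lambda>_. 0) (\<lambda>_. 0) (\<lambda>_. 0)" unfolding C1_heis_def by simp
  then show ?case by blast
next
  case (add f g)
  then obtain fx fy ft gx gy gt where fg: "C1_heis f fx fy ft" "C1_heis g gx gy gt" by blast
  have "C1_heis (\<lambda>p. f p + g p) (\<lambda>p. fx p + gx p) (\<lambda>p. fy p + gy p) (\<lambda>p. ft p + gt p)"
    unfolding C1_heis_def
  proof (intro conjI allI)
    fix p show "((\<lambda>p. f p + g p) has_derivative (\<lambda>h. (fx p + gx p) * fst h + (fy p + gy p) * fst (snd h) + (ft p + gt p) * snd (snd h))) (at p)"
      by (rule derivative_eq_intros C1_heisD(1)[OF fg(1)] C1_heisD(1)[OF fg(2)] refl)+ (simp add: algebra_simps)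
  qed (intro continuous_intros C1_heisD[OF fg(1)] C1_heisD[OF fg(2)])+
  then show ?case by blast
next
  case (mult f g)
  then obtain fx fy ft gx gy gt where fg: "C1_heis f fx fy ft" "C1_heis g gx gy gt" by blast
  from C1_heis_mult[OF this] show ?case by blast
qed

text \<open>
  The direction \<open>g / |g|\<close> need not extend continuously to the zeros of \<open>g\<close>. Its regularization
  \<open>g / sqrt (\<epsilon>\<^sup>2 + |g|\<^sup>2)\<close> does, and a vector close to it is still nearly a unit vector nearly parallel to \<open>g\<close>.
\<close>

lemma near_calibration:
  fixes p1 p2 g1 g2 \<epsilon> :: real
  assumes e: "0 < \<epsilon>" and a: "\<bar>g1 / sqrt (\<epsilon>\<^sup>2 + (g1\<^sup>2 + g2\<^sup>2)) - p1\<bar> \<le> \<epsilon> / 2" "\<bar>g2 / sqrt (\<epsilon>\<^sup>2 + (g1\<^sup>2 + g2\<^sup>2)) - p2\<bar> \<le> \<epsilon> / 2"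
  shows "p1\<^sup>2 + p2\<^sup>2 \<le> (1 + \<epsilon>)\<^sup>2"
    "sqrt (g1\<^sup>2 + g2\<^sup>2) - \<epsilon> - \<epsilon> * sqrt (g1\<^sup>2 + g2\<^sup>2) \<le> p1 * g1 + p2 * g2"
proof -
  define G where "G = sqrt (g1\<^sup>2 + g2\<^sup>2)"
  define s where "s = sqrt (\<epsilon>\<^sup>2 + (g1\<^sup>2 + g2\<^sup>2))"
  have G: "0 \<le> G" "G\<^sup>2 = g1\<^sup>2 + g2\<^sup>2" by (simp_all add: G_def)
  have s2: "s\<^sup>2 = \<epsilon>\<^sup>2 + G\<^sup>2" unfolding s_def G(2) by simp
  have s: "0 < s" unfolding s_def using e by (simp add: add_pos_nonneg)
  have sG: "G \<le> s" by (rule power2_le_imp_le) (use s s2 in auto)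
  have sG': "s \<le> G + \<epsilon>" by (rule power2_le_imp_le) (use s2 G e in \<open>auto simp: power2_sum\<close>)
  let ?f = "(g1 / s, g2 / s)" and ?p = "(p1, p2)" and ?g = "(g1, g2)"
  have ng: "norm ?g = G" by (simp add: norm_Pair G_def)
  have fg: "?f = (1 / s) *\<^sub>R ?g" by simp
  have nf: "norm ?f \<le> 1" unfolding fg norm_scaleR ng using s sG by simp
  have "norm (?f - ?p) \<le> \<bar>g1 / s - p1\<bar> + \<bar>g2 / s - p2\<bar>" by (simp add: norm_Pair sqrt_sum_squares_le_sum_abs)
  also have "\<dots> \<le> \<epsilon>" using a unfolding s_def[symmetric] by linarith
  finally have nd: "norm (?f - ?p) \<le> \<epsilon>" .
  have "norm ?p \<le> norm ?f + norm (?f - ?p)" using norm_triangle_sub[of ?p ?f] by (simp only: norm_minus_commute)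
  then have "norm ?p \<le> 1 + \<epsilon>" using nf nd by linarith
  then have "(norm ?p)\<^sup>2 \<le> (1 + \<epsilon>)\<^sup>2" by (intro power_mono) simp_all
  then show "p1\<^sup>2 + p2\<^sup>2 \<le> (1 + \<epsilon>)\<^sup>2" by (simp add: norm_Pair)
  have "(G - \<epsilon>) * s \<le> G\<^sup>2"
  proof (cases "\<epsilon> \<le> G")
    case True
    then have "(G - \<epsilon>) * s \<le> (G - \<epsilon>) * (G + \<epsilon>)" using sG' by (intro mult_left_mono) auto
    also have "(G - \<epsilon>) * (G + \<epsilon>) = G\<^sup>2 - \<epsilon>\<^sup>2" by (simp add: algebra_simps power2_eq_square)
    also have "\<dots> \<le> G\<^sup>2" by simp
    finally show ?thesis .
  next
    case False
    then have "(G - \<epsilon>) * s \<le> 0" using s by (simp add: mult_nonpos_nonneg)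
    then show ?thesis using zero_le_power2[of G] by linarith
  qed
  then have 1: "G - \<epsilon> \<le> G\<^sup>2 / s" using s by (simp add: pos_le_divide_eq)
  have "?f \<bullet> ?g = G\<^sup>2 / s" unfolding G(2) by (simp add: inner_prod_def power2_eq_square add_divide_distrib)
  moreover have "(?f - ?p) \<bullet> ?g \<le> \<epsilon> * G"
    using norm_cauchy_schwarz[of "?f - ?p" ?g] mult_right_mono[OF nd G(1)] unfolding ng by linarith
  moreover have "?p \<bullet> ?g = ?f \<bullet> ?g - (?f - ?p) \<bullet> ?g" using inner_diff_left[of ?f ?p ?g] by linarith
  moreover have "?p \<bullet> ?g = p1 * g1 + p2 * g2" by (simp add: inner_prod_def)
  ultimately show "sqrt (g1\<^sup>2 + g2\<^sup>2) - \<epsilon> - \<epsilon> * sqrt (g1\<^sup>2 + g2\<^sup>2) \<le> p1 * g1 + p2 * g2" unfolding G_def[symmetric] using 1 by linarith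
qed

text \<open>
  The test field is a cutoff times a polynomial approximation, in the sense of Stone and Weierstrass, of the regularized
  normal, divided by \<open>1 + \<epsilon>\<close> to restore the bound on its length.
\<close>

lemma perimeter_subgraph_ge_approx:
  assumes E: "E \<in> sets lebesgue" "ae_eq E (subgraph w)" and w: "C1_plane w wx wy"
    and R: "0 < R'" "R' < R" "0 < M'" "M' < M" and \<epsilon>: "0 < \<epsilon>"
  shows "ereal (LINT q|lborel. bump (-R') R' n (fst q) * bump (-R') R' n (snd q) * bump (-M') M' n (w q)
      * ((speed wx wy q - \<epsilon> - \<epsilon> * speed wx wy q) / (1 + \<epsilon>))) \<le> perimeter E (slab R M)"
proof -
  note wc = C1_planeD(2-4)[OF w]
  define K :: "heis set" where "K = cbox (-R', -R', -M') (R', R', M')"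
  have K: "compact K" "K \<subseteq> slab R M" unfolding K_def using R by (auto simp: slab_def cbox_Pair_iff)
  define ct0 where "ct0 p = bump (-R') R' n (fst p) * bump (-R') R' n (fst (snd p)) * bump (-M') M' n (snd (snd p))" for p :: heis
  have ctK: "ct0 p = 0" if "p \<notin> K" for p
  proof -
    have "\<not> (- R' < fst p \<and> fst p < R') \<or> \<not> (- R' < fst (snd p) \<and> fst (snd p) < R') \<or> \<not> (- M' < snd (snd p) \<and> snd (snd p) < M')"
      using that by (cases p) (force simp: K_def cbox_Pair_iff)
    then show ?thesis using bump_outside[of "-R'" R'] bump_outside[of "-M'" M'] R unfolding ct0_def by fastforce
  qed
  have ct01: "0 \<le> ct0 p" "ct0 p \<le> 1" for p
    using bump_bounds[of "-R'" R' n] bump_bounds[of "-M'" M' n] R unfolding ct0_def by (auto intro!: mult_le_one)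
  obtain b b' d d' where bd: "\<And>x. (bump (-R') R' n has_real_derivative b' x) (at x)" "continuous_on UNIV b'"
    "\<And>x. (bump (-M') M' n has_real_derivative d' x) (at x)" "continuous_on UNIV d'"
    using C2_real_bump[of "-R'" R' n] C2_real_bump[of "-M'" M' n] DERIV_continuous_on unfolding C2_real_def by metis
  obtain cx cy ct where ctC: "C1_heis ct0 cx cy ct"
    using C1_heis_product[OF bd(1,2) bd(1,2) bd(3,4)] unfolding ct0_def by blast
  let ?g1 = "\<lambda>q. wx q - snd q" and ?g2 = "\<lambda>q. wy q + fst q"
  define s where "s q = sqrt (\<epsilon>\<^sup>2 + ((?g1 q)\<^sup>2 + (?g2 q)\<^sup>2))" for q
  have s: "s q > 0" for q unfolding s_def using \<epsilon> by (simp add: add_pos_nonneg)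
  have sc: "continuous_on UNIV s" unfolding s_def by (intro continuous_intros wc)
  have f1c: "continuous_on K (\<lambda>p. ?g1 (fst p, fst (snd p)) / s (fst p, fst (snd p)))"
    by (rule continuous_on_UNIV_compose[of "\<lambda>q. ?g1 q / s q"]; (intro continuous_intros wc sc)?) (use s less_irrefl in \<open>metis\<close>)
  have f2c: "continuous_on K (\<lambda>p. ?g2 (fst p, fst (snd p)) / s (fst p, fst (snd p)))"
    by (rule continuous_on_UNIV_compose[of "\<lambda>q. ?g2 q / s q"]; (intro continuous_intros wc sc)?) (use s less_irrefl in \<open>metis\<close>)
  have e2: "0 < \<epsilon> / 2" using \<epsilon> by simp
  obtain P1 where P1: "real_polynomial_function P1" "\<And>p. p \<in> K \<Longrightarrow> \<bar>?g1 (fst p, fst (snd p)) / s (fst p, fst (snd p)) - P1 p\<bar> < \<epsilon> / 2"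
    by (rule Stone_Weierstrass_real_polynomial_function[OF K(1) f1c e2]) (rule that; assumption)
  obtain P2 where P2: "real_polynomial_function P2" "\<And>p. p \<in> K \<Longrightarrow> \<bar>?g2 (fst p, fst (snd p)) / s (fst p, fst (snd p)) - P2 p\<bar> < \<epsilon> / 2"
    by (rule Stone_Weierstrass_real_polynomial_function[OF K(1) f2c e2]) (rule that; assumption)
  obtain P1x P1y P1t where P1C: "C1_heis P1 P1x P1y P1t" using real_polynomial_C1_heis[OF P1(1)] by blast
  obtain P2x P2y P2t where P2C: "C1_heis P2 P2x P2y P2t" using real_polynomial_C1_heis[OF P2(1)] by blast
  have cC: "C1_heis (\<lambda>_. - 1 / (1 + \<epsilon>)) (\<lambda>_. 0) (\<lambda>_. 0) (\<lambda>_. 0)" unfolding C1_heis_def by simp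
  define v1 v2 where "v1 p = (- 1 / (1 + \<epsilon>)) * (ct0 p * P1 p)" and "v2 p = (- 1 / (1 + \<epsilon>)) * (ct0 p * P2 p)" for p
  obtain v1x v1y v1t where v1: "C1_heis v1 v1x v1y v1t"
    using C1_heis_mult[OF cC C1_heis_mult[OF ctC P1C]] unfolding v1_def by blast
  obtain v2x v2y v2t where v2: "C1_heis v2 v2x v2y v2t"
    using C1_heis_mult[OF cC C1_heis_mult[OF ctC P2C]] unfolding v2_def by blast
  have z: "v1 p = 0" "v2 p = 0" if "p \<notin> K" for p using ctK[OF that] by (simp_all add: v1_def v2_def)
  have cal: "(P1 p)\<^sup>2 + (P2 p)\<^sup>2 \<le> (1 + \<epsilon>)\<^sup>2"
    "speed wx wy (fst p, fst (snd p)) - \<epsilon> - \<epsilon> * speed wx wy (fst p, fst (snd p)) \<le> P1 p * ?g1 (fst p, fst (snd p)) + P2 p * ?g2 (fst p, fst (snd p))"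
    if "p \<in> K" for p
    unfolding speed_def
    by (rule near_calibration[OF \<epsilon> less_imp_le[OF P1(2)[OF that, unfolded s_def]] less_imp_le[OF P2(2)[OF that, unfolded s_def]]])+
  have norm1: "(v1 p)\<^sup>2 + (v2 p)\<^sup>2 \<le> 1" for p
  proof (cases "p \<in> K")
    case True
    have "(v1 p)\<^sup>2 + (v2 p)\<^sup>2 = (ct0 p)\<^sup>2 * (((P1 p)\<^sup>2 + (P2 p)\<^sup>2) / (1 + \<epsilon>)\<^sup>2)"
      by (simp add: v1_def v2_def power_mult_distrib power_divide add_divide_distrib algebra_simps)
    also have "\<dots> \<le> 1 * 1" using ct01[of p] cal(1)[OF True] \<epsilon> by (intro mult_mono power_le_one) (simp_all add: divide_le_eq)
    finally show ?thesis by simp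
  qed (simp add: z)
  have tf: "(v1, v2) \<in> test_fields (slab R M)" by (rule test_fieldsI[OF v1 v2 K z norm1])
  have "\<exists>S1. \<forall>R\<ge>S1. box_supp R v1" by (rule exists_box_supp[OF K(1)]) (rule z(1))
  then obtain S1 where S1: "\<forall>R\<ge>S1. box_supp R v1" by (elim exE)
  have "\<exists>S2. \<forall>R\<ge>S2. box_supp R v2" by (rule exists_box_supp[OF K(1)]) (rule z(2))
  then obtain S2 where S2: "\<forall>R\<ge>S2. box_supp R v2" by (elim exE)
  define S where "S = max S1 S2"
  have S: "box_supp S v1" "box_supp S v2" using S1 S2 by (simp_all add: S_def)
  have vc: "continuous_on UNIV (\<lambda>q. v1 (fst q, snd q, w q))" "continuous_on UNIV (\<lambda>q. v2 (fst q, snd q, w q))"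
    by (intro continuous_on_UNIV_compose[OF C1_heisD(5)[OF v1]] continuous_on_UNIV_compose[OF C1_heisD(5)[OF v2]] continuous_intros wc)+
  let ?g = "\<lambda>q. - (v1 (fst q, snd q, w q) * ?g1 q + v2 (fst q, snd q, w q) * ?g2 q)"
  let ?h = "\<lambda>q. bump (-R') R' n (fst q) * bump (-R') R' n (snd q) * bump (-M') M' n (w q)
      * ((speed wx wy q - \<epsilon> - \<epsilon> * speed wx wy q) / (1 + \<epsilon>))"
  have "(LINT q|lborel. ?h q) \<le> (LINT q|lborel. ?g q)"
  proof (rule integral_mono)
    show "integrable lborel ?g"
    proof (rule plane_integral_iter(2)[where R = S])
      show "continuous_on UNIV ?g" by (intro continuous_intros vc wc)
      show "?g (x, y) = 0" if "S < \<bar>x\<bar> \<or> S < \<bar>y\<bar>" for x y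
      proof -
        have "v1 (x, y, w (x, y)) = 0" "v2 (x, y, w (x, y)) = 0" using box_suppD[OF S(1)] box_suppD[OF S(2)] that by blast+
        then show ?thesis by simp
      qed
    qed
    show "integrable lborel ?h"
    proof (rule plane_integral_iter(2)[where R = R'])
      show "continuous_on UNIV ?h"
        by (intro continuous_intros speed_continuous[OF w] continuous_on_UNIV_compose[OF bump_continuous] wc) (use \<epsilon> in simp)
      show "?h (x, y) = 0" if "R' < \<bar>x\<bar> \<or> R' < \<bar>y\<bar>" for x y
      proof -
        have "\<not> (- R' < x \<and> x < R') \<or> \<not> (- R' < y \<and> y < R')" using that by linarith
        then have "bump (-R') R' n x = 0 \<or> bump (-R') R' n y = 0" using bump_outside[of "-R'" R'] R by auto
        then show ?thesis by auto
      qed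
    qed
    fix q
    let ?p = "(fst q, snd q, w q)"
    have h: "?h q = ct0 ?p * ((speed wx wy q - \<epsilon> - \<epsilon> * speed wx wy q) / (1 + \<epsilon>))" by (simp add: ct0_def)
    have g: "?g q = ct0 ?p * ((P1 ?p * ?g1 q + P2 ?p * ?g2 q) / (1 + \<epsilon>))"
      by (simp add: v1_def v2_def algebra_simps add_divide_distrib diff_divide_distrib)
    show "?h q \<le> ?g q"
    proof (cases "?p \<in> K")
      case True
      have "speed wx wy q - \<epsilon> - \<epsilon> * speed wx wy q \<le> P1 ?p * ?g1 q + P2 ?p * ?g2 q"
        using cal(2)[OF True] by simp
      then show ?thesis unfolding h g using ct01(1)[of ?p] \<epsilon> by (intro mult_left_mono divide_right_mono) auto
    next
      case False
      then show ?thesis unfolding h g using ctK by simp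
    qed
  qed
  also have "(LINT q|lborel. ?g q) = (LINT p|lborel. indicator (subgraph w) p * hdiv v1 v2 p)"
    by (simp only: Bochner_Integration.integral_minus subgraph_divergence[OF v1 S(1) v2 S(2) w])
  also have "\<dots> = (LINT p:E|lebesgue. hdiv v1 v2 p)"
    by (rule ae_eq_integral[OF E(1) subgraph_borel[OF wc(3)] E(2) hdiv_continuous[OF v1 v2], symmetric])
  finally have "ereal (LINT q|lborel. ?h q) \<le> ereal (LINT p:E|lebesgue. hdiv v1 v2 p)" by simp
  also have "\<dots> \<le> perimeter E (slab R M)" unfolding perimeter_def by (rule SUP_upper2[OF tf]) simp
  finally show ?thesis .
qed

section \<open>First variation\<close>

lemma square_mono: "R \<le> R' \<Longrightarrow> q \<in> square R \<Longrightarrow> q \<in> square R'"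
  by (auto simp: square_def)

text \<open>
  The cutoffs increase to the indicator of the cylinder over the square, and the graph stays away from the top and the
  bottom of the slab; so the lower bounds of \<open>perimeter_subgraph_ge_approx\<close> converge to the area.
\<close>

lemma area_approx_le_perimeter:
  assumes E: "E \<in> sets lebesgue" "ae_eq E (subgraph w)" and w: "C1_plane w wx wy"
    and R: "0 < R'" "R' < R" "0 < M'" "M' < M" and bd: "\<And>q. q \<in> square R \<Longrightarrow> \<bar>w q\<bar> < M'"
  shows "ereal (area R' wx wy) \<le> perimeter E (slab R M)"
proof -
  note wc = C1_planeD(2-4)[OF w]
  define \<epsilon> where "\<epsilon> n = 1 / (real n + 1)" for n
  have \<epsilon>: "0 < \<epsilon> n" "\<epsilon> n \<le> 1" for n by (simp_all add: \<epsilon>_def)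
  have \<epsilon>0: "\<epsilon> \<longlonglongrightarrow> 0" unfolding \<epsilon>_def using LIMSEQ_inverse_real_of_nat by (simp add: inverse_eq_divide add.commute)
  let ?s = "speed wx wy"
  define h where "h n q = bump (-R') R' n (fst q) * bump (-R') R' n (snd q) * bump (-M') M' n (w q)
      * ((?s q - \<epsilon> n - \<epsilon> n * ?s q) / (1 + \<epsilon> n))" for n q
  have le: "ereal (LINT q|lborel. h n q) \<le> perimeter E (slab R M)" for n
    unfolding h_def by (rule perimeter_subgraph_ge_approx[OF E w R \<epsilon>(1)])
  have R2: "-R' < R'" "-M' < M'" using R by simp_all
  have hc: "continuous_on UNIV (h n)" for n
    unfolding h_def[abs_def]
    by (intro continuous_intros speed_continuous[OF w] continuous_on_UNIV_compose[OF bump_continuous] wc) (use \<epsilon>(1)[of n] in simp)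
  have s0: "0 \<le> ?s q" for q by (simp add: speed_def)
  have dom: "norm (h n q) \<le> indicator (square R') q * (1 + 2 * ?s q)" for n q
  proof (cases "q \<in> square R'")
    case True
    let ?b = "bump (-R') R' n (fst q) * bump (-R') R' n (snd q) * bump (-M') M' n (w q)"
    have b: "0 \<le> ?b" "?b \<le> 1"
      using bump_bounds[OF R2(1), of n] bump_bounds[OF R2(2), of n] by (auto intro!: mult_le_one)
    have "0 \<le> \<epsilon> n * ?s q" using \<epsilon>(1)[of n] s0[of q] by simp
    moreover have "\<epsilon> n * ?s q \<le> 1 * ?s q" by (rule mult_right_mono[OF \<epsilon>(2) s0])
    ultimately have "\<bar>?s q - \<epsilon> n - \<epsilon> n * ?s q\<bar> \<le> 1 + 2 * ?s q" using \<epsilon>[of n] s0[of q] by linarith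
    also have "\<dots> \<le> (1 + 2 * ?s q) * (1 + \<epsilon> n)" using \<epsilon>(1)[of n] s0[of q] by (simp add: mult_le_cancel_left1)
    finally have "\<bar>(?s q - \<epsilon> n - \<epsilon> n * ?s q) / (1 + \<epsilon> n)\<bar> \<le> 1 + 2 * ?s q"
      using \<epsilon>(1)[of n] by (simp add: abs_divide pos_divide_le_eq)
    then have "\<bar>?b\<bar> * \<bar>(?s q - \<epsilon> n - \<epsilon> n * ?s q) / (1 + \<epsilon> n)\<bar> \<le> 1 * (1 + 2 * ?s q)"
      using b by (intro mult_mono) auto
    then show ?thesis using True by (simp add: h_def abs_mult)
  next
    case False
    then have "\<not> (- R' < fst q \<and> fst q < R') \<or> \<not> (- R' < snd q \<and> snd q < R')" by (auto simp: square_def)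
    then have "bump (-R') R' n (fst q) = 0 \<or> bump (-R') R' n (snd q) = 0" using bump_outside[OF R2(1)] by blast
    then have "h n q = 0" by (auto simp: h_def)
    then show ?thesis using False by simp
  qed
  have lim: "(\<lambda>n. h n q) \<longlonglongrightarrow> indicator (square R') q * ?s q" for q
  proof -
    have "(\<lambda>n. h n q) \<longlonglongrightarrow> indicator {-R'<..<R'} (fst q) * indicator {-R'<..<R'} (snd q) * indicator {-M'<..<M'} (w q)
      * ((?s q - 0 - 0 * ?s q) / (1 + 0))"
      unfolding h_def by (intro tendsto_intros bump_tendsto R2 \<epsilon>0) simp
    moreover have "indicator {-R'<..<R'} (fst q) * indicator {-R'<..<R'} (snd q) * indicator {-M'<..<M'} (w q)
      * ((?s q - 0 - 0 * ?s q) / (1 + 0)) = indicator (square R') q * ?s q"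
    proof (cases "q \<in> square R'")
      case True
      then have "\<bar>w q\<bar> < M'" using bd[OF square_mono[of R' R]] R by simp
      then show ?thesis using True by (auto simp: indicator_def square_def)
    next
      case False
      then show ?thesis by (auto simp: indicator_def square_def)
    qed
    ultimately show ?thesis by (simp only:)
  qed
  have "(\<lambda>n. LINT q|lborel. h n q) \<longlonglongrightarrow> (LINT q|lborel. indicator (square R') q * ?s q)"
  proof (rule integral_dominated_convergence[where w = "\<lambda>q. indicator (square R') q * (1 + 2 * ?s q)"])
    show "integrable lborel (\<lambda>q. indicator (square R') q * (1 + 2 * ?s q))"
      by (intro integrable_on_square continuous_intros speed_continuous[OF w])
    show "h n \<in> borel_measurable lborel" for n using borel_measurable_continuous_onI[OF hc] by simp
    show "(\<lambda>q. indicat_real (square R') q * ?s q) \<in> borel_measurable lborel"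
      using borel_measurable_integrable[OF integrable_on_square[OF speed_continuous[OF w]]] .
  qed (use lim dom in auto)
  then have "(\<lambda>n. ereal (LINT q|lborel. h n q)) \<longlonglongrightarrow> ereal (area R' wx wy)" by (simp add: area_def)
  then show ?thesis by (rule LIMSEQ_le_const2) (use le in blast)
qed

theorem area_le_perimeter:
  assumes E: "E \<in> sets lebesgue" "ae_eq E (subgraph w)" and w: "C1_plane w wx wy"
    and R: "0 < R" "0 < M'" "M' < M" and bd: "\<And>q. q \<in> square R \<Longrightarrow> \<bar>w q\<bar> < M'"
  shows "ereal (area R wx wy) \<le> perimeter E (slab R M)"
proof -
  (* smaller squares, since the cutoffs have to vanish near the boundary of the slab *)
  define r where "r n = R - R / (real n + 2)" for n
  have r: "0 < r n" "r n < R" for n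
  proof -
    have "R * 1 < R * (real n + 2)" using R(1) by (intro mult_strict_left_mono) auto
    then have "R / (real n + 2) < R" by (simp add: pos_divide_less_eq)
    then show "0 < r n" "r n < R" using R(1) by (simp_all add: r_def)
  qed
  have "(\<lambda>n. 1 / (real n + 2)) \<longlonglongrightarrow> 0"
    by (rule real_tendsto_sandwich[of "\<lambda>_. 0" _ _ "\<lambda>n. 1 / real (Suc n)"])
       (use LIMSEQ_inverse_real_of_nat in \<open>auto simp: inverse_eq_divide frac_le\<close>)
  from tendsto_diff[OF tendsto_const tendsto_mult[OF tendsto_const[of R] this], of R]
  have rl: "r \<longlonglongrightarrow> R" by (simp add: r_def[abs_def])
  let ?s = "speed wx wy"
  have "(\<lambda>n. LINT q|lborel. indicator (square (r n)) q * ?s q) \<longlonglongrightarrow> (LINT q|lborel. indicator (square R) q * ?s q)"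
  proof (rule integral_dominated_convergence[where w = "\<lambda>q. indicator (square R) q * ?s q"])
    have i: "integrable lborel (\<lambda>q. indicator (square \<rho>) q * ?s q)" for \<rho>
      by (rule integrable_on_square[OF speed_continuous[OF w]])
    show "integrable lborel (\<lambda>q. indicator (square R) q * ?s q)" by (rule i)
    show "(\<lambda>q. indicat_real (square R) q * ?s q) \<in> borel_measurable lborel" "(\<lambda>q. indicat_real (square (r n)) q * ?s q) \<in> borel_measurable lborel" for n
      using borel_measurable_integrable[OF i] by blast+
    show "AE q in lborel. (\<lambda>n. indicator (square (r n)) q * ?s q) \<longlonglongrightarrow> indicator (square R) q * ?s q"
    proof (rule AE_I2)
      fix q
      show "(\<lambda>n. indicator (square (r n)) q * ?s q) \<longlonglongrightarrow> indicator (square R) q * ?s q"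
      proof (cases "q \<in> square R")
        case True
        then have "\<forall>\<^sub>F n in sequentially. \<bar>fst q\<bar> < r n" "\<forall>\<^sub>F n in sequentially. \<bar>snd q\<bar> < r n"
          using order_tendstoD(1)[OF rl] by (auto simp: square_def)
        then have "\<forall>\<^sub>F n in sequentially. indicator (square R) q * ?s q = indicator (square (r n)) q * ?s q"
          by eventually_elim (use True in \<open>simp add: square_def\<close>)
        then show ?thesis by (rule Lim_transform_eventually[OF tendsto_const])
      next
        case False
        then have "q \<notin> square (r n)" for n using square_mono[of "r n" R q] r[of n] by auto
        then show ?thesis using False by simp
      qed
    qed
    show "AE q in lborel. norm (indicator (square (r n)) q * ?s q) \<le> indicator (square R) q * ?s q" for n
    proof (rule AE_I2)
      fix q
      have "0 \<le> ?s q" by (simp add: speed_def)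
      then show "norm (indicator (square (r n)) q * ?s q) \<le> indicator (square R) q * ?s q"
        using square_mono[of "r n" R q] r[of n] by (auto simp: indicator_def)
    qed
  qed
  then have "(\<lambda>n. ereal (area (r n) wx wy)) \<longlonglongrightarrow> ereal (area R wx wy)" by (simp add: area_def)
  then show ?thesis
    by (rule LIMSEQ_le_const2) (use area_approx_le_perimeter[OF E w r R(2,3) bd] in blast)
qed

lemma C1_plane_add_scaled:
  assumes "C1_plane u ux uy" "C1_plane \<phi> \<phi>x \<phi>y"
  shows "C1_plane (\<lambda>q. u q + \<epsilon> * \<phi> q) (\<lambda>q. ux q + \<epsilon> * \<phi>x q) (\<lambda>q. uy q + \<epsilon> * \<phi>y q)"
  unfolding C1_plane_def
proof (intro conjI allI)
  fix p show "((\<lambda>q. u q + \<epsilon> * \<phi> q) has_derivative (\<lambda>v. (ux p + \<epsilon> * \<phi>x p) * fst v + (uy p + \<epsilon> * \<phi>y p) * snd v)) (at p)"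
    by (rule derivative_eq_intros C1_planeD(1)[OF assms(1)] C1_planeD(1)[OF assms(2)] refl)+ (simp add: algebra_simps)
qed (intro continuous_intros C1_planeD[OF assms(1)] C1_planeD[OF assms(2)])+

text \<open>
  The competitor replaces \<open>E\<close> by the subgraph of \<open>w\<close> inside a box high enough to contain both graphs over the
  square where they differ. Hence its symmetric difference with \<open>E\<close> is compactly contained in the slab, and it is almost everywhere the
  subgraph of \<open>w\<close>.
\<close>

theorem area_minimizing:
  assumes E: "E \<in> sets lebesgue" "ae_eq E (subgraph u)" "local_perimeter_minimizer E"
    and u: "C1_plane u ux uy" and w: "C1_plane w wx wy"
    and R: "0 < \<rho>" "\<rho> < R" and supp: "\<And>x y. \<rho> < \<bar>x\<bar> \<or> \<rho> < \<bar>y\<bar> \<Longrightarrow> w (x, y) = u (x, y)"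
  shows "area R ux uy \<le> area R wx wy"
proof -
  obtain M1 where M1: "M1 \<ge> 0" "\<And>x y. \<bar>x\<bar> \<le> R \<and> \<bar>y\<bar> \<le> R \<Longrightarrow> \<bar>u (x, y)\<bar> \<le> M1"
    using bounded_on_square[OF C1_planeD(4)[OF u], of R] by blast
  obtain M2 where M2: "M2 \<ge> 0" "\<And>x y. \<bar>x\<bar> \<le> R \<and> \<bar>y\<bar> \<le> R \<Longrightarrow> \<bar>w (x, y)\<bar> \<le> M2"
    using bounded_on_square[OF C1_planeD(4)[OF w], of R] by blast
  define M where "M = M1 + M2 + 1"
  have M: "0 < M" "\<bar>u (x, y)\<bar> < M" "\<bar>w (x, y)\<bar> < M" if "\<bar>x\<bar> \<le> R \<and> \<bar>y\<bar> \<le> R" for x y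
    using M1(1) M1(2)[OF that] M2(1) M2(2)[OF that] by (simp_all add: M_def)
  have Mp: "0 < M" using M1(1) M2(1) by (simp add: M_def)
  let ?\<Omega> = "slab R (M + 1)"
  define K :: "heis set" where "K = cbox (-\<rho>, -\<rho>, -M) (\<rho>, \<rho>, M)"
  have Km: "(x, y, t) \<in> K \<longleftrightarrow> \<bar>x\<bar> \<le> \<rho> \<and> \<bar>y\<bar> \<le> \<rho> \<and> \<bar>t\<bar> \<le> M" for x y t
    unfolding K_def cbox_Pair_iff by auto
  have K: "compact K" "K \<subseteq> ?\<Omega>" using R by (auto simp: K_def slab_def cbox_Pair_iff)
  have KB: "K \<in> sets borel" unfolding K_def by simp
  (* K has height M, beyond both graphs, so outside K the two subgraphs coincide *)
  define F where "F = (E - K) \<union> (K \<inter> subgraph w)"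
  have wB: "subgraph w \<in> sets borel" by (rule subgraph_borel[OF C1_planeD(4)[OF w]])
  have FL: "F \<in> sets lebesgue" unfolding F_def using E(1) KB wB by (intro sets.Un sets.Diff sets.Int) simp_all
  have "ae_eq F (subgraph w)"
    unfolding ae_eq_def using E(2)[unfolded ae_eq_def]
  proof eventually_elim
    fix p assume p: "p \<in> E \<longleftrightarrow> p \<in> subgraph u"
    show "p \<in> F \<longleftrightarrow> p \<in> subgraph w"
    proof (cases "p \<in> K")
      case True
      then show ?thesis by (simp add: F_def)
    next
      case False
      obtain x y t where xyt: "p = (x, y, t)" by (cases p)
      have "t < u (x, y) \<longleftrightarrow> t < w (x, y)"
      proof (cases "\<rho> < \<bar>x\<bar> \<or> \<rho> < \<bar>y\<bar>")
        case True
        then show ?thesis using supp by simp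
      next
        case in\<rho>: False
        then have "M < \<bar>t\<bar>" using False Km[of x y t] xyt by auto
        moreover have "\<bar>x\<bar> \<le> R \<and> \<bar>y\<bar> \<le> R" using in\<rho> R by linarith
        ultimately show ?thesis using M(2,3)[of x y] by linarith
      qed
      then show ?thesis using p False by (simp add: F_def xyt subgraph_mem)
    qed
  qed
  then have F: "F \<in> sets lebesgue" "ae_eq F (subgraph w)" using FL by simp_all
  have "sym_diff E F \<subseteq> K" by (auto simp: F_def)
  then have cl: "closure (sym_diff E F) \<subseteq> K" using compact_imp_closed[OF K(1)] by (rule closure_minimal)
  have cc: "compact (closure (sym_diff E F))"
    unfolding compact_closure by (rule bounded_subset[OF compact_imp_bounded[OF K(1)] \<open>sym_diff E F \<subseteq> K\<close>])
  have "perimeter_minimizer_in ?\<Omega> E"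
    using E(3) slab_open slab_bounded unfolding local_perimeter_minimizer_def by blast
  from this[unfolded perimeter_minimizer_in_def, rule_format, of F]
  have PEF: "perimeter E ?\<Omega> \<le> perimeter F ?\<Omega>"
    using subgraph_locally_finite[OF F w] cc subset_trans[OF cl K(2)] by (simp only: simp_thms)
  have "ereal (area R ux uy) \<le> perimeter E ?\<Omega>"
  proof (rule area_le_perimeter[OF E(1,2) u _ Mp])
    show "\<bar>u q\<bar> < M" if "q \<in> square R" for q
      using M(2)[of "fst q" "snd q"] that by (simp add: square_def)
  qed (use R in simp_all)
  also note PEF
  also have "perimeter F ?\<Omega> \<le> ereal (area R wx wy)"
    by (rule perimeter_subgraph_le[OF F w]) (simp add: slab_def)
  finally show ?thesis by simp
qed

text \<open>
  The Euler-Lagrange equation of the area: the horizontal normal is weakly divergence free.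
\<close>

definition stationary :: "(plane \<Rightarrow> real) \<Rightarrow> (plane \<Rightarrow> real) \<Rightarrow> bool" where
  "stationary ux uy \<longleftrightarrow> (\<forall>\<phi> \<phi>x \<phi>y \<rho>. C1_plane \<phi> \<phi>x \<phi>y \<and> (\<forall>x y. \<rho> < \<bar>x\<bar> \<or> \<rho> < \<bar>y\<bar> \<longrightarrow> \<phi> (x, y) = 0) \<longrightarrow>
     (LINT q|lborel. ((ux q - snd q) * \<phi>x q + (uy q + fst q) * \<phi>y q) / speed ux uy q) = 0)"

lemma C1_plane_support:
  assumes "C1_plane \<phi> \<phi>x \<phi>y" "\<And>x y. \<rho> < \<bar>x\<bar> \<or> \<rho> < \<bar>y\<bar> \<Longrightarrow> \<phi> (x, y) = 0" "\<rho> < \<bar>x\<bar> \<or> \<rho> < \<bar>y\<bar>"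
  shows "\<phi>x (x, y) = 0" "\<phi>y (x, y) = 0"
proof -
  define N where "N = - cbox (-\<rho>, -\<rho>) (\<rho>, \<rho> :: real)"
  have "open N" unfolding N_def by (simp add: closed_cbox open_Compl)
  have pN: "(x, y) \<in> N" using assms(3) unfolding N_def Compl_iff notin_square .
  have "(\<phi> has_derivative (\<lambda>h. 0)) (at (x, y))"
  proof (rule has_derivative_transform_within_open[OF has_derivative_const[of 0] \<open>open N\<close> pN])
    fix q assume "q \<in> N"
    moreover obtain a b where q: "q = (a, b)" by (cases q)
    ultimately have "\<rho> < \<bar>a\<bar> \<or> \<rho> < \<bar>b\<bar>" unfolding N_def Compl_iff by (simp only: notin_square)
    then show "0 = \<phi> q" unfolding q by (simp only: assms(2))
  qed
  from has_derivative_unique[OF this C1_planeD(1)[OF assms(1)]]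
  have e: "0 = \<phi>x (x, y) * fst h + \<phi>y (x, y) * snd h" for h by (rule fun_cong)
  show "\<phi>x (x, y) = 0" "\<phi>y (x, y) = 0" using e[of "(1, 0)"] e[of "(0, 1)"] by simp_all
qed

lemma norm_difference_quotient:
  fixes a b c d :: real
  assumes "a\<^sup>2 + b\<^sup>2 \<noteq> 0" "e \<longlonglongrightarrow> 0" "\<And>n. 0 < e n"
  shows "(\<lambda>n. (sqrt ((a + e n * c)\<^sup>2 + (b + e n * d)\<^sup>2) - sqrt (a\<^sup>2 + b\<^sup>2)) / e n) \<longlonglongrightarrow> (a * c + b * d) / sqrt (a\<^sup>2 + b\<^sup>2)"
proof -
  let ?S = "\<lambda>n. sqrt ((a + e n * c)\<^sup>2 + (b + e n * d)\<^sup>2)" and ?G = "sqrt (a\<^sup>2 + b\<^sup>2)"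
  have "0 \<le> a\<^sup>2 + b\<^sup>2" by simp
  then have G: "0 < ?G" using assms(1) by (simp add: order_less_le)
  have "(\<lambda>n. (2 * (a * c + b * d) + e n * (c\<^sup>2 + d\<^sup>2)) / (?S n + ?G))
    \<longlonglongrightarrow> (2 * (a * c + b * d) + 0 * (c\<^sup>2 + d\<^sup>2)) / (sqrt ((a + 0 * c)\<^sup>2 + (b + 0 * d)\<^sup>2) + ?G)"
  proof (intro tendsto_intros assms(2))
    have "sqrt ((a + 0 * c)\<^sup>2 + (b + 0 * d)\<^sup>2) = ?G" by simp
    then show "sqrt ((a + 0 * c)\<^sup>2 + (b + 0 * d)\<^sup>2) + ?G \<noteq> 0" using G by linarith
  qed
  moreover have "(2 * (a * c + b * d) + 0 * (c\<^sup>2 + d\<^sup>2)) / (sqrt ((a + 0 * c)\<^sup>2 + (b + 0 * d)\<^sup>2) + ?G) = (a * c + b * d) / ?G"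
  proof -
    have *: "(2 * X + 0 * Y) / (g + g) = X / g" if "0 < g" for X Y g :: real using that by (simp add: field_simps)
    have "sqrt ((a + 0 * c)\<^sup>2 + (b + 0 * d)\<^sup>2) = ?G" by simp
    then show ?thesis by (simp only: *[OF G])
  qed
  moreover have "(2 * (a * c + b * d) + e n * (c\<^sup>2 + d\<^sup>2)) / (?S n + ?G) = (?S n - ?G) / e n" for n
  proof -
    have p: "0 < ?S n + ?G" using G by (simp add: add_nonneg_pos)
    have "(?S n - ?G) * (?S n + ?G) = (?S n)\<^sup>2 - ?G\<^sup>2" by (simp add: power2_eq_square algebra_simps)
    also have "(?S n)\<^sup>2 = (a + e n * c)\<^sup>2 + (b + e n * d)\<^sup>2" by (rule real_sqrt_pow2) simp
    also have "?G\<^sup>2 = a\<^sup>2 + b\<^sup>2" by (rule real_sqrt_pow2) simp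
    also have "(a + e n * c)\<^sup>2 + (b + e n * d)\<^sup>2 - (a\<^sup>2 + b\<^sup>2) = e n * (2 * (a * c + b * d) + e n * (c\<^sup>2 + d\<^sup>2))"
      by (simp add: power2_eq_square algebra_simps)
    finally show ?thesis using p assms(3)[of n] by (simp add: divide_eq_eq eq_divide_eq mult.commute)
  qed
  ultimately show ?thesis by (simp only:)
qed

text \<open>
  The area of \<open>u + \<epsilon> \<phi>\<close> is least at \<open>\<epsilon> = 0\<close>. Its difference quotients are dominated by \<open>|\<nabla>\<phi>|\<close> and converge wherever
  the normal exists, so the derivative at \<open>0\<close> can be taken under the integral. One-sided derivatives for \<open>\<phi>\<close> and \<open>- \<phi>\<close>
  suffice.
\<close>

theorem minimizer_stationary:
  assumes E: "E \<in> sets lebesgue" "ae_eq E (subgraph u)" "local_perimeter_minimizer E"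
    and u: "C1_plane u ux uy" and ae: "AE q in lborel. speed ux uy q \<noteq> 0"
  shows "stationary ux uy"
proof -
  note uc = C1_planeD(2-4)[OF u]
  have half: "0 \<le> (LINT q|lborel. ((ux q - snd q) * \<phi>x q + (uy q + fst q) * \<phi>y q) / speed ux uy q)"
    if \<phi>: "C1_plane \<phi> \<phi>x \<phi>y" and s: "\<And>x y. \<rho> < \<bar>x\<bar> \<or> \<rho> < \<bar>y\<bar> \<Longrightarrow> \<phi> (x, y) = 0" for \<phi> \<phi>x \<phi>y \<rho>
  proof -
    note \<phi>c = C1_planeD(2-4)[OF \<phi>]
    define r where "r = \<bar>\<rho>\<bar> + 1"
    have r: "0 < r" "r < r + 1" by (simp_all add: r_def)
    have sr: "\<phi> (x, y) = 0" if "r < \<bar>x\<bar> \<or> r < \<bar>y\<bar>" for x y using s[of x y] that by (simp add: r_def) linarith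
    define e where "e n = 1 / (real n + 1)" for n
    have e: "0 < e n" for n by (simp add: e_def)
    have e0: "e \<longlonglongrightarrow> 0" unfolding e_def using LIMSEQ_inverse_real_of_nat by (simp add: inverse_eq_divide add.commute)
    let ?R = "r + 1"
    define wx wy where "wx n q = ux q + e n * \<phi>x q" and "wy n q = uy q + e n * \<phi>y q" for n q
    have w: "C1_plane (\<lambda>q. u q + e n * \<phi> q) (wx n) (wy n)" for n
      unfolding wx_def wy_def by (rule C1_plane_add_scaled[OF u \<phi>])
    have min: "area ?R ux uy \<le> area ?R (wx n) (wy n)" for n
      by (rule area_minimizing[OF E u w r]) (simp add: sr)
    define g where "g n q = indicator (square ?R) q * ((speed (wx n) (wy n) q - speed ux uy q) / e n)" for n q
    have ii: "integrable lborel (\<lambda>q. indicator (square ?R) q * speed (wx n) (wy n) q)" "integrable lborel (\<lambda>q. indicator (square ?R) q * speed ux uy q)" for n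
      by (intro integrable_on_square speed_continuous[OF w] speed_continuous[OF u])+
    have "0 \<le> (LINT q|lborel. g n q)" for n
    proof -
      have "(LINT q|lborel. g n q) = (LINT q|lborel. (indicator (square ?R) q * speed (wx n) (wy n) q - indicator (square ?R) q * speed ux uy q) / e n)"
        by (simp add: g_def right_diff_distrib)
      also have "\<dots> = (area ?R (wx n) (wy n) - area ?R ux uy) / e n" unfolding area_def using ii by simp
      finally show ?thesis using min[of n] e[of n] by simp
    qed
    moreover have "(\<lambda>n. LINT q|lborel. g n q) \<longlonglongrightarrow> (LINT q|lborel. indicator (square ?R) q * (((ux q - snd q) * \<phi>x q + (uy q + fst q) * \<phi>y q) / speed ux uy q))"
    proof (rule integral_dominated_convergence[where w = "\<lambda>q. indicator (square ?R) q * (sqrt ((\<phi>x q)\<^sup>2 + (\<phi>y q)\<^sup>2))"])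
      show "integrable lborel (\<lambda>q. indicator (square ?R) q * (sqrt ((\<phi>x q)\<^sup>2 + (\<phi>y q)\<^sup>2)))"
        by (intro integrable_on_square continuous_intros \<phi>c)
      have m: "ux \<in> borel_measurable borel" "uy \<in> borel_measurable borel" "\<phi>x \<in> borel_measurable borel" "\<phi>y \<in> borel_measurable borel"
        using borel_measurable_continuous_onI uc \<phi>c by blast+
      have sm: "speed ux uy \<in> borel_measurable borel" "speed (wx n) (wy n) \<in> borel_measurable borel" for n
        using borel_measurable_continuous_onI speed_continuous[OF u] speed_continuous[OF w] by blast+
      have pm: "(fst :: plane \<Rightarrow> real) \<in> borel_measurable borel" "(snd :: plane \<Rightarrow> real) \<in> borel_measurable borel"
        by (intro borel_measurable_continuous_onI continuous_intros)+
      have im: "(indicator (square ?R) :: plane \<Rightarrow> real) \<in> borel_measurable borel" using square_borel by (rule borel_measurable_indicator)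
      show "(\<lambda>q. indicator (square ?R) q * (((ux q - snd q) * \<phi>x q + (uy q + fst q) * \<phi>y q) / speed ux uy q)) \<in> borel_measurable lborel"
        unfolding measurable_lborel2 by (intro borel_measurable_times borel_measurable_divide borel_measurable_add borel_measurable_diff m sm(1) pm im)
      show "g n \<in> borel_measurable lborel" for n
        unfolding measurable_lborel2 g_def[abs_def] by (intro borel_measurable_times borel_measurable_divide borel_measurable_diff sm im borel_measurable_const)
      show "AE q in lborel. (\<lambda>n. g n q) \<longlonglongrightarrow> indicator (square ?R) q * (((ux q - snd q) * \<phi>x q + (uy q + fst q) * \<phi>y q) / speed ux uy q)"
        using ae
      proof eventually_elim
        fix q assume q: "speed ux uy q \<noteq> 0"
        have "(\<lambda>n. (sqrt ((ux q - snd q + e n * \<phi>x q)\<^sup>2 + (uy q + fst q + e n * \<phi>y q)\<^sup>2) - sqrt ((ux q - snd q)\<^sup>2 + (uy q + fst q)\<^sup>2)) / e n)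
          \<longlonglongrightarrow> ((ux q - snd q) * \<phi>x q + (uy q + fst q) * \<phi>y q) / sqrt ((ux q - snd q)\<^sup>2 + (uy q + fst q)\<^sup>2)"
          by (rule norm_difference_quotient[OF _ e0 e]) (use q in \<open>simp add: speed_def\<close>)
        then show "(\<lambda>n. g n q) \<longlonglongrightarrow> indicator (square ?R) q * (((ux q - snd q) * \<phi>x q + (uy q + fst q) * \<phi>y q) / speed ux uy q)"
          unfolding g_def speed_def wx_def wy_def by (intro tendsto_mult tendsto_const) (simp add: algebra_simps)
      qed
      show "AE q in lborel. norm (g n q) \<le> indicator (square ?R) q * (sqrt ((\<phi>x q)\<^sup>2 + (\<phi>y q)\<^sup>2))" for n
      proof (rule AE_I2)
        fix q
        let ?a = "(ux q - snd q, uy q + fst q)" and ?b = "(\<phi>x q, \<phi>y q)"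
        have "speed ux uy q = norm ?a" by (simp add: speed_def norm_Pair)
        moreover have "speed (wx n) (wy n) q = norm (?a + e n *\<^sub>R ?b)" by (simp add: speed_def norm_Pair wx_def wy_def algebra_simps)
        ultimately have "\<bar>speed (wx n) (wy n) q - speed ux uy q\<bar> \<le> norm (e n *\<^sub>R ?b)"
          using norm_triangle_ineq3[of "?a + e n *\<^sub>R ?b" ?a] by simp
        then have "\<bar>(speed (wx n) (wy n) q - speed ux uy q) / e n\<bar> \<le> norm ?b"
          using e[of n] by (simp only: norm_scaleR abs_divide) (simp add: pos_divide_le_eq mult.commute)
        then show "norm (g n q) \<le> indicator (square ?R) q * (sqrt ((\<phi>x q)\<^sup>2 + (\<phi>y q)\<^sup>2))"
          unfolding g_def by (simp add: norm_Pair indicator_def)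
      qed
    qed
    ultimately have "0 \<le> (LINT q|lborel. indicator (square ?R) q * (((ux q - snd q) * \<phi>x q + (uy q + fst q) * \<phi>y q) / speed ux uy q))"
      by (intro LIMSEQ_le_const) blast+
    also have "(\<lambda>q. indicator (square ?R) q * (((ux q - snd q) * \<phi>x q + (uy q + fst q) * \<phi>y q) / speed ux uy q))
      = (\<lambda>q. ((ux q - snd q) * \<phi>x q + (uy q + fst q) * \<phi>y q) / speed ux uy q)"
    proof
      fix q
      show "indicator (square ?R) q * (((ux q - snd q) * \<phi>x q + (uy q + fst q) * \<phi>y q) / speed ux uy q)
        = ((ux q - snd q) * \<phi>x q + (uy q + fst q) * \<phi>y q) / speed ux uy q"
      proof (cases "q \<in> square ?R")
        case False
        then have "r < \<bar>fst q\<bar> \<or> r < \<bar>snd q\<bar>" by (auto simp: square_def)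
        then have "\<phi>x (fst q, snd q) = 0" "\<phi>y (fst q, snd q) = 0" using C1_plane_support[OF \<phi> sr] by blast+
        then show ?thesis by simp
      qed simp
    qed
    finally show ?thesis .
  qed
  show ?thesis unfolding stationary_def
  proof (intro allI impI)
    fix \<phi> \<phi>x \<phi>y \<rho> assume a: "C1_plane \<phi> \<phi>x \<phi>y \<and> (\<forall>x y. \<rho> < \<bar>x\<bar> \<or> \<rho> < \<bar>y\<bar> \<longrightarrow> \<phi> (x, y) = 0)"
    have zero: "C1_plane (\<lambda>_. 0) (\<lambda>_. 0) (\<lambda>_. 0)" unfolding C1_plane_def by simp
    have "C1_plane (\<lambda>q. 0 + (-1) * \<phi> q) (\<lambda>q. 0 + (-1) * \<phi>x q) (\<lambda>q. 0 + (-1) * \<phi>y q)"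
      by (rule C1_plane_add_scaled[OF zero]) (use a in blast)
    then have neg: "C1_plane (\<lambda>q. - \<phi> q) (\<lambda>q. - \<phi>x q) (\<lambda>q. - \<phi>y q)" by simp
    have "0 \<le> (LINT q|lborel. ((ux q - snd q) * (- \<phi>x q) + (uy q + fst q) * (- \<phi>y q)) / speed ux uy q)"
      by (rule half[OF neg, of \<rho>]) (simp add: conjunct2[OF a, rule_format])
    also have "(\<lambda>q. ((ux q - snd q) * (- \<phi>x q) + (uy q + fst q) * (- \<phi>y q)) / speed ux uy q)
      = (\<lambda>q. - (((ux q - snd q) * \<phi>x q + (uy q + fst q) * \<phi>y q) / speed ux uy q))"
      by (simp only: mult_minus_right minus_add_distrib[symmetric] minus_divide_left)
    finally have "(LINT q|lborel. ((ux q - snd q) * \<phi>x q + (uy q + fst q) * \<phi>y q) / speed ux uy q) \<le> 0"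
      by (simp only: Bochner_Integration.integral_minus)
    moreover have "0 \<le> (LINT q|lborel. ((ux q - snd q) * \<phi>x q + (uy q + fst q) * \<phi>y q) / speed ux uy q)"
    proof (rule half[of \<phi> \<phi>x \<phi>y \<rho>])
      show "C1_plane \<phi> \<phi>x \<phi>y" using a by (rule conjunct1)
      show "\<phi> (x, y) = 0" if "\<rho> < \<bar>x\<bar> \<or> \<rho> < \<bar>y\<bar>" for x y using conjunct2[OF a, rule_format, OF that] .
    qed
    ultimately show "(LINT q|lborel. ((ux q - snd q) * \<phi>x q + (uy q + fst q) * \<phi>y q) / speed ux uy q) = 0" by linarith
  qed
qed

section \<open>Sets without perimeter are locally constant\<close>

lemma lebesgue_ae_borel: assumes "E \<in> sets lebesgue" shows "\<exists>B\<in>sets borel. ae_eq E B"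
proof -
  from assms obtain S N N' where s: "E = S \<union> N" "N \<subseteq> N'" "N' \<in> null_sets lborel" "S \<in> sets lborel"
    by (rule sets_completionE) (rule that; assumption)
  have "ae_eq E S" unfolding ae_eq_def
    using AE_not_in[OF s(3)] by eventually_elim (use s in auto)
  then show ?thesis using s(4) by auto
qed

lemma hdiv_at:
  assumes "C1_heis v1 v1x v1y v1t" "C1_heis v2 v2x v2y v2t"
  shows "hdiv v1 v2 p = v1x p + fst (snd p) * v1t p + v2y p - fst p * v2t p"
  using hdiv_eq[OF assms] by (cases p) simp

lemma C1_heis_scale:
  assumes "C1_heis v vx vy vt"
  shows "C1_heis (\<lambda>p. c * v p) (\<lambda>p. c * vx p) (\<lambda>p. c * vy p) (\<lambda>p. c * vt p)"
proof -
  have "C1_heis (\<lambda>_. c) (\<lambda>_. 0) (\<lambda>_. 0) (\<lambda>_. 0)" unfolding C1_heis_def by simp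
  from C1_heis_mult[OF this assms] show ?thesis by simp
qed

text \<open>
  Scaling removes the bound on the length of the field, and the two signs turn the inequality into an equation.
\<close>

lemma zero_perimeter_divergence:
  assumes E: "E \<in> sets lebesgue" "B \<in> sets borel" "ae_eq E B" and P: "perimeter E \<Omega> \<le> 0"
    and v: "C1_heis v1 v1x v1y v1t" "C1_heis v2 v2x v2y v2t"
    and K: "compact K" "K \<subseteq> \<Omega>" "\<And>p. p \<notin> K \<Longrightarrow> v1 p = 0" "\<And>p. p \<notin> K \<Longrightarrow> v2 p = 0"
  shows "(LINT p|lborel. indicator B p * hdiv v1 v2 p) = 0"
proof -
  have c: "continuous_on K (\<lambda>p. (v1 p)\<^sup>2 + (v2 p)\<^sup>2)"
    by (intro continuous_intros continuous_on_subset[OF C1_heisD(5)[OF v(1)]] continuous_on_subset[OF C1_heisD(5)[OF v(2)]]) simp_all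
  obtain C where C: "\<And>p. p \<in> K \<Longrightarrow> (v1 p)\<^sup>2 + (v2 p)\<^sup>2 \<le> C"
    using compact_imp_bounded[OF compact_continuous_image[OF c K(1)]] unfolding bounded_iff by (force simp: abs_le_iff)
  define D where "D = max 1 C"
  have D: "1 \<le> D" "(v1 p)\<^sup>2 + (v2 p)\<^sup>2 \<le> D" for p
    using C[of p] K(3,4)[of p] by (cases "p \<in> K"; simp add: D_def)+
  have "D * 1 \<le> D * D" using D(1) by (intro mult_left_mono) simp_all
  then have D2: "(v1 p)\<^sup>2 + (v2 p)\<^sup>2 \<le> D\<^sup>2" for p using D(2)[of p] by (simp add: power2_eq_square)
  have half: "s * (LINT p|lborel. indicator B p * hdiv v1 v2 p) \<le> 0" if s: "s\<^sup>2 * D\<^sup>2 \<le> 1" for s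
  proof -
    note sv = C1_heis_scale[OF v(1), of s] C1_heis_scale[OF v(2), of s]
    have tf: "(\<lambda>p. s * v1 p, \<lambda>p. s * v2 p) \<in> test_fields \<Omega>"
    proof (rule test_fieldsI[OF sv K(1,2)])
      show "s * v1 p = 0" "s * v2 p = 0" if "p \<notin> K" for p using K(3,4)[OF that] by simp_all
      fix p
      have "(s * v1 p)\<^sup>2 + (s * v2 p)\<^sup>2 = s\<^sup>2 * ((v1 p)\<^sup>2 + (v2 p)\<^sup>2)" by (simp add: power_mult_distrib distrib_left)
      also have "\<dots> \<le> s\<^sup>2 * D\<^sup>2" using D2 by (intro mult_left_mono) simp_all
      finally show "(s * v1 p)\<^sup>2 + (s * v2 p)\<^sup>2 \<le> 1" using s by linarith
    qed
    have hd: "hdiv (\<lambda>p. s * v1 p) (\<lambda>p. s * v2 p) p = s * hdiv v1 v2 p" for p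
      unfolding hdiv_at[OF sv] hdiv_at[OF v] by (simp add: algebra_simps)
    have "ereal (LINT p:E|lebesgue. hdiv (\<lambda>p. s * v1 p) (\<lambda>p. s * v2 p) p) \<le> perimeter E \<Omega>"
      unfolding perimeter_def by (rule SUP_upper2[OF tf]) simp
    from order_trans[OF this P] have "(LINT p:E|lebesgue. hdiv (\<lambda>p. s * v1 p) (\<lambda>p. s * v2 p) p) \<le> 0" by simp
    also have "(LINT p:E|lebesgue. hdiv (\<lambda>p. s * v1 p) (\<lambda>p. s * v2 p) p)
      = (LINT p|lborel. indicator B p * hdiv (\<lambda>p. s * v1 p) (\<lambda>p. s * v2 p) p)"
      by (rule ae_eq_integral[OF E hdiv_continuous[OF sv]])
    also have "\<dots> = s * (LINT p|lborel. indicator B p * hdiv v1 v2 p)"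
      unfolding hd by (subst integral_mult_right_zero[symmetric]) (simp add: mult.left_commute)
    finally show ?thesis .
  qed
  have "0 < 1 / D" using D(1) by simp
  moreover have "(1 / D)\<^sup>2 * D\<^sup>2 \<le> 1" "(- 1 / D)\<^sup>2 * D\<^sup>2 \<le> 1" using D(1) by (simp_all add: power_divide)
  note half[OF this(1)] half[OF this(2)]
  ultimately show ?thesis by (auto simp: mult_le_0_iff divide_le_0_iff zero_le_divide_iff)
qed

lemma einterval_UNIV: "\<exists>F. \<forall>x. (F has_real_derivative f x) (at x)" if "continuous_on UNIV f" for f :: "real \<Rightarrow> real"
proof -
  have "\<exists>F. \<forall>x. - \<infinity> < ereal x \<longrightarrow> ereal x < \<infinity> \<longrightarrow> (F has_vector_derivative f x) (at x)"
    by (rule einterval_antiderivative) (use that in \<open>simp_all add: continuous_on_eq_continuous_at\<close>)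
  then show ?thesis by (simp add: has_real_derivative_iff_has_vector_derivative)
qed

definition C2_supp :: "real \<Rightarrow> real \<Rightarrow> (real \<Rightarrow> real) \<Rightarrow> bool" where
  "C2_supp a b f \<longleftrightarrow> C2_real f \<and> (\<forall>x. x \<notin> {a..b} \<longrightarrow> f x = 0)"

lemma DERIV_zero_outside:
  assumes "\<And>x. (f has_real_derivative f' x) (at x)" "\<And>x. x \<notin> {a..b} \<Longrightarrow> f x = 0" "x \<notin> {a..b}" shows "f' x = 0"
proof -
  have "open (- {a..b})" by (simp add: open_Compl)
  have "((\<lambda>x. 0) has_real_derivative 0) (at x)" by simp
  then have "(f has_real_derivative 0) (at x)"
    by (rule has_field_derivative_transform_within_open[OF _ \<open>open (- {a..b})\<close>]) (use assms in auto)
  then show ?thesis using assms(1) DERIV_unique by blast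
qed

lemma C2_supp_integrable: assumes "C2_supp a b f" shows "integrable lborel f"
proof -
  have "continuous_on UNIV f" using assms DERIV_continuous_on unfolding C2_supp_def C2_real_def by metis
  then show ?thesis by (rule integrable_continuous_compact_support[OF _ compact_Icc[of a b]]) (use assms in \<open>simp add: C2_supp_def\<close>)
qed

text \<open>
  Zero mean is exactly what makes the antiderivative vanish again on the far side of the support.
\<close>

lemma zero_mean_antiderivative:
  assumes m: "C2_supp a b m" and ab: "a < b" and z: "(LINT x|lborel. m x) = 0"
  shows "\<exists>\<kappa>. C2_supp a b \<kappa> \<and> (\<forall>x. (\<kappa> has_real_derivative m x) (at x))"
proof -
  obtain m' m'' where m': "\<And>x. (m has_real_derivative m' x) (at x)" "\<And>x. (m' has_real_derivative m'' x) (at x)"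
    using m unfolding C2_supp_def C2_real_def by blast
  have mc: "continuous_on UNIV m" by (rule DERIV_continuous_on[OF m'(1)])
  have m0: "m x = 0" if "x \<notin> {a..b}" for x using m that by (simp add: C2_supp_def)
  obtain F where F: "\<And>x. (F has_real_derivative m x) (at x)" using einterval_UNIV[OF mc] by blast
  define \<kappa> where "\<kappa> x = F x - F a" for x
  have D: "(\<kappa> has_real_derivative m x) (at x)" for x unfolding \<kappa>_def[abs_def] by (rule derivative_eq_intros F refl)+ simp
  have Fab: "F b - F a = 0"
  proof -
    have "(LINT x|lborel. m x * indicator {a..b} x) = F b - F a"
      by (rule integral_FTC_Icc_real) (use ab F mc in \<open>auto simp: continuous_on_eq_continuous_at\<close>)
    moreover have "(\<lambda>x. m x * indicator {a..b} x) = m" using m0 by (auto simp: indicator_def fun_eq_iff)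
    ultimately show ?thesis using z by simp
  qed
  have z: "\<kappa> x = 0" if "x \<notin> {a..b}" for x
  proof (cases "x < a")
    case True
    have "\<exists>c. \<forall>x\<in>{..<a}. \<kappa> x = c"
    proof (rule has_field_derivative_zero_constant)
      fix x assume "x \<in> {..<a}"
      then show "(\<kappa> has_real_derivative 0) (at x within {..<a})"
        using has_field_derivative_at_within[OF D[of x], of "{..<a}"] m0[of x] by simp
    qed simp
    then obtain c where c: "\<And>x. x < a \<Longrightarrow> \<kappa> x = c" by auto
    have "continuous_on UNIV \<kappa>" by (rule DERIV_continuous_on[OF D])
    then have "\<kappa> a = c" using continuous_constant_on_closure[of "{..<a}" \<kappa> c a] c by (auto intro: continuous_on_subset)
    then show ?thesis using c[OF True] by (simp add: \<kappa>_def)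
  next
    case False
    then have xb: "b < x" using that by simp
    have "\<exists>c. \<forall>x\<in>{b<..}. \<kappa> x = c"
    proof (rule has_field_derivative_zero_constant)
      fix x assume "x \<in> {b<..}"
      then show "(\<kappa> has_real_derivative 0) (at x within {b<..})"
        using has_field_derivative_at_within[OF D[of x], of "{b<..}"] m0[of x] by simp
    qed simp
    then obtain c where c: "\<And>x. b < x \<Longrightarrow> \<kappa> x = c" by auto
    have "continuous_on UNIV \<kappa>" by (rule DERIV_continuous_on[OF D])
    then have "\<kappa> b = c" using continuous_constant_on_closure[of "{b<..}" \<kappa> c b] c by (auto intro: continuous_on_subset)
    then show ?thesis using c[OF xb] Fab by (simp add: \<kappa>_def)
  qed
  have "C2_real \<kappa>" by (rule C2_realI[OF D m'(1) DERIV_continuous_on[OF m'(2)]])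
  then show ?thesis using z D unfolding C2_supp_def by blast
qed

lemma C2_supp_combine: assumes "C2_supp a b f" "C2_supp a b g" shows "C2_supp a b (\<lambda>x. f x - c * g x)"
proof -
  have "C2_real (\<lambda>x. f x - c * g x)"
    using assms by (intro C2_real_diff C2_real_mult C2_real_const) (simp_all add: C2_supp_def)
  then show ?thesis using assms by (simp add: C2_supp_def)
qed

lemma C2_supp_bump: "a < b \<Longrightarrow> a' \<le> a \<Longrightarrow> b \<le> b' \<Longrightarrow> C2_supp a' b' (bump a b n)"
  unfolding C2_supp_def using C2_real_bump bump_outside by auto

text \<open>
  Only the consequence for test fields is kept of the hypothesis that the perimeter vanishes near the box.
\<close>

locale zero_perimeter_box =
  fixes B :: "heis set" and a1 b1 a2 b2 a3 b3 :: real
  assumes B: "B \<in> sets borel" and ab: "a1 < b1" "a2 < b2" "a3 < b3"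
    and div0: "C1_heis v1 v1x v1y v1t \<Longrightarrow> C1_heis v2 v2x v2y v2t \<Longrightarrow>
      (\<And>p. p \<notin> cbox (a1, a2, a3) (b1, b2, b3) \<Longrightarrow> v1 p = 0) \<Longrightarrow> (\<And>p. p \<notin> cbox (a1, a2, a3) (b1, b2, b3) \<Longrightarrow> v2 p = 0) \<Longrightarrow>
      (LINT p|lborel. indicator B p * hdiv v1 v2 p) = 0"
begin

text \<open>
  The pairing of \<open>B\<close> with a product of functions of one variable. Such products are enough to recover the measure of \<open>B\<close> in boxes.
\<close>

definition J :: "(real \<Rightarrow> real) \<Rightarrow> (real \<Rightarrow> real) \<Rightarrow> (real \<Rightarrow> real) \<Rightarrow> real" where
  "J f g k = (LINT p|lborel. indicator B p * (f (fst p) * g (fst (snd p)) * k (snd (snd p))))"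

lemma outside: "p \<notin> cbox (a1, a2, a3) (b1, b2, b3) \<Longrightarrow> fst p \<notin> {a1..b1} \<or> fst (snd p) \<notin> {a2..b2} \<or> snd (snd p) \<notin> {a3..b3}"
  by (cases p) (auto simp: cbox_Pair_iff)

lemma J_integrable:
  fixes f g k :: "real \<Rightarrow> real"
  assumes "continuous_on UNIV f" "continuous_on UNIV g" "continuous_on UNIV k"
    "\<And>x. x \<notin> {a1..b1} \<Longrightarrow> f x = 0" "\<And>x. x \<notin> {a2..b2} \<Longrightarrow> g x = 0" "\<And>x. x \<notin> {a3..b3} \<Longrightarrow> k x = 0"
  shows "integrable lborel (\<lambda>p. indicator B p * (f (fst p) * g (fst (snd p)) * k (snd (snd p))))"
proof (rule integrable_indicator_times[OF _ B], rule integrable_continuous_compact_support[OF _ compact_cbox[of "(a1, a2, a3)" "(b1, b2, b3)"]])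
  show "continuous_on UNIV (\<lambda>p::heis. f (fst p) * g (fst (snd p)) * k (snd (snd p)))"
    by (intro continuous_intros continuous_on_UNIV_compose[OF assms(1)] continuous_on_UNIV_compose[OF assms(2)] continuous_on_UNIV_compose[OF assms(3)])
  fix p assume "p \<notin> cbox (a1, a2, a3) (b1, b2, b3)"
  from outside[OF this] show "f (fst p) * g (fst (snd p)) * k (snd (snd p)) = 0" using assms(4-6) by auto
qed

text \<open>
  Obtained from the fields \<open>\<phi> X\<close> and \<open>\<phi> Y\<close> with the product \<open>\<phi> = f g k\<close>.
\<close>

lemma J_X_Y:
  assumes f: "\<And>x. (f has_real_derivative f' x) (at x)" "continuous_on UNIV f'" "\<And>x. x \<notin> {a1..b1} \<Longrightarrow> f x = 0"
    and g: "\<And>x. (g has_real_derivative g' x) (at x)" "continuous_on UNIV g'" "\<And>x. x \<notin> {a2..b2} \<Longrightarrow> g x = 0"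
    and k: "\<And>x. (k has_real_derivative k' x) (at x)" "continuous_on UNIV k'" "\<And>x. x \<notin> {a3..b3} \<Longrightarrow> k x = 0"
  shows "J f' g k + J f (\<lambda>y. y * g y) k' = 0" "J f g' k - J (\<lambda>x. x * f x) g k' = 0"
proof -
  note P = C1_heis_product[OF f(1,2) g(1,2) k(1,2)]
  have Z: "C1_heis (\<lambda>_. 0) (\<lambda>_. 0) (\<lambda>_. 0) (\<lambda>_. 0)" unfolding C1_heis_def by simp
  have out: "f (fst p) * g (fst (snd p)) * k (snd (snd p)) = 0" if "p \<notin> cbox (a1, a2, a3) (b1, b2, b3)" for p
    using outside[OF that] f(3) g(3) k(3) by auto
  have c: "continuous_on UNIV f" "continuous_on UNIV g" "continuous_on UNIV k"
    using DERIV_continuous_on f(1) g(1) k(1) by blast+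
  have f'0: "\<And>x. x \<notin> {a1..b1} \<Longrightarrow> f' x = 0" by (rule DERIV_zero_outside[OF f(1,3)])
  have g'0: "\<And>x. x \<notin> {a2..b2} \<Longrightarrow> g' x = 0" by (rule DERIV_zero_outside[OF g(1,3)])
  have k'0: "\<And>x. x \<notin> {a3..b3} \<Longrightarrow> k' x = 0" by (rule DERIV_zero_outside[OF k(1,3)])
  have "J f' g k + J f (\<lambda>y. y * g y) k' = (LINT p|lborel. indicator B p * (f' (fst p) * g (fst (snd p)) * k (snd (snd p)))
    + indicator B p * (f (fst p) * (fst (snd p) * g (fst (snd p))) * k' (snd (snd p))))"
    unfolding J_def
    by (rule Bochner_Integration.integral_add[symmetric]; rule J_integrable; (intro continuous_intros c f(2) k(2))?)
       (simp_all add: f(3) g(3) k(3) f'0 k'0)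
  also have "\<dots> = (LINT p|lborel. indicator B p * hdiv (\<lambda>p. f (fst p) * g (fst (snd p)) * k (snd (snd p))) (\<lambda>_. 0) p)"
  proof (rule Bochner_Integration.integral_cong[OF refl])
    fix p
    show "indicator B p * (f' (fst p) * g (fst (snd p)) * k (snd (snd p))) + indicator B p * (f (fst p) * (fst (snd p) * g (fst (snd p))) * k' (snd (snd p)))
      = indicator B p * hdiv (\<lambda>p. f (fst p) * g (fst (snd p)) * k (snd (snd p))) (\<lambda>_. 0) p"
      unfolding hdiv_at[OF P Z] by (simp add: algebra_simps)
  qed
  also have "\<dots> = 0" by (rule div0[OF P Z out]) simp_all
  finally show "J f' g k + J f (\<lambda>y. y * g y) k' = 0" .
  have "J f g' k - J (\<lambda>x. x * f x) g k' = (LINT p|lborel. indicator B p * (f (fst p) * g' (fst (snd p)) * k (snd (snd p)))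
    - indicator B p * (fst p * f (fst p) * g (fst (snd p)) * k' (snd (snd p))))"
    unfolding J_def
    by (rule Bochner_Integration.integral_diff[symmetric]; rule J_integrable; (intro continuous_intros c g(2) k(2))?)
       (simp_all add: f(3) g(3) k(3) g'0 k'0)
  also have "\<dots> = (LINT p|lborel. indicator B p * hdiv (\<lambda>_. 0) (\<lambda>p. f (fst p) * g (fst (snd p)) * k (snd (snd p))) p)"
  proof (rule Bochner_Integration.integral_cong[OF refl])
    fix p
    show "indicator B p * (f (fst p) * g' (fst (snd p)) * k (snd (snd p))) - indicator B p * (fst p * f (fst p) * g (fst (snd p)) * k' (snd (snd p)))
      = indicator B p * hdiv (\<lambda>_. 0) (\<lambda>p. f (fst p) * g (fst (snd p)) * k (snd (snd p))) p"
      unfolding hdiv_at[OF Z P] by (simp add: algebra_simps)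
  qed
  also have "\<dots> = 0" by (rule div0[OF Z P _ out]) simp_all
  finally show "J f g' k - J (\<lambda>x. x * f x) g k' = 0" .
qed

lemma J_add:
  assumes "continuous_on UNIV f" "continuous_on UNIV g" "continuous_on UNIV k"
    "\<And>x. x \<notin> {a1..b1} \<Longrightarrow> f x = 0" "\<And>x. x \<notin> {a2..b2} \<Longrightarrow> g x = 0" "\<And>x. x \<notin> {a3..b3} \<Longrightarrow> k x = 0"
  shows "continuous_on UNIV f2 \<Longrightarrow> (\<And>x. x \<notin> {a1..b1} \<Longrightarrow> f2 x = 0) \<Longrightarrow> J (\<lambda>x. f x + c * f2 x) g k = J f g k + c * J f2 g k"
    "continuous_on UNIV g2 \<Longrightarrow> (\<And>x. x \<notin> {a2..b2} \<Longrightarrow> g2 x = 0) \<Longrightarrow> J f (\<lambda>x. g x + c * g2 x) k = J f g k + c * J f g2 k"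
    "continuous_on UNIV k2 \<Longrightarrow> (\<And>x. x \<notin> {a3..b3} \<Longrightarrow> k2 x = 0) \<Longrightarrow> J f g (\<lambda>x. k x + c * k2 x) = J f g k + c * J f g k2"
proof -
  have i0: "integrable lborel (\<lambda>p. indicator B p * (f (fst p) * g (fst (snd p)) * k (snd (snd p))))"
    by (rule J_integrable) (use assms in blast)+
  {
    assume a: "continuous_on UNIV f2" "\<And>x. x \<notin> {a1..b1} \<Longrightarrow> f2 x = 0"
    have i: "integrable lborel (\<lambda>p. indicator B p * (f2 (fst p) * g (fst (snd p)) * k (snd (snd p))))"
      by (rule J_integrable) (use assms a in blast)+
    have "J (\<lambda>x. f x + c * f2 x) g k = (LINT p|lborel. indicator B p * (f (fst p) * g (fst (snd p)) * k (snd (snd p)))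
      + c * (indicator B p * (f2 (fst p) * g (fst (snd p)) * k (snd (snd p)))))"
      unfolding J_def by (rule Bochner_Integration.integral_cong[OF refl]) (simp add: algebra_simps)
    also have "\<dots> = J f g k + c * J f2 g k"
      unfolding J_def by (subst Bochner_Integration.integral_add[OF i0 integrable_mult_right[OF i]]) simp
    finally show "J (\<lambda>x. f x + c * f2 x) g k = J f g k + c * J f2 g k" .
  }
  {
    assume a: "continuous_on UNIV g2" "\<And>x. x \<notin> {a2..b2} \<Longrightarrow> g2 x = 0"
    have i: "integrable lborel (\<lambda>p. indicator B p * (f (fst p) * g2 (fst (snd p)) * k (snd (snd p))))"
      by (rule J_integrable) (use assms a in blast)+
    have "J f (\<lambda>x. g x + c * g2 x) k = (LINT p|lborel. indicator B p * (f (fst p) * g (fst (snd p)) * k (snd (snd p)))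
      + c * (indicator B p * (f (fst p) * g2 (fst (snd p)) * k (snd (snd p)))))"
      unfolding J_def by (rule Bochner_Integration.integral_cong[OF refl]) (simp add: algebra_simps)
    also have "\<dots> = J f g k + c * J f g2 k"
      unfolding J_def by (subst Bochner_Integration.integral_add[OF i0 integrable_mult_right[OF i]]) simp
    finally show "J f (\<lambda>x. g x + c * g2 x) k = J f g k + c * J f g2 k" .
  }
  {
    assume a: "continuous_on UNIV k2" "\<And>x. x \<notin> {a3..b3} \<Longrightarrow> k2 x = 0"
    have i: "integrable lborel (\<lambda>p. indicator B p * (f (fst p) * g (fst (snd p)) * k2 (snd (snd p))))"
      by (rule J_integrable) (use assms a in blast)+
    have "J f g (\<lambda>x. k x + c * k2 x) = (LINT p|lborel. indicator B p * (f (fst p) * g (fst (snd p)) * k (snd (snd p)))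
      + c * (indicator B p * (f (fst p) * g (fst (snd p)) * k2 (snd (snd p)))))"
      unfolding J_def by (rule Bochner_Integration.integral_cong[OF refl]) (simp add: algebra_simps)
    also have "\<dots> = J f g k + c * J f g k2"
      unfolding J_def by (subst Bochner_Integration.integral_add[OF i0 integrable_mult_right[OF i]]) simp
    finally show "J f g (\<lambda>x. k x + c * k2 x) = J f g k + c * J f g k2" .
  }
qed

text \<open>
  As \<open>[X, Y] = - 2 T\<close>, the horizontal fields control the vertical derivative, and then the other two as well.
\<close>

lemma J_deriv_zero:
  assumes "C2_supp a1 b1 f" "C2_supp a2 b2 g" "C2_supp a3 b3 k"
    and D: "\<And>x. (f has_real_derivative f' x) (at x)" "\<And>x. (g has_real_derivative g' x) (at x)" "\<And>x. (k has_real_derivative k' x) (at x)"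
  shows "J f g k' = 0" "J f' g k = 0" "J f g' k = 0"
proof -
  have T: "J f g k' = 0"
    if s: "C2_supp a1 b1 f" "C2_supp a2 b2 g" "C2_supp a3 b3 k"
      and D: "\<And>x. (f has_real_derivative f' x) (at x)" "\<And>x. (g has_real_derivative g' x) (at x)" "\<And>x. (k has_real_derivative k' x) (at x)"
    for f g k f' g' k'
  proof -
    have z: "\<And>x. x \<notin> {a1..b1} \<Longrightarrow> f x = 0" "\<And>x. x \<notin> {a2..b2} \<Longrightarrow> g x = 0" "\<And>x. x \<notin> {a3..b3} \<Longrightarrow> k x = 0"
      using s by (simp_all add: C2_supp_def)
    have z': "\<And>x. x \<notin> {a1..b1} \<Longrightarrow> f' x = 0" "\<And>x. x \<notin> {a2..b2} \<Longrightarrow> g' x = 0" "\<And>x. x \<notin> {a3..b3} \<Longrightarrow> k' x = 0"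
      by (rule DERIV_zero_outside[OF D(1)], rule z(1), assumption+) (rule DERIV_zero_outside[OF D(2)], rule z(2), assumption+,
        rule DERIV_zero_outside[OF D(3)], rule z(3), assumption+)
    have 2: "\<exists>h''. (\<forall>x. (h' has_real_derivative h'' x) (at x)) \<and> continuous_on UNIV h''"
      if h: "C2_real h" "\<And>x. (h has_real_derivative h' x) (at x)" for h h'
    proof -
      obtain d d' where d: "\<And>x. (h has_real_derivative d x) (at x)" "\<And>x. (d has_real_derivative d' x) (at x)" "continuous_on UNIV d'"
        using h(1) unfolding C2_real_def by blast
      have "h' = d" using DERIV_unique[OF h(2) d(1)] by blast
      then show ?thesis using d by blast
    qed
    obtain f'' where f'': "\<And>x. (f' has_real_derivative f'' x) (at x)" "continuous_on UNIV f''"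
      using 2[OF _ D(1)] s(1) unfolding C2_supp_def by blast
    obtain g'' where g'': "\<And>x. (g' has_real_derivative g'' x) (at x)" "continuous_on UNIV g''"
      using 2[OF _ D(2)] s(2) unfolding C2_supp_def by blast
    obtain k'' where k'': "\<And>x. (k' has_real_derivative k'' x) (at x)" "continuous_on UNIV k''"
      using 2[OF _ D(3)] s(3) unfolding C2_supp_def by blast
    have c: "continuous_on UNIV f" "continuous_on UNIV g" "continuous_on UNIV k" "continuous_on UNIV f'" "continuous_on UNIV g'" "continuous_on UNIV k'"
      using DERIV_continuous_on D f''(1) g''(1) k''(1) by blast+
    have xf: "((\<lambda>x. x * f x) has_real_derivative f x + x * f' x) (at x)" for x
      by (rule derivative_eq_intros D refl)+ simp
    have yg: "((\<lambda>x. x * g x) has_real_derivative g x + x * g' x) (at x)" for x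
      by (rule derivative_eq_intros D refl)+ simp
    (* A and B test the field (Y phi) X, C and E the field (X phi) Y, where phi = f g k; their difference is the commutator term *)
    have A: "J f' g' k + J f (\<lambda>y. y * g' y) k' = 0"
      by (rule J_X_Y(1)[OF D(1) c(4) z(1) g''(1,2) z'(2) D(3) c(6) z(3)])
    have B: "J (\<lambda>x. f x + x * f' x) g k' + J (\<lambda>x. x * f x) (\<lambda>y. y * g y) k'' = 0"
      by (rule J_X_Y(1)[OF xf _ _ D(2) c(5) z(2) k''(1,2) z'(3)]) (simp_all add: z(1) continuous_intros c)
    have C: "J f' g' k - J (\<lambda>x. x * f' x) g k' = 0"
      by (rule J_X_Y(2)[OF f''(1,2) z'(1) D(2) c(5) z(2) D(3) c(6) z(3)])
    have E: "J f (\<lambda>y. g y + y * g' y) k' - J (\<lambda>x. x * f x) (\<lambda>y. y * g y) k'' = 0"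
      by (rule J_X_Y(2)[OF D(1) c(4) z(1) yg _ _ k''(1,2) z'(3)]) (simp_all add: z(2) continuous_intros c)
    have B': "J (\<lambda>x. f x + 1 * (x * f' x)) g k' = J f g k' + 1 * J (\<lambda>x. x * f' x) g k'"
      by (rule J_add(1)[OF c(1,2,6) z(1,2) z'(3)]) (simp_all add: z'(1) continuous_intros c)
    have E': "J f (\<lambda>y. g y + 1 * (y * g' y)) k' = J f g k' + 1 * J f (\<lambda>y. y * g' y) k'"
      by (rule J_add(2)[OF c(1,2,6) z(1,2) z'(3)]) (simp_all add: z'(2) continuous_intros c)
    show ?thesis using A B C E B' E' by simp
  qed
  note s = assms(1-3)
  show "J f g k' = 0" by (rule T[OF s D])
  have c: "continuous_on UNIV f'" "continuous_on UNIV g'" "continuous_on UNIV k'"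
  proof -
    have "continuous_on UNIV h'" if h: "C2_real h" "\<And>x. (h has_real_derivative h' x) (at x)" for h h'
    proof -
      obtain d d' where d: "\<And>x. (h has_real_derivative d x) (at x)" "\<And>x. (d has_real_derivative d' x) (at x)"
        using h(1) unfolding C2_real_def by blast
      have "h' = d" using DERIV_unique[OF h(2) d(1)] by blast
      then show ?thesis using DERIV_continuous_on[OF d(2)] by simp
    qed
    then show "continuous_on UNIV f'" "continuous_on UNIV g'" "continuous_on UNIV k'" using s D unfolding C2_supp_def by blast+
  qed
  have z: "\<And>x. x \<notin> {a1..b1} \<Longrightarrow> f x = 0" "\<And>x. x \<notin> {a2..b2} \<Longrightarrow> g x = 0" "\<And>x. x \<notin> {a3..b3} \<Longrightarrow> k x = 0"
    using s by (simp_all add: C2_supp_def)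
  have yg: "C2_supp a2 b2 (\<lambda>y. y * g y)" and xf: "C2_supp a1 b1 (\<lambda>x. x * f x)"
    using s C2_real_mult[OF C2_real_id] by (simp_all add: C2_supp_def)
  have ygD: "((\<lambda>x. x * g x) has_real_derivative g x + x * g' x) (at x)" for x
    by (rule derivative_eq_intros D refl)+ simp
  have xfD: "((\<lambda>x. x * f x) has_real_derivative f x + x * f' x) (at x)" for x
    by (rule derivative_eq_intros D refl)+ simp
  show "J f' g k = 0"
    using J_X_Y(1)[OF D(1) c(1) z(1) D(2) c(2) z(2) D(3) c(3) z(3)] T[OF s(1) yg s(3) D(1) ygD D(3)] by simp
  show "J f g' k = 0"
    using J_X_Y(2)[OF D(1) c(1) z(1) D(2) c(2) z(2) D(3) c(3) z(3)] T[OF xf s(2,3) xfD D(2,3)] by simp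
qed

end

lemma C2_supp_D: assumes "C2_supp a b f"
  shows "\<exists>f'. \<forall>x. (f has_real_derivative f' x) (at x)" "continuous_on UNIV f" "x \<notin> {a..b} \<Longrightarrow> f x = 0"
proof -
  show 1: "\<exists>f'. \<forall>x. (f has_real_derivative f' x) (at x)" using assms unfolding C2_supp_def C2_real_def by blast
  then obtain f' where "\<And>x. (f has_real_derivative f' x) (at x)" by blast
  then show "continuous_on UNIV f" by (rule DERIV_continuous_on)
  show "x \<notin> {a..b} \<Longrightarrow> f x = 0" using assms by (simp add: C2_supp_def)
qed

lemma bump_integral_nonzero: assumes "a < b" shows "(LINT x|lborel. bump a b 1 x) \<noteq> 0"
proof
  assume z: "(LINT x|lborel. bump a b 1 x) = 0"
  have s: "C2_supp a b (bump a b 1)" by (rule C2_supp_bump[OF assms]) simp_all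
  obtain \<kappa> where k: "C2_supp a b \<kappa>" "\<And>x. (\<kappa> has_real_derivative bump a b 1 x) (at x)"
    using zero_mean_antiderivative[OF s assms z] by blast
  have mono: "\<kappa> x \<le> \<kappa> y" if "x \<le> y" for x y
    by (rule DERIV_nonneg_imp_nondecreasing[OF that]) (use k(2) bump_bounds[OF assms] in blast)
  have "\<kappa> (a - 1) = 0" "\<kappa> (b + 1) = 0" using k(1) by (simp_all add: C2_supp_def)
  then have zero: "\<kappa> x = 0" if "x \<in> {a<..<b}" for x using mono[of "a - 1" x] mono[of x "b + 1"] that by auto
  have mid: "(a + b) / 2 \<in> {a<..<b}" using assms by simp
  have "((\<lambda>x. 0) has_real_derivative 0) (at ((a + b) / 2))" by simp
  then have "(\<kappa> has_real_derivative 0) (at ((a + b) / 2))"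
    by (rule has_field_derivative_transform_within_open[OF _ _ mid]) (use zero in auto)
  then have "bump a b 1 ((a + b) / 2) = 0" using k(2) DERIV_unique by blast
  then show False using bump_positive[of a "(a + b) / 2" b] assms by simp
qed

lemma bump_integral_tendsto: assumes "a < b" shows "(\<lambda>n. LINT x|lborel. bump a b n x) \<longlonglongrightarrow> b - a"
proof -
  have "(\<lambda>n. LINT x|lborel. bump a b n x) \<longlonglongrightarrow> (LINT x|lborel. indicator {a<..<b} x)"
  proof (rule integral_dominated_convergence[where w = "indicator {a..b}"])
    show "AE x in lborel. (\<lambda>n. bump a b n x) \<longlonglongrightarrow> indicator {a<..<b} x" using bump_tendsto[OF assms] by simp
    show "AE x in lborel. norm (bump a b n x) \<le> indicator {a..b} x" for n
      using bump_bounds[OF assms, of n] bump_outside[OF assms, of _ n] by (intro AE_I2) (force simp: indicator_def)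
    show "bump a b n \<in> borel_measurable lborel" for n using borel_measurable_continuous_onI[OF bump_continuous] by simp
    show "integrable lborel (indicator {a..b} :: real \<Rightarrow> real)"
      using integrable_continuous_compact_support[OF continuous_on_const[of UNIV "1::real"]] assms
      by (intro integrable_real_indicator) simp_all
  qed simp_all
  then show ?thesis using assms by simp
qed

context zero_perimeter_box
begin

lemma J_scale_third:
  assumes s: "C2_supp a1 b1 f" "C2_supp a2 b2 g" "C2_supp a3 b3 k" "C2_supp a3 b3 k0" and z: "(LINT x|lborel. k x) = r * (LINT x|lborel. k0 x)"
  shows "J f g k = r * J f g k0"
proof -
  let ?m = "\<lambda>x. k x - r * k0 x"
  have m: "C2_supp a3 b3 ?m" by (rule C2_supp_combine[OF s(3,4)])
  have "(LINT x|lborel. ?m x) = 0"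
    using z C2_supp_integrable[OF s(3)] C2_supp_integrable[OF s(4)] by simp
  then obtain \<kappa> where \<kappa>: "C2_supp a3 b3 \<kappa>" "\<And>x. (\<kappa> has_real_derivative ?m x) (at x)"
    using zero_mean_antiderivative[OF m ab(3)] by blast
  obtain f' where f': "\<And>x. (f has_real_derivative f' x) (at x)" using C2_supp_D(1)[OF s(1)] by blast
  obtain g' where g': "\<And>x. (g has_real_derivative g' x) (at x)" using C2_supp_D(1)[OF s(2)] by blast
  have "J f g ?m = 0" by (rule J_deriv_zero(1)[OF s(1,2) \<kappa>(1) f' g' \<kappa>(2)])
  moreover have "J f g (\<lambda>x. k x + (- r) * k0 x) = J f g k + (- r) * J f g k0"
    by (rule J_add(3)) (use C2_supp_D(2,3)[OF s(1)] C2_supp_D(2,3)[OF s(2)] C2_supp_D(2,3)[OF s(3)] C2_supp_D(2,3)[OF s(4)] in blast)+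
  ultimately show ?thesis by simp
qed

lemma J_scale_second:
  assumes s: "C2_supp a1 b1 f" "C2_supp a2 b2 g" "C2_supp a3 b3 k" "C2_supp a2 b2 g0" and z: "(LINT x|lborel. g x) = r * (LINT x|lborel. g0 x)"
  shows "J f g k = r * J f g0 k"
proof -
  let ?m = "\<lambda>x. g x - r * g0 x"
  have m: "C2_supp a2 b2 ?m" by (rule C2_supp_combine[OF s(2,4)])
  have "(LINT x|lborel. ?m x) = 0"
    using z C2_supp_integrable[OF s(2)] C2_supp_integrable[OF s(4)] by simp
  then obtain \<kappa> where \<kappa>: "C2_supp a2 b2 \<kappa>" "\<And>x. (\<kappa> has_real_derivative ?m x) (at x)"
    using zero_mean_antiderivative[OF m ab(2)] by blast
  obtain f' where f': "\<And>x. (f has_real_derivative f' x) (at x)" using C2_supp_D(1)[OF s(1)] by blast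
  obtain k' where k': "\<And>x. (k has_real_derivative k' x) (at x)" using C2_supp_D(1)[OF s(3)] by blast
  have "J f ?m k = 0" by (rule J_deriv_zero(3)[OF s(1) \<kappa>(1) s(3) f' \<kappa>(2) k'])
  moreover have "J f (\<lambda>x. g x + (- r) * g0 x) k = J f g k + (- r) * J f g0 k"
    by (rule J_add(2)) (use C2_supp_D(2,3)[OF s(1)] C2_supp_D(2,3)[OF s(2)] C2_supp_D(2,3)[OF s(3)] C2_supp_D(2,3)[OF s(4)] in blast)+
  ultimately show ?thesis by simp
qed

lemma J_scale_first:
  assumes s: "C2_supp a1 b1 f" "C2_supp a2 b2 g" "C2_supp a3 b3 k" "C2_supp a1 b1 f0" and z: "(LINT x|lborel. f x) = r * (LINT x|lborel. f0 x)"
  shows "J f g k = r * J f0 g k"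
proof -
  let ?m = "\<lambda>x. f x - r * f0 x"
  have m: "C2_supp a1 b1 ?m" by (rule C2_supp_combine[OF s(1,4)])
  have "(LINT x|lborel. ?m x) = 0"
    using z C2_supp_integrable[OF s(1)] C2_supp_integrable[OF s(4)] by simp
  then obtain \<kappa> where \<kappa>: "C2_supp a1 b1 \<kappa>" "\<And>x. (\<kappa> has_real_derivative ?m x) (at x)"
    using zero_mean_antiderivative[OF m ab(1)] by blast
  obtain g' where g': "\<And>x. (g has_real_derivative g' x) (at x)" using C2_supp_D(1)[OF s(2)] by blast
  obtain k' where k': "\<And>x. (k has_real_derivative k' x) (at x)" using C2_supp_D(1)[OF s(3)] by blast
  have "J ?m g k = 0" by (rule J_deriv_zero(2)[OF \<kappa>(1) s(2,3) \<kappa>(2) g' k'])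
  moreover have "J (\<lambda>x. f x + (- r) * f0 x) g k = J f g k + (- r) * J f0 g k"
    by (rule J_add(1)) (use C2_supp_D(2,3)[OF s(1)] C2_supp_D(2,3)[OF s(2)] C2_supp_D(2,3)[OF s(3)] C2_supp_D(2,3)[OF s(4)] in blast)+
  ultimately show ?thesis by simp
qed

text \<open>
  Since \<open>J\<close> annihilates derivatives in each slot, it depends on each function through its integral only.
\<close>

lemma J_product:
  "\<exists>c. \<forall>f g k. C2_supp a1 b1 f \<longrightarrow> C2_supp a2 b2 g \<longrightarrow> C2_supp a3 b3 k \<longrightarrow>
    J f g k = c * ((LINT x|lborel. f x) * (LINT x|lborel. g x) * (LINT x|lborel. k x))"
proof -
  let ?f = "bump a1 b1 1" and ?g = "bump a2 b2 1" and ?k = "bump a3 b3 1"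
  note s0 = C2_supp_bump[OF ab(1) order_refl order_refl, of 1] C2_supp_bump[OF ab(2) order_refl order_refl, of 1] C2_supp_bump[OF ab(3) order_refl order_refl, of 1]
  note n = bump_integral_nonzero[OF ab(1)] bump_integral_nonzero[OF ab(2)] bump_integral_nonzero[OF ab(3)]
  define I1 I2 I3 where "I1 = (LINT x|lborel. ?f x)" and "I2 = (LINT x|lborel. ?g x)" and "I3 = (LINT x|lborel. ?k x)"
  have I: "I1 \<noteq> 0" "I2 \<noteq> 0" "I3 \<noteq> 0" using n by (simp_all add: I1_def I2_def I3_def)
  have "J f g k = J ?f ?g ?k / (I1 * I2 * I3) * ((LINT x|lborel. f x) * (LINT x|lborel. g x) * (LINT x|lborel. k x))"
    if s: "C2_supp a1 b1 f" "C2_supp a2 b2 g" "C2_supp a3 b3 k" for f g k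
  proof -
    have "J f g k = (LINT x|lborel. k x) / I3 * J f g ?k"
      by (rule J_scale_third[OF s s0(3)]) (use I in \<open>simp add: I3_def\<close>)
    also have "J f g ?k = (LINT x|lborel. g x) / I2 * J f ?g ?k"
      by (rule J_scale_second[OF s(1,2) s0(3) s0(2)]) (use I in \<open>simp add: I2_def\<close>)
    also have "J f ?g ?k = (LINT x|lborel. f x) / I1 * J ?f ?g ?k"
      by (rule J_scale_first[OF s(1) s0(2,3) s0(1)]) (use I in \<open>simp add: I1_def\<close>)
    finally show ?thesis using I by (simp add: field_simps)
  qed
  then show ?thesis by blast
qed

lemma box_mem: "(x, y, t) \<in> box (l1, l2, l3) (u1, u2, u3) \<longleftrightarrow> l1 < x \<and> x < u1 \<and> l2 < y \<and> y < u2 \<and> l3 < t \<and> t < u3"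
  for x y t l1 l2 l3 u1 u2 u3 :: real
  by (auto simp: box_def Basis_prod_def inner_prod_def)

text \<open>
  The indicator of a box is a limit of products of bumps.
\<close>

lemma box_density:
  "\<exists>c. \<forall>l1 u1 l2 u2 l3 u3. a1 \<le> l1 \<and> l1 < u1 \<and> u1 \<le> b1 \<and> a2 \<le> l2 \<and> l2 < u2 \<and> u2 \<le> b2 \<and> a3 \<le> l3 \<and> l3 < u3 \<and> u3 \<le> b3 \<longrightarrow>
    measure lborel (B \<inter> box (l1, l2, l3) (u1, u2, u3)) = c * ((u1 - l1) * (u2 - l2) * (u3 - l3))"
proof -
  obtain c where c: "\<And>f g k. C2_supp a1 b1 f \<Longrightarrow> C2_supp a2 b2 g \<Longrightarrow> C2_supp a3 b3 k \<Longrightarrow>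
    J f g k = c * ((LINT x|lborel. f x) * (LINT x|lborel. g x) * (LINT x|lborel. k x))"
    using J_product by blast
  have "measure lborel (B \<inter> box (l1, l2, l3) (u1, u2, u3)) = c * ((u1 - l1) * (u2 - l2) * (u3 - l3))"
    if q: "a1 \<le> l1" "l1 < u1" "u1 \<le> b1" "a2 \<le> l2" "l2 < u2" "u2 \<le> b2" "a3 \<le> l3" "l3 < u3" "u3 \<le> b3" for l1 u1 l2 u2 l3 u3
  proof -
    let ?Q = "box (l1, l2, l3) (u1, u2, u3)"
    let ?f = "bump l1 u1" and ?g = "bump l2 u2" and ?k = "bump l3 u3"
    have J: "J (?f n) (?g n) (?k n) = c * ((LINT x|lborel. ?f n x) * (LINT x|lborel. ?g n x) * (LINT x|lborel. ?k n x))" for n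
      by (rule c; rule C2_supp_bump) (use q in simp_all)
    have 1: "(\<lambda>n. J (?f n) (?g n) (?k n)) \<longlonglongrightarrow> c * ((u1 - l1) * (u2 - l2) * (u3 - l3))"
      unfolding J by (intro tendsto_intros bump_integral_tendsto q)
    have QB: "?Q \<in> sets borel" by simp
    have fin: "emeasure lborel ?Q < \<infinity>" using emeasure_bounded_finite[OF bounded_box] by blast
    have "(\<lambda>n. J (?f n) (?g n) (?k n)) \<longlonglongrightarrow> (LINT p|lborel. indicator B p * indicator ?Q p)"
      unfolding J_def
    proof (rule integral_dominated_convergence[where w = "indicator ?Q"])
      show "(\<lambda>p. indicator B p * indicator ?Q p :: real) \<in> borel_measurable lborel" using B QB by simp
      show "integrable lborel (indicator ?Q :: heis \<Rightarrow> real)" using QB fin by (simp add: integrable_real_indicator)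
      show "(\<lambda>p. indicator B p * (?f n (fst p) * ?g n (fst (snd p)) * ?k n (snd (snd p)))) \<in> borel_measurable lborel" for n
        unfolding measurable_lborel2
        by (intro borel_measurable_times borel_measurable_indicator B borel_measurable_continuous_onI continuous_on_mult
          continuous_on_UNIV_compose[OF bump_continuous] continuous_intros)
      show "AE p in lborel. (\<lambda>n. indicator B p * (?f n (fst p) * ?g n (fst (snd p)) * ?k n (snd (snd p)))) \<longlonglongrightarrow> indicator B p * indicator ?Q p"
      proof (rule AE_I2)
        fix p :: heis
        have "indicator ?Q p = indicator {l1<..<u1} (fst p) * indicator {l2<..<u2} (fst (snd p)) * (indicator {l3<..<u3} (snd (snd p)) :: real)"
          by (cases p) (simp add: indicator_def box_mem)
        then show "(\<lambda>n. indicator B p * (?f n (fst p) * ?g n (fst (snd p)) * ?k n (snd (snd p)))) \<longlonglongrightarrow> indicator B p * indicator ?Q p"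
          by (simp only:) (intro tendsto_mult tendsto_const bump_tendsto q)
      qed
      show "AE p in lborel. norm (indicator B p * (?f n (fst p) * ?g n (fst (snd p)) * ?k n (snd (snd p)))) \<le> indicator ?Q p" for n
      proof (rule AE_I2)
        fix p :: heis
        obtain x y t where p: "p = (x, y, t)" by (cases p)
        show "norm (indicator B p * (?f n (fst p) * ?g n (fst (snd p)) * ?k n (snd (snd p)))) \<le> indicator ?Q p"
        proof (cases "p \<in> ?Q")
          case True
          have b: "0 \<le> ?f n x" "?f n x \<le> 1" "0 \<le> ?g n y" "?g n y \<le> 1" "0 \<le> ?k n t" "?k n t \<le> 1"
            using bump_bounds q by blast+
          then have "0 \<le> ?f n x * ?g n y * ?k n t" "?f n x * ?g n y * ?k n t \<le> 1" by (auto intro!: mult_le_one mult_nonneg_nonneg)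
          then show ?thesis using True by (simp add: p indicator_def)
        next
          case False
          then have "?f n x * ?g n y * ?k n t = 0"
            using bump_outside[OF q(2)] bump_outside[OF q(5)] bump_outside[OF q(8)] unfolding p box_mem by fastforce
          then show ?thesis using False by (simp add: p)
        qed
      qed
    qed
    moreover have "(LINT p|lborel. indicator B p * indicator ?Q p) = measure lborel (B \<inter> ?Q)"
      unfolding indicator_inter_arith[symmetric] using B QB by simp
    ultimately show ?thesis using LIMSEQ_unique[OF 1] by metis
  qed
  then show ?thesis by blast
qed

text \<open>
  On all boxes inside the given box \<open>X\<close>, the measure \<open>B \<inter> \<cdot>\<close> is \<open>c\<close> times the volume. If \<open>c > 0\<close>, then Lebesgue measure agrees on
  boxes, hence everywhere, with the measure that has density \<open>1 / c\<close> on \<open>B \<inter> X\<close>, \<open>0\<close> on the rest of \<open>X\<close> and \<open>1\<close> outside. So \<open>X - B\<close> is null.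
\<close>

lemma box_null_or_full:
  "(AE p in lborel. p \<in> box (a1, a2, a3) (b1, b2, b3) \<longrightarrow> p \<notin> B) \<or> (AE p in lborel. p \<in> box (a1, a2, a3) (b1, b2, b3) \<longrightarrow> p \<in> B)"
proof -
  let ?X = "box (a1, a2, a3) (b1, b2, b3)"
  obtain c where c: "\<And>l1 u1 l2 u2 l3 u3. a1 \<le> l1 \<and> l1 < u1 \<and> u1 \<le> b1 \<and> a2 \<le> l2 \<and> l2 < u2 \<and> u2 \<le> b2 \<and> a3 \<le> l3 \<and> l3 < u3 \<and> u3 \<le> b3 \<Longrightarrow>
    measure lborel (B \<inter> box (l1, l2, l3) (u1, u2, u3)) = c * ((u1 - l1) * (u2 - l2) * (u3 - l3))"
    using box_density by blast
  have XB: "?X \<in> sets borel" by simp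
  have fin: "emeasure lborel (C \<inter> box l u) \<noteq> \<infinity>" if "C \<in> sets borel" for C and l u :: heis
  proof -
    have "emeasure lborel (C \<inter> box l u) \<le> emeasure lborel (box l u)" by (rule emeasure_mono) simp_all
    also have "\<dots> < \<infinity>" using emeasure_bounded_finite[OF bounded_box] by blast
    finally show ?thesis by simp
  qed
  have vol: "measure lborel (box (l1, l2, l3) (u1, u2, u3)) = (u1 - l1) * (u2 - l2) * (u3 - l3)"
    if "l1 < u1" "l2 < u2" "l3 < u3" for l1 l2 l3 u1 u2 u3 :: real
  proof -
    have "measure lborel (box (l1, l2, l3) (u1, u2, u3)) = measure lborel (cbox (l1, l2, l3) (u1, u2, u3))"
      unfolding measure_lborel_box_eq measure_lborel_cbox_eq ..
    also have "\<dots> = measure lborel (cbox l1 u1) * (measure lborel (cbox l2 u2) * measure lborel (cbox l3 u3))"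
      unfolding content_Pair ..
    also have "\<dots> = (u1 - l1) * (u2 - l2) * (u3 - l3)" using that by simp
    finally show ?thesis .
  qed
  have eq: "measure lborel (B \<inter> box (l1, l2, l3) (u1, u2, u3)) = c * measure lborel (box (l1, l2, l3) (u1, u2, u3))"
    if q: "a1 \<le> l1 \<and> u1 \<le> b1 \<and> a2 \<le> l2 \<and> u2 \<le> b2 \<and> a3 \<le> l3 \<and> u3 \<le> b3" for l1 u1 l2 u2 l3 u3
  proof (cases "l1 < u1 \<and> l2 < u2 \<and> l3 < u3")
    case True
    then show ?thesis using c[of l1 u1 l2 u2 l3 u3] vol[of l1 u1 l2 u2 l3 u3] q by simp
  next
    case False
    have "p \<notin> box (l1, l2, l3) (u1, u2, u3)" for p :: heis
    proof -
      obtain x y t where p: "p = (x, y, t)" by (cases p)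
      show ?thesis using False unfolding p box_mem by linarith
    qed
    then have "box (l1, l2, l3) (u1, u2, u3) = {}" by blast
    then show ?thesis by simp
  qed
  have inter: "\<exists>l1 l2 l3 u1 u2 u3. ?X \<inter> box l u = box (l1, l2, l3) (u1, u2, u3)
     \<and> a1 \<le> l1 \<and> u1 \<le> b1 \<and> a2 \<le> l2 \<and> u2 \<le> b2 \<and> a3 \<le> l3 \<and> u3 \<le> b3" for l u :: heis
  proof -
    obtain l1 l2 l3 u1 u2 u3 where lu: "l = (l1, l2, l3)" "u = (u1, u2, u3)" by (cases l; cases u)
    have "?X \<inter> box l u = box (max a1 l1, max a2 l2, max a3 l3) (min b1 u1, min b2 u2, min b3 u3)"
    proof (rule set_eqI)
      fix p :: heis
      obtain x y t where p: "p = (x, y, t)" by (cases p)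
      show "p \<in> ?X \<inter> box l u \<longleftrightarrow> p \<in> box (max a1 l1, max a2 l2, max a3 l3) (min b1 u1, min b2 u2, min b3 u3)"
        unfolding p lu Int_iff box_mem max_less_iff_conj min_less_iff_conj by blast
    qed
    then show ?thesis
      by (intro exI[of _ "max a1 l1"] exI[of _ "max a2 l2"] exI[of _ "max a3 l3"] exI[of _ "min b1 u1"] exI[of _ "min b2 u2"] exI[of _ "min b3 u3"] conjI)
         simp_all
  qed
  have c0: "0 \<le> c"
  proof -
    have "0 \<le> measure lborel (B \<inter> ?X)" by simp
    also have "\<dots> = c * ((b1 - a1) * (b2 - a2) * (b3 - a3))" by (rule c) (use ab in simp)
    finally have 1: "0 \<le> c * ((b1 - a1) * (b2 - a2) * (b3 - a3))" .
    have "0 < (b1 - a1) * (b2 - a2) * (b3 - a3)" using ab by simp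
    from mult_neg_pos[OF _ this] 1 show ?thesis by (meson not_le)
  qed
  show ?thesis
  proof (cases "c = 0")
    case True
    then have "measure lborel (B \<inter> ?X) = 0" using eq[of a1 b1 a2 b2 a3 b3] by simp
    then have "emeasure lborel (B \<inter> ?X) = 0" using fin[OF B] by (simp add: emeasure_eq_ennreal_measure)
    then have "B \<inter> ?X \<in> null_sets lborel" using B XB by (intro null_setsI) auto
    from AE_not_in[OF this] have "AE p in lborel. p \<in> ?X \<longrightarrow> p \<notin> B" by eventually_elim blast
    then show ?thesis by blast
  next
    case False
    then have cp: "0 < c" using c0 by simp
    define M where "M = density lborel (\<lambda>p. ennreal (1 / c) * indicator (B \<inter> ?X) p + indicator (- ?X) p)"
    have emM: "emeasure M A = ennreal (1 / c) * emeasure lborel (B \<inter> ?X \<inter> A) + emeasure lborel (- ?X \<inter> A)" if A: "A \<in> sets borel" for A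
    proof -
      have "emeasure M A = (\<integral>\<^sup>+p. (ennreal (1 / c) * indicator (B \<inter> ?X) p + indicator (- ?X) p) * indicator A p \<partial>lborel)"
        unfolding M_def using A B XB by (subst emeasure_density) auto
      also have "\<dots> = (\<integral>\<^sup>+p. ennreal (1 / c) * indicator (B \<inter> ?X \<inter> A) p + indicator (- ?X \<inter> A) p \<partial>lborel)"
        by (rule nn_integral_cong) (auto simp: indicator_def)
      also have "\<dots> = ennreal (1 / c) * emeasure lborel (B \<inter> ?X \<inter> A) + emeasure lborel (- ?X \<inter> A)"
        using A B XB by (subst nn_integral_add) (auto simp: nn_integral_cmult)
      finally show ?thesis .
    qed
    have "lborel = M"
    proof (rule lborel_eqI)
      fix l u :: heis assume lu: "\<And>b. b \<in> Basis \<Longrightarrow> l \<bullet> b \<le> u \<bullet> b"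
      obtain l1 l2 l3 u1 u2 u3 where i: "?X \<inter> box l u = box (l1, l2, l3) (u1, u2, u3)"
        "a1 \<le> l1 \<and> u1 \<le> b1 \<and> a2 \<le> l2 \<and> u2 \<le> b2 \<and> a3 \<le> l3 \<and> u3 \<le> b3"
        using inter[of l u] by blast
      have "emeasure lborel (B \<inter> ?X \<inter> box l u) = ennreal (measure lborel (B \<inter> box (l1, l2, l3) (u1, u2, u3)))"
        using fin[OF B, of "(l1, l2, l3)" "(u1, u2, u3)"] by (simp add: Int_assoc i(1) emeasure_eq_ennreal_measure)
      also have "\<dots> = ennreal c * ennreal (measure lborel (box (l1, l2, l3) (u1, u2, u3)))"
        unfolding eq[OF i(2)] using c0 by (simp add: ennreal_mult)
      also have "ennreal (measure lborel (box (l1, l2, l3) (u1, u2, u3))) = emeasure lborel (?X \<inter> box l u)"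
        using fin[of UNIV "(l1, l2, l3)" "(u1, u2, u3)"] by (simp add: i(1) emeasure_eq_ennreal_measure)
      finally have "ennreal (1 / c) * emeasure lborel (B \<inter> ?X \<inter> box l u) = (ennreal (1 / c) * ennreal c) * emeasure lborel (?X \<inter> box l u)"
        by (simp add: mult.assoc)
      also have "ennreal (1 / c) * ennreal c = 1" using cp by (simp add: ennreal_mult[symmetric])
      finally have "emeasure M (box l u) = emeasure lborel (?X \<inter> box l u) + emeasure lborel (- ?X \<inter> box l u)"
        by (simp add: emM)
      also have "\<dots> = emeasure lborel ((?X \<inter> box l u) \<union> (- ?X \<inter> box l u))"
        by (rule plus_emeasure) (use XB in auto)
      also have "(?X \<inter> box l u) \<union> (- ?X \<inter> box l u) = box l u" by blast
      also have "emeasure lborel (box l u) = (\<Prod>b\<in>Basis. (u - l) \<bullet> b)" using lu by (rule emeasure_lborel_box)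
      finally show "emeasure M (box l u) = (\<Prod>b\<in>Basis. (u - l) \<bullet> b)" .
    qed (simp add: M_def)
    then have "emeasure lborel (?X - B) = emeasure M (?X - B)" by simp
    also have "\<dots> = 0"
    proof -
      have "B \<inter> ?X \<inter> (?X - B) = {}" "- ?X \<inter> (?X - B) = {}" by blast+
      then show ?thesis using B XB by (subst emM) simp_all
    qed
    finally have "?X - B \<in> null_sets lborel" using B XB by (intro null_setsI) auto
    from AE_not_in[OF this] have "AE p in lborel. p \<in> ?X \<longrightarrow> p \<in> B" by eventually_elim blast
    then show ?thesis by blast
  qed
qed

end

lemma zero_perimeter_locally_constant:
  assumes E: "E \<in> sets lebesgue" and \<Omega>: "open \<Omega>" "p \<in> \<Omega>" "perimeter E \<Omega> \<le> 0"
  shows "\<exists>Q. open Q \<and> p \<in> Q \<and> ((AE x in lborel. x \<in> Q \<longrightarrow> x \<notin> E) \<or> (AE x in lborel. x \<in> Q \<longrightarrow> x \<in> E))"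
proof -
  obtain B where Bb: "B \<in> sets borel" "ae_eq E B" using lebesgue_ae_borel[OF E] by blast
  obtain a b where Q: "cbox a b \<subseteq> \<Omega>" "p \<in> box a b" using open_contains_cbox[OF \<Omega>(1,2)] by metis
  obtain a1 a2 a3 b1 b2 b3 x y t where c: "a = (a1, a2, a3)" "b = (b1, b2, b3)" "p = (x, y, t)" by (cases a; cases b; cases p)
  interpret zero_perimeter_box B a1 b1 a2 b2 a3 b3
  proof
    show "B \<in> sets borel" by (rule Bb(1))
    show "a1 < b1" "a2 < b2" "a3 < b3" using Q(2) unfolding c by (auto simp: box_def Basis_prod_def inner_prod_def)
  next
    fix v1 v1x v1y v1t v2 v2x v2y v2t
    assume v: "C1_heis v1 v1x v1y v1t" "C1_heis v2 v2x v2y v2t"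
      and o: "\<And>p. p \<notin> cbox (a1, a2, a3) (b1, b2, b3) \<Longrightarrow> v1 p = 0" "\<And>p. p \<notin> cbox (a1, a2, a3) (b1, b2, b3) \<Longrightarrow> v2 p = 0"
    show "(LINT p|lborel. indicator B p * hdiv v1 v2 p) = 0"
      by (rule zero_perimeter_divergence[OF E Bb \<Omega>(3) v compact_cbox Q(1)[unfolded c]]) (rule o, assumption)+
  qed
  have r: "(AE x in lborel. x \<in> box a b \<longrightarrow> x \<notin> E) \<or> (AE x in lborel. x \<in> box a b \<longrightarrow> x \<in> E)"
    using box_null_or_full
  proof
    assume a: "AE p in lborel. p \<in> box (a1, a2, a3) (b1, b2, b3) \<longrightarrow> p \<notin> B"
    have "AE x in lborel. x \<in> box a b \<longrightarrow> x \<notin> E" unfolding c using a Bb(2)[unfolded ae_eq_def] by eventually_elim blast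
    then show ?thesis by (rule disjI1)
  next
    assume a: "AE p in lborel. p \<in> box (a1, a2, a3) (b1, b2, b3) \<longrightarrow> p \<in> B"
    have "AE x in lborel. x \<in> box a b \<longrightarrow> x \<in> E" unfolding c using a Bb(2)[unfolded ae_eq_def] by eventually_elim blast
    then show ?thesis by (rule disjI2)
  qed
  show ?thesis by (intro exI[of _ "box a b"] conjI open_box Q(2) r)
qed

section \<open>The two sides of a minimal graph\<close>

lemma AE_locally:
  fixes \<Omega> :: "'a::euclidean_space set"
  assumes "\<And>p. p \<in> \<Omega> \<Longrightarrow> \<exists>Q. open Q \<and> p \<in> Q \<and> (AE x in lborel. x \<in> Q \<longrightarrow> P x)"
  shows "AE x in lborel. x \<in> \<Omega> \<longrightarrow> P x"
proof -
  define \<F> where "\<F> = {Q. open Q \<and> (AE x in lborel. x \<in> Q \<longrightarrow> P x)}"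
  have op: "openin (top_of_set UNIV) S" if "S \<in> \<F>" for S using that by (simp add: \<F>_def)
  obtain \<F>' where F': "\<F>' \<subseteq> \<F>" "countable \<F>'" "\<Union>\<F>' = \<Union>\<F>"
    by (rule Lindelof_openin[of \<F> UNIV], rule op, assumption) (rule that; assumption)
  have "AE x in lborel. \<forall>Q\<in>\<F>'. x \<in> Q \<longrightarrow> P x"
    using F'(1) by (intro AE_ball_countable[OF F'(2), THEN iffD2]) (auto simp: \<F>_def)
  then show ?thesis
  proof eventually_elim
    fix x assume a: "\<forall>Q\<in>\<F>'. x \<in> Q \<longrightarrow> P x"
    show "x \<in> \<Omega> \<longrightarrow> P x"
    proof
      assume "x \<in> \<Omega>"
      then have "x \<in> \<Union>\<F>" using assms[of x] by (auto simp: \<F>_def)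
      then show "P x" using a F'(3) by blast
    qed
  qed
qed

text \<open>
  The union of the open sets in which \<open>E\<close> is null and the union of those in which it is full are disjoint and cover.
\<close>

lemma zero_perimeter_connected:
  assumes E: "E \<in> sets lebesgue" and \<Omega>: "connected \<Omega>"
    and P: "\<And>p. p \<in> \<Omega> \<Longrightarrow> \<exists>U. open U \<and> p \<in> U \<and> perimeter E U \<le> 0"
  shows "(AE x in lborel. x \<in> \<Omega> \<longrightarrow> x \<notin> E) \<or> (AE x in lborel. x \<in> \<Omega> \<longrightarrow> x \<in> E)"
proof -
  define A where "A R = \<Union>{Q. open Q \<and> (AE x in lborel. x \<in> Q \<longrightarrow> R x)}" for R :: "heis \<Rightarrow> bool"
  let ?A1 = "A (\<lambda>x. x \<notin> E)" and ?A2 = "A (\<lambda>x. x \<in> E)"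
  have op: "open ?A1" "open ?A2" by (auto simp: A_def)
  have AEA: "AE x in lborel. x \<in> A R \<longrightarrow> R x" for R
    by (rule AE_locally) (auto simp: A_def)
  have cov: "\<Omega> \<subseteq> ?A1 \<union> ?A2"
  proof
    fix p assume "p \<in> \<Omega>"
    then obtain U where "open U" "p \<in> U" "perimeter E U \<le> 0" using P by blast
    from zero_perimeter_locally_constant[OF E this] show "p \<in> ?A1 \<union> ?A2" by (auto simp: A_def)
  qed
  have disj: "?A1 \<inter> ?A2 = {}"
  proof (rule ccontr)
    assume ne: "?A1 \<inter> ?A2 \<noteq> {}"
    have "AE x in lborel. x \<notin> ?A1 \<inter> ?A2" using AEA[of "\<lambda>x. x \<notin> E"] AEA[of "\<lambda>x. x \<in> E"] by eventually_elim auto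
    moreover have "?A1 \<inter> ?A2 \<in> sets lborel" using op by (simp add: open_Int)
    ultimately have "?A1 \<inter> ?A2 \<in> null_sets lborel" by (simp only: AE_iff_null_sets)
    then have "negligible (?A1 \<inter> ?A2)" by (simp add: negligible_iff_null_sets null_sets_completionI)
    then show False using open_not_negligible[OF open_Int[OF op] ne] by blast
  qed
  have "?A1 \<inter> \<Omega> = {} \<or> ?A2 \<inter> \<Omega> = {}"
    by (rule connectedD[OF \<Omega> op]) (use disj cov in blast)+
  then show ?thesis
  proof
    assume "?A1 \<inter> \<Omega> = {}"
    then have "\<Omega> \<subseteq> ?A2" using cov by blast
    then have "AE x in lborel. x \<in> \<Omega> \<longrightarrow> x \<in> E" using AEA[of "\<lambda>x. x \<in> E"] by (auto elim!: eventually_mono)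
    then show ?thesis by blast
  next
    assume "?A2 \<inter> \<Omega> = {}"
    then have "\<Omega> \<subseteq> ?A1" using cov by blast
    then have "AE x in lborel. x \<in> \<Omega> \<longrightarrow> x \<notin> E" using AEA[of "\<lambda>x. x \<notin> E"] by (auto elim!: eventually_mono)
    then show ?thesis by blast
  qed
qed

lemma total_divergence_zero:
  assumes v1: "C1_heis v1 v1x v1y v1t" "box_supp R v1" and v2: "C1_heis v2 v2x v2y v2t" "box_supp R v2"
  shows "(LINT p|lborel. hdiv v1 v2 p) = 0"
proof -
  have w: "C1_plane (\<lambda>_. \<bar>R\<bar> + 1) (\<lambda>_. 0) (\<lambda>_. 0)" unfolding C1_plane_def by simp
  have ih: "indicator (subgraph (\<lambda>_. \<bar>R\<bar> + 1)) p * hdiv v1 v2 p = hdiv v1 v2 p" for p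
  proof (cases "p \<in> subgraph (\<lambda>_. \<bar>R\<bar> + 1)")
    case False
    obtain x y t where p: "p = (x, y, t)" by (cases p)
    have "R < \<bar>t\<bar>" using False unfolding p subgraph_mem by linarith
    then have "v1x p = 0" "v1t p = 0" "v2y p = 0" "v2t p = 0"
      unfolding p using box_suppD[OF box_supp_deriv(1)[OF v1]] box_suppD[OF box_supp_deriv(3)[OF v1]] box_suppD[OF box_supp_deriv(2)[OF v2]] box_suppD[OF box_supp_deriv(3)[OF v2]] by blast+
    then show ?thesis by (simp add: hdiv_at[OF v1(1) v2(1)])
  qed simp
  from subgraph_divergence[OF v1 v2 w]
  have "(LINT p|lborel. hdiv v1 v2 p) = - (LINT q|lborel. v1 (fst q, snd q, \<bar>R\<bar> + 1) * (0 - snd q) + v2 (fst q, snd q, \<bar>R\<bar> + 1) * (0 + fst q))"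
    by (simp only: ih)
  moreover have "v1 (x, y, \<bar>R\<bar> + 1) = 0" "v2 (x, y, \<bar>R\<bar> + 1) = 0" for x y
    by (rule box_suppD[OF v1(2)], linarith) (rule box_suppD[OF v2(2)], linarith)
  ultimately show ?thesis by simp
qed

lemma test_field_integral_complement:
  assumes E: "E \<in> sets lebesgue" and v: "(v1, v2) \<in> test_fields \<Omega>"
  shows "(LINT p:- E|lebesgue. hdiv v1 v2 p) = - (LINT p:E|lebesgue. hdiv v1 v2 p)"
proof -
  from test_fieldsE[OF v] obtain v1x v1y v1t v2x v2y v2t S
    where v1: "C1_heis v1 v1x v1y v1t" "box_supp S v1" and v2: "C1_heis v2 v2x v2y v2t" "box_supp S v2"
    by (elim exE conjE)
  obtain B where B: "B \<in> sets borel" "ae_eq E B" using lebesgue_ae_borel[OF E] by blast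
  have B': "- B \<in> sets borel" "ae_eq (- E) (- B)" "- E \<in> sets lebesgue"
  proof -
    show "- B \<in> sets borel" using B(1) by (rule borel_comp)
    show "- E \<in> sets lebesgue" using sets.compl_sets[OF E] by (simp add: Compl_eq_Diff_UNIV)
    show "ae_eq (- E) (- B)" using B(2) unfolding ae_eq_def by eventually_elim simp
  qed
  note hc = hdiv_continuous[OF v1(1) v2(1)]
  have hs: "box_supp S (hdiv v1 v2)"
    unfolding box_supp_def
  proof (intro allI impI)
    fix x y t assume a: "S < \<bar>x\<bar> \<or> S < \<bar>y\<bar> \<or> S < \<bar>t\<bar>"
    show "hdiv v1 v2 (x, y, t) = 0"
      unfolding hdiv_at[OF v1(1) v2(1)] using box_suppD[OF box_supp_deriv(1)[OF v1] a] box_suppD[OF box_supp_deriv(3)[OF v1] a]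
        box_suppD[OF box_supp_deriv(2)[OF v2] a] box_suppD[OF box_supp_deriv(3)[OF v2] a] by simp
  qed
  have "(LINT p:E|lebesgue. hdiv v1 v2 p) + (LINT p:- E|lebesgue. hdiv v1 v2 p)
    = (LINT p|lborel. indicator B p * hdiv v1 v2 p) + (LINT p|lborel. indicator (- B) p * hdiv v1 v2 p)"
    unfolding ae_eq_integral[OF E B hc] ae_eq_integral[OF B'(3,1,2) hc] ..
  also have "\<dots> = (LINT p|lborel. indicator B p * hdiv v1 v2 p + indicator (- B) p * hdiv v1 v2 p)"
    by (rule Bochner_Integration.integral_add[symmetric, OF slice_integrable(1)[OF hc hs B(1)] slice_integrable(1)[OF hc hs B'(1)]])
  also have "\<dots> = (LINT p|lborel. hdiv v1 v2 p)"
    by (rule Bochner_Integration.integral_cong[OF refl]) (simp add: indicator_def)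
  also have "\<dots> = 0" by (rule total_divergence_zero[OF v1 v2])
  finally show ?thesis by simp
qed

lemma perimeter_complement_le:
  assumes E: "E \<in> sets lebesgue" shows "perimeter (- E) \<Omega> \<le> perimeter E \<Omega>"
  unfolding perimeter_def[of "- E"]
proof (rule SUP_least, clarify)
  fix v1 v2 assume v: "(v1, v2) \<in> test_fields \<Omega>"
  from test_fieldsE[OF v] obtain v1x v1y v1t v2x v2y v2t
    where c: "C1_heis v1 v1x v1y v1t" "C1_heis v2 v2x v2y v2t" by (elim exE conjE)
  note n = C1_heis_scale[OF c(1), of "-1"] C1_heis_scale[OF c(2), of "-1"]
  have tf: "(\<lambda>p. (-1) * v1 p, \<lambda>p. (-1) * v2 p) \<in> test_fields \<Omega>"
    using v C1_heis_imp_C1_on[OF n(1)] C1_heis_imp_C1_on[OF n(2)] unfolding test_fields_def by simp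
  have hn: "hdiv (\<lambda>p. (-1) * v1 p) (\<lambda>p. (-1) * v2 p) p = - hdiv v1 v2 p" for p
    unfolding hdiv_at[OF n] hdiv_at[OF c] by simp
  have "(LINT p:- E|lebesgue. hdiv v1 v2 p) = - (LINT p:E|lebesgue. hdiv v1 v2 p)"
    by (rule test_field_integral_complement[OF E v])
  also have "\<dots> = (LINT p:E|lebesgue. hdiv (\<lambda>p. (-1) * v1 p) (\<lambda>p. (-1) * v2 p) p)"
    unfolding hn set_lebesgue_integral_def by simp
  finally show "ereal (LINT p:- E|lebesgue. hdiv v1 v2 p) \<le> perimeter E \<Omega>"
    unfolding perimeter_def by (intro SUP_upper2[OF tf]) simp
qed

lemma perimeter_complement:
  assumes E: "E \<in> sets lebesgue" shows "perimeter (- E) \<Omega> = perimeter E \<Omega>"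
proof (rule antisym[OF perimeter_complement_le[OF E]])
  have "- E \<in> sets lebesgue" using sets.compl_sets[OF E] by (simp add: Compl_eq_Diff_UNIV)
  from perimeter_complement_le[OF this] show "perimeter E \<Omega> \<le> perimeter (- E) \<Omega>" by simp
qed

lemma local_perimeter_minimizer_complement:
  assumes E: "E \<in> sets lebesgue" "local_perimeter_minimizer E" shows "local_perimeter_minimizer (- E)"
  unfolding local_perimeter_minimizer_def perimeter_minimizer_in_def
proof (intro allI impI)
  fix \<Omega> F assume \<Omega>: "open \<Omega> \<and> bounded \<Omega>"
    and F: "locally_finite_perimeter F \<and> compact (closure (sym_diff (- E) F)) \<and> closure (sym_diff (- E) F) \<subseteq> \<Omega>"
  have FL: "F \<in> sets lebesgue" using F by (simp add: locally_finite_perimeter_def)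
  then have FcL: "- F \<in> sets lebesgue" using sets.compl_sets[OF FL] by (simp add: Compl_eq_Diff_UNIV)
  have s: "sym_diff E (- F) = sym_diff (- E) F" by blast
  have "locally_finite_perimeter (- F)"
    using F FcL unfolding locally_finite_perimeter_def perimeter_complement[OF FL] by blast
  then have "perimeter E \<Omega> \<le> perimeter (- F) \<Omega>"
    using E(2) \<Omega> F unfolding local_perimeter_minimizer_def perimeter_minimizer_in_def s[symmetric] by blast
  then show "perimeter (- E) \<Omega> \<le> perimeter F \<Omega>" by (simp add: perimeter_complement[OF E(1)] perimeter_complement[OF FL])
qed

lemma connected_below: assumes "continuous_on UNIV u" shows "connected (subgraph u)"
proof -
  define \<Psi> where "\<Psi> p = (fst p, fst (snd p), snd (snd p) + u (fst p, fst (snd p)))" for p :: heis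
  have "convex {p :: heis. (0, 0, 1) \<bullet> p < 0}" by (rule convex_halfspace_lt)
  then have "connected {p :: heis. (0, 0, 1) \<bullet> p < 0}" by (rule convex_connected)
  moreover have "continuous_on {p :: heis. (0, 0, 1) \<bullet> p < 0} \<Psi>"
    unfolding \<Psi>_def by (intro continuous_intros continuous_on_UNIV_compose[OF assms])
  ultimately have "connected (\<Psi> ` {p :: heis. (0, 0, 1) \<bullet> p < 0})" by (rule connected_continuous_image[rotated])
  moreover have "\<Psi> ` {p :: heis. (0, 0, 1) \<bullet> p < 0} = subgraph u"
  proof (intro subset_antisym subsetI)
    fix p assume "p \<in> \<Psi> ` {p :: heis. (0, 0, 1) \<bullet> p < 0}"
    then show "p \<in> subgraph u" by (auto simp: \<Psi>_def subgraph_def inner_prod_def)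
  next
    fix p assume "p \<in> subgraph u"
    then show "p \<in> \<Psi> ` {p :: heis. (0, 0, 1) \<bullet> p < 0}"
      by (intro image_eqI[of _ _ "(fst p, fst (snd p), snd (snd p) - u (fst p, fst (snd p)))"]) (auto simp: \<Psi>_def subgraph_def inner_prod_def)
  qed
  ultimately show ?thesis by simp
qed

definition supergraph :: "(plane \<Rightarrow> real) \<Rightarrow> heis set" where
  "supergraph w = {(x, y, t). w (x, y) < t}"

lemma connected_above: assumes "continuous_on UNIV u" shows "connected (supergraph u)"
proof -
  have c: "continuous_on UNIV (\<lambda>q. - u q)" using assms by (rule continuous_on_minus)
  have "continuous_on (subgraph (\<lambda>q. - u q)) (\<lambda>p. (fst p, fst (snd p), - snd (snd p)))" by (intro continuous_intros)
  from connected_continuous_image[OF this connected_below[OF c]]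
  have "connected ((\<lambda>p. (fst p, fst (snd p), - snd (snd p))) ` subgraph (\<lambda>q. - u q))" .
  moreover have "(\<lambda>p. (fst p, fst (snd p), - snd (snd p))) ` subgraph (\<lambda>q. - u q) = supergraph u"
  proof (intro subset_antisym subsetI)
    fix p assume "p \<in> supergraph u"
    then show "p \<in> (\<lambda>p. (fst p, fst (snd p), - snd (snd p))) ` subgraph (\<lambda>q. - u q)"
      by (intro image_eqI[of _ _ "(fst p, fst (snd p), - snd (snd p))"]) (auto simp: supergraph_def subgraph_def)
  qed (auto simp: supergraph_def subgraph_def)
  ultimately show ?thesis by simp
qed

lemma graph_null: assumes "continuous_on UNIV u" shows "AE p in lborel. p \<in> subgraph u \<or> p \<in> supergraph u"
proof -
  define G where "G = {p :: heis. snd (snd p) = u (fst p, fst (snd p))}"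
  have uc: "continuous_on UNIV (\<lambda>p::heis. u (fst p, fst (snd p)))" by (intro continuous_on_UNIV_compose[OF assms] continuous_intros)
  have "closed G" unfolding G_def by (intro closed_Collect_eq continuous_intros uc)
  then have GB: "G \<in> sets borel" by simp
  have "emeasure lborel G = emeasure (lborel \<Otimes>\<^sub>M lborel) G" by (simp add: lborel_prod)
  also have "\<dots> = (\<integral>\<^sup>+x. emeasure lborel (Pair x -` G) \<partial>lborel)"
    using GB by (intro lborel.emeasure_pair_measure_alt) (simp only: lborel_prod sets_lborel)
  also have "\<dots> = (\<integral>\<^sup>+(x::real). 0 \<partial>lborel)"
  proof (rule nn_integral_cong)
    fix x :: real
    have GxB: "Pair x -` G \<in> sets borel" by (rule section_borel[OF GB])
    have "emeasure lborel (Pair x -` G) = emeasure (lborel \<Otimes>\<^sub>M lborel) (Pair x -` G)" by (simp add: lborel_prod)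
    also have "\<dots> = (\<integral>\<^sup>+y. emeasure lborel (Pair y -` (Pair x -` G)) \<partial>lborel)"
      using GxB by (intro lborel.emeasure_pair_measure_alt) (simp only: lborel_prod sets_lborel)
    also have "\<dots> = (\<integral>\<^sup>+(y::real). 0 \<partial>lborel)"
    proof (rule nn_integral_cong)
      fix y :: real
      have "Pair y -` (Pair x -` G) = {u (x, y)}" by (auto simp: G_def)
      then show "emeasure lborel (Pair y -` (Pair x -` G)) = 0" by simp
    qed
    finally show "emeasure lborel (Pair x -` G) = 0" by simp
  qed
  finally have "G \<in> null_sets lborel" using GB by (intro null_setsI) simp_all
  from AE_not_in[OF this] show ?thesis
    by eventually_elim (auto simp: G_def subgraph_def supergraph_def split: prod.splits)
qed

text \<open>
  Each side of the graph is connected and carries no perimeter. If \<open>E\<close> were null or full on both sides, it would have no perimeter at all, but the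
  graph is the support of its perimeter.
\<close>

theorem minimizer_one_side:
  assumes E: "E \<in> sets lebesgue" and u: "continuous_on UNIV u" and S: "perimeter_support E = {(x, y, u (x, y)) | x y. True}"
  shows "ae_eq E (subgraph u) \<or> ae_eq (- E) (subgraph u)"
proof -
  have P: "\<exists>U. open U \<and> p \<in> U \<and> perimeter E U \<le> 0" if "p \<in> subgraph u \<or> p \<in> supergraph u" for p
  proof -
    have "p \<notin> perimeter_support E" unfolding S using that by (auto simp: subgraph_def supergraph_def)
    then show ?thesis unfolding perimeter_support_def by (auto simp: not_less)
  qed
  have below: "(AE x in lborel. x \<in> subgraph u \<longrightarrow> x \<notin> E) \<or> (AE x in lborel. x \<in> subgraph u \<longrightarrow> x \<in> E)"
    by (rule zero_perimeter_connected[OF E connected_below[OF u]]) (use P in blast)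
  have above: "(AE x in lborel. x \<in> supergraph u \<longrightarrow> x \<notin> E) \<or> (AE x in lborel. x \<in> supergraph u \<longrightarrow> x \<in> E)"
    by (rule zero_perimeter_connected[OF E connected_above[OF u]]) (use P in blast)
  have pos: "perimeter E UNIV > 0"
  proof -
    have "(0, 0, u (0, 0)) \<in> perimeter_support E" unfolding S by blast
    then show ?thesis unfolding perimeter_support_def by blast
  qed
  have triv: False if "ae_eq F {}" "F \<in> sets lebesgue" "perimeter F UNIV > 0" for F
  proof -
    have "perimeter F UNIV \<le> 0"
      unfolding perimeter_def
    proof (rule SUP_least, clarify)
      fix v1 v2 assume "(v1, v2) \<in> test_fields (UNIV :: heis set)"
      from test_fieldsE[OF this] obtain v1x v1y v1t v2x v2y v2t
        where c: "C1_heis v1 v1x v1y v1t" "C1_heis v2 v2x v2y v2t" by (elim exE conjE)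
      show "ereal (LINT p:F|lebesgue. hdiv v1 v2 p) \<le> 0"
        using ae_eq_integral[OF that(2) _ that(1) hdiv_continuous[OF c]] by simp
    qed
    then show False using that(3) by simp
  qed
  have n: "\<not> (p \<in> subgraph u \<and> p \<in> supergraph u)" for p by (auto simp: subgraph_def supergraph_def)
  note g = graph_null[OF u]
  have EC: "- E \<in> sets lebesgue" using sets.compl_sets[OF E] by (simp add: Compl_eq_Diff_UNIV)
  from below show ?thesis
  proof
    assume b: "AE x in lborel. x \<in> subgraph u \<longrightarrow> x \<notin> E"
    from above show ?thesis
    proof
      assume a: "AE x in lborel. x \<in> supergraph u \<longrightarrow> x \<notin> E"
      have "ae_eq E {}" unfolding ae_eq_def using a b g by eventually_elim blast
      then show ?thesis using triv[OF _ E pos] by blast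
    next
      assume a: "AE x in lborel. x \<in> supergraph u \<longrightarrow> x \<in> E"
      have "ae_eq (- E) (subgraph u)" unfolding ae_eq_def using a b g by eventually_elim (use n in blast)
      then show ?thesis by blast
    qed
  next
    assume b: "AE x in lborel. x \<in> subgraph u \<longrightarrow> x \<in> E"
    from above show ?thesis
    proof
      assume a: "AE x in lborel. x \<in> supergraph u \<longrightarrow> x \<notin> E"
      have "ae_eq E (subgraph u)" unfolding ae_eq_def using a b g by eventually_elim (use n in blast)
      then show ?thesis by blast
    next
      assume a: "AE x in lborel. x \<in> supergraph u \<longrightarrow> x \<in> E"
      have "ae_eq (- E) {}" unfolding ae_eq_def using a b g by eventually_elim blast
      then show ?thesis using triv[OF _ EC] pos unfolding perimeter_complement[OF E] by blast
    qed
  qed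
qed

text \<open>
  If the minimizer is the region above the graph, its complement is a minimizer as well, since a set and its complement have the same perimeter.
\<close>

theorem minimal_graph_stationary:
  assumes E: "E \<in> sets lebesgue" "local_perimeter_minimizer E" and u: "C1_plane u ux uy"
    and S: "perimeter_support E = {(x, y, u (x, y)) | x y. True}" and ae: "AE q in lborel. speed ux uy q \<noteq> 0"
  shows "stationary ux uy"
  using minimizer_one_side[OF E(1) C1_planeD(4)[OF u] S]
proof
  assume "ae_eq E (subgraph u)"
  then show ?thesis by (rule minimizer_stationary[OF E(1) _ E(2) u ae])
next
  assume a: "ae_eq (- E) (subgraph u)"
  have EC: "- E \<in> sets lebesgue" using sets.compl_sets[OF E(1)] by (simp add: Compl_eq_Diff_UNIV)
  show ?thesis by (rule minimizer_stationary[OF EC a local_perimeter_minimizer_complement[OF E] u ae])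
qed

section \<open>Homogeneous graphs\<close>

lemma C1_plane_partials:
  assumes "C1_plane w wx wy"
  shows "((\<lambda>x. w (x, y)) has_real_derivative wx (x, y)) (at x)" "((\<lambda>y. w (x, y)) has_real_derivative wy (x, y)) (at y)"
proof -
  have 1: "((\<lambda>x. (x, y)) has_derivative (\<lambda>h. (h, 0))) (at x)" and 2: "((\<lambda>y. (x, y)) has_derivative (\<lambda>h. (0, h))) (at y)"
    by (auto intro!: derivative_eq_intros)
  from has_derivative_compose[OF 1 C1_planeD(1)[OF assms]]
  show "((\<lambda>x. w (x, y)) has_real_derivative wx (x, y)) (at x)" by (simp add: has_field_derivative_def mult.commute[of _ "wx _"])
  from has_derivative_compose[OF 2 C1_planeD(1)[OF assms]]
  show "((\<lambda>y. w (x, y)) has_real_derivative wy (x, y)) (at y)" by (simp add: has_field_derivative_def mult.commute[of _ "wy _"])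
qed

locale homogeneous_graph =
  fixes u ux uy :: "plane \<Rightarrow> real"
  assumes C1: "C1_plane u ux uy" and homog: "0 < r \<Longrightarrow> u (r * x, r * y) = r\<^sup>2 * u (x, y)"
begin

lemma euler: "x * ux (x, y) + y * uy (x, y) = 2 * u (x, y)"
proof -
  have "((\<lambda>r. (r * x, r * y)) has_derivative (\<lambda>k. (k * x, k * y))) (at 1)" by (auto intro!: derivative_eq_intros)
  from has_derivative_compose[OF this C1_planeD(1)[OF C1]]
  have "((\<lambda>r. u (r * x, r * y)) has_real_derivative x * ux (x, y) + y * uy (x, y)) (at 1)"
    unfolding has_field_derivative_def by (rule has_derivative_eq_rhs) (simp add: fun_eq_iff algebra_simps)
  moreover have "((\<lambda>r. u (r * x, r * y)) has_real_derivative 2 * u (x, y)) (at 1)"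
  proof (rule has_field_derivative_transform_within_open[of "\<lambda>r. r\<^sup>2 * u (x, y)" _ _ "{0<..}"])
    show "((\<lambda>r. r\<^sup>2 * u (x, y)) has_real_derivative 2 * u (x, y)) (at 1)" by (auto intro!: derivative_eq_intros)
  qed (auto simp: homog)
  ultimately show ?thesis by (rule DERIV_unique)
qed

lemma gradient_homog:
  assumes r: "0 < r" shows "ux (r * x, r * y) = r * ux (x, y)" "uy (r * x, r * y) = r * uy (x, y)"
proof -
  have "((\<lambda>x. u (r * x, r * y)) has_real_derivative ux (r * x, r * y) * r) (at x)"
    by (rule DERIV_chain2[OF C1_plane_partials(1)[OF C1]]) (auto intro!: derivative_eq_intros)
  moreover have "((\<lambda>x. u (r * x, r * y)) has_real_derivative r\<^sup>2 * ux (x, y)) (at x)"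
    unfolding homog[OF r] by (intro DERIV_cmult C1_plane_partials(1)[OF C1])
  ultimately have "ux (r * x, r * y) * r = r\<^sup>2 * ux (x, y)" by (rule DERIV_unique)
  then show "ux (r * x, r * y) = r * ux (x, y)" using r by (simp add: power2_eq_square)
  have "((\<lambda>y. u (r * x, r * y)) has_real_derivative uy (r * x, r * y) * r) (at y)"
    by (rule DERIV_chain2[OF C1_plane_partials(2)[OF C1]]) (auto intro!: derivative_eq_intros)
  moreover have "((\<lambda>y. u (r * x, r * y)) has_real_derivative r\<^sup>2 * uy (x, y)) (at y)"
    unfolding homog[OF r] by (intro DERIV_cmult C1_plane_partials(2)[OF C1])
  ultimately have "uy (r * x, r * y) * r = r\<^sup>2 * uy (x, y)" by (rule DERIV_unique)
  then show "uy (r * x, r * y) = r * uy (x, y)" using r by (simp add: power2_eq_square)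
qed

lemma origin: "u (0, 0) = 0" "ux (0, 0) = 0" "uy (0, 0) = 0"
  using homog[of 2 0 0] gradient_homog[of 2 0 0] by simp_all

lemma speed_zero_iff: "speed ux uy (x, y) = 0 \<longleftrightarrow> ux (x, y) = y \<and> uy (x, y) = - x"
  unfolding speed_def by (simp add: sum_power2_eq_zero_iff) linarith

lemma speed_zero_imp: "speed ux uy (x, y) = 0 \<Longrightarrow> u (x, y) = 0"
  using euler[of x y] unfolding speed_zero_iff by (simp add: mult.commute)

lemma speed_slice_continuous: "continuous_on A (\<lambda>y. speed ux uy (x, y))"
  by (intro continuous_on_UNIV_compose[OF speed_continuous[OF C1]] continuous_intros)

text \<open>
  At a zero of the speed, \<open>u\<close> vanishes by Euler's identity while \<open>\<partial>\<^sub>y u = - x \<noteq> 0\<close>; thus \<open>u\<close> does not vanish at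
  nearby points of the line, and neither does the speed.
\<close>

lemma nonsingular_near:
  assumes x: "x \<noteq> 0" shows "\<forall>\<^sub>F y in at y0. speed ux uy (x, y) \<noteq> 0"
proof (cases "speed ux uy (x, y0) = 0")
  case False
  have "isCont (\<lambda>y. speed ux uy (x, y)) y0" using speed_slice_continuous[of UNIV x] by (simp add: continuous_on_eq_continuous_at)
  then have "((\<lambda>y. speed ux uy (x, y)) \<longlongrightarrow> speed ux uy (x, y0)) (at y0)" by (simp add: isCont_def)
  then show ?thesis using False by (rule tendsto_imp_eventually_ne)
next
  case True
  then have z: "uy (x, y0) = - x" "u (x, y0) = 0" using speed_zero_imp[OF True] by (simp_all add: speed_zero_iff)
  have D: "((\<lambda>y. u (x, y)) has_real_derivative - x) (at y0)" using C1_plane_partials(2)[OF C1, of x y0] z by simp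
  have "((\<lambda>y. (u (x, y) - u (x, y0)) / (y - y0)) \<longlongrightarrow> - x) (at y0)" using D by (simp add: has_field_derivative_iff)
  then have "\<forall>\<^sub>F y in at y0. (u (x, y) - u (x, y0)) / (y - y0) \<noteq> 0" by (rule tendsto_imp_eventually_ne) (use x in simp)
  then show ?thesis
  proof eventually_elim
    fix y assume "(u (x, y) - u (x, y0)) / (y - y0) \<noteq> 0"
    then have "u (x, y) \<noteq> 0" using z by auto
    then show "speed ux uy (x, y) \<noteq> 0" using speed_zero_imp by blast
  qed
qed

lemma AE_speed_nonzero: "AE q in lborel. speed ux uy q \<noteq> 0"
proof -
  have sl: "AE y in lborel. speed ux uy (x, y) \<noteq> 0" if x: "x \<noteq> 0" for x
  proof -
    have "AE y in lborel. y \<in> UNIV \<longrightarrow> speed ux uy (x, y) \<noteq> 0"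
    proof (rule AE_locally)
      fix y0 :: real
      obtain d where d: "d > 0" "\<And>y. y \<noteq> y0 \<Longrightarrow> dist y y0 < d \<Longrightarrow> speed ux uy (x, y) \<noteq> 0"
        using nonsingular_near[OF x, of y0] unfolding eventually_at by blast
      have "AE y in lborel. y \<in> ball y0 d \<longrightarrow> speed ux uy (x, y) \<noteq> 0"
        using AE_lborel_singleton[of y0] by eventually_elim (use d(2) in \<open>auto simp: dist_commute\<close>)
      then show "\<exists>Q. open Q \<and> y0 \<in> Q \<and> (AE y in lborel. y \<in> Q \<longrightarrow> speed ux uy (x, y) \<noteq> 0)"
        by (intro exI[of _ "ball y0 d"] conjI open_ball) (use d(1) in simp_all)
    qed
    then show ?thesis by simp
  qed
  have "AE x in lborel. AE y in lborel. speed ux uy (x, y) \<noteq> 0"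
    using AE_lborel_singleton[of "0::real"] by eventually_elim (rule sl)
  moreover have "{q. speed ux uy q \<noteq> 0} \<in> sets borel"
    by (intro borel_open open_Collect_neq speed_continuous[OF C1] continuous_intros)
  ultimately have "AE q in lborel \<Otimes>\<^sub>M lborel. speed ux uy q \<noteq> 0"
    by (intro lborel_pair.AE_pair_measure) (simp_all only: lborel_prod sets_lborel space_lborel space_borel UNIV_I simp_thms)
  then show ?thesis by (simp only: lborel_prod)
qed

end

text \<open>
  Quarter turns are the only rotations needed: the slope coordinate covers the half-plane \<open>x > 0\<close>, and four of these
  half-planes cover the plane without the origin.
\<close>

lemma lborel_quarter_turn: "distr lborel borel (\<lambda>q::plane. (- snd q, fst q)) = lborel"
proof -
  have m: "(\<lambda>q::plane. (- snd q, fst q)) \<in> lborel \<rightarrow>\<^sub>M borel"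
    unfolding measurable_lborel2 by (intro borel_measurable_continuous_onI continuous_intros)
  show ?thesis
  proof (rule lborel_eqI[symmetric])
    fix l u :: plane assume "\<And>b. b \<in> Basis \<Longrightarrow> l \<bullet> b \<le> u \<bullet> b"
    from this[of "(1, 0)"] this[of "(0, 1)"] have lu: "fst l \<le> fst u" "snd l \<le> snd u" by (simp_all add: Basis_prod_def inner_prod_def)
    have v: "(\<lambda>q::plane. (- snd q, fst q)) -` box l u = box (snd l, - fst u) (snd u, - fst l)"
      by (cases l; cases u) (auto simp: box_def Basis_prod_def inner_prod_def)
    show "emeasure (distr lborel borel (\<lambda>q::plane. (- snd q, fst q))) (box l u) = (\<Prod>b\<in>Basis. (u - l) \<bullet> b)"
      using lu by (subst emeasure_distr[OF m]) (simp_all add: v emeasure_lborel_box_eq Basis_prod_def inner_prod_def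
        prod.union_disjoint prod.reindex inj_on_def algebra_simps ball_Un)
  qed simp
qed

lemma quarter_turn_stationary:
  assumes s: "stationary ux uy" and c: "continuous_on UNIV ux" "continuous_on UNIV uy"
  shows "stationary (\<lambda>q. uy (- snd q, fst q)) (\<lambda>q. - ux (- snd q, fst q))"
  unfolding stationary_def
proof (intro allI impI, elim conjE)
  fix \<phi> \<phi>x \<phi>y \<rho> assume \<phi>: "C1_plane \<phi> \<phi>x \<phi>y" and o: "\<forall>x y. \<rho> < \<bar>x\<bar> \<or> \<rho> < \<bar>y\<bar> \<longrightarrow> \<phi> (x, y) = 0"
  note pc = C1_planeD[OF \<phi>]
  have t: "((\<lambda>q::plane. (snd q, - fst q)) has_derivative (\<lambda>v. (snd v, - fst v))) (at q)" for q
    by (auto intro!: derivative_eq_intros)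
  have tc: "continuous_on A (\<lambda>q::plane. (snd q, - fst q))" for A by (intro continuous_intros)
  have "C1_plane (\<lambda>q. \<phi> (snd q, - fst q)) (\<lambda>q. - \<phi>y (snd q, - fst q)) (\<lambda>q. \<phi>x (snd q, - fst q))"
    unfolding C1_plane_def
  proof (intro conjI allI)
    fix q
    have "((\<lambda>q. \<phi> (snd q, - fst q)) has_derivative (\<lambda>v. \<phi>x (snd q, - fst q) * fst (snd v, - fst v) + \<phi>y (snd q, - fst q) * snd (snd v, - fst v))) (at q)"
      by (rule has_derivative_compose[OF t pc(1)])
    then show "((\<lambda>q. \<phi> (snd q, - fst q)) has_derivative (\<lambda>v. - \<phi>y (snd q, - fst q) * fst v + \<phi>x (snd q, - fst q) * snd v)) (at q)"
      by (simp add: algebra_simps)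
    show "continuous_on UNIV (\<lambda>q. - \<phi>y (snd q, - fst q))" by (intro continuous_on_minus continuous_on_UNIV_compose[OF pc(3) tc])
    show "continuous_on UNIV (\<lambda>q. \<phi>x (snd q, - fst q))" by (intro continuous_on_UNIV_compose[OF pc(2) tc])
  qed
  moreover have "\<forall>x y. \<rho> < \<bar>x\<bar> \<or> \<rho> < \<bar>y\<bar> \<longrightarrow> \<phi> (snd (x, y), - fst (x, y)) = 0" using o by simp
  ultimately have z: "(LINT q|lborel. ((ux q - snd q) * - \<phi>y (snd q, - fst q) + (uy q + fst q) * \<phi>x (snd q, - fst q)) / speed ux uy q) = 0"
    using s unfolding stationary_def by blast
  define f where "f q = ((ux q - snd q) * - \<phi>y (snd q, - fst q) + (uy q + fst q) * \<phi>x (snd q, - fst q)) / speed ux uy q" for q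
  have m: "(\<lambda>q::plane. (- snd q, fst q)) \<in> lborel \<rightarrow>\<^sub>M borel"
    unfolding measurable_lborel2 by (intro borel_measurable_continuous_onI continuous_intros)
  have fm: "f \<in> borel_measurable borel" unfolding f_def[abs_def] speed_def[abs_def]
    by (intro borel_measurable_divide borel_measurable_continuous_onI continuous_intros c continuous_on_UNIV_compose[OF pc(2) tc] continuous_on_UNIV_compose[OF pc(3) tc])
  have "(LINT q|lborel. f q) = (LINT q|distr lborel borel (\<lambda>q::plane. (- snd q, fst q)). f q)" unfolding lborel_quarter_turn ..
  also have "\<dots> = (LINT q|lborel. f (- snd q, fst q))" by (rule integral_distr[OF m fm])
  also have "\<dots> = (LINT q|lborel. ((uy (- snd q, fst q) - snd q) * \<phi>x q + (- ux (- snd q, fst q) + fst q) * \<phi>y q) / speed (\<lambda>q. uy (- snd q, fst q)) (\<lambda>q. - ux (- snd q, fst q)) q)"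
  proof (rule Bochner_Integration.integral_cong[OF refl])
    fix q :: plane
    have "(ux (- snd q, fst q) - fst q)\<^sup>2 + (uy (- snd q, fst q) - snd q)\<^sup>2 = (uy (- snd q, fst q) - snd q)\<^sup>2 + (- ux (- snd q, fst q) + fst q)\<^sup>2"
      by (simp add: power2_eq_square algebra_simps)
    then have "speed ux uy (- snd q, fst q) = speed (\<lambda>q. uy (- snd q, fst q)) (\<lambda>q. - ux (- snd q, fst q)) q"
      unfolding speed_def by simp
    then show "f (- snd q, fst q) = ((uy (- snd q, fst q) - snd q) * \<phi>x q + (- ux (- snd q, fst q) + fst q) * \<phi>y q) / speed (\<lambda>q. uy (- snd q, fst q)) (\<lambda>q. - ux (- snd q, fst q)) q"
      unfolding f_def by (simp add: algebra_simps)
  qed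
  finally show "(LINT q|lborel. ((uy (- snd q, fst q) - snd q) * \<phi>x q + (- ux (- snd q, fst q) + fst q) * \<phi>y q) / speed (\<lambda>q. uy (- snd q, fst q)) (\<lambda>q. - ux (- snd q, fst q)) q) = 0"
    using z unfolding f_def by simp
qed

text \<open>
  Functions of \<open>x\<close> and of the slope \<open>y / x\<close> separate the variables in the weak equation, because the normal depends on the slope only. The
  factor \<open>\<kappa>\<close> removes the line \<open>x = 0\<close>.
\<close>

lemma cone_test_function:
  assumes \<kappa>: "\<And>x. (\<kappa> has_real_derivative \<kappa>' x) (at x)" "continuous_on UNIV \<kappa>'" "\<And>x. x \<le> 1 \<Longrightarrow> \<kappa> x = 0" "\<And>x. x \<le> 1 \<Longrightarrow> \<kappa>' x = 0"
    and \<psi>: "\<And>m. (\<psi> has_real_derivative \<psi>' m) (at m)" "continuous_on UNIV \<psi>'"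
  shows "C1_plane (\<lambda>q. \<kappa> (fst q) * \<psi> (snd q / fst q))
    (\<lambda>q. \<kappa>' (fst q) * \<psi> (snd q / fst q) - \<kappa> (fst q) * \<psi>' (snd q / fst q) * snd q / (fst q)\<^sup>2)
    (\<lambda>q. \<kappa> (fst q) * \<psi>' (snd q / fst q) / fst q)" (is "C1_plane ?f ?fx ?fy")
proof -
  define A where "A = {q :: plane. 1/2 < fst q}"
  define B where "B = {q :: plane. fst q < 1}"
  have op: "open A" "open B" unfolding A_def B_def by (intro open_Collect_less continuous_intros)+
  have AB: "UNIV = A \<union> B" by (auto simp: A_def B_def)
  have z: "?f q = 0" "?fx q = 0" "?fy q = 0" if "q \<in> B" for q using that \<kappa>(3,4)[of "fst q"] by (simp_all add: B_def)
  have kc: "continuous_on UNIV \<kappa>" and pc: "continuous_on UNIV \<psi>" by (rule DERIV_continuous_on[OF \<kappa>(1)], rule DERIV_continuous_on[OF \<psi>(1)])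
  have cA: "continuous_on A ?fx" "continuous_on A ?fy"
    by (intro continuous_intros continuous_on_UNIV_compose[OF kc] continuous_on_UNIV_compose[OF pc] continuous_on_UNIV_compose[OF \<kappa>(2)] continuous_on_UNIV_compose[OF \<psi>(2)]; auto simp: A_def)+
  have "continuous_on B ?fx" by (rule continuous_on_eq[OF continuous_on_const[of _ 0]]) (rule z(2)[symmetric])
  with cA(1) have c1: "continuous_on UNIV ?fx" unfolding AB by (rule continuous_on_open_Un[OF op])
  have "continuous_on B ?fy" by (rule continuous_on_eq[OF continuous_on_const[of _ 0]]) (rule z(3)[symmetric])
  with cA(2) have c2: "continuous_on UNIV ?fy" unfolding AB by (rule continuous_on_open_Un[OF op])
  have D: "(?f has_derivative (\<lambda>v. ?fx q * fst v + ?fy q * snd v)) (at q)" for q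
  proof (cases "q \<in> A")
    case True
    then have q: "fst q \<noteq> 0" by (simp add: A_def)
    have 1: "((\<lambda>q::plane. \<kappa> (fst q)) has_derivative (\<lambda>v. \<kappa>' (fst q) * fst v)) (at q)"
      by (rule has_derivative_compose[OF _ \<kappa>(1)[unfolded has_field_derivative_def]]) (rule has_derivative_fst[OF has_derivative_ident])
    have "((\<lambda>q::plane. snd q / fst q) has_derivative (\<lambda>v. snd v / fst q - snd q * fst v / (fst q)\<^sup>2)) (at q)"
      using q by (auto intro!: derivative_eq_intros simp: field_simps power2_eq_square)
    from has_derivative_compose[OF this \<psi>(1)[unfolded has_field_derivative_def]]
    have 2: "((\<lambda>q::plane. \<psi> (snd q / fst q)) has_derivative (\<lambda>v. \<psi>' (snd q / fst q) * (snd v / fst q - snd q * fst v / (fst q)\<^sup>2))) (at q)" .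
    show ?thesis
      by (rule has_derivative_eq_rhs[OF has_derivative_mult[OF 1 2]]) (rule ext, simp add: algebra_simps diff_divide_distrib)
  next
    case False
    then have q: "q \<in> B" using AB by blast
    have "((\<lambda>_. 0) has_derivative (\<lambda>v. ?fx q * fst v + ?fy q * snd v)) (at q)" unfolding z[OF q] by simp
    then show ?thesis by (rule has_derivative_transform_within_open[OF _ op(2) q]) (rule z(1)[symmetric])
  qed
  show ?thesis unfolding C1_plane_def using D c1 c2 by blast
qed

section \<open>The weak equation in slope coordinates\<close>

context homogeneous_graph begin

text \<open>
  The horizontal normal at the points with slope \<open>m\<close> of the half-plane \<open>x > 0\<close>. It is \<open>0\<close> at the singular slopes.
\<close>

definition n1 :: "real \<Rightarrow> real" where "n1 m = (ux (1, m) - m) / speed ux uy (1, m)"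
definition n2 :: "real \<Rightarrow> real" where "n2 m = (uy (1, m) + 1) / speed ux uy (1, m)"

lemma speed_homog: assumes "0 < r" shows "speed ux uy (r * x, r * y) = r * speed ux uy (x, y)"
proof -
  have "(r * ux (x, y) - r * y)\<^sup>2 + (r * uy (x, y) + r * x)\<^sup>2 = r\<^sup>2 * ((ux (x, y) - y)\<^sup>2 + (uy (x, y) + x)\<^sup>2)"
    by (simp add: power2_eq_square algebra_simps)
  then show ?thesis using assms unfolding speed_def by (simp add: gradient_homog[OF assms] real_sqrt_mult)
qed

lemma direction_on_ray:
  assumes x: "0 < x"
  shows "(ux (x, x * m) - x * m) / speed ux uy (x, x * m) = n1 m" "(uy (x, x * m) + x) / speed ux uy (x, x * m) = n2 m"
proof -
  have 1: "ux (x, x * m) - x * m = x * (ux (1, m) - m)" and 2: "uy (x, x * m) + x = x * (uy (1, m) + 1)" and 3: "speed ux uy (x, x * m) = x * speed ux uy (1, m)"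
    using gradient_homog[OF x, of 1 m] speed_homog[OF x, of 1 m] by (simp_all add: algebra_simps)
  show "(ux (x, x * m) - x * m) / speed ux uy (x, x * m) = n1 m" "(uy (x, x * m) + x) / speed ux uy (x, x * m) = n2 m"
    unfolding 1 2 3 n1_def n2_def using x by simp_all
qed

lemma speed_nonneg: "0 \<le> speed ux uy q" by (simp add: speed_def)

lemma direction_bounds: "\<bar>n1 m\<bar> \<le> 1" "\<bar>n2 m\<bar> \<le> 1"
proof -
  have "\<bar>ux (1, m) - m\<bar> \<le> speed ux uy (1, m)" "\<bar>uy (1, m) + 1\<bar> \<le> speed ux uy (1, m)"
    unfolding speed_def by simp_all
  then show "\<bar>n1 m\<bar> \<le> 1" "\<bar>n2 m\<bar> \<le> 1" unfolding n1_def n2_def abs_divide by (cases "speed ux uy (1, m) = 0"; simp add: divide_le_eq_1 speed_nonneg abs_of_nonneg[OF speed_nonneg] order.strict_iff_order)+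
qed

lemma n_numerators_continuous: "continuous_on A (\<lambda>m. ux (1, m) - m)" "continuous_on A (\<lambda>m. uy (1, m) + 1)"
  by (intro continuous_intros continuous_on_UNIV_compose[OF C1_planeD(2)[OF C1]] continuous_on_UNIV_compose[OF C1_planeD(3)[OF C1]])+

lemma n_borel: "n1 \<in> borel_measurable borel" "n2 \<in> borel_measurable borel"
  unfolding n1_def[abs_def] n2_def[abs_def]
  by (intro borel_measurable_divide borel_measurable_continuous_onI n_numerators_continuous speed_slice_continuous)+

lemma n_continuous: assumes "speed ux uy (1, m) \<noteq> 0" shows "isCont n1 m" "isCont n2 m"
proof -
  have "isCont (\<lambda>m. ux (1, m) - m) m" "isCont (\<lambda>m. uy (1, m) + 1) m" "isCont (\<lambda>m. speed ux uy (1, m)) m"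
    using n_numerators_continuous[of UNIV] speed_slice_continuous[of UNIV 1] unfolding continuous_on_eq_continuous_at[OF open_UNIV] by blast+
  then show "isCont n1 m" "isCont n2 m" unfolding n1_def[abs_def] n2_def[abs_def] using assms by (intro isCont_divide; simp)+
qed

text \<open>
  This is \<open>(n2 - m n1)' = - n1\<close> in the weak sense. With the test function \<open>\<kappa> (x) \<psi> (y / x)\<close> and the
  substitution \<open>y = x m\<close>, the weak equation becomes \<open>(\<integral> x \<kappa>') A + (\<integral> \<kappa>) B = 0\<close> with \<open>A = \<integral> n1 \<psi>\<close> and
  \<open>B = \<integral> (n2 - m n1) \<psi>'\<close>, and \<open>\<integral> x \<kappa>' = - \<integral> \<kappa> \<noteq> 0\<close>.
\<close>

lemma slope_equation:
  assumes s: "stationary ux uy"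
    and \<psi>: "\<And>m. (\<psi> has_real_derivative \<psi>' m) (at m)" "continuous_on UNIV \<psi>'" "\<And>m. M < \<bar>m\<bar> \<Longrightarrow> \<psi> m = 0" "\<And>m. M < \<bar>m\<bar> \<Longrightarrow> \<psi>' m = 0"
  shows "(LINT m|lborel. (n2 m - m * n1 m) * \<psi>' m - n1 m * \<psi> m) = 0"
proof -
  define \<kappa> :: "real \<Rightarrow> real" where "\<kappa> = bump 1 2 1"
  have kb: "0 \<le> \<kappa> x" for x using bump_bounds[of 1 2 1 x] by (simp add: \<kappa>_def)
  obtain \<kappa>' \<kappa>'' where k: "\<And>x. (\<kappa> has_real_derivative \<kappa>' x) (at x)" "\<And>x. (\<kappa>' has_real_derivative \<kappa>'' x) (at x)"
    using C2_real_bump[of 1 2 1] unfolding C2_real_def \<kappa>_def by blast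
  have kc: "continuous_on UNIV \<kappa>'" by (rule DERIV_continuous_on[OF k(2)])
  have kc': "continuous_on UNIV \<kappa>" by (rule DERIV_continuous_on[OF k(1)])
  have k0: "\<kappa> x = 0" if "x \<notin> {1<..<2}" for x using bump_outside[of 1 2 x 1] that by (simp add: \<kappa>_def)
  have d0: "\<kappa>' x = 0" if x: "x \<notin> {1<..<2}" for x
  proof -
    have mn: "\<kappa> x \<le> \<kappa> y" for y using k0[OF x] kb[of y] by simp
    show ?thesis by (rule DERIV_local_min[OF k(1), of 1]) (use mn in simp_all)
  qed
  have pc: "continuous_on UNIV \<psi>" by (rule DERIV_continuous_on[OF \<psi>(1)])
  define \<phi> where "\<phi> q = \<kappa> (fst q) * \<psi> (snd q / fst q)" for q :: plane
  define \<phi>x where "\<phi>x q = \<kappa>' (fst q) * \<psi> (snd q / fst q) - \<kappa> (fst q) * \<psi>' (snd q / fst q) * snd q / (fst q)\<^sup>2" for q :: plane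
  define \<phi>y where "\<phi>y q = \<kappa> (fst q) * \<psi>' (snd q / fst q) / fst q" for q :: plane
  have \<phi>: "C1_plane \<phi> \<phi>x \<phi>y" unfolding \<phi>_def[abs_def] \<phi>x_def[abs_def] \<phi>y_def[abs_def]
    by (rule cone_test_function[OF k(1) kc _ _ \<psi>(1,2)]) (use k0 d0 in simp_all)
  (* kappa is supported in [1, 2], where |y / x| at most M forces |y| at most 2 |M| *)
  define \<rho> where "\<rho> = 2 + 2 * \<bar>M\<bar>"
  have supp: "\<phi> (x, y) = 0" if "\<rho> < \<bar>x\<bar> \<or> \<rho> < \<bar>y\<bar>" for x y
  proof (cases "x \<in> {1<..<2}")
    case False then show ?thesis using k0[of x] by (simp add: \<phi>_def)
  next
    case True
    then have "\<rho> < \<bar>y\<bar>" using that by (auto simp: \<rho>_def)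
    have "M * x \<le> \<bar>M\<bar> * 2" using True by (intro mult_mono) auto
    also have "\<dots> < \<bar>y\<bar>" using \<open>\<rho> < \<bar>y\<bar>\<close> by (simp add: \<rho>_def)
    finally have "M < \<bar>y / x\<bar>" using True by (simp add: abs_divide less_divide_eq)
    then show ?thesis using \<psi>(3) by (simp add: \<phi>_def)
  qed
  define F where "F q = ((ux q - snd q) * \<phi>x q + (uy q + fst q) * \<phi>y q) / speed ux uy q" for q
  have F0: "(LINT q|lborel. F q) = 0" unfolding F_def using s \<phi> supp unfolding stationary_def by blast
  have Fi: "integrable lborel F"
  proof (rule Bochner_Integration.integrable_bound)
    have c: "continuous_on UNIV (\<lambda>q. \<bar>\<phi>x q\<bar> + \<bar>\<phi>y q\<bar>)" by (intro continuous_intros C1_planeD(2,3)[OF \<phi>])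
    show "integrable lborel (\<lambda>q. \<bar>\<phi>x q\<bar> + \<bar>\<phi>y q\<bar>)"
      by (rule plane_integral_iter(2)[OF c, of \<rho>]) (simp add: C1_plane_support[OF \<phi> supp])
    show "F \<in> borel_measurable lborel" unfolding F_def[abs_def] measurable_lborel2
      by (intro borel_measurable_divide borel_measurable_continuous_onI continuous_intros C1_planeD(2,3)[OF \<phi>] C1_planeD(2,3)[OF C1] speed_continuous[OF C1])
    show "AE q in lborel. norm (F q) \<le> norm (\<bar>\<phi>x q\<bar> + \<bar>\<phi>y q\<bar>)"
    proof (rule AE_I2)
      fix q
      let ?s = "speed ux uy q"
      have s: "\<bar>ux q - snd q\<bar> \<le> ?s" "\<bar>uy q + fst q\<bar> \<le> ?s" unfolding speed_def by simp_all
      show "norm (F q) \<le> norm (\<bar>\<phi>x q\<bar> + \<bar>\<phi>y q\<bar>)"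
      proof (cases "?s = 0")
        case True then show ?thesis by (simp add: F_def)
      next
        case False
        then have sp: "0 < ?s" using s(1) by linarith
        have "\<bar>(ux q - snd q) * \<phi>x q + (uy q + fst q) * \<phi>y q\<bar> \<le> \<bar>ux q - snd q\<bar> * \<bar>\<phi>x q\<bar> + \<bar>uy q + fst q\<bar> * \<bar>\<phi>y q\<bar>"
          by (simp add: abs_mult[symmetric] abs_triangle_ineq)
        also have "\<dots> \<le> ?s * \<bar>\<phi>x q\<bar> + ?s * \<bar>\<phi>y q\<bar>" using s by (intro add_mono mult_right_mono) simp_all
        finally show ?thesis using sp unfolding F_def by (simp add: abs_divide divide_le_eq algebra_simps)
      qed
    qed
  qed
  define A where "A = (LINT m|lborel. n1 m * \<psi> m)"
  define B where "B = (LINT m|lborel. (n2 m - m * n1 m) * \<psi>' m)"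
  have nm: "\<bar>m\<bar> \<le> M" if "\<psi> m \<noteq> 0 \<or> \<psi>' m \<noteq> 0" for m using that \<psi>(3,4)[of m] by linarith
  have Ai: "integrable lborel (\<lambda>m. n1 m * \<psi> m)"
  proof (rule Bochner_Integration.integrable_bound)
    show "integrable lborel \<psi>" by (rule integrable_continuous_compact_support[OF pc compact_Icc[of "-M" M]]) (use nm in fastforce)
    show "(\<lambda>m. n1 m * \<psi> m) \<in> borel_measurable lborel" unfolding measurable_lborel2
      by (intro borel_measurable_times n_borel borel_measurable_continuous_onI pc)
    show "AE m in lborel. norm (n1 m * \<psi> m) \<le> norm (\<psi> m)"
      by (rule AE_I2) (simp add: abs_mult mult_left_le_one_le direction_bounds)
  qed
  have Bi: "integrable lborel (\<lambda>m. (n2 m - m * n1 m) * \<psi>' m)"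
  proof (rule Bochner_Integration.integrable_bound)
    show "integrable lborel (\<lambda>m. (1 + \<bar>m\<bar>) * \<psi>' m)"
      by (rule integrable_continuous_compact_support[OF _ compact_Icc[of "-M" M]]) (intro continuous_intros \<psi>(2), use nm in fastforce)
    show "(\<lambda>m. (n2 m - m * n1 m) * \<psi>' m) \<in> borel_measurable lborel" unfolding measurable_lborel2
      by (intro borel_measurable_times borel_measurable_diff n_borel borel_measurable_continuous_onI \<psi>(2) continuous_intros)
    show "AE m in lborel. norm ((n2 m - m * n1 m) * \<psi>' m) \<le> norm ((1 + \<bar>m\<bar>) * \<psi>' m)"
    proof (rule AE_I2)
      fix m
      have "\<bar>m * n1 m\<bar> \<le> \<bar>m\<bar>" by (simp add: abs_mult mult_left_le direction_bounds)
      then have "\<bar>n2 m - m * n1 m\<bar> \<le> \<bar>1 + \<bar>m\<bar>\<bar>" using direction_bounds(2)[of m] by linarith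
      then show "norm ((n2 m - m * n1 m) * \<psi>' m) \<le> norm ((1 + \<bar>m\<bar>) * \<psi>' m)" by (simp only: real_norm_def abs_mult) (rule mult_right_mono, simp_all)
    qed
  qed
  have inner: "(LINT y|lborel. F (x, y)) = x * \<kappa>' x * A + \<kappa> x * B" for x
  proof (cases "x \<in> {1<..<2}")
    case False
    then have "\<kappa>' x = 0" "\<kappa> x = 0" by (rule d0, rule k0)
    then show ?thesis by (simp add: F_def \<phi>x_def \<phi>y_def)
  next
    case True
    then have x: "0 < x" by simp
    have "(LINT y|lborel. F (x, y)) = x * (LINT m|lborel. F (x, x * m))"
      using lborel_integral_real_affine[of x "\<lambda>y. F (x, y)" 0] x by simp
    also have "(\<lambda>m. F (x, x * m)) = (\<lambda>m. \<kappa>' x * (n1 m * \<psi> m) + \<kappa> x / x * ((n2 m - m * n1 m) * \<psi>' m))"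
    proof
      fix m
      have gen: "(a * p + b * q) / s = a / s * p + b / s * q" for a b p q s :: real by (simp add: add_divide_distrib)
      have "F (x, x * m) = (ux (x, x * m) - x * m) / speed ux uy (x, x * m) * \<phi>x (x, x * m) + (uy (x, x * m) + x) / speed ux uy (x, x * m) * \<phi>y (x, x * m)"
        unfolding F_def fst_conv snd_conv by (rule gen)
      also have "\<dots> = n1 m * \<phi>x (x, x * m) + n2 m * \<phi>y (x, x * m)" unfolding direction_on_ray[OF x] ..
      also have "\<dots> = \<kappa>' x * (n1 m * \<psi> m) + \<kappa> x / x * ((n2 m - m * n1 m) * \<psi>' m)"
        unfolding \<phi>x_def \<phi>y_def using x by (simp add: field_simps power2_eq_square)
      finally show "F (x, x * m) = \<kappa>' x * (n1 m * \<psi> m) + \<kappa> x / x * ((n2 m - m * n1 m) * \<psi>' m)" .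
    qed
    also have "(LINT m|lborel. \<kappa>' x * (n1 m * \<psi> m) + \<kappa> x / x * ((n2 m - m * n1 m) * \<psi>' m)) = \<kappa>' x * A + \<kappa> x / x * B"
      unfolding A_def B_def by (subst Bochner_Integration.integral_add) (simp_all add: Ai Bi)
    finally have "(LINT y|lborel. F (x, y)) = x * (\<kappa>' x * A + \<kappa> x / x * B)" .
    also have "\<dots> = x * \<kappa>' x * A + \<kappa> x * B" using x by (simp add: field_simps)
    finally show ?thesis .
  qed
  have out: "\<kappa> x = 0" "\<kappa>' x = 0" if "2 < \<bar>x\<bar>" for x using that by (intro k0 d0; auto)+
  have ki: "integrable lborel \<kappa>" by (rule integrable_continuous_compact_support[OF kc' compact_Icc[of 1 2]]) (rule k0, auto)
  have xi: "integrable lborel (\<lambda>x. x * \<kappa>' x)"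
    by (rule integrable_continuous_compact_support[OF _ compact_Icc[of 1 2]]) (intro continuous_intros kc, use d0 in auto)
  have "((\<lambda>x. x * \<kappa> x) has_real_derivative x * \<kappa>' x + \<kappa> x) (at x)" for x
    using DERIV_mult[OF DERIV_ident k(1)] by (simp add: algebra_simps)
  then have "(LINT x|lborel. x * \<kappa>' x + \<kappa> x) = 0"
    by (rule integral_deriv_zero(1)[where R = 2]) (intro continuous_intros kc kc', simp_all add: out)
  then have xk: "(LINT x|lborel. x * \<kappa>' x) = - (LINT x|lborel. \<kappa> x)" using xi ki by simp
  have "0 = (LINT x|lborel. LINT y|lborel. F (x, y))" using fubini_fst[OF Fi] F0 by simp
  also have "\<dots> = (LINT x|lborel. x * \<kappa>' x) * A + (LINT x|lborel. \<kappa> x) * B"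
    unfolding inner by (subst Bochner_Integration.integral_add) (simp_all add: xi ki)
  also have "\<dots> = (LINT x|lborel. \<kappa> x) * (B - A)" unfolding xk by (simp add: algebra_simps)
  finally have z: "(LINT x|lborel. \<kappa> x) * (B - A) = 0" by simp
  have "(LINT x|lborel. \<kappa> x) \<noteq> 0"
    unfolding \<kappa>_def by (rule bump_integral_nonzero) simp
  then have "B - A = 0" using z by simp
  then show ?thesis unfolding A_def B_def using Ai Bi by simp
qed

lemma n1_integrable: "n1 integrable_on {a..b}"
proof -
  have "set_integrable lborel {a..b} n1"
    unfolding set_integrable_def
  proof (rule Bochner_Integration.integrable_bound)
    show "integrable lborel (indicator {a..b} :: real \<Rightarrow> real)"
      by (rule integrable_real_indicator) (simp_all add: emeasure_lborel_cbox_eq[where 'a = real, simplified] less_top[symmetric])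
    show "(\<lambda>m. indicator {a..b} m *\<^sub>R n1 m) \<in> borel_measurable lborel"
      unfolding measurable_lborel2 by (intro borel_measurable_scaleR borel_measurable_indicator n_borel) simp
    show "AE m in lborel. norm (indicator {a..b} m *\<^sub>R n1 m) \<le> norm (indicator {a..b} m :: real)"
      by (rule AE_I2) (simp add: indicator_def direction_bounds)
  qed
  then show ?thesis by (rule set_borel_integral_eq_integral(1))
qed

text \<open>
  The equation says that \<open>k = (n2 - m n1) + \<integral> n1\<close> has weak derivative zero, so \<open>k\<close> is constant where it is continuous. The
  possible jumps of \<open>n1\<close> at finitely many points do not matter, since the integral of \<open>n1\<close> is continuous across
  them. One inequality is enough, because \<open>m1\<close> and \<open>m2\<close> can be exchanged.
\<close>

lemma flux_constant:
  assumes s: "stationary ux uy" and fin: "finite Z"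
    and reg: "\<And>m. a < m \<Longrightarrow> m < b \<Longrightarrow> m \<notin> Z \<Longrightarrow> speed ux uy (1, m) \<noteq> 0"
    and m1: "a < m1" "m1 < b" "m1 \<notin> Z" and m2: "a < m2" "m2 < b" "m2 \<notin> Z"
  shows "n2 m1 - m1 * n1 m1 + integral {a..m1} n1 \<le> n2 m2 - m2 * n1 m2 + integral {a..m2} n1"
proof (rule ccontr)
  define Q where "Q m = integral {a..m} n1" for m
  define k where "k m = n2 m - m * n1 m + Q m" for m
  assume "\<not> ?thesis"
  then have lt: "k m2 < k m1" by (simp add: k_def Q_def)
  define c where "c = (k m1 + k m2) / 2"
  define \<delta> where "\<delta> = (k m1 - k m2) / 4"
  have dp: "0 < \<delta>" using lt by (simp add: \<delta>_def)
  have ab: "a < b" using m1 by simp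
  have QD: "(Q has_vector_derivative n1 m) (at m)" if m: "a < m" "m < b" "m \<notin> Z" for m
  proof -
    have "(Q has_vector_derivative n1 m) (at m within ({a..b} - {}))" unfolding Q_def[abs_def]
      by (rule integral_has_vector_derivative_continuous_at[OF n1_integrable])
         (use m n_continuous(1)[OF reg[OF m]] in \<open>auto intro: continuous_at_imp_continuous_at_within\<close>)
    then show ?thesis using m at_within_Icc_at[of a m b] by simp
  qed
  have Qc: "continuous_on {a..b} Q" unfolding Q_def[abs_def] by (rule indefinite_integral_continuous_1[OF n1_integrable])
  have kc: "isCont k m" if m: "a < m" "m < b" "m \<notin> Z" for m
  proof -
    have "isCont Q m" using QD[OF m] has_vector_derivative_continuous by blast
    then show ?thesis unfolding k_def[abs_def] by (intro continuous_intros n_continuous reg[OF m])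
  qed
  have "\<forall>\<^sub>F m in at m1. c + \<delta> < k m"
    by (rule order_tendstoD(1)[OF kc[OF m1, unfolded isCont_def]]) (use lt in \<open>simp add: c_def \<delta>_def field_simps\<close>)
  then obtain e1 where e1: "e1 > 0" "\<And>m. m \<noteq> m1 \<Longrightarrow> \<bar>m - m1\<bar> < e1 \<Longrightarrow> c + \<delta> < k m"
    unfolding eventually_at dist_real_def by blast
  have k1: "c + \<delta> \<le> k m" if "\<bar>m - m1\<bar> < e1" for m
    using e1(2)[OF _ that] lt by (cases "m = m1") (simp_all add: c_def \<delta>_def field_simps)
  have "\<forall>\<^sub>F m in at m2. k m < c"
    by (rule order_tendstoD(2)[OF kc[OF m2, unfolded isCont_def]]) (use lt in \<open>simp add: c_def field_simps\<close>)
  then obtain e2 where e2: "e2 > 0" "\<And>m. m \<noteq> m2 \<Longrightarrow> \<bar>m - m2\<bar> < e2 \<Longrightarrow> k m < c"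
    unfolding eventually_at dist_real_def by blast
  have k2: "k m \<le> c" if "\<bar>m - m2\<bar> < e2" for m
    using e2(2)[OF _ that] lt by (cases "m = m2") (simp_all add: c_def field_simps)
  define e where "e = Min {e1, e2, m1 - a, b - m1, m2 - a, b - m2}"
  (* the width e keeps both bumps inside (a, b) and inside the neighbourhoods where k > c + delta and k < c *)
  have "0 < e" unfolding e_def by (subst Min_gr_iff) (use e1(1) e2(1) m1 m2 in simp_all)
  moreover have "e \<le> x" if "x \<in> {e1, e2, m1 - a, b - m1, m2 - a, b - m2}" for x unfolding e_def by (rule Min_le[OF _ that]) simp
  ultimately have e: "0 < e" "e \<le> e1" "e \<le> e2" "e \<le> m1 - a" "e \<le> b - m1" "e \<le> m2 - a" "e \<le> b - m2" by blast+
  define \<beta> where "\<beta> j = bump (j - e) (j + e) 1" for j :: real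
  have \<beta>2: "C2_real (\<beta> j)" for j unfolding \<beta>_def by (rule C2_real_bump)
  have \<beta>c: "continuous_on A (\<beta> j)" for A j unfolding \<beta>_def by (rule bump_continuous)
  have \<beta>0: "0 \<le> \<beta> j m" for j m using bump_bounds[of "j - e" "j + e" 1 m] e(1) by (simp add: \<beta>_def)
  have \<beta>out: "\<beta> j m = 0" if "e \<le> \<bar>m - j\<bar>" for j m using bump_outside[of "j - e" "j + e" m 1] that e(1) by (auto simp: \<beta>_def abs_if split: if_splits)
  have \<beta>pos: "0 < \<beta> j j" for j using bump_positive[of "j - e" j "j + e"] e(1) by (simp add: \<beta>_def)
  have \<beta>i: "integrable lborel (\<beta> j)" for j
    by (rule integrable_continuous_compact_support[OF \<beta>c compact_Icc[of "j - e" "j + e"]]) (rule \<beta>out, auto)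
  have \<beta>shift: "\<beta> j m = \<beta> 0 (m - j)" for j m by (simp add: \<beta>_def bump_def algebra_simps)
  define \<eta> where "\<eta> m = \<beta> m1 m - \<beta> m2 m" for m
  have \<eta>out: "\<eta> m = 0" if "m \<notin> {a..b}" for m
  proof -
    have "e \<le> \<bar>m - m1\<bar>" "e \<le> \<bar>m - m2\<bar>" using that e by auto
    then show ?thesis by (simp add: \<eta>_def \<beta>out)
  qed
  have "C2_supp a b \<eta>" unfolding C2_supp_def \<eta>_def[abs_def] using C2_real_diff[OF \<beta>2 \<beta>2] \<eta>out[unfolded \<eta>_def] by blast
  moreover have "(LINT m|lborel. \<eta> m) = 0"
  proof -
    have "(LINT m|lborel. \<beta> j m) = (LINT m|lborel. \<beta> 0 m)" for j
      unfolding \<beta>shift[of j] by (subst integral_translate[of _ j]) simp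
    from this[of m1] this[of m2] show ?thesis unfolding \<eta>_def by (simp add: \<beta>i)
  qed
  ultimately obtain \<psi> where "C2_supp a b \<psi>" and \<psi>D: "\<And>m. (\<psi> has_real_derivative \<eta> m) (at m)"
    using zero_mean_antiderivative[OF _ ab] by blast
  then have \<psi>out: "\<psi> m = 0" if "m \<notin> {a..b}" for m using that by (simp add: C2_supp_def)
  have \<eta>c: "continuous_on A \<eta>" for A unfolding \<eta>_def[abs_def] by (intro continuous_intros \<beta>c)
  have \<psi>c: "continuous_on A \<psi>" for A by (rule DERIV_continuous_on[OF \<psi>D])
  have "\<psi> a = 0" using continuous_constant_on_closure[of "{..<a}" \<psi> 0 a] \<psi>out \<psi>c by auto
  have "\<psi> b = 0" using continuous_constant_on_closure[of "{b<..}" \<psi> 0 b] \<psi>out \<psi>c by auto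
  define f where "f m = (n2 m - m * n1 m) * \<eta> m - n1 m * \<psi> m" for m
  define M where "M = \<bar>a\<bar> + \<bar>b\<bar>"
  have "(LINT m|lborel. f m) = 0" unfolding f_def
    by (rule slope_equation[OF s \<psi>D \<eta>c, of M]) (intro \<psi>out \<eta>out; auto simp: M_def)+
  have fi: "integrable lborel f"
  proof (rule Bochner_Integration.integrable_bound)
    have c: "continuous_on UNIV (\<lambda>m. (1 + \<bar>m\<bar>) * \<bar>\<eta> m\<bar> + \<bar>\<psi> m\<bar>)" by (intro continuous_intros \<psi>c \<eta>c)
    show "integrable lborel (\<lambda>m. (1 + \<bar>m\<bar>) * \<bar>\<eta> m\<bar> + \<bar>\<psi> m\<bar>)"
      by (rule integrable_continuous_compact_support[OF c compact_Icc[of a b]]) (simp add: \<psi>out \<eta>out)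
    show "f \<in> borel_measurable lborel" unfolding measurable_lborel2 f_def[abs_def]
      by (intro borel_measurable_times borel_measurable_diff n_borel borel_measurable_continuous_onI continuous_intros \<eta>c \<psi>c)
    show "AE m in lborel. norm (f m) \<le> norm ((1 + \<bar>m\<bar>) * \<bar>\<eta> m\<bar> + \<bar>\<psi> m\<bar>)"
    proof (rule AE_I2)
      fix m
      have "\<bar>m * n1 m\<bar> \<le> \<bar>m\<bar>" by (simp add: abs_mult mult_left_le direction_bounds)
      then have "\<bar>n2 m - m * n1 m\<bar> \<le> 1 + \<bar>m\<bar>" using direction_bounds(2)[of m] by linarith
      then have "\<bar>(n2 m - m * n1 m) * \<eta> m\<bar> \<le> (1 + \<bar>m\<bar>) * \<bar>\<eta> m\<bar>" unfolding abs_mult by (rule mult_right_mono) simp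
      moreover have "\<bar>n1 m * \<psi> m\<bar> \<le> \<bar>\<psi> m\<bar>" by (simp add: abs_mult mult_left_le_one_le direction_bounds)
      moreover have "\<bar>f m\<bar> \<le> \<bar>(n2 m - m * n1 m) * \<eta> m\<bar> + \<bar>n1 m * \<psi> m\<bar>" unfolding f_def by (rule abs_triangle_ineq4)
      ultimately show "norm (f m) \<le> norm ((1 + \<bar>m\<bar>) * \<bar>\<eta> m\<bar> + \<bar>\<psi> m\<bar>)" by simp
    qed
  qed
  have "(f has_integral 0) UNIV" using has_integral_integral_real[OF fi] \<open>(LINT m|lborel. f m) = 0\<close> by simp
  moreover have "f = (\<lambda>m. if m \<in> {a..b} then f m else 0)" using \<psi>out \<eta>out by (auto simp: f_def)
  ultimately have I1: "(f has_integral 0) {a..b}" using has_integral_restrict_UNIV[of "{a..b}" f 0] by simp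
  (* integration by parts for Q psi; Q is continuous, and differentiable outside the finite set Z *)
  have I2: "((\<lambda>m. Q m * \<eta> m + n1 m * \<psi> m) has_integral (Q b * \<psi> b - Q a * \<psi> a)) {a..b}"
  proof (rule fundamental_theorem_of_calculus_interior_strong[OF fin])
    show "a \<le> b" using ab by simp
    show "continuous_on {a..b} (\<lambda>m. Q m * \<psi> m)" by (intro continuous_intros Qc \<psi>c)
    fix m assume "m \<in> {a<..<b} - Z"
    then have "(Q has_vector_derivative n1 m) (at m)" by (intro QD) auto
    from has_vector_derivative_mult[OF this \<psi>D[of m, unfolded has_real_derivative_iff_has_vector_derivative]]
    show "((\<lambda>m. Q m * \<psi> m) has_vector_derivative Q m * \<eta> m + n1 m * \<psi> m) (at m)" .
  qed
  have I3: "(\<eta> has_integral (\<psi> b - \<psi> a)) {a..b}"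
    by (rule fundamental_theorem_of_calculus) (use ab \<psi>D in \<open>auto simp: has_real_derivative_iff_has_vector_derivative[symmetric] intro: has_field_derivative_at_within\<close>)
  have I: "((\<lambda>m. (k m - c) * \<eta> m) has_integral 0) {a..b}"
    using has_integral_diff[OF has_integral_add[OF I1 I2] has_integral_mult_right[OF I3, of c]]
    by (simp add: f_def k_def algebra_simps \<open>\<psi> a = 0\<close> \<open>\<psi> b = 0\<close>)
  have bi: "(\<beta> m1) integrable_on {a..b}" by (rule integrable_continuous_interval[OF \<beta>c])
  have ge: "\<delta> * \<beta> m1 m \<le> (k m - c) * \<eta> m" for m
  proof -
    have 1: "\<delta> * \<beta> m1 m \<le> (k m - c) * \<beta> m1 m"
    proof (cases "\<bar>m - m1\<bar> < e")
      case True
      then have "\<delta> \<le> k m - c" using k1[of m] e(2) by simp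
      then show ?thesis by (rule mult_right_mono) (rule \<beta>0)
    qed (simp add: \<beta>out)
    have "(k m - c) * \<beta> m2 m \<le> 0"
    proof (cases "\<bar>m - m2\<bar> < e")
      case True
      then have "k m - c \<le> 0" using k2[of m] e(3) by simp
      then show ?thesis by (rule mult_nonpos_nonneg) (rule \<beta>0)
    qed (simp add: \<beta>out)
    then show ?thesis using 1 by (simp add: \<eta>_def algebra_simps)
  qed
  have "\<delta> * integral {a..b} (\<beta> m1) \<le> 0"
    by (rule has_integral_le[OF has_integral_mult_right[OF integrable_integral[OF bi]] I]) (rule ge)
  then have "integral {a..b} (\<beta> m1) \<le> 0" using dp by (simp add: mult_le_0_iff)
  moreover have "0 \<le> integral {a..b} (\<beta> m1)" by (rule integral_nonneg[OF bi \<beta>0])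
  ultimately have "((\<beta> m1) has_integral 0) (cbox a b)" using integrable_integral[OF bi] by simp
  from has_integral_0_cbox_imp_0[OF \<beta>c _ this] have "\<beta> m1 m1 = 0" using \<beta>0 m1 by auto
  then show False using \<beta>pos[of m1] by simp
qed

definition profile :: "real \<Rightarrow> real" where "profile \<theta> = u (cos \<theta>, sin \<theta>)"
definition profile' :: "real \<Rightarrow> real" where "profile' \<theta> = cos \<theta> * uy (cos \<theta>, sin \<theta>) - sin \<theta> * ux (cos \<theta>, sin \<theta>)"

lemma profile_deriv: "(profile has_real_derivative profile' \<theta>) (at \<theta>)"
proof -
  have "((\<lambda>\<theta>. (cos \<theta>, sin \<theta>)) has_derivative (\<lambda>k. (- sin \<theta> * k, cos \<theta> * k))) (at \<theta>)" by (auto intro!: derivative_eq_intros)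
  from has_derivative_compose[OF this C1_planeD(1)[OF C1]]
  show ?thesis unfolding has_field_derivative_def profile_def[abs_def] profile'_def
    by (rule has_derivative_eq_rhs) (simp add: fun_eq_iff algebra_simps)
qed

lemma profile'_continuous: "continuous_on A profile'"
  unfolding profile'_def[abs_def]
  by (intro continuous_intros continuous_on_UNIV_compose[OF C1_planeD(2)[OF C1]] continuous_on_UNIV_compose[OF C1_planeD(3)[OF C1]])

lemma profile_periodic: "profile (\<theta> + 2 * pi) = profile \<theta>" by (simp add: profile_def)

lemma speed_on_circle: "sqrt ((2 * profile \<theta>)\<^sup>2 + (profile' \<theta> + 1)\<^sup>2) = speed ux uy (cos \<theta>, sin \<theta>)"
proof -
  let ?c = "cos \<theta>" and ?s = "sin \<theta>"
  define a where "a = ux (?c, ?s) - ?s"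
  define b where "b = uy (?c, ?s) + ?c"
  have cs: "?c\<^sup>2 + ?s\<^sup>2 = 1" by simp
  have 1: "2 * profile \<theta> = ?c * a + ?s * b" using euler[of ?c ?s] by (simp add: profile_def a_def b_def algebra_simps)
  have 2: "profile' \<theta> + 1 = ?c * b - ?s * a" using cs by (simp add: profile'_def a_def b_def power2_eq_square algebra_simps)
  have "(2 * profile \<theta>)\<^sup>2 + (profile' \<theta> + 1)\<^sup>2 = (?c\<^sup>2 + ?s\<^sup>2) * (a\<^sup>2 + b\<^sup>2)" unfolding 1 2 by algebra
  then show ?thesis unfolding cs speed_def a_def b_def by simp
qed

text \<open>
  The component of the horizontal normal in the direction of increasing angle.
\<close>

definition angular :: "real \<Rightarrow> real" where
  "angular \<theta> = (profile' \<theta> + 1) / sqrt ((2 * profile \<theta>)\<^sup>2 + (profile' \<theta> + 1)\<^sup>2)"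
text \<open>
  The component of the horizontal normal in the radial direction.
\<close>

definition radial :: "real \<Rightarrow> real" where
  "radial \<theta> = 2 * profile \<theta> / sqrt ((2 * profile \<theta>)\<^sup>2 + (profile' \<theta> + 1)\<^sup>2)"

lemma components_by_slope:
  assumes c: "0 < cos \<theta>"
  shows "angular \<theta> = cos \<theta> * (n2 (tan \<theta>) - tan \<theta> * n1 (tan \<theta>))" "radial \<theta> = cos \<theta> * n1 (tan \<theta>) + sin \<theta> * n2 (tan \<theta>)"
proof -
  let ?c = "cos \<theta>" and ?s = "sin \<theta>" and ?v = "speed ux uy (cos \<theta>, sin \<theta>)"
  have gen: "k * (p / v) - l * (q / v) = (k * p - l * q) / v" "k * (p / v) + l * (q / v) = (k * p + l * q) / v" for k l p q v :: real
    by (simp_all add: diff_divide_distrib add_divide_distrib)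
  have s: "?c * tan \<theta> = ?s" using c by (simp add: tan_def)
  have d: "n1 (tan \<theta>) = (ux (?c, ?s) - ?s) / ?v" "n2 (tan \<theta>) = (uy (?c, ?s) + ?c) / ?v"
    using direction_on_ray[OF c, of "tan \<theta>"] unfolding s by simp_all
  have "?c * (n2 (tan \<theta>) - tan \<theta> * n1 (tan \<theta>)) = ?c * n2 (tan \<theta>) - (?c * tan \<theta>) * n1 (tan \<theta>)" by (simp add: algebra_simps)
  also have "\<dots> = (?c * (uy (?c, ?s) + ?c) - ?s * (ux (?c, ?s) - ?s)) / ?v" unfolding s d by (rule gen(1))
  also have "?c * (uy (?c, ?s) + ?c) - ?s * (ux (?c, ?s) - ?s) = profile' \<theta> + 1"
    using sin_cos_squared_add[of \<theta>] by (simp add: profile'_def power2_eq_square algebra_simps)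
  finally show "angular \<theta> = ?c * (n2 (tan \<theta>) - tan \<theta> * n1 (tan \<theta>))" unfolding angular_def speed_on_circle by simp
  have "?c * n1 (tan \<theta>) + ?s * n2 (tan \<theta>) = (?c * (ux (?c, ?s) - ?s) + ?s * (uy (?c, ?s) + ?c)) / ?v"
    unfolding d by (rule gen(2))
  also have "?c * (ux (?c, ?s) - ?s) + ?s * (uy (?c, ?s) + ?c) = 2 * profile \<theta>"
    using euler[of ?c ?s] by (simp add: profile_def algebra_simps)
  finally show "radial \<theta> = ?c * n1 (tan \<theta>) + ?s * n2 (tan \<theta>)" unfolding radial_def speed_on_circle by simp
qed

text \<open>
  The angular component is \<open>cos \<theta> (n2 - m n1)\<close> at \<open>m = tan \<theta>\<close>, and by constancy of the flux \<open>n2 - m n1\<close> agrees, except perhaps at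
  the singular slope, with a function that is continuous, and differentiable wherever \<open>n1\<close> is continuous.
\<close>

lemma balance_in_chart:
  assumes s: "stationary ux uy" and c: "0 < cos \<theta>0"
  shows "profile \<theta>0 \<noteq> 0 \<Longrightarrow> (angular has_real_derivative - radial \<theta>0) (at \<theta>0)" "\<exists>l. (angular \<longlongrightarrow> l) (at \<theta>0)"
proof -
  define m0 where "m0 = tan \<theta>0"
  obtain d where d: "d > 0" "\<And>m. m \<noteq> m0 \<Longrightarrow> dist m m0 < d \<Longrightarrow> speed ux uy (1, m) \<noteq> 0"
    using nonsingular_near[of 1 m0] unfolding eventually_at by auto
  define a where "a = m0 - d"
  define b where "b = m0 + d"
  define Z where "Z = (if speed ux uy (1, m0) = 0 then {m0} else {})"
  have Z: "finite Z" "Z \<subseteq> {m0}" by (simp_all add: Z_def)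
  have reg: "speed ux uy (1, m) \<noteq> 0" if "a < m" "m < b" "m \<notin> Z" for m
    using that d(2)[of m] by (cases "m = m0") (auto simp: Z_def a_def b_def dist_real_def split: if_splits)
  have m0: "a < m0" "m0 < b" using d(1) by (simp_all add: a_def b_def)
  define Q where "Q m = integral {a..m} n1" for m
  (* m0 is the only possibly singular slope in (a, b), so the flux may be evaluated at m0 + d/2 *)
  define K where "K = n2 (m0 + d/2) - (m0 + d/2) * n1 (m0 + d/2) + Q (m0 + d/2)"
  have h: "a < m0 + d/2" "m0 + d/2 < b" "m0 + d/2 \<notin> Z" using d(1) Z(2) by (auto simp: a_def b_def)
  have q: "n2 m - m * n1 m = K - Q m" if "a < m" "m < b" "m \<notin> Z" for m
    using flux_constant[OF s Z(1) reg that h] flux_constant[OF s Z(1) reg h that] unfolding K_def Q_def by simp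
  have Qc: "isCont Q m0"
    unfolding Q_def[abs_def]
    by (rule continuous_on_interior[OF indefinite_integral_continuous_1[OF n1_integrable, of a b]]) (use m0 in simp)
  have tc: "isCont tan \<theta>0" using c by (intro isCont_tan) simp
  have ev: "\<forall>\<^sub>F \<theta> in nhds \<theta>0. 0 < cos \<theta> \<and> a < tan \<theta> \<and> tan \<theta> < b \<and> (tan \<theta> = m0 \<longrightarrow> \<theta> = \<theta>0)"
  proof -
    have 1: "\<forall>\<^sub>F \<theta> in nhds \<theta>0. 0 < cos \<theta>"
      by (rule order_tendstoD(1)[OF _ c]) (rule isCont_cos[unfolded isCont_def tendsto_at_iff_tendsto_nhds])
    have t: "(tan \<longlongrightarrow> m0) (nhds \<theta>0)" using tc unfolding isCont_def tendsto_at_iff_tendsto_nhds m0_def .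
    have 4: "\<forall>\<^sub>F \<theta> in nhds \<theta>0. tan \<theta> = m0 \<longrightarrow> \<theta> = \<theta>0"
    proof -
      have "(tan has_real_derivative inverse ((cos \<theta>0)\<^sup>2)) (at \<theta>0)" using c by (intro DERIV_tan) simp
      then have "((\<lambda>\<theta>. (tan \<theta> - tan \<theta>0) / (\<theta> - \<theta>0)) \<longlongrightarrow> inverse ((cos \<theta>0)\<^sup>2)) (at \<theta>0)" by (simp add: has_field_derivative_iff)
      then have "\<forall>\<^sub>F \<theta> in at \<theta>0. (tan \<theta> - tan \<theta>0) / (\<theta> - \<theta>0) \<noteq> 0" by (rule tendsto_imp_eventually_ne) (use c in simp)
      then have "\<forall>\<^sub>F \<theta> in at \<theta>0. tan \<theta> = m0 \<longrightarrow> \<theta> = \<theta>0" by eventually_elim (auto simp: m0_def)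
      then show ?thesis unfolding eventually_at_filter by (auto elim: eventually_mono)
    qed
    show ?thesis using 1 order_tendstoD(1)[OF t m0(1)] order_tendstoD(2)[OF t m0(2)] 4 by eventually_elim blast
  qed
  have QD: "(Q has_real_derivative n1 m0) (at m0)" if "speed ux uy (1, m0) \<noteq> 0"
  proof -
    have "(Q has_vector_derivative n1 m0) (at m0 within ({a..b} - {}))" unfolding Q_def[abs_def]
      by (rule integral_has_vector_derivative_continuous_at[OF n1_integrable])
         (use m0 n_continuous(1)[OF that] in \<open>auto intro: continuous_at_imp_continuous_at_within\<close>)
    then show ?thesis using m0 at_within_Icc_at[of a m0 b] by (simp add: has_real_derivative_iff_has_vector_derivative)
  qed
  show "(angular has_real_derivative - radial \<theta>0) (at \<theta>0)" if p: "profile \<theta>0 \<noteq> 0"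
  proof -
    have nz: "speed ux uy (1, m0) \<noteq> 0"
    proof
      assume "speed ux uy (1, m0) = 0"
      then have "speed ux uy (cos \<theta>0 * 1, cos \<theta>0 * m0) = 0" unfolding speed_homog[OF c] by simp
      moreover have "cos \<theta>0 * m0 = sin \<theta>0" using c by (simp add: m0_def tan_def)
      ultimately show False using speed_zero_imp[of "cos \<theta>0" "sin \<theta>0"] p by (simp add: profile_def)
    qed
    then have Ze: "Z = {}" by (simp add: Z_def)
    have D: "((\<lambda>\<theta>. cos \<theta> * (K - Q (tan \<theta>))) has_real_derivative
        - sin \<theta>0 * (K - Q m0) + cos \<theta>0 * - (n1 m0 * inverse ((cos \<theta>0)\<^sup>2))) (at \<theta>0)"
    proof -
      have "cos \<theta>0 \<noteq> 0" using c by simp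
      from DERIV_mult[OF DERIV_cos DERIV_diff[OF DERIV_const DERIV_chain2[OF QD[OF nz, unfolded m0_def] DERIV_tan[OF this]]], of K]
      show ?thesis unfolding m0_def[symmetric] by (rule DERIV_cong) simp
    qed
    have "- sin \<theta>0 * (K - Q m0) + cos \<theta>0 * - (n1 m0 * inverse ((cos \<theta>0)\<^sup>2)) = - radial \<theta>0"
    proof -
      have t: "m0 = sin \<theta>0 / cos \<theta>0" by (simp add: m0_def tan_def)
      have "K - Q m0 = n2 m0 - m0 * n1 m0" using q[OF m0] Ze by simp
      moreover have "- sin \<theta>0 * (n2 m0 - m0 * n1 m0) + cos \<theta>0 * - (n1 m0 * inverse ((cos \<theta>0)\<^sup>2))
         = - sin \<theta>0 * n2 m0 + n1 m0 * ((sin \<theta>0)\<^sup>2 - 1) / cos \<theta>0"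
        using c by (subst (2) t) (simp add: field_simps power2_eq_square)
      moreover have "(sin \<theta>0)\<^sup>2 - 1 = - (cos \<theta>0)\<^sup>2" using sin_cos_squared_add[of \<theta>0] by linarith
      ultimately show ?thesis using c components_by_slope(2)[OF c] by (simp add: m0_def[symmetric] power2_eq_square)
    qed
    with D have "((\<lambda>\<theta>. cos \<theta> * (K - Q (tan \<theta>))) has_real_derivative - radial \<theta>0) (at \<theta>0)" by simp
    moreover have "\<forall>\<^sub>F \<theta> in nhds \<theta>0. angular \<theta> = cos \<theta> * (K - Q (tan \<theta>))"
      using ev by eventually_elim (use components_by_slope(1) q Ze in simp)
    ultimately show ?thesis by (subst DERIV_cong_ev[OF refl _ refl])
  qed
  have "((\<lambda>\<theta>. cos \<theta> * (K - Q (tan \<theta>))) \<longlongrightarrow> cos \<theta>0 * (K - Q m0)) (at \<theta>0)"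
  proof -
    have "isCont (\<lambda>\<theta>. Q (tan \<theta>)) \<theta>0" using isCont_o2[OF tc] Qc by (simp add: m0_def)
    then have "isCont (\<lambda>\<theta>. cos \<theta> * (K - Q (tan \<theta>))) \<theta>0" by (intro continuous_intros)
    then show ?thesis by (simp add: isCont_def m0_def)
  qed
  moreover have "\<forall>\<^sub>F \<theta> in at \<theta>0. cos \<theta> * (K - Q (tan \<theta>)) = angular \<theta>"
    unfolding eventually_at_filter using ev
  proof eventually_elim
    fix \<theta> assume a: "0 < cos \<theta> \<and> a < tan \<theta> \<and> tan \<theta> < b \<and> (tan \<theta> = m0 \<longrightarrow> \<theta> = \<theta>0)"
    show "\<theta> \<noteq> \<theta>0 \<longrightarrow> \<theta> \<in> UNIV \<longrightarrow> cos \<theta> * (K - Q (tan \<theta>)) = angular \<theta>"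
    proof (intro impI)
      assume "\<theta> \<noteq> \<theta>0"
      then have "tan \<theta> \<notin> Z" using a Z(2) by blast
      then show "cos \<theta> * (K - Q (tan \<theta>)) = angular \<theta>" using a q[of "tan \<theta>"] components_by_slope(1)[of \<theta>] by simp
    qed
  qed
  ultimately have "(angular \<longlongrightarrow> cos \<theta>0 * (K - Q m0)) (at \<theta>0)" by (rule Lim_transform_eventually)
  then show "\<exists>l. (angular \<longlongrightarrow> l) (at \<theta>0)" by blast
qed

end

section \<open>The ordinary differential equation\<close>

text \<open>
  The function \<open>h\<close> describes the surface \<open>t = r\<^sup>2 h \<theta>\<close>. The quotient is the angular component of the horizontal normal, and its
  derivative in \<open>balance\<close> is minus the radial component. The condition \<open>flux\<close> is what remains of the weak equation in a singular direction.
\<close>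

locale cone_profile =
  fixes h h' :: "real \<Rightarrow> real"
  assumes deriv: "(h has_real_derivative h' \<theta>) (at \<theta>)"
    and cont: "continuous_on UNIV h'"
    and per: "h (\<theta> + 2 * pi) = h \<theta>"
    and balance: "h \<theta> \<noteq> 0 \<Longrightarrow>
      ((\<lambda>\<theta>. (h' \<theta> + 1) / sqrt ((2 * h \<theta>)\<^sup>2 + (h' \<theta> + 1)\<^sup>2)) has_real_derivative
        - (2 * h \<theta> / sqrt ((2 * h \<theta>)\<^sup>2 + (h' \<theta> + 1)\<^sup>2))) (at \<theta>)"
    and flux: "h \<theta> = 0 \<Longrightarrow> h' \<theta> = -1 \<Longrightarrow>
      \<exists>l. ((\<lambda>\<theta>. (h' \<theta> + 1) / sqrt ((2 * h \<theta>)\<^sup>2 + (h' \<theta> + 1)\<^sup>2)) \<longlongrightarrow> l) (at \<theta>)"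
begin

definition modulus :: "real \<Rightarrow> real" where
  "modulus \<theta> = sqrt ((2 * h \<theta>)\<^sup>2 + (h' \<theta> + 1)\<^sup>2)"

definition rad :: "real \<Rightarrow> real" where
  "rad \<theta> = 2 * h \<theta> / modulus \<theta>"

definition ang :: "real \<Rightarrow> real" where
  "ang \<theta> = (h' \<theta> + 1) / modulus \<theta>"

lemma ang_deriv: "h \<theta> \<noteq> 0 \<Longrightarrow> (ang has_real_derivative - rad \<theta>) (at \<theta>)"
  using balance[of \<theta>] unfolding ang_def[abs_def] rad_def[abs_def] modulus_def by blast

lemma ang_limit: "h \<theta> = 0 \<Longrightarrow> h' \<theta> = -1 \<Longrightarrow> \<exists>l. (ang \<longlongrightarrow> l) (at \<theta>)"
  using flux[of \<theta>] unfolding ang_def[abs_def] modulus_def by blast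

lemma modulus_pos: "h \<theta> \<noteq> 0 \<Longrightarrow> 0 < modulus \<theta>"
  unfolding modulus_def by (simp add: add_pos_nonneg)

lemma rad_ang_unit: "h \<theta> \<noteq> 0 \<Longrightarrow> (rad \<theta>)\<^sup>2 + (ang \<theta>)\<^sup>2 = 1"
proof -
  assume "h \<theta> \<noteq> 0"
  then have p: "0 < (2 * h \<theta>)\<^sup>2 + (h' \<theta> + 1)\<^sup>2" by (simp add: add_pos_nonneg)
  show ?thesis unfolding rad_def ang_def modulus_def
    using p by (simp add: power_divide flip: add_divide_distrib)
qed

lemma h_cont: "continuous_on A h"
  by (meson DERIV_isCont continuous_at_imp_continuous_on deriv)

lemma rad_eq_sqrt: assumes "0 < h \<theta>" shows "rad \<theta> = sqrt (1 - (ang \<theta>)\<^sup>2)"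
proof -
  have "rad \<theta> > 0" using assms modulus_pos[of \<theta>] by (simp add: rad_def)
  moreover have "1 - (ang \<theta>)\<^sup>2 = (rad \<theta>)\<^sup>2" using rad_ang_unit[of \<theta>] assms by simp
  ultimately show ?thesis by simp
qed

text \<open>
  The pair \<open>(rad, ang)\<close> moves on the unit circle with \<open>ang' = - rad\<close>, hence \<open>rad' = ang\<close> as long as
  \<open>rad > 0\<close>. So it rotates with unit speed: the horizontal normal is a constant vector, seen in the rotating polar frame.
\<close>

lemma direction_constant:
  assumes I: "convex I" "\<tau> \<in> I" and pos: "\<And>x. x \<in> I \<Longrightarrow> 0 < h x"
  obtains c where "0 < \<tau> - c" "\<tau> - c < pi"
    "\<And>x. x \<in> I \<Longrightarrow> rad x = sin (x - c)" "\<And>x. x \<in> I \<Longrightarrow> ang x = cos (x - c)"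
proof -
  (* the two expressions that are constant below are the coordinates of (rad, ang) in a frame rotating with the angle *)
  define c where "c = \<tau> - arccos (ang \<tau>)"
  define r where "r x = sqrt (1 - (ang x)\<^sup>2)" for x
  have r_rad: "r x = rad x" if "x \<in> I" for x using rad_eq_sqrt[OF pos[OF that]] r_def by simp
  have radpos: "0 < rad x" if "x \<in> I" for x
    using pos[OF that] modulus_pos[of x] by (simp add: rad_def)
  have unit: "(rad x)\<^sup>2 + (ang x)\<^sup>2 = 1" if "x \<in> I" for x using rad_ang_unit pos[OF that] by force
  have small: "\<bar>ang x\<bar> < 1" if "x \<in> I" for x
  proof -
    have "(ang x)\<^sup>2 < 1" using unit[OF that] radpos[OF that] by (smt (verit) zero_less_power)
    then show ?thesis by (simp add: abs_square_less_1)
  qed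
  have angD: "(ang has_real_derivative - rad x) (at x within I)" if "x \<in> I" for x
    using ang_deriv[of x] pos[OF that] by (simp add: has_field_derivative_at_within)
  have rD: "(r has_real_derivative ang x) (at x within I)" if "x \<in> I" for x
  proof -
    have p: "0 < 1 - (ang x)\<^sup>2" using unit[OF that] radpos[OF that] by (smt (verit) zero_less_power)
    have e: "sqrt (1 - (ang x)\<^sup>2) = rad x" using r_rad[OF that] r_def by simp
    have "(r has_real_derivative (- (2 * ang x * (- rad x))) * (inverse (sqrt (1 - (ang x)\<^sup>2)) / 2)) (at x within I)"
      unfolding r_def[abs_def]
      by (rule derivative_eq_intros angD[OF that] refl | use p in simp)+
    then show ?thesis using e radpos[OF that] by (simp add: field_simps)
  qed
  have "\<exists>k. \<forall>x\<in>I. r x * cos (x - c) - ang x * sin (x - c) = k"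
  proof (rule has_field_derivative_zero_constant[OF I(1)])
    fix x assume x: "x \<in> I"
    show "((\<lambda>x. r x * cos (x - c) - ang x * sin (x - c)) has_real_derivative 0) (at x within I)"
      by (rule derivative_eq_intros rD[OF x] angD[OF x] refl)+ (simp add: r_rad[OF x])
  qed
  then obtain k1 where k1: "\<And>x. x \<in> I \<Longrightarrow> r x * cos (x - c) - ang x * sin (x - c) = k1" by blast
  have "\<exists>k. \<forall>x\<in>I. r x * sin (x - c) + ang x * cos (x - c) = k"
  proof (rule has_field_derivative_zero_constant[OF I(1)])
    fix x assume x: "x \<in> I"
    show "((\<lambda>x. r x * sin (x - c) + ang x * cos (x - c)) has_real_derivative 0) (at x within I)"
      by (rule derivative_eq_intros rD[OF x] angD[OF x] refl)+ (simp add: r_rad[OF x])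
  qed
  then obtain k2 where k2: "\<And>x. x \<in> I \<Longrightarrow> r x * sin (x - c) + ang x * cos (x - c) = k2" by blast
  have s: "\<bar>ang \<tau>\<bar> < 1" by (rule small[OF I(2)])
  have tc: "\<tau> - c = arccos (ang \<tau>)" by (simp add: c_def)
  have cs: "cos (\<tau> - c) = ang \<tau>" "sin (\<tau> - c) = r \<tau>" unfolding tc r_def using s by (auto simp: sin_arccos abs_less_iff abs_le_iff)
  have "k1 = 0" using k1[OF I(2)] cs by simp
  moreover have "k2 = 1" using k2[OF I(2)] cs unit[OF I(2)] r_rad[OF I(2)] by (simp add: power2_eq_square)
  ultimately have eqs: "r x * cos (x - c) = ang x * sin (x - c)" "r x * sin (x - c) + ang x * cos (x - c) = 1" if "x \<in> I" for x
    using k1[OF that] k2[OF that] by auto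
  have fin: "r x = sin (x - c) \<and> ang x = cos (x - c)" if "x \<in> I" for x
  proof -
    let ?s = "sin (x - c)" and ?c = "cos (x - c)"
    have u: "?s\<^sup>2 + ?c\<^sup>2 = 1" by simp
    have "r x = r x * (?s\<^sup>2 + ?c\<^sup>2)" using u by simp
    also have "\<dots> = ?s * (r x * ?s) + ?c * (r x * ?c)" unfolding power2_eq_square by argo
    also have "\<dots> = ?s * (r x * ?s + ang x * ?c)" using eqs(1)[OF that] by (simp add: algebra_simps)
    finally have 1: "r x = ?s" using eqs(2)[OF that] by simp
    have "ang x = ang x * (?s\<^sup>2 + ?c\<^sup>2)" using u by simp
    also have "\<dots> = ?s * (ang x * ?s) + ?c * (ang x * ?c)" unfolding power2_eq_square by argo
    also have "\<dots> = ?c * (r x * ?s + ang x * ?c)" using eqs(1)[OF that, symmetric] by (simp add: algebra_simps)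
    finally have "ang x = ?c" using eqs(2)[OF that] by simp
    with 1 show ?thesis by blast
  qed
  have "0 < \<tau> - c \<and> \<tau> - c < pi"
    unfolding tc using s arccos_lt_bounded[of "ang \<tau>"] by (auto simp: abs_less_iff)
  then show thesis using that[of c] fin r_rad by metis
qed

text \<open>
  Where \<open>h > 0\<close> the function \<open>rad = sin (\<theta> - c)\<close> is positive, which fails within any interval of length \<open>\<pi>\<close>.
\<close>

lemma zero_within_pi_right: assumes "0 < h \<tau>" shows "\<exists>x\<in>{\<tau>..\<tau>+pi}. h x = 0"
proof (rule ccontr)
  assume "\<not> ?thesis"
  then have nz: "h x \<noteq> 0" if "x \<in> {\<tau>..\<tau>+pi}" for x using that by auto
  have pos: "0 < h x" if "x \<in> {\<tau>..\<tau>+pi}" for x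
  proof (rule ccontr)
    assume "\<not> 0 < h x"
    then have "\<exists>z\<ge>\<tau>. z \<le> x \<and> h z = 0"
      using IVT2'[of h x 0 \<tau>] assms that h_cont by auto
    then show False using nz that by force
  qed
  obtain c where c: "0 < \<tau> - c" "\<tau> - c < pi" "\<And>x. x \<in> {\<tau>..\<tau>+pi} \<Longrightarrow> rad x = sin (x - c)"
    by (rule direction_constant[of "{\<tau>..\<tau>+pi}" \<tau>]) (use pos in auto)
  have m: "c + pi \<in> {\<tau>..\<tau>+pi}" using c by auto
  then have "rad (c + pi) = 0" using c(3)[OF m] by simp
  moreover have "rad (c + pi) > 0" using pos[OF m] modulus_pos[of "c+pi"] by (simp add: rad_def)
  ultimately show False by simp
qed

lemma zero_within_pi_left: assumes "0 < h \<tau>" shows "\<exists>x\<in>{\<tau>-pi..\<tau>}. h x = 0"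
proof (rule ccontr)
  assume "\<not> ?thesis"
  then have nz: "h x \<noteq> 0" if "x \<in> {\<tau>-pi..\<tau>}" for x using that by auto
  have pos: "0 < h x" if "x \<in> {\<tau>-pi..\<tau>}" for x
  proof (rule ccontr)
    assume "\<not> 0 < h x"
    then have "\<exists>z\<ge>x. z \<le> \<tau> \<and> h z = 0"
      using IVT'[of h x 0 \<tau>] assms that h_cont by auto
    then show False using nz that by force
  qed
  obtain c where c: "0 < \<tau> - c" "\<tau> - c < pi" "\<And>x. x \<in> {\<tau>-pi..\<tau>} \<Longrightarrow> rad x = sin (x - c)"
    by (rule direction_constant[of "{\<tau>-pi..\<tau>}" \<tau>]) (use pos in auto)
  have m: "c \<in> {\<tau>-pi..\<tau>}" using c by auto
  then have "rad c = 0" using c(3)[OF m] by simp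
  moreover have "rad c > 0" using pos[OF m] modulus_pos[of "c"] by (simp add: rad_def)
  ultimately show False by simp
qed

lemma positive_interval:
  assumes "0 < h \<tau>"
  obtains l m where "l < \<tau>" "\<tau> < m" "h l = 0" "h m = 0" "\<And>x. x \<in> {l<..<m} \<Longrightarrow> 0 < h x"
proof -
  have cl: "closed {x. h x = 0}"
    using closed_vimage[of "{0}" h] h_cont[of UNIV] by (simp add: vimage_def)
  have "compact ({\<tau>..\<tau>+pi} \<inter> {x. h x = 0})" by (intro compact_Int_closed compact_Icc cl)
  moreover have "{\<tau>..\<tau>+pi} \<inter> {x. h x = 0} \<noteq> {}" using zero_within_pi_right[OF assms] by auto
  ultimately obtain m where "m \<in> {\<tau>..\<tau>+pi} \<inter> {x. h x = 0}" "\<forall>x\<in>{\<tau>..\<tau>+pi} \<inter> {x. h x = 0}. m \<le> x"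
    using compact_attains_inf by blast
  then have m: "m \<in> {\<tau>..\<tau>+pi}" "h m = 0" "\<And>x. x \<in> {\<tau>..\<tau>+pi} \<Longrightarrow> h x = 0 \<Longrightarrow> m \<le> x" by auto
  have "compact ({\<tau>-pi..\<tau>} \<inter> {x. h x = 0})" by (intro compact_Int_closed compact_Icc cl)
  moreover have "{\<tau>-pi..\<tau>} \<inter> {x. h x = 0} \<noteq> {}" using zero_within_pi_left[OF assms] by auto
  ultimately obtain l where "l \<in> {\<tau>-pi..\<tau>} \<inter> {x. h x = 0}" "\<forall>x\<in>{\<tau>-pi..\<tau>} \<inter> {x. h x = 0}. x \<le> l"
    using compact_attains_sup by blast
  then have l: "l \<in> {\<tau>-pi..\<tau>}" "h l = 0" "\<And>x. x \<in> {\<tau>-pi..\<tau>} \<Longrightarrow> h x = 0 \<Longrightarrow> x \<le> l" by auto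
  have "\<tau> \<noteq> m" "\<tau> \<noteq> l" using l m assms by auto
  then have lm: "l < \<tau>" "\<tau> < m" using l m by auto
  have "0 < h x" if x: "x \<in> {l<..<m}" for x
  proof (rule ccontr)
    assume n: "\<not> 0 < h x"
    show False
    proof (cases "x \<le> \<tau>")
      case True
      then obtain z where "z \<ge> x" "z \<le> \<tau>" "h z = 0"
        using IVT'[of h x 0 \<tau>] assms n h_cont by auto
      then show False using l(3)[of z] x l(1) by auto
    next
      case False
      then obtain z where "z \<ge> \<tau>" "z \<le> x" "h z = 0"
        using IVT2'[of h x 0 \<tau>] assms n h_cont by auto
      then show False using m(3)[of z] x m(1) by auto
    qed
  qed
  then show thesis using that lm l m by blast
qed

text \<open>
  On a maximal interval with \<open>h > 0\<close>, \<open>2 h cos (x - c) = (h' + 1) sin (x - c)\<close>, which means that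
  \<open>h / sin\<^sup>2 (x - c) - cot (x - c)\<close> is a constant \<open>K\<close>. With \<open>K = - cot \<alpha>\<close> this is the asserted formula, whose
  zeros \<open>c\<close> and \<open>c + \<alpha>\<close> must be the ends of the interval.
\<close>

lemma positive_arc:
  assumes "0 < h \<tau>"
  obtains c \<alpha> where "0 < \<alpha>" "\<alpha> < pi" "c < \<tau>" "\<tau> < c + \<alpha>"
    "\<And>x. x \<in> {c..c+\<alpha>} \<Longrightarrow> h x = sin (x - c) * sin (c + \<alpha> - x) / sin \<alpha>"
    "h' c = 1" "h' (c + \<alpha>) = -1" "\<And>x. x \<in> {c<..<c+\<alpha>} \<Longrightarrow> ang x = cos (x - c)"
proof -
  obtain l m where lm: "l < \<tau>" "\<tau> < m" "h l = 0" "h m = 0" and pos: "\<And>x. x \<in> {l<..<m} \<Longrightarrow> 0 < h x"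
    using positive_interval[OF assms] by blast
  obtain c where c: "0 < \<tau> - c" "\<tau> - c < pi" and rc: "\<And>x. x \<in> {l<..<m} \<Longrightarrow> rad x = sin (x - c)"
    and ac: "\<And>x. x \<in> {l<..<m} \<Longrightarrow> ang x = cos (x - c)"
    by (rule direction_constant[of "{l<..<m}" \<tau>]) (use pos lm in auto)
  have sinpos: "0 < sin (x - c)" if "x \<in> {l<..<m}" for x
    using pos[OF that] modulus_pos[of x] rc[OF that, symmetric] by (simp add: rad_def)
  have bnd: "0 < x - c \<and> x - c < pi" if x: "x \<in> {l<..<m}" for x
  proof (rule ccontr)
    assume n: "\<not> ?thesis"
    then have "c \<in> {l<..<m} \<or> c + pi \<in> {l<..<m}" using x c lm by auto
    then show False using sinpos[of c] sinpos[of "c + pi"] by auto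
  qed
  have ode: "2 * h x * cos (x - c) = (h' x + 1) * sin (x - c)" if x: "x \<in> {l<..<m}" for x
  proof -
    have "2 * h x = modulus x * sin (x - c)" "h' x + 1 = modulus x * cos (x - c)"
      using rc[OF x] ac[OF x] modulus_pos[of x] pos[OF x] by (auto simp: rad_def ang_def field_simps)
    then show ?thesis by simp
  qed
  have "\<exists>k. \<forall>x\<in>{l<..<m}. h x / (sin (x - c))\<^sup>2 - cos (x - c) / sin (x - c) = k"
  proof (rule has_field_derivative_zero_constant)
    fix x assume x: "x \<in> {l<..<m}"
    let ?s = "sin (x - c)" and ?c = "cos (x - c)"
    have s: "?s \<noteq> 0" using sinpos[OF x] by simp
    have hD: "(h has_real_derivative h' x) (at x within {l<..<m})" by (rule has_field_derivative_at_within[OF deriv])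
    have e: "(h' x * ?s\<^sup>2 - h x * (2 * ?s * ?c)) / (?s\<^sup>2 * ?s\<^sup>2) - ((- ?s) * ?s - ?c * ?c) / (?s * ?s) = 0"
    proof -
      have "?s * ?s + ?c * ?c = 1" using sin_cos_squared_add[of "x - c"] unfolding power2_eq_square .
      then have "(- ?s) * ?s - ?c * ?c = - 1" by simp
      then have *: "((- ?s) * ?s - ?c * ?c) / (?s * ?s) = - 1 / ?s\<^sup>2" by (simp only: power2_eq_square)
      have **: "(h' x * ?s\<^sup>2 - h x * (2 * ?s * ?c)) / (?s\<^sup>2 * ?s\<^sup>2) = (h' x * ?s - 2 * h x * ?c) / ?s ^ 3"
        using s by (simp add: field_simps power2_eq_square power3_eq_cube)
      have ***: "h' x * ?s - 2 * h x * ?c = - ?s" using ode[OF x] by (simp add: algebra_simps)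
      have ****: "- ?s / ?s ^ 3 = - 1 / ?s\<^sup>2" using s by (simp add: field_simps power2_eq_square power3_eq_cube)
      show ?thesis unfolding * ** *** **** by simp
    qed
    have "((\<lambda>x. h x / (sin (x - c))\<^sup>2 - cos (x - c) / sin (x - c)) has_real_derivative
      (h' x * ?s\<^sup>2 - h x * (2 * ?s * ?c)) / (?s\<^sup>2 * ?s\<^sup>2) - ((- ?s) * ?s - ?c * ?c) / (?s * ?s)) (at x within {l<..<m})"
      by (rule derivative_eq_intros hD refl | use s in simp)+
    then show "((\<lambda>x. h x / (sin (x - c))\<^sup>2 - cos (x - c) / sin (x - c)) has_real_derivative 0) (at x within {l<..<m})"
      using e by simp
  qed simp
  then obtain K where K: "\<And>x. x \<in> {l<..<m} \<Longrightarrow> h x / (sin (x - c))\<^sup>2 - cos (x - c) / sin (x - c) = K" by blast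
  (* the angle in (0, pi) with cot alpha = - K *)
  define \<alpha> where "\<alpha> = pi / 2 + arctan K"
  have al: "0 < \<alpha>" "\<alpha> < pi" using arctan_bounded[of K] by (auto simp: \<alpha>_def)
  have sa: "0 < sin \<alpha>" using al by (simp add: sin_gt_zero)
  have Ka: "K * sin \<alpha> = - cos \<alpha>"
  proof -
    have 1: "sin \<alpha> = cos (arctan K)" by (simp add: \<alpha>_def sin_add)
    have 2: "cos \<alpha> = - sin (arctan K)" by (simp add: \<alpha>_def cos_add)
    have "tan (arctan K) = K" by (rule tan_arctan)
    then show ?thesis using 1 2 sa by (simp add: tan_def field_simps)
  qed
  define g where "g x = sin (x - c) * sin (c + \<alpha> - x) / sin \<alpha>" for x
  have hg: "h x = g x" if x: "x \<in> {l<..<m}" for x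
  proof -
    let ?s = "sin (x - c)" and ?c = "cos (x - c)"
    have s: "?s \<noteq> 0" using sinpos[OF x] by simp
    have "h x = (K + ?c / ?s) * ?s\<^sup>2" using K[OF x] s by (simp add: field_simps)
    also have "\<dots> = K * ?s\<^sup>2 + ?c * ?s" using s by (simp add: field_simps power2_eq_square)
    finally have "h x * sin \<alpha> = ?s * (sin \<alpha> * ?c + ?s * (K * sin \<alpha>))"
      by (simp add: algebra_simps power2_eq_square)
    also have "\<dots> = ?s * sin (\<alpha> - (x - c))" unfolding Ka sin_diff[of \<alpha> "x - c"] by (simp add: algebra_simps)
    finally show ?thesis using sa by (simp add: g_def field_simps)
  qed
  have hgc: "h x = g x" if x: "x \<in> {l..m}" for x
  proof -
    have "continuous_on (closure {l<..<m}) (\<lambda>x. h x - g x)"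
      unfolding g_def using sa by (intro continuous_intros h_cont) auto
    moreover have "x \<in> closure {l<..<m}" using x lm by simp
    ultimately have "h x - g x = 0" using continuous_constant_on_closure[of "{l<..<m}" "\<lambda>x. h x - g x" 0 x] hg by auto
    then show ?thesis by simp
  qed
  have below: "x - c < \<alpha>" if x: "x \<in> {l<..<m}" for x
  proof (rule ccontr)
    assume "\<not> ?thesis"
    then have "0 \<le> (x - c) - \<alpha>" "(x - c) - \<alpha> < pi" using bnd[OF x] al by auto
    then have "0 \<le> sin ((x - c) - \<alpha>)" by (simp add: sin_ge_zero)
    moreover have "sin (c + \<alpha> - x) = - sin ((x - c) - \<alpha>)" by (simp add: algebra_simps flip: sin_minus)
    ultimately have "g x \<le> 0" using sinpos[OF x] sa unfolding g_def
      by (auto simp: divide_le_0_iff mult_le_0_iff)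
    then show False using pos[OF x] hg[OF x] by simp
  qed
  have lim1: "c \<le> l"
  proof (rule ccontr)
    assume "\<not> c \<le> l" then have "c \<in> {l<..<m}" using c lm by auto
    then show False using bnd[of c] by simp
  qed
  have lim2: "m \<le> c + \<alpha>"
  proof (rule ccontr)
    assume "\<not> m \<le> c + \<alpha>"
    then have "c + \<alpha> \<in> {l<..<m}" using below[of \<tau>] lm by auto
    then show False using below[of "c + \<alpha>"] by simp
  qed
  have l: "l = c"
  proof (rule ccontr)
    assume "l \<noteq> c"
    then have "0 < l - c" "l - c < pi" "0 < c + \<alpha> - l" "c + \<alpha> - l < pi" using lim1 c lm below[of \<tau>] al by auto
    then have "0 < g l" unfolding g_def using sa sin_gt_zero by simp
    then show False using hgc[of l] lm by auto
  qed
  have m: "m = c + \<alpha>"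
  proof (rule ccontr)
    assume "m \<noteq> c + \<alpha>"
    then have "0 < m - c" "m - c < pi" "0 < c + \<alpha> - m" "c + \<alpha> - m < pi" using lim2 c lm al by auto
    then have "0 < g m" unfolding g_def using sa sin_gt_zero by simp
    then show False using hgc[of m] lm by auto
  qed
  define g' where "g' x = (cos (x - c) * sin (c + \<alpha> - x) - sin (x - c) * cos (c + \<alpha> - x)) / sin \<alpha>" for x
  have gD: "(g has_real_derivative g' x) (at x)" for x
    unfolding g_def[abs_def] g'_def using sa by (auto intro!: derivative_eq_intros simp: field_simps)
  have h'g': "h' x = g' x" if x: "x \<in> {l<..<m}" for x
  proof -
    have "(h has_real_derivative g' x) (at x)"
      by (rule has_field_derivative_transform_within_open[OF gD, of "{l<..<m}"]) (use x hg in auto)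
    then show ?thesis using deriv DERIV_unique by blast
  qed
  have h'gc: "h' x = g' x" if x: "x \<in> {l..m}" for x
  proof -
    have "continuous_on (closure {l<..<m}) h'" using cont continuous_on_subset by blast
    then have "continuous_on (closure {l<..<m}) (\<lambda>x. h' x - g' x)"
      unfolding g'_def using sa by (intro continuous_intros) auto
    moreover have "x \<in> closure {l<..<m}" using x lm by simp
    ultimately have "h' x - g' x = 0" using continuous_constant_on_closure[of "{l<..<m}" "\<lambda>x. h' x - g' x" 0 x] h'g' by auto
    then show ?thesis by simp
  qed
  have "h' c = 1" using h'gc[of l] lm sa unfolding l g'_def by simp
  moreover have "h' (c + \<alpha>) = -1" using h'gc[of m] lm sa unfolding m g'_def by simp
  ultimately show thesis
    using that[of \<alpha> c] al lm hgc ac unfolding l m g_def by auto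
qed

text \<open>
  The map \<open>(x, y, t) \<mapsto> (x, - y, - t)\<close> is an automorphism of the Heisenberg group and a Euclidean isometry. It acts on profiles in this way.
\<close>

lemma reflected: "cone_profile (\<lambda>\<theta>. - h (- \<theta>)) (\<lambda>\<theta>. h' (- \<theta>))"
proof
  fix \<theta> :: real
  show "((\<lambda>\<theta>. - h (- \<theta>)) has_real_derivative h' (- \<theta>)) (at \<theta>)"
    using DERIV_mirror[THEN iffD1, OF deriv[of "-\<theta>"]] by (auto intro!: derivative_eq_intros)
  show "continuous_on UNIV (\<lambda>\<theta>. h' (- \<theta>))"
    using continuous_on_compose2[OF cont, of UNIV uminus] by (simp add: continuous_on_minus)
  show "- h (- (\<theta> + 2 * pi)) = - h (- \<theta>)" using per[of "- \<theta> - 2 * pi"] by simp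
  have sp: "sqrt ((2 * - h (- \<theta>))\<^sup>2 + (h' (- \<theta>) + 1)\<^sup>2) = modulus (- \<theta>)" for \<theta> by (simp add: modulus_def)
  have an: "(h' (- \<theta>) + 1) / modulus (- \<theta>) = ang (- \<theta>)" for \<theta> by (simp add: ang_def)
  have ra: "- (2 * - h (- \<theta>) / modulus (- \<theta>)) = rad (- \<theta>)" by (simp add: rad_def)
  show "((\<lambda>\<theta>. (h' (- \<theta>) + 1) / sqrt ((2 * - h (- \<theta>))\<^sup>2 + (h' (- \<theta>) + 1)\<^sup>2)) has_real_derivative
    - (2 * - h (- \<theta>) / sqrt ((2 * - h (- \<theta>))\<^sup>2 + (h' (- \<theta>) + 1)\<^sup>2))) (at \<theta>)" if "- h (- \<theta>) \<noteq> 0"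
    unfolding sp an ra using that DERIV_mirror[THEN iffD1, OF ang_deriv[of "-\<theta>"]] by simp
  show "\<exists>l. ((\<lambda>\<theta>. (h' (- \<theta>) + 1) / sqrt ((2 * - h (- \<theta>))\<^sup>2 + (h' (- \<theta>) + 1)\<^sup>2)) \<longlongrightarrow> l) (at \<theta>)"
    if z: "- h (- \<theta>) = 0" "h' (- \<theta>) = -1"
  proof -
    obtain l where l: "(ang \<longlongrightarrow> l) (at (- \<theta>))" using ang_limit[of "-\<theta>"] z by auto
    have "((\<lambda>\<theta>. ang (- \<theta>)) \<longlongrightarrow> l) (at \<theta>)"
      by (rule LIM_compose2[of uminus "- \<theta>" \<theta> ang l]) (use l in \<open>auto intro!: tendsto_intros exI[of _ 1]\<close>)
    then show ?thesis unfolding sp an by blast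
  qed
qed

lemma negative_arc:
  assumes "h \<tau> < 0"
  obtains s \<alpha> where "0 < \<alpha>" "\<alpha> < pi" "s < \<tau>" "\<tau> < s + \<alpha>"
    "\<And>x. x \<in> {s..s+\<alpha>} \<Longrightarrow> h x = - (sin (x - s) * sin (s + \<alpha> - x) / sin \<alpha>)"
    "h' s = -1" "h' (s + \<alpha>) = 1" "\<And>x. x \<in> {s<..<s+\<alpha>} \<Longrightarrow> ang x = cos (s + \<alpha> - x)"
proof -
  interpret R: cone_profile "\<lambda>\<theta>. - h (- \<theta>)" "\<lambda>\<theta>. h' (- \<theta>)" by (rule reflected)
  have Rang: "R.ang \<theta> = ang (- \<theta>)" for \<theta> by (simp add: ang_def R.ang_def modulus_def R.modulus_def)
  obtain c \<alpha> where a: "0 < \<alpha>" "\<alpha> < pi" "c < - \<tau>" "- \<tau> < c + \<alpha>"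
    and f: "\<And>x. x \<in> {c..c+\<alpha>} \<Longrightarrow> - h (- x) = sin (x - c) * sin (c + \<alpha> - x) / sin \<alpha>"
    and d: "h' (- c) = 1" "h' (- (c + \<alpha>)) = -1" and g: "\<And>x. x \<in> {c<..<c+\<alpha>} \<Longrightarrow> R.ang x = cos (x - c)"
  proof -
    have p: "0 < - h (- (- \<tau>))" using assms by simp
    show thesis by (rule R.positive_arc[OF p]) (rule that; assumption)
  qed
  have e: "- x - c = - (c + \<alpha>) + \<alpha> - x" "c + \<alpha> - - x = x - - (c + \<alpha>)" "- x - c = - (c + \<alpha>) + \<alpha> - x" for x by auto
  show thesis
  proof (rule that[of \<alpha> "- (c + \<alpha>)"])
    fix x
    { assume "x \<in> {- (c + \<alpha>)..- (c + \<alpha>) + \<alpha>}"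
      then show "h x = - (sin (x - - (c + \<alpha>)) * sin (- (c + \<alpha>) + \<alpha> - x) / sin \<alpha>)"
        using f[of "- x"] unfolding e by (simp add: mult.commute) }
    { assume "x \<in> {- (c + \<alpha>)<..<- (c + \<alpha>) + \<alpha>}"
      then show "ang x = cos (- (c + \<alpha>) + \<alpha> - x)" using g[of "- x"] unfolding e Rang by simp }
  qed (use a d in auto)
qed

definition arc_profile :: "real \<Rightarrow> real \<Rightarrow> real" where
  "arc_profile \<alpha> \<eta> = sin \<eta> * (\<bar>sin \<eta>\<bar> * cot \<alpha> - cos \<eta>)"

text \<open>
  The closed arc of length \<open>2 \<alpha>\<close> about the direction \<open>s\<close> on which \<open>h\<close> is the profile of \<open>u\<^sub>I\<close>.
\<close>

definition sym_arc :: "real \<Rightarrow> real \<Rightarrow> bool" where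
  "sym_arc s \<alpha> \<longleftrightarrow> 0 < \<alpha> \<and> \<alpha> < pi \<and> (\<forall>\<eta>. \<bar>\<eta>\<bar> \<le> \<alpha> \<longrightarrow> h (s + \<eta>) = arc_profile \<alpha> \<eta>)"

lemma arc_profile_minus: "arc_profile \<alpha> (- \<eta>) = - arc_profile \<alpha> \<eta>"
  by (simp add: arc_profile_def algebra_simps)

lemma arc_profile_pos:
  assumes "0 < \<alpha>" "\<alpha> < pi" "0 \<le> \<eta>" "\<eta> \<le> \<alpha>"
  shows "arc_profile \<alpha> \<eta> = - (sin \<eta> * sin (\<alpha> - \<eta>) / sin \<alpha>)"
proof -
  have "sin \<alpha> > 0" "sin \<eta> \<ge> 0" using assms by (auto intro: sin_gt_zero sin_ge_zero)
  then show ?thesis by (simp add: arc_profile_def cot_def sin_diff field_simps)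
qed

lemma arc_profile_nonzero:
  assumes "0 < \<alpha>" "\<alpha> < pi" "0 < \<bar>\<eta>\<bar>" "\<bar>\<eta>\<bar> < \<alpha>" shows "arc_profile \<alpha> \<eta> \<noteq> 0"
proof -
  have "arc_profile \<alpha> \<bar>\<eta>\<bar> \<noteq> 0"
  proof -
    have "0 < sin \<alpha>" "0 < sin \<bar>\<eta>\<bar>" "0 < sin (\<alpha> - \<bar>\<eta>\<bar>)" using assms by (auto intro!: sin_gt_zero)
    then show ?thesis using arc_profile_pos[of \<alpha> "\<bar>\<eta>\<bar>"] assms by simp
  qed
  then show ?thesis using arc_profile_minus[of \<alpha> \<eta>] by (auto simp: abs_if split: if_splits)
qed

lemma arc_profile_end:
  assumes "0 < \<alpha>" "\<alpha> < pi" "\<bar>\<eta>\<bar> = \<alpha>" shows "arc_profile \<alpha> \<eta> = 0"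
  using arc_profile_pos[of \<alpha> \<alpha>] arc_profile_minus[of \<alpha> \<alpha>] assms by (auto simp: abs_if split: if_splits)

text \<open>
  As the slope at \<open>s\<close> is \<open>-1\<close>, a positive arc ends at \<open>s\<close> and a negative one starts there, with lengths \<open>\<alpha>\<close> and
  \<open>\<beta>\<close>. The angular component tends to \<open>cos \<alpha>\<close> from the left and to \<open>cos \<beta>\<close> from the right. It has a limit at \<open>s\<close>,
  so \<open>\<alpha> = \<beta>\<close>.
\<close>

lemma singular_sym_arc:
  assumes s: "h s = 0" "h' s = -1"
  shows "\<exists>\<alpha>. sym_arc s \<alpha>"
proof -
  obtain d where d: "d > 0" "\<And>e. 0 < e \<Longrightarrow> e < d \<Longrightarrow> 0 < h (s - e)"
    using DERIV_neg_dec_left[OF deriv[of s]] s by auto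
  have "0 < h (s - d/2)" using d by auto
  then obtain c \<alpha> where a: "0 < \<alpha>" "\<alpha> < pi" "c < s - d/2" "s - d/2 < c + \<alpha>"
    and hf: "\<And>x. x \<in> {c..c+\<alpha>} \<Longrightarrow> h x = sin (x - c) * sin (c + \<alpha> - x) / sin \<alpha>"
    and ac: "\<And>x. x \<in> {c<..<c+\<alpha>} \<Longrightarrow> ang x = cos (x - c)"
    by (rule positive_arc) (rule that; assumption)
  have "sin \<alpha> > 0" using a by (simp add: sin_gt_zero)
  have sca: "c + \<alpha> = s"
  proof (rule linorder_cases)
    assume l: "c + \<alpha> < s"
    then show ?thesis using d(2)[of "s - (c + \<alpha>)"] a hf[of "c + \<alpha>"] by auto
  next
    assume l: "s < c + \<alpha>"
    then have "0 < sin (s - c)" "0 < sin (c + \<alpha> - s)" using a d by (auto intro!: sin_gt_zero)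
    then have "0 < h s" using hf[of s] l a d \<open>sin \<alpha> > 0\<close> by simp
    then show ?thesis using s by simp
  qed simp
  obtain d' where d': "d' > 0" "\<And>e. 0 < e \<Longrightarrow> e < d' \<Longrightarrow> h (s + e) < 0"
    using DERIV_neg_dec_right[OF deriv[of s]] s by auto
  have "h (s + d'/2) < 0" using d' by auto
  then obtain s' \<beta> where b: "0 < \<beta>" "\<beta> < pi" "s' < s + d'/2" "s + d'/2 < s' + \<beta>"
    and hg: "\<And>x. x \<in> {s'..s'+\<beta>} \<Longrightarrow> h x = - (sin (x - s') * sin (s' + \<beta> - x) / sin \<beta>)"
    and bc: "\<And>x. x \<in> {s'<..<s'+\<beta>} \<Longrightarrow> ang x = cos (s' + \<beta> - x)"
    by (rule negative_arc) (rule that; assumption)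
  have "sin \<beta> > 0" using b by (simp add: sin_gt_zero)
  have ss': "s' = s"
  proof (rule linorder_cases)
    assume l: "s < s'"
    then show ?thesis using d'(2)[of "s' - s"] b hg[of s'] by auto
  next
    assume l: "s' < s"
    then have "0 < sin (s - s')" "0 < sin (s' + \<beta> - s)" using b d' by (auto intro!: sin_gt_zero)
    then have "h s < 0" using hg[of s] l b d' \<open>sin \<beta> > 0\<close> by simp
    then show ?thesis using s by simp
  qed simp
  obtain l where l: "(ang \<longlongrightarrow> l) (at s)" using ang_limit[OF s] by blast
  have "((\<lambda>x. cos (x - c)) \<longlongrightarrow> cos (s - c)) (at_left s)" by (intro tendsto_intros)
  moreover have "\<forall>\<^sub>F x in at_left s. cos (x - c) = ang x"
    using eventually_at_left_real[of c s] a sca by (auto elim!: eventually_mono simp: ac)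
  ultimately have "(ang \<longlongrightarrow> cos (s - c)) (at_left s)" using a sca by (auto elim: Lim_transform_eventually)
  moreover have "(ang \<longlongrightarrow> l) (at_left s)" using l by (simp add: filterlim_at_split)
  ultimately have l1: "l = cos \<alpha>" using tendsto_unique[OF trivial_limit_at_left_real] sca by fastforce
  have "((\<lambda>x. cos (s + \<beta> - x)) \<longlongrightarrow> cos (s + \<beta> - s)) (at_right s)" by (intro tendsto_intros)
  moreover have "\<forall>\<^sub>F x in at_right s. cos (s + \<beta> - x) = ang x"
    using eventually_at_right_real[of s "s + \<beta>"] b by (auto elim!: eventually_mono simp: bc ss')
  ultimately have "(ang \<longlongrightarrow> cos (s + \<beta> - s)) (at_right s)" by (auto elim: Lim_transform_eventually)
  moreover have "(ang \<longlongrightarrow> l) (at_right s)" using l by (simp add: filterlim_at_split)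
  ultimately have l2: "l = cos \<beta>" using tendsto_unique[OF trivial_limit_at_right_real] by fastforce
  have ab: "\<alpha> = \<beta>" using l1 l2 a b cos_inj_pi[of \<alpha> \<beta>] by auto
  have "h (s + \<eta>) = arc_profile \<alpha> \<eta>" if e: "\<bar>\<eta>\<bar> \<le> \<alpha>" for \<eta>
  proof (cases "0 \<le> \<eta>")
    case True
    then show ?thesis using hg[of "s + \<eta>"] arc_profile_pos[of \<alpha> \<eta>] a e ab ss' by simp
  next
    case False
    then have "h (s + \<eta>) = sin (\<alpha> + \<eta>) * sin (- \<eta>) / sin \<alpha>" using hf[of "s + \<eta>"] sca e by (simp add: algebra_simps flip: sca)
    moreover have "arc_profile \<alpha> (- \<eta>) = - (sin (- \<eta>) * sin (\<alpha> - - \<eta>) / sin \<alpha>)"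
      using a e False by (intro arc_profile_pos) auto
    ultimately show ?thesis unfolding arc_profile_minus by (simp add: mult.commute)
  qed
  then show ?thesis using a unfolding sym_arc_def by blast
qed

lemma sym_arc_center: assumes "sym_arc s \<alpha>" shows "h s = 0" "h' s = -1"
proof -
  have p: "0 < \<alpha>" "\<alpha> < pi" and f: "\<And>\<eta>. \<bar>\<eta>\<bar> \<le> \<alpha> \<Longrightarrow> h (s + \<eta>) = arc_profile \<alpha> \<eta>"
    using assms by (auto simp: sym_arc_def)
  have sa: "sin \<alpha> > 0" using p by (simp add: sin_gt_zero)
  show "h s = 0" using f[of 0] p by (simp add: arc_profile_def)
  let ?g = "\<lambda>x. - (sin (x - s) * sin (\<alpha> - (x - s)) / sin \<alpha>)"
  have gD: "(?g has_real_derivative -1) (at s within {s..s+\<alpha>})"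
    using sa by (auto intro!: derivative_eq_intros simp: field_simps)
  have "(h has_real_derivative -1) (at s within {s..s+\<alpha>})"
  proof (rule has_field_derivative_transform_within[OF gD p(1)])
    fix x assume "x \<in> {s..s+\<alpha>}"
    then show "?g x = h x" using f[of "x - s"] arc_profile_pos[of \<alpha> "x - s"] p by simp
  qed (use p in auto)
  moreover have "(h has_real_derivative h' s) (at s within {s..s+\<alpha>})" using deriv has_field_derivative_at_within by blast
  moreover have "at s within {s..s+\<alpha>} \<noteq> bot" using p by (simp add: at_within_Icc_at_right trivial_limit_at_right_real)
  ultimately show "h' s = -1" unfolding has_field_derivative_iff by (metis tendsto_unique)
qed

lemma sym_arc_nonzero: "sym_arc s \<alpha> \<Longrightarrow> x \<noteq> s \<Longrightarrow> \<bar>x - s\<bar> < \<alpha> \<Longrightarrow> h x \<noteq> 0"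
proof -
  assume a: "sym_arc s \<alpha>" "x \<noteq> s" "\<bar>x - s\<bar> < \<alpha>"
  then have "h (s + (x - s)) = arc_profile \<alpha> (x - s)" unfolding sym_arc_def by (metis less_imp_le)
  then show ?thesis using arc_profile_nonzero[of \<alpha> "x - s"] a by (simp add: sym_arc_def)
qed

lemma sym_arc_ends: assumes "sym_arc s \<alpha>" shows "h (s + \<alpha>) = 0" "h (s - \<alpha>) = 0"
proof -
  have p: "0 < \<alpha>" "\<alpha> < pi" and f: "\<And>\<eta>. \<bar>\<eta>\<bar> \<le> \<alpha> \<Longrightarrow> h (s + \<eta>) = arc_profile \<alpha> \<eta>"
    using assms by (auto simp: sym_arc_def)
  show "h (s + \<alpha>) = 0" "h (s - \<alpha>) = 0"
    using f[of \<alpha>] f[of "- \<alpha>"] arc_profile_end[of \<alpha> \<alpha>] arc_profile_end[of \<alpha> "- \<alpha>"] p by auto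
qed

lemma per_int: "h (\<theta> + 2 * pi * of_int n) = h \<theta>"
proof (induction n rule: int_induct[where k=0])
  case (step1 i)
  then show ?case using per[of "\<theta> + 2 * pi * of_int i"] by (simp add: algebra_simps)
next
  case (step2 i)
  then show ?case using per[of "\<theta> + 2 * pi * of_int (i - 1)"] by (simp add: algebra_simps)
qed simp

lemma sym_arc_shift: "sym_arc s \<alpha> \<Longrightarrow> sym_arc (s + 2 * pi * of_int n) \<alpha>"
  unfolding sym_arc_def using per_int[of "s + _" n] by (simp add: ac_simps)

lemma sym_arc_sign: assumes "sym_arc s \<alpha>" "0 < \<eta>" "\<eta> < \<alpha>" shows "h (s + \<eta>) < 0" "h (s - \<eta>) > 0"
proof -
  have p: "0 < \<alpha>" "\<alpha> < pi" and f: "\<And>\<eta>. \<bar>\<eta>\<bar> \<le> \<alpha> \<Longrightarrow> h (s + \<eta>) = arc_profile \<alpha> \<eta>"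
    using assms by (auto simp: sym_arc_def)
  have "arc_profile \<alpha> \<eta> < 0"
    using arc_profile_pos[of \<alpha> "\<eta>"] p assms sin_gt_zero[of \<alpha>] sin_gt_zero[of "\<eta>"] sin_gt_zero[of "\<alpha> - \<eta>"] by simp
  then show "h (s + \<eta>) < 0" "h (s - \<eta>) > 0"
    using f[of \<eta>] f[of "- \<eta>"] arc_profile_minus[of \<alpha> \<eta>] assms by auto
qed

text \<open>
  Neighbouring arcs touch at most at their ends: the centre of one is a zero of \<open>h\<close> and so not inside the other, and it is not an end of the other either, as
  \<open>h\<close> changes sign from \<open>+\<close> to \<open>-\<close> at a centre.
\<close>

lemma sym_arc_disjoint:
  assumes "sym_arc s \<alpha>" "sym_arc s' \<alpha>'" "s < s'" shows "s + \<alpha> \<le> s' - \<alpha>'"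
proof (rule ccontr)
  assume n: "\<not> ?thesis"
  have p: "0 < \<alpha>" "0 < \<alpha>'" using assms by (auto simp: sym_arc_def)
  have "s' \<ge> s + \<alpha>"
    using sym_arc_nonzero[OF assms(1), of s'] sym_arc_center[OF assms(2)] assms(3) by force
  then have e: "s' = s + \<alpha>"
    using n sym_arc_nonzero[OF assms(2), of "s + \<alpha>"] sym_arc_ends[OF assms(1)] by force
  define \<epsilon> where "\<epsilon> = min \<alpha> \<alpha>' / 2"
  have \<epsilon>: "0 < \<epsilon>" "\<epsilon> < \<alpha>" "\<epsilon> < \<alpha>'" using p by (auto simp: \<epsilon>_def)
  have "h (s' - \<epsilon>) > 0" by (rule sym_arc_sign(2)[OF assms(2)]) (use \<epsilon> in auto)
  moreover have "h (s + (\<alpha> - \<epsilon>)) < 0" by (rule sym_arc_sign(1)[OF assms(1)]) (use \<epsilon> in auto)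
  ultimately show False unfolding e by (simp add: add_diff_eq)
qed

lemma sym_arc_unique: "sym_arc s \<alpha> \<Longrightarrow> sym_arc s \<beta> \<Longrightarrow> \<alpha> = \<beta>"
proof -
  have *: "\<not> \<alpha> < \<beta>" if "sym_arc s \<alpha>" "sym_arc s \<beta>" for \<alpha> \<beta>
  proof
    assume "\<alpha> < \<beta>"
    moreover have "0 < \<alpha>" using that(1) by (simp add: sym_arc_def)
    ultimately have "h (s + \<alpha>) \<noteq> 0" by (intro sym_arc_nonzero[OF that(2)]) auto
    then show False using sym_arc_ends[OF that(1)] by simp
  qed
  assume "sym_arc s \<alpha>" "sym_arc s \<beta>"
  then show ?thesis using *[of \<alpha> \<beta>] *[of \<beta> \<alpha>] by linarith
qed

lemma sym_arc_covers_before_center: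
  assumes "sym_arc s \<alpha>" "\<theta> < s" "\<And>x. \<theta> < x \<Longrightarrow> x < s \<Longrightarrow> h x \<noteq> 0" shows "s - \<theta> \<le> \<alpha>"
proof (rule ccontr)
  assume "\<not> ?thesis"
  moreover have "0 < \<alpha>" using assms(1) by (simp add: sym_arc_def)
  ultimately have "h (s - \<alpha>) \<noteq> 0" by (intro assms(3)) auto
  then show False using sym_arc_ends[OF assms(1)] by simp
qed

lemma sym_arc_covers_after_center:
  assumes "sym_arc s \<alpha>" "s < \<theta>" "\<And>x. s < x \<Longrightarrow> x < \<theta> \<Longrightarrow> h x \<noteq> 0" shows "\<theta> - s \<le> \<alpha>"
proof (rule ccontr)
  assume "\<not> ?thesis"
  moreover have "0 < \<alpha>" using assms(1) by (simp add: sym_arc_def)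
  ultimately have "h (s + \<alpha>) \<noteq> 0" by (intro assms(3)) auto
  then show False using sym_arc_ends[OF assms(1)] by simp
qed

lemma nonzero_right_end:
  assumes "h \<tau> \<noteq> 0"
  shows "\<exists>z>\<tau>. h z = 0 \<and> \<bar>h' z\<bar> = 1 \<and> (\<forall>x. \<tau> \<le> x \<and> x < z \<longrightarrow> h x \<noteq> 0)"
proof (cases "0 < h \<tau>")
  case True
  obtain c \<alpha> where a: "0 < \<alpha>" "\<alpha> < pi" "c < \<tau>" "\<tau> < c + \<alpha>"
    and f: "\<And>x. x \<in> {c..c+\<alpha>} \<Longrightarrow> h x = sin (x - c) * sin (c + \<alpha> - x) / sin \<alpha>" and d: "h' (c + \<alpha>) = -1"
    by (rule positive_arc[OF True]) (rule that; assumption)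
  have "sin \<alpha> > 0" using a by (simp add: sin_gt_zero)
  have "h x \<noteq> 0" if "\<tau> \<le> x" "x < c + \<alpha>" for x
    using f[of x] that a sin_gt_zero[of "x - c"] sin_gt_zero[of "c + \<alpha> - x"] \<open>sin \<alpha> > 0\<close> by auto
  moreover have "h (c + \<alpha>) = 0" "\<bar>h' (c + \<alpha>)\<bar> = 1" using f[of "c + \<alpha>"] a d by simp_all
  ultimately show ?thesis using a(4) by (intro exI[of _ "c + \<alpha>"] conjI allI impI) simp_all
next
  case False
  then have "h \<tau> < 0" using assms by simp
  then obtain c \<alpha> where a: "0 < \<alpha>" "\<alpha> < pi" "c < \<tau>" "\<tau> < c + \<alpha>"
    and f: "\<And>x. x \<in> {c..c+\<alpha>} \<Longrightarrow> h x = - (sin (x - c) * sin (c + \<alpha> - x) / sin \<alpha>)" and d: "h' (c + \<alpha>) = 1"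
    by (rule negative_arc) (rule that; assumption)
  have "sin \<alpha> > 0" using a by (simp add: sin_gt_zero)
  have "h x \<noteq> 0" if "\<tau> \<le> x" "x < c + \<alpha>" for x
    using f[of x] that a sin_gt_zero[of "x - c"] sin_gt_zero[of "c + \<alpha> - x"] \<open>sin \<alpha> > 0\<close> by auto
  moreover have "h (c + \<alpha>) = 0" "\<bar>h' (c + \<alpha>)\<bar> = 1" using f[of "c + \<alpha>"] a d by simp_all
  ultimately show ?thesis using a(4) by (intro exI[of _ "c + \<alpha>"] conjI allI impI) simp_all
qed

text \<open>
  This excludes intervals on which \<open>h = 0\<close>, if \<open>h\<close> is not zero everywhere. Going left from such an interval, a point \<open>e\<close>
  is reached near which \<open>h\<close> takes nonzero values. It is an end of an arc or a limit of such ends, so that \<open>|h' e| = 1\<close> by continuity of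
  \<open>h'\<close>; but then \<open>h\<close> is nonzero immediately to the right of \<open>e\<close>.
\<close>

lemma zero_slope:
  assumes nz: "h \<tau>0 \<noteq> 0" and z: "h \<theta> = 0" shows "\<bar>h' \<theta>\<bar> = 1"
proof -
  define T where "T = {\<tau>. \<tau> \<le> \<theta> \<and> h \<tau> \<noteq> 0}"
  obtain n :: int where n: "(\<tau>0 - \<theta>) / (2 * pi) \<le> of_int n" using ex_le_of_int[of "(\<tau>0 - \<theta>) / (2 * pi)"] by (elim exE)
  have "\<tau>0 + 2 * pi * of_int (- n) \<in> T"
    using n per_int[of \<tau>0 "- n"] nz by (simp add: T_def field_simps)
  then have T: "T \<noteq> {}" "bdd_above T" by (auto simp: T_def intro: bdd_aboveI[of _ \<theta>])
  define e where "e = Sup T"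
  have e\<theta>: "e \<le> \<theta>" unfolding e_def by (rule cSup_least) (use T in \<open>auto simp: T_def\<close>)
  have up: "\<tau> \<le> e" if "\<tau> \<in> T" for \<tau> unfolding e_def using T that by (simp add: cSup_upper)
  have he: "h e = 0"
  proof (rule ccontr)
    assume ne: "h e \<noteq> 0"
    obtain w where w: "e < w" "h w = 0" "\<forall>x. e \<le> x \<and> x < w \<longrightarrow> h x \<noteq> 0" using nonzero_right_end[OF ne] by (elim exE conjE)
    have "w \<le> \<theta>" using w(3)[rule_format, of \<theta>] z e\<theta> by linarith
    then have "(e + w) / 2 \<in> T" using w by (auto simp: T_def)
    then show False using up[of "(e + w) / 2"] w by simp
  qed
  have cl: "closed {x. \<bar>h' x\<bar> = 1}"
    using continuous_closed_preimage_constant[of UNIV "\<lambda>x. \<bar>h' x\<bar>" 1] cont by (simp add: continuous_on_rabs vimage_def)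
  have "e \<in> closure {x. \<bar>h' x\<bar> = 1}"
  proof (unfold closure_approachable, intro allI impI)
    fix \<epsilon> :: real assume "\<epsilon> > 0"
    then obtain \<tau> where \<tau>: "\<tau> \<in> T" "e - \<epsilon> < \<tau>"
      using less_cSup_iff[OF T, of "e - \<epsilon>"] by (auto simp: e_def)
    have "\<tau> \<le> e" "\<tau> \<noteq> e" using up \<tau> he by (auto simp: T_def)
    have "h \<tau> \<noteq> 0" using \<tau>(1) by (simp add: T_def)
    from nonzero_right_end[OF this] obtain w where w: "\<tau> < w" "\<bar>h' w\<bar> = 1" "\<forall>x. \<tau> \<le> x \<and> x < w \<longrightarrow> h x \<noteq> 0"
      by (elim exE conjE)
    have "w \<le> e" using w(3)[rule_format, of e] he \<open>\<tau> \<le> e\<close> by linarith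
    then show "\<exists>y\<in>{x. \<bar>h' x\<bar> = 1}. dist y e < \<epsilon>" using w \<tau> by (intro bexI[of _ w]) (auto simp: dist_real_def)
  qed
  then have h'e: "\<bar>h' e\<bar> = 1" using cl by simp
  have "e = \<theta>"
  proof (rule ccontr)
    assume "e \<noteq> \<theta>"
    have zero: "h x = 0" if "e < x" "x \<le> \<theta>" for x using up[of x] that by (force simp: T_def)
    have "h' e > 0 \<or> h' e < 0" using h'e by auto
    then have "\<exists>d>0. \<forall>k>0. k < d \<longrightarrow> h (e + k) \<noteq> 0"
    proof
      assume "h' e > 0"
      from DERIV_pos_inc_right[OF deriv this] show ?thesis unfolding he by fastforce
    next
      assume "h' e < 0"
      from DERIV_neg_dec_right[OF deriv this] show ?thesis unfolding he by fastforce
    qed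
    then obtain d where d: "d > 0" "\<And>k. 0 < k \<Longrightarrow> k < d \<Longrightarrow> h (e + k) \<noteq> 0" by blast
    define k where "k = min (d/2) (\<theta> - e)"
    have k: "0 < k" "k < d" "e + k \<le> \<theta>" using d(1) e\<theta> \<open>e \<noteq> \<theta>\<close> by (auto simp: k_def)
    show False using zero[of "e + k"] d(2)[of k] k by simp
  qed
  then show ?thesis using h'e by simp
qed

lemma positive_end:
  assumes "0 < h \<tau>"
  shows "\<exists>s>\<tau>. h s = 0 \<and> h' s = -1 \<and> (\<forall>x. \<tau> \<le> x \<and> x < s \<longrightarrow> h x \<noteq> 0)"
proof -
  obtain c \<alpha> where a: "0 < \<alpha>" "\<alpha> < pi" "c < \<tau>" "\<tau> < c + \<alpha>"
    and f: "\<And>x. x \<in> {c..c+\<alpha>} \<Longrightarrow> h x = sin (x - c) * sin (c + \<alpha> - x) / sin \<alpha>" and d: "h' (c + \<alpha>) = -1"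
    by (rule positive_arc[OF assms]) (rule that; assumption)
  have "sin \<alpha> > 0" using a by (simp add: sin_gt_zero)
  have "h x \<noteq> 0" if "\<tau> \<le> x" "x < c + \<alpha>" for x
    using f[of x] that a sin_gt_zero[of "x - c"] sin_gt_zero[of "c + \<alpha> - x"] \<open>sin \<alpha> > 0\<close> by auto
  moreover have "h (c + \<alpha>) = 0" using f[of "c + \<alpha>"] a by simp
  ultimately show ?thesis using a(4) d by (intro exI[of _ "c + \<alpha>"] conjI allI impI) simp_all
qed

lemma negative_start:
  assumes "h \<tau> < 0"
  shows "\<exists>s<\<tau>. h s = 0 \<and> h' s = -1 \<and> (\<forall>x. s < x \<and> x \<le> \<tau> \<longrightarrow> h x \<noteq> 0)"
proof -
  obtain s \<alpha> where a: "0 < \<alpha>" "\<alpha> < pi" "s < \<tau>" "\<tau> < s + \<alpha>"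
    and f: "\<And>x. x \<in> {s..s+\<alpha>} \<Longrightarrow> h x = - (sin (x - s) * sin (s + \<alpha> - x) / sin \<alpha>)" and d: "h' s = -1"
    by (rule negative_arc[OF assms]) (rule that; assumption)
  have "sin \<alpha> > 0" using a by (simp add: sin_gt_zero)
  have "h x \<noteq> 0" if "s < x" "x \<le> \<tau>" for x
    using f[of x] that a sin_gt_zero[of "x - s"] sin_gt_zero[of "s + \<alpha> - x"] \<open>sin \<alpha> > 0\<close> by auto
  moreover have "h s = 0" using f[of s] a by simp
  ultimately show ?thesis using a(3) d by (intro exI[of _ s] conjI allI impI) simp_all
qed

text \<open>
  A direction where \<open>h > 0\<close> lies in the left half of the arc about the next zero, one where \<open>h < 0\<close> in the right half of
  the arc about the previous zero. A zero has slope \<open>1\<close> or \<open>-1\<close>: in the first case \<open>h > 0\<close> immediately to its right and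
  the first argument applies, in the second it is a centre itself.
\<close>

lemma covered_by_sym_arc:
  assumes nz: "h \<tau>0 \<noteq> 0"
  shows "\<exists>s \<alpha>. sym_arc s \<alpha> \<and> \<bar>\<theta> - s\<bar> \<le> \<alpha>"
proof -
  have pos: "\<exists>s \<alpha>. sym_arc s \<alpha> \<and> \<bar>\<theta> - s\<bar> \<le> \<alpha>"
    if \<tau>: "\<theta> \<le> \<tau>" "\<And>x. \<theta> < x \<Longrightarrow> x \<le> \<tau> \<Longrightarrow> h x \<noteq> 0" "0 < h \<tau>" for \<tau>
  proof -
    obtain s where s: "\<tau> < s" "h s = 0" "h' s = -1" "\<forall>x. \<tau> \<le> x \<and> x < s \<longrightarrow> h x \<noteq> 0"
      using positive_end[OF \<tau>(3)] by (elim exE conjE)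
    obtain \<beta> where b: "sym_arc s \<beta>" using singular_sym_arc[OF s(2,3)] by blast
    have "s - \<theta> \<le> \<beta>"
    proof (rule sym_arc_covers_before_center[OF b])
      show "\<theta> < s" using \<tau>(1) s(1) by simp
      show "h x \<noteq> 0" if "\<theta> < x" "x < s" for x using \<tau>(2)[of x] s(4) that by (cases "x \<le> \<tau>") auto
    qed
    then have "\<bar>\<theta> - s\<bar> \<le> \<beta>" using \<tau>(1) s(1) by simp
    then show ?thesis using b by blast
  qed
  consider "h \<theta> > 0" | "h \<theta> < 0" | "h \<theta> = 0" "h' \<theta> = 1" | "h \<theta> = 0" "h' \<theta> = -1" using zero_slope[OF nz, of \<theta>] by linarith
  then show ?thesis
  proof cases
    case 1
    show ?thesis by (rule pos[of \<theta>]) (use 1 in simp_all)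
  next
    case 2
    obtain s where s: "s < \<theta>" "h s = 0" "h' s = -1" "\<forall>x. s < x \<and> x \<le> \<theta> \<longrightarrow> h x \<noteq> 0"
      using negative_start[OF 2] by (elim exE conjE)
    obtain \<beta> where b: "sym_arc s \<beta>" using singular_sym_arc[OF s(2,3)] by blast
    have "\<theta> - s \<le> \<beta>" by (rule sym_arc_covers_after_center[OF b s(1)]) (use s(4) in simp)
    then have "\<bar>\<theta> - s\<bar> \<le> \<beta>" using s(1) by simp
    then show ?thesis using b by blast
  next
    case 3
    then have "0 < h' \<theta>" by simp
    from DERIV_pos_inc_right[OF deriv this] obtain d where d: "d > 0" "\<And>k. 0 < k \<Longrightarrow> k < d \<Longrightarrow> h (\<theta> + k) > 0"
      unfolding 3(1) by blast
    have "h x \<noteq> 0" if x: "\<theta> < x" "x \<le> \<theta> + d/2" for x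
    proof -
      have "0 < x - \<theta>" "x - \<theta> < d" using x d(1) by linarith+
      from d(2)[OF this] show ?thesis by simp
    qed
    moreover have "0 < h (\<theta> + d/2)" "\<theta> \<le> \<theta> + d/2" using d(2)[of "d/2"] d(1) by simp_all
    ultimately show ?thesis using pos[of "\<theta> + d/2"] by blast
  next
    case 4
    then obtain \<beta> where b: "sym_arc \<theta> \<beta>" using singular_sym_arc by blast
    then have "\<bar>\<theta> - \<theta>\<bar> \<le> \<beta>" by (simp add: sym_arc_def)
    then show ?thesis using b by blast
  qed
qed

text \<open>
  A limit of centres is a centre, but \<open>h\<close> has no zeros other than the centre inside its arc.
\<close>

lemma finite_singular_angles: "finite {\<theta>\<in>{0..2*pi}. h \<theta> = 0 \<and> h' \<theta> = -1}" (is "finite ?Z")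
proof (rule ccontr)
  assume "infinite ?Z"
  moreover have "?Z \<subseteq> {0..2*pi}" by auto
  ultimately obtain x where x: "x islimpt ?Z" using Heine_Borel_imp_Bolzano_Weierstrass[OF compact_Icc[of 0 "2*pi"]] by blast
  have "closed {x. h x = 0}" "closed {x. h' x = -1}"
    using continuous_closed_preimage_constant[of UNIV h 0] continuous_closed_preimage_constant[of UNIV h' "-1"] cont h_cont
    by (simp_all add: vimage_def)
  then have "closed ({x. h x = 0} \<inter> {x. h' x = -1})" by (rule closed_Int)
  moreover have "x islimpt ({x. h x = 0} \<inter> {x. h' x = -1})" by (rule islimpt_subset[OF x]) auto
  ultimately have "x \<in> {x. h x = 0} \<inter> {x. h' x = -1}" unfolding closed_limpt by blast
  then have "h x = 0" "h' x = -1" by simp_all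
  then obtain \<alpha> where a: "sym_arc x \<alpha>" using singular_sym_arc by blast
  then have "0 < \<alpha>" by (simp add: sym_arc_def)
  then obtain y where "y \<in> ?Z" "y \<noteq> x" "dist y x < \<alpha>" using x by (auto simp: islimpt_approachable)
  then show False using sym_arc_nonzero[OF a, of y] by (simp add: dist_real_def)
qed

end

section \<open>Recognizing the cones over arcs\<close>

text \<open>
  The multiples of \<open>2 \<pi>\<close> account for the choice of the angle.
\<close>

lemma u_arc_polar:
  assumes "0 < r" "0 < \<alpha>"
  shows "u_arc \<theta>0 \<alpha> (r * cos \<theta>, r * sin \<theta>) =
    (if \<exists>n::int. \<bar>\<theta> - \<theta>0 + 2 * pi * n\<bar> < \<alpha>
     then r\<^sup>2 * (sin (\<theta> - \<theta>0) * (\<bar>sin (\<theta> - \<theta>0)\<bar> * cot \<alpha> - cos (\<theta> - \<theta>0))) else 0)"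
proof -
  let ?\<phi> = "\<theta> - \<theta>0"
  have rot: "rot (- \<theta>0) (r * cos \<theta>, r * sin \<theta>) = (r * cos ?\<phi>, r * sin ?\<phi>)"
    by (simp add: cos_diff sin_diff algebra_simps)
  have sec: "(r * cos ?\<phi>, r * sin ?\<phi>) \<in> sector (arc_of 0 \<alpha>) \<longleftrightarrow> (\<exists>n::int. \<bar>?\<phi> + 2 * pi * n\<bar> < \<alpha>)"
  proof
    assume "(r * cos ?\<phi>, r * sin ?\<phi>) \<in> sector (arc_of 0 \<alpha>)"
    then obtain t \<psi> where t: "t \<ge> 0" "\<bar>\<psi>\<bar> < \<alpha>" "r * cos ?\<phi> = t * cos \<psi>" "r * sin ?\<phi> = t * sin \<psi>"
      by (auto simp: sector_def arc_of_def)
    have "r\<^sup>2 = (r * cos ?\<phi>)\<^sup>2 + (r * sin ?\<phi>)\<^sup>2" by (simp add: power_mult_distrib flip: distrib_left)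
    also have "\<dots> = t\<^sup>2" unfolding t by (simp add: power_mult_distrib flip: distrib_left)
    finally have "r = t" using t(1) assms(1) by (simp add: power2_eq_iff_nonneg)
    then have "sin \<psi> = sin ?\<phi> \<and> cos \<psi> = cos ?\<phi>" using t assms by auto
    then obtain n :: int where "\<psi> = ?\<phi> + 2 * pi * n" by (auto simp: sin_cos_eq_iff)
    then show "\<exists>n::int. \<bar>?\<phi> + 2 * pi * n\<bar> < \<alpha>" using t(2) by blast
  next
    assume "\<exists>n::int. \<bar>?\<phi> + 2 * pi * n\<bar> < \<alpha>"
    then obtain n :: int where n: "\<bar>?\<phi> + 2 * pi * n\<bar> < \<alpha>" by blast
    have "sin (?\<phi> + 2 * pi * n) = sin ?\<phi> \<and> cos (?\<phi> + 2 * pi * n) = cos ?\<phi>" by (subst sin_cos_eq_iff) blast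
    then have "(r * cos ?\<phi>, r * sin ?\<phi>) = r *\<^sub>R (cos (?\<phi> + 2 * pi * n), sin (?\<phi> + 2 * pi * n))" by simp
    moreover have "(cos (?\<phi> + 2 * pi * n), sin (?\<phi> + 2 * pi * n)) \<in> arc_of 0 \<alpha>"
      unfolding arc_of_def using n by (intro CollectI exI[of _ "?\<phi> + 2 * pi * n"]) simp
    ultimately show "(r * cos ?\<phi>, r * sin ?\<phi>) \<in> sector (arc_of 0 \<alpha>)"
      unfolding sector_def using assms(1) less_imp_le by blast
  qed
  have "u_centred \<alpha> (r * cos ?\<phi>, r * sin ?\<phi>) =
    (if \<exists>n::int. \<bar>?\<phi> + 2 * pi * n\<bar> < \<alpha> then r\<^sup>2 * (sin ?\<phi> * (\<bar>sin ?\<phi>\<bar> * cot \<alpha> - cos ?\<phi>)) else 0)"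
    unfolding u_centred.simps sec using assms(1) by (simp add: abs_mult power2_eq_square algebra_simps)
  then show ?thesis by (simp only: u_arc_def comp_apply rot)
qed

lemma u_arc_origin: "u_arc \<theta>0 \<alpha> (0, 0) = 0" by (simp add: u_arc_def)

lemma polar_exists: "\<exists>r\<ge>0. \<exists>\<theta>. (x, y) = (r * cos \<theta>, r * sin \<theta>)" for x y :: real
proof -
  have "Complex x y = rcis (cmod (Complex x y)) (Arg (Complex x y))" by (simp add: rcis_cmod_Arg)
  then have "x = cmod (Complex x y) * cos (Arg (Complex x y))" "y = cmod (Complex x y) * sin (Arg (Complex x y))"
    by (metis Re_rcis complex.sel(1), metis Im_rcis complex.sel(2))
  then show ?thesis using norm_ge_zero by blast
qed

lemma shift_into_period:
  obtains n :: int where "0 \<le> \<theta> + 2 * pi * n" "\<theta> + 2 * pi * n < 2 * pi"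
proof
  let ?n = "- \<lfloor>\<theta> / (2 * pi)\<rfloor>"
  have "of_int \<lfloor>\<theta> / (2 * pi)\<rfloor> \<le> \<theta> / (2 * pi)" "\<theta> / (2 * pi) < of_int \<lfloor>\<theta> / (2 * pi)\<rfloor> + 1" by linarith+
  then have "of_int \<lfloor>\<theta> / (2 * pi)\<rfloor> * (2 * pi) \<le> \<theta>" "\<theta> < (of_int \<lfloor>\<theta> / (2 * pi)\<rfloor> + 1) * (2 * pi)"
    by (simp_all only: pos_le_divide_eq pos_divide_less_eq pi_gt_zero mult_pos_pos zero_less_numeral)
  then show "0 \<le> \<theta> + 2 * pi * of_int ?n" "\<theta> + 2 * pi * of_int ?n < 2 * pi" by (simp_all add: algebra_simps)
qed

context cone_profile
begin

text \<open>
  The centres of the arcs are the singular angles in \<open>[0, 2 \<pi>)\<close>. One arc alone cannot cover the circle, as its half length is less than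
  \<open>\<pi>\<close>. Directions outside the open arcs are ends of arcs, where \<open>h\<close> and all the \<open>u\<^sub>I\<close> vanish.
\<close>

lemma cone_is_C_surface:
  assumes nz: "h \<tau> \<noteq> 0"
    and u: "\<And>r \<theta>. 0 \<le> r \<Longrightarrow> u (r * cos \<theta>, r * sin \<theta>) = r\<^sup>2 * h \<theta>"
  shows "is_C_surface {(x, y, u (x, y)) | x y. True}"
proof -
  define Z where "Z = {\<theta>\<in>{0..<2*pi}. h \<theta> = 0 \<and> h' \<theta> = -1}"
  have finZ: "finite Z" by (rule finite_subset[OF _ finite_singular_angles]) (auto simp: Z_def)
  have "\<exists>\<alpha>. \<forall>s\<in>Z. sym_arc s (\<alpha> s)" using singular_sym_arc by (intro bchoice) (auto simp: Z_def)
  then obtain A where A: "\<And>s. s \<in> Z \<Longrightarrow> sym_arc s (A s)" by blast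
  have cov: "\<exists>z\<in>Z. \<exists>n::int. \<bar>\<theta> - z + 2 * pi * n\<bar> \<le> A z" for \<theta>
  proof -
    obtain s \<alpha> where s: "sym_arc s \<alpha>" "\<bar>\<theta> - s\<bar> \<le> \<alpha>" using covered_by_sym_arc[OF nz] by blast
    obtain n :: int where n: "0 \<le> s + 2 * pi * n" "s + 2 * pi * n < 2 * pi" by (rule shift_into_period)
    have s': "sym_arc (s + 2 * pi * n) \<alpha>" by (rule sym_arc_shift[OF s(1)])
    have z: "s + 2 * pi * n \<in> Z" using n sym_arc_center[OF s'] by (simp add: Z_def)
    then have "\<alpha> = A (s + 2 * pi * n)" using sym_arc_unique[OF s' A] by blast
    then have "\<bar>\<theta> - (s + 2 * pi * n) + 2 * pi * n\<bar> \<le> A (s + 2 * pi * n)" using s(2) by simp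
    then show ?thesis using z by blast
  qed
  have disj: "z = z'" if z: "z \<in> Z" "z' \<in> Z" and "\<bar>\<theta> - z + 2 * pi * of_int n\<bar> < A z" "\<bar>\<theta> - z' + 2 * pi * of_int n'\<bar> \<le> A z'" for z z' \<theta> and n n' :: int
  proof -
    let ?s = "z + 2 * pi * of_int (- n)" and ?s' = "z' + 2 * pi * of_int (- n')"
    have s: "sym_arc ?s (A z)" "sym_arc ?s' (A z')" using A z sym_arc_shift by blast+
    have d: "\<bar>\<theta> - ?s\<bar> < A z" "\<bar>\<theta> - ?s'\<bar> \<le> A z'" using that by (auto simp: algebra_simps)
    have "\<not> ?s < ?s'" using sym_arc_disjoint[OF s] d by linarith
    moreover have "\<not> ?s' < ?s" using sym_arc_disjoint[OF s(2,1)] d by linarith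
    ultimately have "?s = ?s'" by linarith
    then have e: "z - z' = 2 * pi * of_int (n - n')" by (simp add: algebra_simps)
    have "\<bar>z - z'\<bar> < 2 * pi" using z by (auto simp: Z_def)
    then have "\<bar>real_of_int (n - n')\<bar> < 1" unfolding e by (simp add: abs_mult)
    then have "n = n'" by linarith
    then show ?thesis using e by simp
  qed
  define k where "k = card Z"
  obtain f where f: "bij_betw f {..<k} Z" using ex_bij_betw_nat_finite[OF finZ] by (auto simp: k_def atLeast0LessThan)
  have fZ: "f i \<in> Z" if "i < k" for i using f that by (auto simp: bij_betw_def)
  have finj: "i = j" if "f i = f j" "i < k" "j < k" for i j using f that by (auto simp: bij_betw_def inj_on_def)
  have pos: "0 < A (f i)" "A (f i) < pi" if "i < k" for i using A[OF fZ[OF that]] by (auto simp: sym_arc_def)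
  have covf: "\<exists>i<k. \<exists>n::int. \<bar>\<theta> - f i + 2 * pi * n\<bar> \<le> A (f i)" for \<theta>
  proof -
    obtain z and n :: int where z: "z \<in> Z" "\<bar>\<theta> - z + 2 * pi * n\<bar> \<le> A z" using cov[of \<theta>] by (elim bexE exE)
    obtain i where "i < k" "f i = z" using z(1) f by (auto simp: bij_betw_def image_iff)
    then show ?thesis using z(2) by (intro exI[of _ i] conjI exI[of _ n]) simp_all
  qed
  have Z1: "k \<ge> 1" using covf[of 0] by auto
  have "k \<ge> 2"
  proof (rule ccontr)
    assume "\<not> 2 \<le> k"
    then have k1: "k = 1" using Z1 by simp
    obtain n :: int where n: "\<bar>(f 0 + pi) - f 0 + 2 * pi * n\<bar> \<le> A (f 0)" using covf[of "f 0 + pi"] k1 by auto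
    have "pi + 2 * pi * of_int n = pi * (1 + 2 * real_of_int n)" by (simp add: algebra_simps)
    then have "\<bar>pi + 2 * pi * of_int n\<bar> = pi * \<bar>1 + 2 * real_of_int n\<bar>" by (simp only: abs_mult) simp
    moreover have "1 \<le> \<bar>1 + 2 * n\<bar>" by presburger
    then have "real_of_int 1 \<le> real_of_int \<bar>1 + 2 * n\<bar>" by (simp only: of_int_le_iff)
    then have "1 \<le> \<bar>1 + 2 * real_of_int n\<bar>" by simp
    then have "pi * 1 \<le> pi * \<bar>1 + 2 * real_of_int n\<bar>" by (intro mult_left_mono) auto
    moreover have "\<bar>pi + 2 * pi * of_int n\<bar> \<le> A (f 0)" using n by simp
    ultimately show False using pos(2)[of 0] k1 by linarith
  qed
  moreover have "disjoint_family_on (\<lambda>i. arc_of (f i) (A (f i))) {..<k}"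
  proof (unfold disjoint_family_on_def, intro ballI impI)
    fix i j assume ij: "i \<in> {..<k}" "j \<in> {..<k}" "i \<noteq> j"
    show "arc_of (f i) (A (f i)) \<inter> arc_of (f j) (A (f j)) = {}"
    proof (rule ccontr)
      assume "arc_of (f i) (A (f i)) \<inter> arc_of (f j) (A (f j)) \<noteq> {}"
      then obtain q where "q \<in> arc_of (f i) (A (f i))" "q \<in> arc_of (f j) (A (f j))" by blast
      then obtain \<phi> \<psi> where p: "\<bar>\<phi> - f i\<bar> < A (f i)" "\<bar>\<psi> - f j\<bar> < A (f j)"
        and "q = (cos \<phi>, sin \<phi>)" "q = (cos \<psi>, sin \<psi>)"
        unfolding arc_of_def by blast
      then have "sin \<psi> = sin \<phi> \<and> cos \<psi> = cos \<phi>" by simp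
      then obtain n :: int where "\<psi> = \<phi> + 2 * pi * n" by (auto simp: sin_cos_eq_iff)
      then have "\<bar>\<phi> - f i + 2 * pi * of_int 0\<bar> < A (f i)" "\<bar>\<phi> - f j + 2 * pi * of_int n\<bar> \<le> A (f j)" using p by (simp_all add: algebra_simps)
      then have "f i = f j" using disj[of "f i" "f j" \<phi> 0 n] fZ ij by blast
      then show False using finj ij by blast
    qed
  qed
  moreover have "sphere 0 1 = (\<Union>i<k. closure (arc_of (f i) (A (f i))))"
  proof (intro subset_antisym subsetI)
    fix p :: plane assume "p \<in> sphere 0 1"
    then obtain x y where p: "p = (x, y)" "x\<^sup>2 + y\<^sup>2 = 1" by (cases p) (auto simp: norm_Pair)
    obtain \<theta> where \<theta>: "x = cos \<theta>" "y = sin \<theta>" by (rule sincos_total_2pi[OF p(2)]) (rule that; assumption)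
    obtain i and n :: int where i: "i < k" "\<bar>\<theta> - f i + 2 * pi * n\<bar> \<le> A (f i)" using covf[of \<theta>] by (elim exE conjE)
    let ?g = "\<lambda>t. (cos t, sin t)"
    have "sin (\<theta> + 2 * pi * n) = sin \<theta> \<and> cos (\<theta> + 2 * pi * n) = cos \<theta>" by (subst sin_cos_eq_iff) blast
    then have "p = ?g (\<theta> + 2 * pi * n)" using p \<theta> by simp
    moreover have "\<theta> + 2 * pi * n \<in> closure {f i - A (f i)<..<f i + A (f i)}"
      using i(2) pos[OF i(1)] by (simp add: abs_le_iff algebra_simps)
    moreover have "?g ` closure {f i - A (f i)<..<f i + A (f i)} \<subseteq> closure (?g ` {f i - A (f i)<..<f i + A (f i)})"
      by (intro image_closure_subset closed_closure closure_subset continuous_intros)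
    moreover have "?g ` {f i - A (f i)<..<f i + A (f i)} = arc_of (f i) (A (f i))"
      by (auto simp: arc_of_def abs_less_iff image_iff algebra_simps)
    ultimately have "p \<in> closure (arc_of (f i) (A (f i)))" by auto
    then show "p \<in> (\<Union>i<k. closure (arc_of (f i) (A (f i))))" using i by blast
  next
    fix p :: plane assume "p \<in> (\<Union>i<k. closure (arc_of (f i) (A (f i))))"
    moreover have "closure (arc_of (f i) (A (f i))) \<subseteq> sphere 0 1" for i
      by (rule closure_minimal) (auto simp: arc_of_def norm_Pair)
    ultimately show "p \<in> sphere 0 1" by blast
  qed
  moreover have "{(x, y, u (x, y)) | x y. True} = C_surface k f (A \<circ> f)"
  proof -
    have "u (x, y) = (\<Sum>i<k. u_arc (f i) ((A \<circ> f) i) (x, y))" for x y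
    proof -
      obtain r \<theta> where r: "r \<ge> 0" "(x, y) = (r * cos \<theta>, r * sin \<theta>)" using polar_exists[of x y] by blast
      show ?thesis
      proof (cases "r = 0")
        case True
        then show ?thesis using r u[of 0 \<theta>] by (simp add: u_arc_origin)
      next
        case False
        then have rp: "0 < r" using r by simp
        define P where "P i \<longleftrightarrow> (\<exists>n::int. \<bar>\<theta> - f i + 2 * pi * n\<bar> < A (f i))" for i
        have PI: "P i" if "\<bar>\<theta> - f i + 2 * pi * of_int n\<bar> < A (f i)" for i and n :: int unfolding P_def by (rule exI[of _ n]) (rule that)
        have PE: "\<exists>n::int. \<bar>\<theta> - f i + 2 * pi * n\<bar> < A (f i)" if "P i" for i using that unfolding P_def .
        have val: "u_arc (f i) ((A \<circ> f) i) (x, y) =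
          (if P i then r\<^sup>2 * (sin (\<theta> - f i) * (\<bar>sin (\<theta> - f i)\<bar> * cot (A (f i)) - cos (\<theta> - f i))) else 0)" if "i < k" for i
          unfolding r(2) comp_apply P_def by (rule u_arc_polar[OF rp pos(1)[OF that]])
        have hval: "h \<theta> = sin (\<theta> - f i) * (\<bar>sin (\<theta> - f i)\<bar> * cot (A (f i)) - cos (\<theta> - f i))"
          if i: "i < k" and n: "\<bar>\<theta> - f i + 2 * pi * n\<bar> \<le> A (f i)" for i and n :: int
        proof -
          have "h (f i + (\<theta> - f i + 2 * pi * n)) = arc_profile (A (f i)) (\<theta> - f i + 2 * pi * n)"
            using A[OF fZ[OF i]] n unfolding sym_arc_def by blast
          moreover have "h (f i + (\<theta> - f i + 2 * pi * n)) = h \<theta>" using per_int[of \<theta> n] by simp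
          moreover have "sin (\<theta> - f i + 2 * pi * n) = sin (\<theta> - f i) \<and> cos (\<theta> - f i + 2 * pi * n) = cos (\<theta> - f i)"
            by (subst sin_cos_eq_iff) blast
          ultimately show ?thesis by (simp only: arc_profile_def)
        qed
        have "(\<Sum>i<k. u_arc (f i) ((A \<circ> f) i) (x, y)) = r\<^sup>2 * h \<theta>"
        proof (cases "\<exists>i<k. P i")
          case True
          then obtain i where i: "i < k" "P i" by blast
          obtain n :: int where n: "\<bar>\<theta> - f i + 2 * pi * n\<bar> < A (f i)" using PE[OF i(2)] by (elim exE)
          have hi: "h \<theta> = sin (\<theta> - f i) * (\<bar>sin (\<theta> - f i)\<bar> * cot (A (f i)) - cos (\<theta> - f i))"
            by (rule hval[OF i(1) less_imp_le[OF n]])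
          have "u_arc (f j) ((A \<circ> f) j) (x, y) = (if j = i then r\<^sup>2 * h \<theta> else 0)" if j: "j < k" for j
          proof (cases "j = i")
            case True
            show ?thesis unfolding True val[OF i(1)] hi by (simp only: i(2) if_True refl)
          next
            case False
            have "\<not> P j"
            proof
              assume Pj: "P j"
              obtain m :: int where m: "\<bar>\<theta> - f j + 2 * pi * m\<bar> < A (f j)" using PE[OF Pj] by (elim exE)
              have "f j = f i" by (rule disj[OF fZ[OF j] fZ[OF i(1)] m less_imp_le[OF n]])
              then show False using finj False i j by blast
            qed
            then show ?thesis unfolding val[OF j] by (simp only: False if_False)
          qed
          then have "(\<Sum>j<k. u_arc (f j) ((A \<circ> f) j) (x, y)) = (\<Sum>j<k. if j = i then r\<^sup>2 * h \<theta> else 0)"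
            by (intro sum.cong refl) (simp only: lessThan_iff)
          then show ?thesis using i(1) by simp
        next
          case False
          obtain i and n :: int where i: "i < k" "\<bar>\<theta> - f i + 2 * pi * n\<bar> \<le> A (f i)" using covf[of \<theta>] by (elim exE conjE)
          have nP: "\<not> P i" using i(1) False by simp
          have "\<not> \<bar>\<theta> - f i + 2 * pi * n\<bar> < A (f i)" using PI[of i n] nP by (rule contrapos_nn[rotated])
          then have "\<bar>\<theta> - f i + 2 * pi * n\<bar> = A (f i)" using i(2) by linarith
          then have "arc_profile (A (f i)) (\<theta> - f i + 2 * pi * n) = 0" by (rule arc_profile_end[OF pos[OF i(1)]])
          moreover have "sin (\<theta> - f i + 2 * pi * n) = sin (\<theta> - f i) \<and> cos (\<theta> - f i + 2 * pi * n) = cos (\<theta> - f i)"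
            by (subst sin_cos_eq_iff) blast
          ultimately have "h \<theta> = 0" using hval[OF i] by (simp only: arc_profile_def)
          moreover have "(\<Sum>i<k. u_arc (f i) ((A \<circ> f) i) (x, y)) = 0"
          proof (intro sum.neutral ballI)
            fix j assume "j \<in> {..<k}"
            then have j: "j < k" by simp
            then have "\<not> P j" using False by blast
            then show "u_arc (f j) ((A \<circ> f) j) (x, y) = 0" unfolding val[OF j] by (simp only: if_False)
          qed
          ultimately show ?thesis by simp
        qed
        then show ?thesis using u[of r \<theta>] r by simp
      qed
    qed
    then show ?thesis by (simp add: C_surface_def)
  qed
  moreover have "\<forall>i<k. 0 < (A \<circ> f) i \<and> (A \<circ> f) i < pi" using pos by simp
  ultimately show ?thesis unfolding is_C_surface_def
    by (intro exI[of _ k] exI[of _ f] exI[of _ "A \<circ> f"] conjI) (simp_all add: comp_def)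
qed

end

section \<open>From the weak equation to the profile\<close>

context homogeneous_graph begin

lemma quarter_turn_homogeneous: "homogeneous_graph (\<lambda>q. u (- snd q, fst q)) (\<lambda>q. uy (- snd q, fst q)) (\<lambda>q. - ux (- snd q, fst q))"
proof
  have t: "((\<lambda>q::plane. (- snd q, fst q)) has_derivative (\<lambda>v. (- snd v, fst v))) (at q)" for q
    by (auto intro!: derivative_eq_intros)
  have tc: "continuous_on A (\<lambda>q::plane. (- snd q, fst q))" for A by (intro continuous_intros)
  show "C1_plane (\<lambda>q. u (- snd q, fst q)) (\<lambda>q. uy (- snd q, fst q)) (\<lambda>q. - ux (- snd q, fst q))"
    unfolding C1_plane_def
  proof (intro conjI allI)
    fix q
    have "((\<lambda>q. u (- snd q, fst q)) has_derivative (\<lambda>v. ux (- snd q, fst q) * fst (- snd v, fst v) + uy (- snd q, fst q) * snd (- snd v, fst v))) (at q)"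
      by (rule has_derivative_compose[OF t C1_planeD(1)[OF C1]])
    then show "((\<lambda>q. u (- snd q, fst q)) has_derivative (\<lambda>v. uy (- snd q, fst q) * fst v + - ux (- snd q, fst q) * snd v)) (at q)"
      by (simp add: algebra_simps)
    show "continuous_on UNIV (\<lambda>q. uy (- snd q, fst q))" by (intro continuous_on_UNIV_compose[OF C1_planeD(3)[OF C1] tc])
    show "continuous_on UNIV (\<lambda>q. - ux (- snd q, fst q))" by (intro continuous_on_minus continuous_on_UNIV_compose[OF C1_planeD(2)[OF C1] tc])
  qed
  show "u (- snd (r * x, r * y), fst (r * x, r * y)) = r\<^sup>2 * u (- snd (x, y), fst (x, y))" if "0 < r" for r x y
    using homog[OF that, of "- y" x] by simp
qed

definition balanced :: "real \<Rightarrow> bool" where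
  "balanced \<theta> \<longleftrightarrow> (profile \<theta> \<noteq> 0 \<longrightarrow> (angular has_real_derivative - radial \<theta>) (at \<theta>)) \<and> (\<exists>l. (angular \<longlongrightarrow> l) (at \<theta>))"

end

lemma balanced_quarter_turn:
  assumes "homogeneous_graph u ux uy"
    and "homogeneous_graph.balanced (\<lambda>q. u (- snd q, fst q)) (\<lambda>q. uy (- snd q, fst q)) (\<lambda>q. - ux (- snd q, fst q)) \<theta>"
  shows "homogeneous_graph.balanced u ux uy (\<theta> + pi / 2)"
proof -
  interpret homogeneous_graph u ux uy by (rule assms(1))
  interpret t: homogeneous_graph "\<lambda>q. u (- snd q, fst q)" "\<lambda>q. uy (- snd q, fst q)" "\<lambda>q. - ux (- snd q, fst q)"
    by (rule quarter_turn_homogeneous)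
  have p: "t.profile \<theta> = profile (\<theta> + pi / 2)" "t.profile' \<theta> = profile' (\<theta> + pi / 2)" for \<theta>
    by (simp_all add: t.profile_def profile_def t.profile'_def profile'_def cos_add sin_add)
  have a: "t.angular = (\<lambda>\<theta>. angular (\<theta> + pi / 2))" and r: "t.radial \<theta> = radial (\<theta> + pi / 2)" for \<theta>
    by (simp_all add: t.angular_def angular_def t.radial_def radial_def p fun_eq_iff)
  show ?thesis
    unfolding balanced_def
  proof (intro conjI impI)
    assume "profile (\<theta> + pi / 2) \<noteq> 0"
    then show "(angular has_real_derivative - radial (\<theta> + pi / 2)) (at (\<theta> + pi / 2))"
      using assms(2) unfolding t.balanced_def a r p DERIV_shift by blast
  next
    obtain l where "((\<lambda>\<theta>. angular (\<theta> + pi / 2)) \<longlongrightarrow> l) (at \<theta>)" using assms(2) unfolding t.balanced_def a by blast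
    from LIM_offset[OF this, of "- (pi / 2)"] show "\<exists>l. (angular \<longlongrightarrow> l) (at (\<theta> + pi / 2))" by auto
  qed
qed

lemma balanced_turns:
  assumes "homogeneous_graph u ux uy" "stationary ux uy" "0 < cos (\<theta> - real n * (pi / 2))"
  shows "homogeneous_graph.balanced u ux uy \<theta>"
  using assms
proof (induction n arbitrary: u ux uy \<theta>)
  case 0
  then interpret homogeneous_graph u ux uy by simp
  show ?case unfolding balanced_def using balance_in_chart[OF 0(2)] 0(3) by simp
next
  case (Suc n)
  interpret homogeneous_graph u ux uy by (rule Suc(2))
  have "homogeneous_graph.balanced (\<lambda>q. u (- snd q, fst q)) (\<lambda>q. uy (- snd q, fst q)) (\<lambda>q. - ux (- snd q, fst q)) (\<theta> - pi / 2)"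
    by (rule Suc.IH[OF quarter_turn_homogeneous quarter_turn_stationary[OF Suc(3) C1_planeD(2,3)[OF C1]]])
       (use Suc(4) in \<open>simp add: algebra_simps add_divide_distrib\<close>)
  from balanced_quarter_turn[OF Suc(2) this] show ?case by simp
qed

text \<open>
  One of \<open>cos\<close>, \<open>sin\<close>, \<open>- cos\<close>, \<open>- sin\<close> is positive at \<open>\<theta>\<close>, so at most three quarter turns bring \<open>\<theta>\<close> into the half-plane \<open>x > 0\<close>.
\<close>

lemma stationary_balanced:
  assumes "homogeneous_graph u ux uy" "stationary ux uy" shows "homogeneous_graph.balanced u ux uy \<theta>"
proof -
  have "sin \<theta> \<noteq> 0 \<or> cos \<theta> \<noteq> 0" using sin_zero_norm_cos_one[of \<theta>] by auto
  then consider "0 < cos \<theta>" | "0 < sin \<theta>" | "cos \<theta> < 0" | "sin \<theta> < 0" by linarith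
  then show ?thesis
  proof cases
    case 1 then show ?thesis using balanced_turns[OF assms, of \<theta> 0] by simp
  next
    case 2 then show ?thesis using balanced_turns[OF assms, of \<theta> 1] by (simp add: cos_diff)
  next
    case 3 then show ?thesis using balanced_turns[OF assms, of \<theta> 2] by (simp add: cos_diff)
  next
    case 4
    have "cos (\<theta> - real 3 * (pi / 2)) = - sin \<theta>" using sin_3over2_pi cos_3over2_pi by (simp add: cos_diff)
    then show ?thesis using 4 balanced_turns[OF assms, of \<theta> 3] by simp
  qed
qed

theorem (in homogeneous_graph) stationary_cone_profile:
  assumes "stationary ux uy" shows "cone_profile profile profile'"
proof
  have b: "balanced \<theta>" for \<theta> using stationary_balanced[OF _ assms] homogeneous_graph_axioms by blast
  show "(profile has_real_derivative profile' \<theta>) (at \<theta>)" for \<theta> by (rule profile_deriv)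
  show "continuous_on UNIV profile'" by (rule profile'_continuous)
  show "profile (\<theta> + 2 * pi) = profile \<theta>" for \<theta> by (rule profile_periodic)
  show "((\<lambda>\<theta>. (profile' \<theta> + 1) / sqrt ((2 * profile \<theta>)\<^sup>2 + (profile' \<theta> + 1)\<^sup>2)) has_real_derivative
        - (2 * profile \<theta> / sqrt ((2 * profile \<theta>)\<^sup>2 + (profile' \<theta> + 1)\<^sup>2))) (at \<theta>)" if "profile \<theta> \<noteq> 0" for \<theta>
    using b[of \<theta>] that unfolding balanced_def angular_def[abs_def] radial_def by blast
  show "\<exists>l. ((\<lambda>\<theta>. (profile' \<theta> + 1) / sqrt ((2 * profile \<theta>)\<^sup>2 + (profile' \<theta> + 1)\<^sup>2)) \<longlongrightarrow> l) (at \<theta>)" for \<theta>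
    using b[of \<theta>] unfolding balanced_def angular_def[abs_def] by blast
qed

section \<open>Classification\<close>

lemma closed_perimeter_support: "closed (perimeter_support E)"
  unfolding closed_def
proof (subst open_subopen, intro ballI)
  fix p assume "p \<in> - perimeter_support E"
  then obtain \<Omega> where "open \<Omega>" "p \<in> \<Omega>" "\<not> perimeter E \<Omega> > 0" by (auto simp: perimeter_support_def)
  then show "\<exists>T. open T \<and> p \<in> T \<and> T \<subseteq> - perimeter_support E"
    by (intro exI[of _ \<Omega>]) (auto simp: perimeter_support_def)
qed

lemma horizontal_half_line_origin:
  "horizontal_half_line 0 L \<longleftrightarrow> (\<exists>a b. (a, b) \<noteq> (0, 0) \<and> L = {(s * a, s * b, 0) | s. s \<ge> 0})"
  unfolding horizontal_half_line_def by (simp add: zero_prod_def)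

text \<open>
  All half-lines contain \<open>0\<close> and another point, which separates the three kinds of singular sets.
\<close>

lemma half_lines_two_points:
  assumes "\<L> \<noteq> {}" "\<forall>L\<in>\<L>. horizontal_half_line 0 L" shows "\<Union>\<L> \<noteq> {}" "\<Union>\<L> \<noteq> {p}"
proof -
  obtain L where L: "L \<in> \<L>" using assms(1) by blast
  then obtain a b where ab: "(a, b) \<noteq> (0, 0)" "L = {(s * a, s * b, 0) | s. s \<ge> 0}" using assms(2) unfolding horizontal_half_line_origin by blast
  have "(0 * a, 0 * b, 0) \<in> L" unfolding ab by (rule CollectI, rule exI[of _ 0]) simp
  moreover have "(1 * a, 1 * b, 0) \<in> L" unfolding ab by (rule CollectI, rule exI[of _ 1]) simp
  ultimately have z: "(0, 0, 0) \<in> \<Union>\<L>" "(a, b, 0) \<in> \<Union>\<L>" using L by auto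
  moreover have "(0, 0, 0) = (a, b, 0 :: real)" if "\<Union>\<L> = {p}" using z unfolding that by simp
  ultimately have "\<Union>\<L> \<noteq> {}" and "\<Union>\<L> = {p} \<longrightarrow> (0, 0, 0) = (a, b, 0 :: real)" by blast+
  then show "\<Union>\<L> \<noteq> {}" "\<Union>\<L> \<noteq> {p}" using ab(1) by auto
qed

lemma graph_not_vertical:
  fixes S :: "heis set"
  assumes "S = {(x, y, u (x, y)) | x y. True}" shows "\<not> (\<forall>p\<in>S. \<forall>s. p + (0, 0, s) \<in> S)"
proof
  assume a: "\<forall>p\<in>S. \<forall>s. p + (0, 0, s) \<in> S"
  have "(0, 0, u (0, 0)) \<in> S" unfolding assms by blast
  then have "(0, 0, u (0, 0)) + (0, 0, 1) \<in> S" using a by blast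
  then show False unfolding assms by auto
qed

lemma C_surface_graph: assumes "is_C_surface S" shows "\<exists>w. S = {(x, y, w (x, y)) | x y. True}"
proof -
  obtain k \<theta> \<alpha> where "S = C_surface k \<theta> \<alpha>" using assms unfolding is_C_surface_def by blast
  then show ?thesis unfolding C_surface_def by (intro exI[of _ "\<lambda>q. \<Sum>i<k. u_arc (\<theta> i) (\<alpha> i) q"]) simp
qed

text \<open>
  Halfway between the centre and the end of the first arc, \<open>u\<^sub>I\<close> is nonzero for this arc, and it vanishes for the others by
  disjointness.
\<close>

lemma horizontal_not_C_surface: "\<not> is_C_surface {(x, y, t). t = 0}"
proof
  assume "is_C_surface {(x, y, t). t = 0}"
  then obtain k \<theta> \<alpha> where k: "2 \<le> k" and \<alpha>: "\<And>i. i < k \<Longrightarrow> 0 < \<alpha> i \<and> \<alpha> i < pi"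
    and dj: "disjoint_family_on (\<lambda>i. arc_of (\<theta> i) (\<alpha> i)) {..<k}" and S: "{(x, y, t). t = 0} = C_surface k \<theta> \<alpha>"
    unfolding is_C_surface_def by blast
  have \<alpha>0: "0 < \<alpha> 0" "\<alpha> 0 < pi" using \<alpha>[of 0] k by simp_all
  define \<beta> where "\<beta> = \<theta> 0 + \<alpha> 0 / 2"
  have p: "u_arc \<theta>0 \<alpha>' (cos \<beta>, sin \<beta>) =
    (if \<exists>n::int. \<bar>\<beta> - \<theta>0 + 2 * pi * n\<bar> < \<alpha>' then sin (\<beta> - \<theta>0) * (\<bar>sin (\<beta> - \<theta>0)\<bar> * cot \<alpha>' - cos (\<beta> - \<theta>0)) else 0)" if "0 < \<alpha>'" for \<theta>0 \<alpha>'
    using u_arc_polar[of 1 \<alpha>' \<theta>0 \<beta>] that by simp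
  have mem: "(cos \<beta>, sin \<beta>) \<in> arc_of (\<theta> i) (\<alpha> i)" if "\<exists>n::int. \<bar>\<beta> - \<theta> i + 2 * pi * n\<bar> < \<alpha> i" for i
  proof -
    obtain n :: int where n: "\<bar>\<beta> - \<theta> i + 2 * pi * n\<bar> < \<alpha> i" using \<open>\<exists>n::int. \<bar>\<beta> - \<theta> i + 2 * pi * n\<bar> < \<alpha> i\<close> by blast
    have "cos (\<beta> + 2 * pi * n) = cos \<beta>" "sin (\<beta> + 2 * pi * n) = sin \<beta>"
      using cos_int_2pin[of n] sin_int_2pin[of n] by (simp_all add: cos_add sin_add mult.commute)
    moreover have "\<bar>(\<beta> + 2 * pi * n) - \<theta> i\<bar> < \<alpha> i" using n by (simp add: algebra_simps)
    ultimately show ?thesis unfolding arc_of_def by (intro CollectI exI[of _ "\<beta> + 2 * pi * n"]) simp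
  qed
  have in0: "\<exists>n::int. \<bar>\<beta> - \<theta> 0 + 2 * pi * n\<bar> < \<alpha> 0" by (rule exI[of _ 0]) (use \<alpha>0 in \<open>simp add: \<beta>_def\<close>)
  have others: "u_arc (\<theta> i) (\<alpha> i) (cos \<beta>, sin \<beta>) = 0" if "i < k" "i \<noteq> 0" for i
  proof -
    have "arc_of (\<theta> i) (\<alpha> i) \<inter> arc_of (\<theta> 0) (\<alpha> 0) = {}" using dj that k unfolding disjoint_family_on_def by auto
    then have "\<not> (\<exists>n::int. \<bar>\<beta> - \<theta> i + 2 * pi * n\<bar> < \<alpha> i)" using mem[of i] mem[of 0] in0 by blast
    then show ?thesis using p \<alpha>[OF that(1)] by simp
  qed
  have "(\<Sum>i<k. u_arc (\<theta> i) (\<alpha> i) (cos \<beta>, sin \<beta>)) = (\<Sum>i\<in>{0}. u_arc (\<theta> i) (\<alpha> i) (cos \<beta>, sin \<beta>))"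
    by (rule sum.mono_neutral_right) (use k others in auto)
  moreover have "(cos \<beta>, sin \<beta>, \<Sum>i<k. u_arc (\<theta> i) (\<alpha> i) (cos \<beta>, sin \<beta>)) \<in> {(x, y, t). t = 0}" unfolding S C_surface_def by blast
  ultimately have z: "u_arc (\<theta> 0) (\<alpha> 0) (cos \<beta>, sin \<beta>) = 0" by simp
  define h where "h = \<alpha> 0 / 2"
  have h: "0 < sin h" "0 < cos h" using \<alpha>0 by (auto simp: h_def intro!: sin_gt_zero cos_gt_zero)
  have c: "cot (\<alpha> 0) = (2 * (cos h)\<^sup>2 - 1) / (2 * sin h * cos h)"
    using sin_double[of h] cos_double_cos[of h] by (simp add: cot_def h_def)
  have "sin h * (\<bar>sin h\<bar> * cot (\<alpha> 0) - cos h) = 0" using z p[OF \<alpha>0(1)] in0 by (simp add: \<beta>_def h_def)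
  then have "sin h * ((2 * (cos h)\<^sup>2 - 1) / (2 * sin h * cos h)) = cos h" using h unfolding c by simp
  then have "2 * (cos h)\<^sup>2 - 1 = 2 * (cos h)\<^sup>2" using h by (simp add: field_simps power2_eq_square)
  then show False by simp
qed

context homogeneous_graph begin

lemma speed_zero_polar:
  assumes "0 < r"
  shows "speed ux uy (r * cos \<theta>, r * sin \<theta>) = 0 \<longleftrightarrow> profile \<theta> = 0 \<and> profile' \<theta> = -1"
proof -
  have "speed ux uy (r * cos \<theta>, r * sin \<theta>) = 0 \<longleftrightarrow> (2 * profile \<theta>)\<^sup>2 + (profile' \<theta> + 1)\<^sup>2 = 0"
    unfolding speed_homog[OF assms] speed_on_circle[symmetric] using assms by simp
  also have "\<dots> \<longleftrightarrow> 2 * profile \<theta> = 0 \<and> profile' \<theta> + 1 = 0" by (rule sum_power2_eq_zero_iff)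
  also have "\<dots> \<longleftrightarrow> profile \<theta> = 0 \<and> profile' \<theta> = -1" by (simp add: add_eq_0_iff2)
  finally show ?thesis .
qed

lemma u_polar: "0 \<le> r \<Longrightarrow> u (r * cos \<theta>, r * sin \<theta>) = r\<^sup>2 * profile \<theta>"
  using homog[of r "cos \<theta>" "sin \<theta>"] origin(1) by (cases "r = 0") (simp_all add: profile_def)

lemma singular_set_eq: "singular_set {(x, y, u (x, y)) | x y. True} = {(x, y, 0) | x y. speed ux uy (x, y) = 0}"
  unfolding singular_set_graph[OF C1] speed_zero_iff[symmetric] using speed_zero_imp by auto

lemma singular_set_rays:
  "singular_set {(x, y, u (x, y)) | x y. True} = {0} \<union>
     (\<Union>\<theta>\<in>{\<theta>\<in>{0..2*pi}. profile \<theta> = 0 \<and> profile' \<theta> = -1}. {(s * cos \<theta>, s * sin \<theta>, 0) | s. s \<ge> 0})" (is "_ = _ \<union> ?R")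
proof (intro subset_antisym subsetI)
  fix p assume "p \<in> singular_set {(x, y, u (x, y)) | x y. True}"
  then obtain x y where p: "p = (x, y, 0)" "speed ux uy (x, y) = 0" unfolding singular_set_eq by blast
  obtain r \<theta>1 where r: "0 \<le> r" "(x, y) = (r * cos \<theta>1, r * sin \<theta>1)" using polar_exists by blast
  obtain n :: int where n: "0 \<le> \<theta>1 + 2 * pi * n" "\<theta>1 + 2 * pi * n < 2 * pi" by (rule shift_into_period)
  define \<theta> where "\<theta> = \<theta>1 + 2 * pi * n"
  have cs: "cos \<theta> = cos \<theta>1" "sin \<theta> = sin \<theta>1"
    unfolding \<theta>_def using cos_int_2pin[of n] sin_int_2pin[of n] by (simp_all add: cos_add sin_add mult.commute)
  show "p \<in> {0} \<union> ?R"
  proof (cases "r = 0")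
    case True then show ?thesis using r p by (simp add: zero_prod_def)
  next
    case False
    then have rp: "0 < r" using r(1) by simp
    have "profile \<theta> = 0 \<and> profile' \<theta> = -1" using p(2) unfolding r(2) cs[symmetric] speed_zero_polar[OF rp] .
    moreover have "\<theta> \<in> {0..2*pi}" using n by (simp add: \<theta>_def)
    ultimately show ?thesis using p(1) r unfolding cs[symmetric] by blast
  qed
next
  fix p assume p: "p \<in> {0} \<union> ?R"
  have "speed ux uy (0, 0) = 0" using origin by (simp add: speed_zero_iff)
  then have o: "(0, 0, 0) \<in> singular_set {(x, y, u (x, y)) | x y. True}" unfolding singular_set_eq by blast
  from p show "p \<in> singular_set {(x, y, u (x, y)) | x y. True}"
  proof
    assume "p \<in> {0}" then show ?thesis using o by (simp add: zero_prod_def)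
  next
    assume "p \<in> ?R"
    then obtain \<theta> s where s: "profile \<theta> = 0" "profile' \<theta> = -1" "p = (s * cos \<theta>, s * sin \<theta>, 0)" "0 \<le> s" by blast
    show ?thesis
    proof (cases "s = 0")
      case True then show ?thesis using o s by simp
    next
      case False
      then have "0 < s" using s by simp
      from speed_zero_polar[OF this, of \<theta>] have "speed ux uy (s * cos \<theta>, s * sin \<theta>) = 0" using s by blast
      then show ?thesis unfolding singular_set_eq s(3) by blast
    qed
  qed
qed

lemma flat_cone:
  assumes "\<And>\<theta>. profile \<theta> = 0"
  shows "{(x, y, u (x, y)) | x y. True} = {(x, y, t). t = 0}" "singular_set {(x, y, u (x, y)) | x y. True} = {0}"
proof -
  have u0: "u (x, y) = 0" for x y
  proof -
    obtain r \<theta> where "0 \<le> r" "(x, y) = (r * cos \<theta>, r * sin \<theta>)" using polar_exists by blast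
    then show ?thesis using u_polar[of r \<theta>] assms by simp
  qed
  then show "{(x, y, u (x, y)) | x y. True} = {(x, y, t). t = 0}" by auto
  have "profile' \<theta> = 0" for \<theta>
  proof -
    have "profile = (\<lambda>_. 0)" using assms by (simp add: fun_eq_iff)
    with profile_deriv[of \<theta>] have "((\<lambda>_. 0) has_real_derivative profile' \<theta>) (at \<theta>)" by simp
    then show ?thesis by (rule DERIV_unique) simp
  qed
  then show "singular_set {(x, y, u (x, y)) | x y. True} = {0}" unfolding singular_set_rays by simp
qed

lemma curved_cone:
  assumes st: "stationary ux uy" and nz: "profile \<tau> \<noteq> 0"
  shows "is_C_surface {(x, y, u (x, y)) | x y. True}"
    "\<exists>\<L>. finite \<L> \<and> \<L> \<noteq> {} \<and> (\<forall>L\<in>\<L>. horizontal_half_line 0 L) \<and> singular_set {(x, y, u (x, y)) | x y. True} = \<Union>\<L>"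
proof -
  interpret c: cone_profile profile profile' by (rule stationary_cone_profile[OF st])
  show "is_C_surface {(x, y, u (x, y)) | x y. True}" by (rule c.cone_is_C_surface[OF nz u_polar])
  define Z where "Z = {\<theta>\<in>{0..2*pi}. profile \<theta> = 0 \<and> profile' \<theta> = -1}"
  define ray where "ray \<theta> = {(s * cos \<theta>, s * sin \<theta>, 0 :: real) | s. s \<ge> 0}" for \<theta> :: real
  have fin: "finite (ray ` Z)" unfolding Z_def by (rule finite_imageI[OF c.finite_singular_angles])
  have half: "\<forall>L\<in>ray ` Z. horizontal_half_line 0 L"
  proof
    fix L assume "L \<in> ray ` Z"
    then obtain \<theta> where "L = ray \<theta>" by blast
    moreover have "(cos \<theta>, sin \<theta>) \<noteq> (0, 0)" using sin_zero_norm_cos_one[of \<theta>] by auto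
    ultimately show "horizontal_half_line 0 L" unfolding horizontal_half_line_origin ray_def by blast
  qed
  have ne: "ray ` Z \<noteq> {}"
  proof -
    obtain s1 \<alpha> where "c.sym_arc s1 \<alpha>" using c.covered_by_sym_arc[OF nz] by blast
    then have s1: "profile s1 = 0" "profile' s1 = -1" using c.sym_arc_center by auto
    obtain n :: int where n: "0 \<le> s1 + 2 * pi * n" "s1 + 2 * pi * n < 2 * pi" by (rule shift_into_period)
    have "profile (s1 + 2 * pi * n) = profile s1" "profile' (s1 + 2 * pi * n) = profile' s1"
      using cos_int_2pin[of n] sin_int_2pin[of n] by (simp_all add: profile_def profile'_def cos_add sin_add mult.commute)
    then have "s1 + 2 * pi * n \<in> Z" using n s1 by (simp add: Z_def)
    then show ?thesis by blast
  qed
  have "0 \<in> \<Union>(ray ` Z)"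
  proof -
    obtain \<theta> where "\<theta> \<in> Z" using ne by blast
    moreover have "(0 * cos \<theta>, 0 * sin \<theta>, 0) \<in> ray \<theta>" unfolding ray_def by blast
    ultimately show ?thesis by (auto simp: zero_prod_def)
  qed
  then have "singular_set {(x, y, u (x, y)) | x y. True} = \<Union>(ray ` Z)" unfolding singular_set_rays Z_def[symmetric] ray_def by blast
  then show "\<exists>\<L>. finite \<L> \<and> \<L> \<noteq> {} \<and> (\<forall>L\<in>\<L>. horizontal_half_line 0 L) \<and> singular_set {(x, y, u (x, y)) | x y. True} = \<Union>\<L>"
    using fin ne half by blast
qed

end

theorem theorem1p2:
  fixes S :: "heis set"
  assumes "minimal_cone S" and "C1_surface S"
  shows "(vertical_plane S \<or> S = {(x, y, t). t = 0} \<or> is_C_surface S)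
    \<and> (vertical_plane S \<longleftrightarrow> singular_set S = {})
    \<and> (S = {(x, y, t). t = 0} \<longleftrightarrow> (\<exists>p. singular_set S = {p}))
    \<and> (is_C_surface S \<longleftrightarrow>
         (\<exists>\<L>. finite \<L> \<and> \<L> \<noteq> {} \<and> (\<forall>L\<in>\<L>. horizontal_half_line 0 L)
            \<and> singular_set S = \<Union>\<L>))"
proof -
  obtain E where E: "locally_finite_perimeter E" "local_perimeter_minimizer E" "S = perimeter_support E"
    and ne: "S \<noteq> {}" and cone: "heis_cone S"
    using assms(1) unfolding minimal_cone_def minimal_surface_def by blast
  have cl: "closed S" unfolding E(3) by (rule closed_perimeter_support)
  from cone_dichotomy[OF cone assms(2) cl ne] show ?thesis
  proof (elim disjE exE conjE)
    fix a b :: real assume ab: "(a, b) \<noteq> (0, 0)" and S: "S = {(x, y, t). a * x + b * y = 0}"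
    have V: "vertical_plane S" unfolding S by (rule vertical_plane_linear[OF ab])
    have tr: "p + (0, 0, s) \<in> S" if "p \<in> S" for p s using V that unfolding vertical_plane_def by blast
    have sing: "singular_set S = {}" by (rule singular_set_vertical) (rule tr)
    have ng: "S \<noteq> {(x, y, w (x, y)) | x y. True}" for w using graph_not_vertical[of S w] tr by blast
    have n0: "S \<noteq> {(x, y, t). t = 0}" using ng[of "\<lambda>_. 0"] by auto
    have nC: "\<not> is_C_surface S" using C_surface_graph ng by blast
    show ?thesis
    proof (intro conjI iffI)
      assume "\<exists>\<L>. finite \<L> \<and> \<L> \<noteq> {} \<and> (\<forall>L\<in>\<L>. horizontal_half_line 0 L) \<and> singular_set S = \<Union>\<L>"
      then obtain \<L> where "\<L> \<noteq> {}" "\<forall>L\<in>\<L>. horizontal_half_line 0 L" "singular_set S = \<Union>\<L>" by blast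
      then show "is_C_surface S" using half_lines_two_points(1)[of \<L>] sing by metis
    qed (use V sing n0 nC in auto)
  next
    fix u ux uy assume u: "C1_plane u ux uy" and h: "\<forall>r>0. \<forall>x y. u (r * x, r * y) = r\<^sup>2 * u (x, y)"
      and S: "S = {(x, y, u (x, y)) | x y. True}"
    interpret homogeneous_graph u ux uy by standard (use u h in auto)
    have nV: "\<not> vertical_plane S" using graph_not_vertical[OF S] unfolding vertical_plane_def by blast
    have E': "E \<in> sets lebesgue" using E(1) unfolding locally_finite_perimeter_def by blast
    have st: "stationary ux uy" by (rule minimal_graph_stationary[OF E' E(2) u E(3)[unfolded S, symmetric] AE_speed_nonzero])
    show ?thesis
    proof (cases "\<forall>\<theta>. profile \<theta> = 0")
      case True
      then have p0: "profile \<theta> = 0" for \<theta> by blast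
      have h: "S = {(x, y, t). t = 0}" and sing: "singular_set S = {0}" unfolding S by (rule flat_cone[OF p0])+
      show ?thesis
      proof (intro conjI iffI)
        assume "\<exists>\<L>. finite \<L> \<and> \<L> \<noteq> {} \<and> (\<forall>L\<in>\<L>. horizontal_half_line 0 L) \<and> singular_set S = \<Union>\<L>"
        then obtain \<L> where "\<L> \<noteq> {}" "\<forall>L\<in>\<L>. horizontal_half_line 0 L" "singular_set S = \<Union>\<L>" by blast
        then show "is_C_surface S" using half_lines_two_points(2)[of \<L> 0] sing by metis
      next
        show "vertical_plane S \<or> S = {(x, y, t). t = 0} \<or> is_C_surface S" using h by blast
      next
        assume "is_C_surface S" then show "\<exists>\<L>. finite \<L> \<and> \<L> \<noteq> {} \<and> (\<forall>L\<in>\<L>. horizontal_half_line 0 L) \<and> singular_set S = \<Union>\<L>"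
          using horizontal_not_C_surface unfolding h by blast
      qed (use nV sing h in auto)
    next
      case False
      then obtain \<tau> where nz: "profile \<tau> \<noteq> 0" by blast
      note c = curved_cone[OF st nz, folded S]
      have n0: "S \<noteq> {(x, y, t). t = 0}"
      proof
        assume a: "S = {(x, y, t). t = 0}"
        have "(cos \<tau>, sin \<tau>, profile \<tau>) \<in> S" unfolding S profile_def by blast
        then show False using nz unfolding a by simp
      qed
      from c(2) obtain \<L> where L: "finite \<L>" "\<L> \<noteq> {}" "\<forall>L\<in>\<L>. horizontal_half_line 0 L" "singular_set S = \<Union>\<L>" by blast
      show ?thesis using nV n0 c half_lines_two_points[OF L(2,3)] L(4) by auto
    qed
  qed
qed


end
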